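(* Let $q\ge 3$ and let $\chi$ be a primitive Dirichlet character of conductor $q$. Fix $u\ge 2$ and $s_0\in\mathbb{C}$, and let $A_u$ be the set of all positive integers having at least one prime factor greater than $u$. Then $$\xi(s_0,\chi)-\xi_u^{\approx}(s_0,\chi)=\sum_{n\in A_u} J(n),$$ where $$J(n)=\chi(n)\,n^{\kappa(\chi)}\left(\frac{q}{n^2\pi}\right)^{\frac{\kappa(\chi)+s_0}{2}}\Gamma\!\left(\frac{\kappa(\chi)+s_0}{2},\frac{n^2\pi}{q}\right)+\epsilon(\chi)\,\overline{\chi}(n)\,n^{\kappa(\chi)}\left(\frac{q}{n^2\pi}\right)^{\frac{\kappa(\chi)+1-s_0}{2}}\Gamma\!\left(\frac{\kappa(\chi)+1-s_0}{2},\frac{n^2\pi}{q}\right),$$ and $\Gamma(z,x)=\int_x^\infty e^{-t}t^{z-1}\,dt$ (for $x>0$) is the incomplete Gamma function.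
   Context: Let $\chi$ be a primitive Dirichlet character of conductor $q\ge 3$. Set $\kappa(\chi)=0$ if $\chi(-1)=1$ and $\kappa(\chi)=1$ if $\chi(-1)=-1$ (note $\kappa(\overline\chi)=\kappa(\chi)$). Define $g(s,\chi)=(q/\pi)^{(s+\kappa(\chi))/2}\,\Gamma\big((s+\kappa(\chi))/2\big)$ and the completed $L$-function $\xi(s,\chi)=g(s,\chi)L(s,\chi)$. Let $\tau(\chi)=\sum_{n=1}^q\chi(n)e^{2\pi i n/q}$ and $\epsilon(\chi)=\tau(\chi)/(i^{\kappa(\chi)}\sqrt q)$, so that $\xi(s,\chi)=\epsilon(\chi)\xi(1-s,\overline\chi)$. For real $u\ge 2$, let $L_u(s,\chi)=\prod_{p\le u,\ p \text{ prime}}(1-\chi(p)p^{-s})^{-1}$ and $\xi_u(s,\chi)=g(s,\chi)L_u(s,\chi)$, a meromorphic function on $\mathbb{C}$. Let $\xi_u^{pp}(s,\chi)$ denote the sum, over all poles of $\xi_u(\cdot,\chi)$, of the principal parts of its Laurent expansions at those poles, and let $\xi_u^{reg}(s,\chi)=\xi_u(s,\chi)-\xi_u^{pp}(s,\chi)$ (an entire function). Define the approximation $\xi_u^{\approx}(s,\chi)=\xi_u^{reg}(s,\chi)+\epsilon(\chi)\,\xi_u^{reg}(1-s,\overline\chi)$, where $\xi_u^{reg}(\cdot,\overline\chi)$ is defined in the same way with $\overline\chi$ in place of $\chi$. *)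

theory Defs
  imports "HOL-Complex_Analysis.Complex_Analysis"
begin

definition dirichlet_char :: "nat \<Rightarrow> (nat \<Rightarrow> complex) \<Rightarrow> bool" where
  "dirichlet_char q chi \<longleftrightarrow> q \<ge> 1 \<and>
     (\<forall>n. chi (n + q) = chi n) \<and>
     (\<forall>m n. chi (m * n) = chi m * chi n) \<and>
     chi 1 = 1 \<and>
     (\<forall>n. chi n = 0 \<longleftrightarrow> \<not> coprime n q)"

text \<open>Primitive modulo q (i.e. of conductor q): for no proper divisor d of q is chi
  induced by a character modulo d, i.e. for every divisor d < q of q there is n coprime
  to q with n = 1 (mod d) and chi(n) \<noteq> 1.\<close>
definition primitive_dirichlet_char :: "nat \<Rightarrow> (nat \<Rightarrow> complex) \<Rightarrow> bool" where
  "primitive_dirichlet_char q chi \<longleftrightarrow> dirichlet_char q chi \<and>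
     (\<forall>d. d dvd q \<and> d < q \<longrightarrow>
        (\<exists>n. coprime n q \<and> n mod d = 1 mod d \<and> chi n \<noteq> 1))"

text \<open>chi(-1) is chi(q-1) for a character modulo q.\<close>
definition kappa :: "nat \<Rightarrow> (nat \<Rightarrow> complex) \<Rightarrow> nat" where
  "kappa q chi = (if chi (q - 1) = 1 then 0 else 1)"

definition gauss_sum :: "nat \<Rightarrow> (nat \<Rightarrow> complex) \<Rightarrow> complex" where
  "gauss_sum q chi = (\<Sum>n=1..q. chi n * exp (2 * pi * \<i> * of_nat n / of_nat q))"

definition root_number :: "nat \<Rightarrow> (nat \<Rightarrow> complex) \<Rightarrow> complex" where
  "root_number q chi = gauss_sum q chi / (\<i> ^ kappa q chi * of_real (sqrt (real q)))"

definition dirichlet_L :: "(nat \<Rightarrow> complex) \<Rightarrow> complex \<Rightarrow> complex" where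
  "dirichlet_L chi = (THE f. f holomorphic_on UNIV \<and>
      (\<forall>s. 1 < Re s \<longrightarrow> (\<lambda>n. chi (Suc n) / of_nat (Suc n) powr s) sums f s))"

definition gfac :: "nat \<Rightarrow> (nat \<Rightarrow> complex) \<Rightarrow> complex \<Rightarrow> complex" where
  "gfac q chi s = of_real (real q / pi) powr ((s + of_nat (kappa q chi)) / 2)
                  * Gamma ((s + of_nat (kappa q chi)) / 2)"

text \<open>Completed L-function xi(s,chi) = g(s,chi) L(s,chi), an entire function; the
  (removable) singularities of the product at the poles of Gamma are removed.\<close>
definition xi :: "nat \<Rightarrow> (nat \<Rightarrow> complex) \<Rightarrow> complex \<Rightarrow> complex" where
  "xi q chi = remove_sings (\<lambda>s. gfac q chi s * dirichlet_L chi s)"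

definition L_trunc :: "real \<Rightarrow> (nat \<Rightarrow> complex) \<Rightarrow> complex \<Rightarrow> complex" where
  "L_trunc u chi s = (\<Prod>p\<in>{p. prime p \<and> real p \<le> u}. inverse (1 - chi p * of_nat p powr (-s)))"

definition xi_trunc :: "nat \<Rightarrow> real \<Rightarrow> (nat \<Rightarrow> complex) \<Rightarrow> complex \<Rightarrow> complex" where
  "xi_trunc q u chi s = gfac q chi s * L_trunc u chi s"

definition principal_part :: "(complex \<Rightarrow> complex) \<Rightarrow> complex \<Rightarrow> complex \<Rightarrow> complex" where
  "principal_part f z w =
     (let F = laurent_expansion f z in
        \<Sum>k\<in>{fls_subdegree F..<0}. fls_nth F k * (w - z) powi k)"

definition principal_parts_sum :: "(complex \<Rightarrow> complex) \<Rightarrow> complex \<Rightarrow> complex" where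
  "principal_parts_sum f w = (\<Sum>\<^sub>\<infinity>z\<in>{z. is_pole f z}. principal_part f z w)"

definition xi_pp :: "nat \<Rightarrow> real \<Rightarrow> (nat \<Rightarrow> complex) \<Rightarrow> complex \<Rightarrow> complex" where
  "xi_pp q u chi = principal_parts_sum (xi_trunc q u chi)"

definition xi_reg :: "nat \<Rightarrow> real \<Rightarrow> (nat \<Rightarrow> complex) \<Rightarrow> complex \<Rightarrow> complex" where
  "xi_reg q u chi = remove_sings (\<lambda>s. xi_trunc q u chi s - xi_pp q u chi s)"

definition xi_approx :: "nat \<Rightarrow> real \<Rightarrow> (nat \<Rightarrow> complex) \<Rightarrow> complex \<Rightarrow> complex" where
  "xi_approx q u chi s =
     xi_reg q u chi s + root_number q chi * xi_reg q u (\<lambda>n. cnj (chi n)) (1 - s)"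

definition inc_Gamma :: "complex \<Rightarrow> real \<Rightarrow> complex" where
  "inc_Gamma z x = integral {x..} (\<lambda>t. of_real (exp (- t)) * of_real t powr (z - 1))"

definition has_large_prime_factor :: "real \<Rightarrow> nat \<Rightarrow> bool" where
  "has_large_prime_factor u n \<longleftrightarrow> (\<exists>p. prime p \<and> p dvd n \<and> real p > u)"

end

theory Submission
  imports Defs "HOL-Probability.Probability" "HOL-Number_Theory.Number_Theory"
    "HOL-Real_Asymp.Real_Asymp" "Jordan_Normal_Form.Determinant"
begin

text \<open>Put \<open>x = \<pi> n\<^sup>2 / q\<close> and \<open>z = (s + \<kappa>) / 2\<close>. Splitting \<open>\<Gamma>(z)\<close> at \<open>x\<close> writes each term of
  \<open>g(s) \<Sum> \<chi>(n) n powr (-s)\<close> as an upper part \<open>\<chi>(n) n ^ \<kappa> x powr (-z) \<Gamma>(z, x)\<close> and a lower part. Let \<open>E\<close> and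
  \<open>E\<^sub>u\<close> be the entire functions given by the upper parts summed over all \<open>n\<close> and over the \<open>n\<close>
  without prime factors above \<open>u\<close>. The theta transformation turns the lower parts over all \<open>n\<close> into
  the dual series, so \<open>\<xi>(s, \<chi>) = E(s, \<chi>) + \<epsilon> E(1 - s, cnj \<chi>)\<close>, and it remains to show that the regular
  part of \<open>\<xi>\<^sub>u\<close> is \<open>E\<^sub>u\<close>.

  The difference \<open>\<xi>\<^sub>u - E\<^sub>u\<close> is the sum of the lower parts and hence \<open>O(1 / \<bar>s\<bar>)\<close> for \<open>Re s \<ge> 2\<close>; for
  \<open>Re s \<le> 2\<close> so is \<open>E\<^sub>u\<close>, and \<open>\<xi>\<^sub>u\<close> on suitable contours: simultaneous approximation provides
  heights \<open>T\<close> at which all Euler factors stay away from their poles. The residue theorem on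
  expanding rectangles then exhibits \<open>\<xi>\<^sub>u - E\<^sub>u\<close> as a limit of partial sums of its principal parts.
  The sum over all poles has to converge unconditionally. A pole \<open>\<rho> = 2 \<pi> \<i> a / (\<phi>(q) ln p)\<close> has a residue
  containing \<open>1 / (1 - \<chi>(r) r powr (-\<rho>))\<close> for the other primes \<open>r\<close>, so this rests on the estimate
  \<open>C exp (-\<epsilon> a) \<le> \<bar>a ln r - b ln p\<bar>\<close>, which is beaten by the exponential decay of \<open>\<Gamma>\<close>; it is proved
  with interpolation determinants.\<close>

section \<open>A lower bound for linear forms in two logarithms\<close>

text \<open>\<open>infsum\<close> has the value 0 on a family that is not summable, so rectangles
  can only identify the sum of the principal parts after summability over all poles is known. The
  danger is small divisors: all zeros of the factors \<open>1 - ef p\<close> lie on the imaginary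
  axis, and zeros of different primes, though distinct away from 0, can come very close, which makes
  residues large. Gamma decays like exp (- c a) at the a-th point, so it is enough that each of the
  finitely many other primes costs exp (\<epsilon> a) with \<epsilon> as small as desired. This is
  much weaker than the polynomial bounds of Baker's theory, and determinants whose size is a power
  of ln a deliver it with little attention to constants. Finitely many terms never affect
  summability, so the pole at 0, where several factors may meet, needs no estimate. The order 1 /
  |s| is what the contour argument consumes: the kernel 1 / (s - w) supplies a second factor 1 / T
  against a perimeter of order T.\<close>

abbreviation fdet :: "nat \<Rightarrow> (nat \<Rightarrow> nat \<Rightarrow> 'a :: comm_ring_1) \<Rightarrow> 'a" where
  "fdet n f \<equiv> Determinant.det (Matrix.mat n n (\<lambda>(i,j). f i j))"

lemma fdet_cong:
  assumes "\<And>i j. i < n \<Longrightarrow> j < n \<Longrightarrow> f i j = g i j"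
  shows "fdet n f = fdet n g"
proof -
  have "Matrix.mat n n (\<lambda>(i,j). f i j) = Matrix.mat n n (\<lambda>(i,j). g i j)"
    using assms by (intro eq_matI) auto
  thus ?thesis by simp
qed

lemma fdet_leibniz:
  "fdet n f = (\<Sum>p\<in>{p. p permutes {0..<n}}. signof p * (\<Prod>i=0..<n. f i (p i)))"
proof -
  have "fdet n f = (\<Sum>p\<in>{p. p permutes {0..<n}}. signof p *
      (\<Prod>i=0..<n. Matrix.mat n n (\<lambda>(i,j). f i j) $$ (i, p i)))"
    by (rule Determinant.det_def') auto
  also have "\<dots> = (\<Sum>p\<in>{p. p permutes {0..<n}}. signof p * (\<Prod>i=0..<n. f i (p i)))"
    by (intro sum.cong refl arg_cong2[of _ _ _ _ "(*)"] prod.cong)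
       (auto simp: permutes_in_image[where S = "{0..<n}"] dest: permutes_in_image[of _ "{0..<n}"])
  finally show ?thesis .
qed

lemma fdet_laplace_column:
  assumes "k \<le> n"
  shows "fdet (Suc n) f =
    (\<Sum>i\<le>n. f i k * ((-1) ^ (i + k) * fdet n (\<lambda>i' j'. f (insert_index i i') (insert_index k j'))))"
proof -
  let ?A = "Matrix.mat (Suc n) (Suc n) (\<lambda>(i,j). f i j)"
  have "fdet (Suc n) f = (\<Sum>i<Suc n. ?A $$ (i,k) * cofactor ?A i k)"
    by (rule laplace_expansion_column) (use assms in auto)
  also have "\<dots> = (\<Sum>i\<le>n. f i k * ((-1) ^ (i + k) * fdet n (\<lambda>i' j'. f (insert_index i i') (insert_index k j'))))"
  proof (rule sum.cong)
    fix i assume i: "i \<in> {..n}"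
    have "mat_delete ?A i k = Matrix.mat n n (\<lambda>(i',j'). f (insert_index i i') (insert_index k j'))"
      using i assms by (intro eq_matI) (auto simp: mat_delete_def insert_index_def)
    thus "?A $$ (i,k) * cofactor ?A i k = f i k * ((-1) ^ (i + k) * fdet n (\<lambda>i' j'. f (insert_index i i') (insert_index k j')))"
      using i assms by (simp add: cofactor_def)
  qed auto
  finally show ?thesis .
qed

text \<open>On the circle of radius \<rho> the denominator is at least \<rho> - r, so the quotient
  is at most 2 B / (\<rho> - r) there. With the value \<open>deriv f x\<close> at \<open>x\<close>
  it is entire, and the maximum modulus principle carries the bound to the whole disc.\<close>

lemma divided_difference_bound:
  fixes f :: "complex \<Rightarrow> complex"
  assumes holo: "f holomorphic_on UNIV" and B: "\<And>z. norm z \<le> \<rho> \<Longrightarrow> norm (f z) \<le> B"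
    and x: "norm x \<le> r" and r: "r < \<rho>" and z: "norm z \<le> \<rho>"
  shows "norm ((if z = x then deriv f x else (f z - f x) / (z - x))) \<le> 2 * B / (\<rho> - r)"
proof -
  define g where "g = (\<lambda>z. if z = x then deriv f x else (f z - f x) / (z - x))"
  have hg: "g holomorphic_on UNIV"
    unfolding g_def by (rule pole_lemma[OF holo]) auto
  have B0: "0 \<le> B" using B[of x] x r by (meson norm_ge_zero order_trans less_imp_le)
  have r0: "0 \<le> r" using x norm_ge_zero order_trans by blast
  have "norm (g z) \<le> 2 * B / (\<rho> - r)"
  proof (rule maximum_modulus_frontier[of g "cball 0 \<rho>"])
    show "g holomorphic_on interior (cball 0 \<rho>)" "continuous_on (closure (cball 0 \<rho>)) g"
      using hg by (auto intro: holomorphic_on_subset holomorphic_on_imp_continuous_on)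
    show "bounded (cball (0::complex) \<rho>)" by simp
    show "z \<in> cball 0 \<rho>" using z by simp
    fix w :: complex assume "w \<in> frontier (cball 0 \<rho>)"
    hence w: "norm w = \<rho>" using r r0 by auto
    have "\<rho> - r \<le> norm (w - x)" using w x norm_triangle_ineq2[of w x] by linarith
    moreover have "norm (f w - f x) \<le> 2 * B"
      using norm_triangle_ineq4[of "f w" "f x"] B[of w] B[of x] w x r by linarith
    moreover have "w \<noteq> x" using w x r by auto
    ultimately show "norm (g w) \<le> 2 * B / (\<rho> - r)"
      using r B0 by (auto simp: g_def norm_divide intro!: frac_le)
  qed
  thus ?thesis by (simp add: g_def)
qed

text \<open>An analogue of the Schwarz lemma: the determinant is small because it vanishes whenever
  two of the points coincide. Splitting off one point writes \<open>f i (x j)\<close> as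
  \<open>f i (x 0) + (x j - x 0) * g i (x j)\<close> with divided differences \<open>g i\<close>, to
  which the induction hypothesis applies at the remaining points. Going from n + 1 points to n, the
  bounds for the \<open>g i\<close> contribute 2 / (\<rho> - r) per row and the differences at most
  2 r each, together (4 r / (\<rho> - r)) ^ n; these exponents add up to a triangular
  number.\<close>

lemma interpolation_determinant_bound:
  fixes f :: "nat \<Rightarrow> complex \<Rightarrow> complex"
  assumes "\<And>i. i < n \<Longrightarrow> f i holomorphic_on UNIV"
    and "\<And>i z. i < n \<Longrightarrow> norm z \<le> \<rho> \<Longrightarrow> norm (f i z) \<le> B i"
    and "\<And>j. j < n \<Longrightarrow> norm (x j) \<le> r" and r: "r < \<rho>" "0 \<le> r"
  shows "norm (fdet n (\<lambda>i j. f i (x j))) \<le> fact n * (\<Prod>i<n. B i) * (4 * r / (\<rho> - r)) ^ (n * (n - 1) div 2)"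
  using assms(1-3)
proof (induction n arbitrary: f x B)
  case 0
  thus ?case by (simp add: fdet_leibniz)
next
  case (Suc n)
  define g where "g = (\<lambda>i z. if z = x 0 then deriv (f i) (x 0) else (f i z - f i (x 0)) / (z - x 0))"
  define B' where "B' = (\<lambda>i. 2 * B i / (\<rho> - r))"
  have B0: "0 \<le> B i" if "i \<le> n" for i
    using Suc.prems(2)[of i 0] that r by (auto intro: order_trans[OF norm_ge_zero])
  have x0: "norm (x 0) \<le> r" using Suc.prems(3)[of 0] by simp
  have gh: "g i holomorphic_on UNIV" if "i \<le> n" for i
    unfolding g_def by (rule pole_lemma) (use Suc.prems(1)[of i] that in auto)
  have gB: "norm (g i z) \<le> B' i" if "i \<le> n" "norm z \<le> \<rho>" for i z
    unfolding g_def B'_def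
    by (rule divided_difference_bound) (use Suc.prems(1,2)[of i] that x0 r in auto)
  \<comment> \<open>\<open>U\<close> performs the column operations: its first row adds column 0 to
    all others and its diagonal multiplies by the differences \<open>x j - x 0\<close>, so its
    determinant is the product that is split off.\<close>
  define A where "A = (\<lambda>i j. if j = 0 then f i (x 0) else g i (x j))"
  define U where "U = (\<lambda>i j. if j = 0 then (if i = 0 then 1 else 0) else if i = 0 then 1 else if i = j then x j - x 0 else 0)"
  have MAU: "Matrix.mat (Suc n) (Suc n) (\<lambda>(i,j). f i (x j)) =
     Matrix.mat (Suc n) (Suc n) (\<lambda>(i,j). A i j) * Matrix.mat (Suc n) (Suc n) (\<lambda>(i,j). U i j)"
  proof (rule eq_matI)
    fix i j assume "i < dim_row (Matrix.mat (Suc n) (Suc n) (\<lambda>(i,j). A i j) * Matrix.mat (Suc n) (Suc n) (\<lambda>(i,j). U i j))"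
      "j < dim_col (Matrix.mat (Suc n) (Suc n) (\<lambda>(i,j). A i j) * Matrix.mat (Suc n) (Suc n) (\<lambda>(i,j). U i j))"
    hence ij: "i < Suc n" "j < Suc n" by auto
    have "(Matrix.mat (Suc n) (Suc n) (\<lambda>(i,j). A i j) * Matrix.mat (Suc n) (Suc n) (\<lambda>(i,j). U i j)) $$ (i,j)
      = (\<Sum>k=0..<Suc n. A i k * U k j)"
      using ij by (simp add: scalar_prod_def del: sum.op_ivl_Suc)
    also have "\<dots> = (\<Sum>k\<in>{0,j}. A i k * U k j)"
      by (rule sum.mono_neutral_right) (use ij in \<open>auto simp: U_def\<close>)
    also have "\<dots> = f i (x j)"
      by (cases "j = 0") (auto simp: A_def U_def g_def)
    finally show "Matrix.mat (Suc n) (Suc n) (\<lambda>(i,j). f i (x j)) $$ (i,j) = (Matrix.mat (Suc n) (Suc n) (\<lambda>(i,j). A i j) * Matrix.mat (Suc n) (Suc n) (\<lambda>(i,j). U i j)) $$ (i,j)"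
      using ij by simp
  qed auto
  have detU: "fdet (Suc n) U = (\<Prod>j<n. x (Suc j) - x 0)"
  proof -
    have "fdet (Suc n) U = prod_list (diag_mat (Matrix.mat (Suc n) (Suc n) (\<lambda>(i,j). U i j)))"
      by (rule det_upper_triangular) (auto simp: U_def upper_triangular_def)
    also have "\<dots> = (\<Prod>i=0..<Suc n. U i i)"
      by (simp add: prod_list_diag_prod del: prod.op_ivl_Suc)
    also have "\<dots> = U 0 0 * (\<Prod>i<n. U (Suc i) (Suc i))"
      by (subst prod.atLeast0_lessThan_Suc_shift) (simp add: atLeast0LessThan)
    finally show ?thesis by (simp add: U_def)
  qed
  have eq: "fdet (Suc n) (\<lambda>i j. f i (x j)) = fdet (Suc n) A * (\<Prod>j<n. x (Suc j) - x 0)"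
    unfolding MAU detU[symmetric] by (rule Determinant.det_mult) auto
  define c where "c = (4 * r / (\<rho> - r)) ^ (n * (n - 1) div 2)"
  have c0: "0 \<le> c" using r by (simp add: c_def)
  have minor: "norm (fdet n (\<lambda>i' j'. A (insert_index i i') (insert_index 0 j')))
      \<le> fact n * (\<Prod>k\<in>{..n}-{i}. B' k) * c" if i: "i \<le> n" for i
  proof -
    have "fdet n (\<lambda>i' j'. A (insert_index i i') (insert_index 0 j')) =
          fdet n (\<lambda>i' j'. g (insert_index i i') (x (Suc j')))"
      by (rule fdet_cong) (auto simp: A_def insert_index_def)
    also have "norm \<dots> \<le> fact n * (\<Prod>i'<n. B' (insert_index i i')) * c"
      unfolding c_def
      by (rule Suc.IH[of "\<lambda>i'. g (insert_index i i')" "\<lambda>i'. B' (insert_index i i')" "\<lambda>j. x (Suc j)"])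
         (auto simp: insert_index_def intro!: gh gB Suc.prems(3))
    also have "(\<Prod>i'<n. B' (insert_index i i')) = (\<Prod>k\<in>{..n}-{i}. B' k)"
    proof (rule prod.reindex_bij_witness[of _ "\<lambda>k. if k < i then k else k - 1" "insert_index i"])
    qed (use i in \<open>auto simp: insert_index_def\<close>)
    finally show ?thesis .
  qed
  have "norm (fdet (Suc n) A) \<le> (\<Sum>i\<le>n. B i * (fact n * (\<Prod>k\<in>{..n}-{i}. B' k) * c))"
    unfolding fdet_laplace_column[of 0 n A, OF le0] add_0_right
  proof (rule sum_norm_le)
    fix i assume i: "i \<in> {..n}"
    have "norm (A i 0) \<le> B i"
      using i Suc.prems(2)[of i "x 0"] x0 r by (simp add: A_def)
    hence "norm (A i 0) * norm (fdet n (\<lambda>i' j'. A (insert_index i i') (insert_index 0 j')))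
        \<le> B i * (fact n * prod B' ({..n} - {i}) * c)"
      by (rule mult_mono) (use i B0[of i] minor[of i] in auto)
    thus "norm (A i 0 * ((- 1) ^ i * fdet n (\<lambda>i' j'. A (insert_index i i') (insert_index 0 j'))))
        \<le> B i * (fact n * prod B' ({..n} - {i}) * c)"
      unfolding norm_mult norm_power by simp
  qed
  also have "\<dots> = (\<Sum>i\<le>n. fact n * (\<Prod>k\<le>n. B k) * (2 / (\<rho> - r)) ^ n * c)"
  proof (rule sum.cong)
    fix i assume i: "i \<in> {..n}"
    have "(\<Prod>k\<in>{..n}-{i}. B' k) = (\<Prod>k\<in>{..n}-{i}. B k) * (2 / (\<rho> - r)) ^ n"
    proof -
      have "(\<Prod>k\<in>{..n}-{i}. B' k) = (\<Prod>k\<in>{..n}-{i}. B k * (2 / (\<rho> - r)))"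
        by (simp add: B'_def mult_ac)
      also have "\<dots> = (\<Prod>k\<in>{..n}-{i}. B k) * (2 / (\<rho> - r)) ^ card ({..n}-{i})"
        by (simp only: prod.distrib prod_constant)
      finally show ?thesis using i by simp
    qed
    moreover have "(\<Prod>k\<le>n. B k) = B i * (\<Prod>k\<in>{..n}-{i}. B k)"
      using i by (subst prod.remove[of _ i]) auto
    ultimately show "B i * (fact n * (\<Prod>k\<in>{..n}-{i}. B' k) * c) = fact n * (\<Prod>k\<le>n. B k) * (2 / (\<rho> - r)) ^ n * c"
      by simp
  qed auto
  also have "\<dots> = fact (Suc n) * (\<Prod>k\<le>n. B k) * (2 / (\<rho> - r)) ^ n * c"
    by simp
  finally have 1: "norm (fdet (Suc n) A) \<le> fact (Suc n) * (\<Prod>k\<le>n. B k) * (2 / (\<rho> - r)) ^ n * c" .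
  have 2: "norm (\<Prod>j<n. x (Suc j) - x 0) \<le> (2 * r) ^ n"
  proof -
    have "norm (\<Prod>j<n. x (Suc j) - x 0) = (\<Prod>j<n. norm (x (Suc j) - x 0))"
      by (simp add: prod_norm)
    also have "\<dots> \<le> (\<Prod>j<n. 2 * r)"
    proof (rule prod_mono)
      fix j assume "j \<in> {..<n}"
      hence "norm (x (Suc j)) \<le> r" using Suc.prems(3)[of "Suc j"] by simp
      with x0 have "norm (x (Suc j) - x 0) \<le> r + r"
        by (intro order_trans[OF norm_triangle_ineq4]) (rule add_mono)
      thus "0 \<le> norm (x (Suc j) - x 0) \<and> norm (x (Suc j) - x 0) \<le> 2 * r" by simp
    qed
    finally show ?thesis by simp
  qed
  have "norm (fdet (Suc n) (\<lambda>i j. f i (x j))) \<le>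
      (fact (Suc n) * (\<Prod>k\<le>n. B k) * (2 / (\<rho> - r)) ^ n * c) * (2 * r) ^ n"
    unfolding eq norm_mult
    by (rule mult_mono[OF 1 2]) (use B0 c0 r in \<open>auto intro!: mult_nonneg_nonneg prod_nonneg\<close>)
  also have "\<dots> = fact (Suc n) * (\<Prod>k\<le>n. B k) * (c * ((2 / (\<rho> - r)) ^ n * (2 * r) ^ n))"
    by (simp only: mult_ac)
  also have "c * ((2 / (\<rho> - r)) ^ n * (2 * r) ^ n) = (4 * r / (\<rho> - r)) ^ (Suc n * (Suc n - 1) div 2)"
  proof -
    have "(2 / (\<rho> - r)) ^ n * (2 * r) ^ n = (4 * r / (\<rho> - r)) ^ n"
      unfolding power_mult_distrib[symmetric] by simp
    moreover have "Suc n * (Suc n - 1) div 2 = n * (n - 1) div 2 + n"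
    proof -
      have "Suc n * (Suc n - 1) = n * (n - 1) + n * 2" by (cases n) auto
      thus ?thesis by (simp only: div_mult_self1)
    qed
    ultimately show ?thesis by (simp add: c_def power_add)
  qed
  finally show ?case by (simp add: lessThan_Suc_atMost)
qed

text \<open>Functions that are linearly independent on \<open>X\<close> can be separated by points
  of \<open>X\<close>. Given points for the first n functions, the cofactors of one additional
  column are the coefficients of a linear combination of all n + 1 functions. The coefficient of the
  last function is the old determinant, hence nonzero, so the combination is nonzero somewhere on
  \<open>X\<close>, and such a place is the new point.\<close>

lemma exists_nonzero_minor:
  fixes f :: "nat \<Rightarrow> 'x \<Rightarrow> 'a :: field"
  assumes "\<And>c. (\<And>x. x \<in> X \<Longrightarrow> (\<Sum>i<n. c i * f i x) = 0) \<Longrightarrow> (\<forall>i<n. c i = 0)"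
  shows "\<exists>x. (\<forall>j<n. x j \<in> X) \<and> fdet n (\<lambda>i j. f i (x j)) \<noteq> 0"
  using assms
proof (induction n)
  case 0
  show ?case by (simp add: fdet_leibniz)
next
  case (Suc n)
  have "\<exists>x. (\<forall>j<n. x j \<in> X) \<and> fdet n (\<lambda>i j. f i (x j)) \<noteq> 0"
  proof (rule Suc.IH)
    fix c assume c: "\<And>x. x \<in> X \<Longrightarrow> (\<Sum>i<n. c i * f i x) = 0"
    have "\<forall>i<Suc n. (c(n := 0)) i = 0"
      by (rule Suc.prems) (use c in \<open>auto simp: sum.lessThan_Suc cong: sum.cong_simp\<close>)
    thus "\<forall>i<n. c i = 0" by (metis fun_upd_apply less_Suc_eq nat_neq_iff)
  qed
  then obtain x where x: "\<And>j. j < n \<Longrightarrow> x j \<in> X" "fdet n (\<lambda>i j. f i (x j)) \<noteq> 0" by auto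
  define c where "c = (\<lambda>i. (-1) ^ (i + n) * fdet n (\<lambda>i' j'. f (insert_index i i') (x j')))"
  have exp: "fdet (Suc n) (\<lambda>i j. f i ((x(n := y)) j)) = (\<Sum>i<Suc n. c i * f i y)" for y
  proof -
    have "fdet n (\<lambda>i' j'. f (insert_index i i') ((x(n := y)) (insert_index n j'))) =
          fdet n (\<lambda>i' j'. f (insert_index i i') (x j'))" for i
      by (rule fdet_cong) (auto simp: insert_index_def)
    thus ?thesis
      by (subst fdet_laplace_column[of n n]) (auto simp: c_def lessThan_Suc_atMost mult_ac intro!: sum.cong)
  qed
  have "c n = fdet n (\<lambda>i j. f i (x j))"
    unfolding c_def by (auto intro!: fdet_cong simp: insert_index_def simp flip: mult_2)
  with x have "c n \<noteq> 0" by simp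
  hence "\<not> (\<forall>y\<in>X. (\<Sum>i<Suc n. c i * f i y) = 0)"
    using Suc.prems[of c] by blast
  then obtain y where y: "y \<in> X" "(\<Sum>i<Suc n. c i * f i y) \<noteq> 0" by blast
  show ?case
    by (rule exI[of _ "x(n := y)"]) (use x y exp[of y] in \<open>auto simp: less_Suc_eq\<close>)
qed

text \<open>A kernel vector of the transposed matrix is the coefficient vector of a nonzero
  polynomial of degree below n with the n distinct roots \<open>y j\<close>.\<close>

lemma vandermonde_nonzero:
  fixes y :: "nat \<Rightarrow> 'a :: field"
  assumes inj: "inj_on y {..<n}"
  shows "fdet n (\<lambda>i j. y j ^ i) \<noteq> 0"
proof
  assume "fdet n (\<lambda>i j. y j ^ i) = 0"
  let ?A = "Matrix.mat n n (\<lambda>(i,j). y j ^ i)"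
  have "Determinant.det (transpose_mat ?A) = 0"
    using \<open>fdet n (\<lambda>i j. y j ^ i) = 0\<close> by (subst Determinant.det_transpose[of _ n]) auto
  then obtain v where v: "v \<in> carrier_vec n" "v \<noteq> 0\<^sub>v n" "transpose_mat ?A *\<^sub>v v = 0\<^sub>v n"
    using det_0_iff_vec_prod_zero_field[of "transpose_mat ?A" n] by auto
  define P where "P = (\<Sum>i<n. Polynomial.monom (v $ i) i)"
  have root: "poly P (y j) = 0" if "j < n" for j
  proof -
    have "(transpose_mat ?A *\<^sub>v v) $ j = 0" using v(3) that by simp
    thus ?thesis using that v(1)
      by (simp add: P_def poly_sum poly_monom scalar_prod_def mult.commute atLeast0LessThan)
  qed
  have coeffP: "poly.coeff P i = (if i < n then v $ i else 0)" for i
    by (simp add: P_def coeff_sum)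
  have "P \<noteq> 0"
  proof
    assume "P = 0"
    hence "v $ i = 0" if "i < n" for i using coeffP[of i] that by simp
    hence "v = 0\<^sub>v n" using v(1) by (intro eq_vecI) auto
    with v(2) show False by simp
  qed
  have n0: "n > 0" using v by (cases n) auto
  have "card (y ` {..<n}) \<le> card {x. poly P x = 0}"
    using \<open>P \<noteq> 0\<close> root by (intro card_mono poly_roots_finite) auto
  also have "\<dots> \<le> degree P" by (rule card_poly_roots_bound) fact
  also have "\<dots> < n"
    using n0 coeffP by (intro degree_lessI) auto
  finally show False using inj by (simp add: card_image)
qed


section \<open>A zero estimate for polynomials in x and powers of an exponential\<close>

lemma fdet_poly: "poly (fdet n f) x = fdet n (\<lambda>i j. poly (f i j) x)"
  for f :: "nat \<Rightarrow> nat \<Rightarrow> 'a :: comm_ring_1 poly"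
  unfolding fdet_leibniz
  by (auto simp: poly_sum poly_prod sign_def intro!: sum.cong)

lemma coeff_prod_top:
  fixes f :: "'i \<Rightarrow> 'a :: idom poly"
  assumes "finite A" and "\<And>i. i \<in> A \<Longrightarrow> f i \<noteq> 0"
  shows "degree (\<Prod>i\<in>A. f i) = (\<Sum>i\<in>A. degree (f i)) \<and> lead_coeff (\<Prod>i\<in>A. f i) = (\<Prod>i\<in>A. lead_coeff (f i))"
proof
  show "degree (\<Prod>i\<in>A. f i) = (\<Sum>i\<in>A. degree (f i))"
    by (rule degree_prod_eq_sum_degree) (use assms in auto)
qed (rule lead_coeff_prod)

text \<open>This will guarantee a nonzero determinant. For (x, y) in \<open>Z\<close>, the relations
  at the translates (x + i a, \<eta> ^ i y) say that the vector of powers y ^ l lies in the kernel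
  of the matrix with entries P l (x + i a) \<eta> ^ (i l). Its determinant is a polynomial in x
  alone. It is nonzero, since its top coefficient is a Vandermonde determinant in the numbers \<eta>
  ^ l times the leading coefficients, and its degree is at most L (K - 1), fewer than the K L
  abscissae at which it would have to vanish.\<close>

lemma polynomial_exponential_zero_estimate:
  fixes P :: "nat \<Rightarrow> real poly" and a \<eta> :: real and Z :: "(real \<times> real) set"
  assumes \<eta>: "\<eta> > 1" and fin: "finite (fst ` Z)" and card: "card (fst ` Z) \<ge> K * L" and K: "K > 0"
    and nz: "\<And>x y. (x, y) \<in> Z \<Longrightarrow> y \<noteq> 0"
    and deg: "\<And>l. l < L \<Longrightarrow> degree (P l) < K"
    and zero: "\<And>x y i. (x, y) \<in> Z \<Longrightarrow> i < L \<Longrightarrow> (\<Sum>l<L. poly (P l) (x + real i * a) * (\<eta> ^ i * y) ^ l) = 0"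
    and l: "l < L"
  shows "P l = 0"
proof (rule ccontr)
  assume "P l \<noteq> 0"
  \<comment> \<open>Only the nonzero \<open>P l\<close> are kept, so that every column has a leading
    coefficient; \<open>e\<close> will enumerate their indices.\<close>
  define I where "I = {l. l < L \<and> P l \<noteq> 0}"
  have finI: "finite I" by (simp add: I_def)
  define m where "m = card I"
  have m: "m > 0" "m \<le> L"
    using \<open>P l \<noteq> 0\<close> l card_mono[of "{..<L}" I] by (auto simp: m_def I_def card_gt_0_iff)
  obtain e where e: "bij_betw e {..<m} I"
    using ex_bij_betw_nat_finite[OF finI] by (auto simp: m_def atLeast0LessThan)
  have eI: "e j \<in> I" if "j < m" for j using e that by (auto simp: bij_betw_def)
  define A where "A = (\<lambda>i j. Polynomial.smult ((\<eta> ^ e j) ^ i) (P (e j) \<circ>\<^sub>p [:real i * a, 1:]))"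
  define D where "D = fdet m A"
  have A0: "A i j \<noteq> 0" and degA: "degree (A i j) = degree (P (e j))"
    and lcA: "lead_coeff (A i j) = (\<eta> ^ e j) ^ i * lead_coeff (P (e j))" if "j < m" for i j
  proof -
    have "P (e j) \<circ>\<^sub>p [:real i * a, 1:] \<noteq> 0"
      using eI[OF that] by (auto simp: I_def pcompose_eq_0_iff)
    thus "A i j \<noteq> 0" using \<eta> by (auto simp: A_def)
    show 1: "degree (A i j) = degree (P (e j))" using \<eta> by (simp add: A_def degree_pcompose)
    have "lead_coeff (P (e j) \<circ>\<^sub>p [:real i * a, 1:]) = lead_coeff (P (e j))"
      by (subst lead_coeff_comp) auto
    thus "lead_coeff (A i j) = (\<eta> ^ e j) ^ i * lead_coeff (P (e j))"
      using \<eta> by (simp add: A_def)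
  qed
  \<comment> \<open>Shifting the argument changes neither degree nor leading coefficient, so all
    terms of the Leibniz formula have the same degree \<open>d\<close>, and their coefficients at
    \<open>d\<close> form a determinant again.\<close>
  define d where "d = (\<Sum>j<m. degree (P (e j)))"
  have perm: "degree (\<Prod>i=0..<m. A i (p i)) = d \<and>
      poly.coeff (\<Prod>i=0..<m. A i (p i)) d = (\<Prod>i=0..<m. (\<eta> ^ e (p i)) ^ i) * (\<Prod>j<m. lead_coeff (P (e j)))"
    if p: "p permutes {0..<m}" for p
  proof -
    have pm: "p i < m" if "i < m" for i using permutes_in_image[OF p, of i] that by simp
    have r1: "(\<Sum>i=0..<m. degree (P (e (p i)))) = d"
      unfolding d_def atLeast0LessThan[symmetric]
      using sum.permute[OF p, of "\<lambda>j. degree (P (e j))"] by (simp add: o_def)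
    have r2: "(\<Prod>i=0..<m. lead_coeff (P (e (p i)))) = (\<Prod>j<m. lead_coeff (P (e j)))"
      unfolding atLeast0LessThan[symmetric]
      using prod.permute[OF p, of "\<lambda>j. lead_coeff (P (e j))"] by (simp add: o_def)
    have t: "degree (\<Prod>i=0..<m. A i (p i)) = (\<Sum>i=0..<m. degree (A i (p i))) \<and>
        lead_coeff (\<Prod>i=0..<m. A i (p i)) = (\<Prod>i=0..<m. lead_coeff (A i (p i)))"
      by (rule coeff_prod_top) (use A0 pm in auto)
    have "(\<Sum>i=0..<m. degree (A i (p i))) = d"
      unfolding r1[symmetric] by (rule sum.cong) (use degA pm in auto)
    moreover have "(\<Prod>i=0..<m. lead_coeff (A i (p i))) = (\<Prod>i=0..<m. (\<eta> ^ e (p i)) ^ i) * (\<Prod>j<m. lead_coeff (P (e j)))"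
      unfolding r2[symmetric] prod.distrib[symmetric] by (rule prod.cong) (use lcA pm in auto)
    ultimately show ?thesis using t by metis
  qed
  have "poly.coeff D d = fdet m (\<lambda>i j. (\<eta> ^ e j) ^ i) * (\<Prod>j<m. lead_coeff (P (e j)))"
  proof -
    have "poly.coeff D d = (\<Sum>p\<in>{p. p permutes {0..<m}}. signof p * poly.coeff (\<Prod>i=0..<m. A i (p i)) d)"
      unfolding D_def fdet_leibniz coeff_sum by (rule sum.cong) (auto simp: sign_def)
    also have "\<dots> = (\<Sum>p\<in>{p. p permutes {0..<m}}. signof p * (\<Prod>i=0..<m. (\<eta> ^ e (p i)) ^ i) * (\<Prod>j<m. lead_coeff (P (e j))))"
      by (rule sum.cong) (use perm in auto)
    finally show ?thesis by (simp add: fdet_leibniz sum_distrib_right)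
  qed
  moreover have "fdet m (\<lambda>i j. (\<eta> ^ e j) ^ i) \<noteq> 0"
  proof (rule vandermonde_nonzero)
    show "inj_on (\<lambda>j. \<eta> ^ e j) {..<m}"
      using e \<eta> by (auto simp: inj_on_def bij_betw_def power_inject_exp)
  qed
  moreover have "(\<Prod>j<m. lead_coeff (P (e j))) \<noteq> 0"
    using eI by (auto simp: I_def)
  ultimately have D0: "D \<noteq> 0" by auto
  have "degree D \<le> d"
    unfolding D_def fdet_leibniz
  proof (rule degree_sum_le)
    fix p assume "p \<in> {p. p permutes {0..<m}}"
    thus "degree (signof p * (\<Prod>i=0..<m. A i (p i))) \<le> d"
      using perm[of p] by (cases "evenperm p") (auto simp: sign_def)
  qed (auto intro: finite_permutations)
  also have "d \<le> (\<Sum>j<m. K - 1)"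
    unfolding d_def using deg eI by (intro sum_mono) (fastforce simp: I_def)
  also have "\<dots> = m * (K - 1)" by simp
  also have "\<dots> \<le> L * (K - 1)" using m by (intro mult_le_mono1)
  also have "\<dots> < L * K" using m K by (intro mult_less_mono2) auto
  finally have "degree D < card (fst ` Z)" using card by (simp add: mult.commute)
  moreover have "card (fst ` Z) \<le> card {x. poly D x = 0}"
  proof (rule card_mono)
    show "finite {x. poly D x = 0}" using D0 by (rule poly_roots_finite)
    show "fst ` Z \<subseteq> {x. poly D x = 0}"
    proof safe
      fix x y assume xy: "(x, y) \<in> Z"
      let ?M = "Matrix.mat m m (\<lambda>(i,j). poly (A i j) x)"
      let ?v = "Matrix.vec m (\<lambda>j. y ^ e j)"
      have "?M *\<^sub>v ?v = 0\<^sub>v m"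
      proof (rule eq_vecI)
        fix i assume "i < dim_vec (0\<^sub>v m :: real Matrix.vec)"
        hence i: "i < m" by simp
        have "(?M *\<^sub>v ?v) $ i = (\<Sum>j<m. poly (A i j) x * y ^ e j)"
          using i by (simp add: scalar_prod_def atLeast0LessThan)
        also have "\<dots> = (\<Sum>j<m. poly (P (e j)) (x + real i * a) * (\<eta> ^ i * y) ^ e j)"
          by (rule sum.cong) (auto simp: A_def poly_pcompose power_mult_distrib add.commute mult_ac simp flip: power_mult)
        also have "\<dots> = (\<Sum>l\<in>I. poly (P l) (x + real i * a) * (\<eta> ^ i * y) ^ l)"
          by (rule sum.reindex_bij_betw[OF e])
        also have "\<dots> = (\<Sum>l<L. poly (P l) (x + real i * a) * (\<eta> ^ i * y) ^ l)"
          by (rule sum.mono_neutral_left) (auto simp: I_def)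
        also have "\<dots> = 0" using zero[OF xy, of i] i m by simp
        finally show "(?M *\<^sub>v ?v) $ i = 0\<^sub>v m $ i" using i by simp
      qed auto
      moreover have "?v \<noteq> 0\<^sub>v m"
      proof
        assume "?v = 0\<^sub>v m"
        hence "?v $ 0 = 0\<^sub>v m $ 0" by (rule arg_cong)
        thus False using m nz[OF xy] by simp
      qed
      ultimately have "Determinant.det ?M = 0"
        using det_0_iff_vec_prod_zero_field[of ?M m] by (metis mat_carrier vec_carrier)
      thus "poly D (fst (x, y)) = 0" by (simp add: D_def fdet_poly)
    qed
  qed
  moreover have "card {x. poly D x = 0} \<le> degree D" by (rule card_poly_roots_bound[OF D0])
  ultimately show False by simp
qed

section \<open>Perturbation and integrality of determinants\<close>

lemma norm_prod_diff_le:
  fixes z w :: "nat \<Rightarrow> 'a::{real_normed_field}"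
  assumes "M > 0" "\<And>i. i < n \<Longrightarrow> norm (z i) \<le> M" "\<And>i. i < n \<Longrightarrow> norm (w i) \<le> M"
    "\<And>i. i < n \<Longrightarrow> norm (z i - w i) \<le> M * \<delta>"
  shows "norm ((\<Prod>i=0..<n. z i) - (\<Prod>i=0..<n. w i)) \<le> M ^ n * (real n * \<delta>)"
proof -
  have "norm ((\<Prod>i=0..<n. z i / of_real M) - (\<Prod>i=0..<n. w i / of_real M)) \<le> (\<Sum>i=0..<n. norm (z i / of_real M - w i / of_real M))"
    by (rule norm_prod_diff) (use assms in \<open>auto simp: norm_divide\<close>)
  also have "\<dots> \<le> (\<Sum>i=0..<n. \<delta>)"
  proof (rule sum_mono)
    fix i assume "i \<in> {0..<n}"
    hence "norm (z i - w i) \<le> M * \<delta>" using assms by auto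
    thus "norm (z i / of_real M - w i / of_real M) \<le> \<delta>"
      using assms(1) by (simp add: norm_divide field_simps flip: diff_divide_distrib)
  qed
  also have "(\<Prod>i=0..<n. z i / of_real M) - (\<Prod>i=0..<n. w i / of_real M) = ((\<Prod>i=0..<n. z i) - (\<Prod>i=0..<n. w i)) / of_real M ^ n"
    by (simp add: prod_dividef diff_divide_distrib)
  finally show ?thesis using assms(1) by (simp add: norm_divide norm_power field_simps)
qed

lemma fdet_diff_bound:
  fixes f g :: "nat \<Rightarrow> nat \<Rightarrow> 'a::{real_normed_field}"
  assumes "M > 0" "\<And>i j. i < n \<Longrightarrow> j < n \<Longrightarrow> norm (f i j) \<le> M"
    "\<And>i j. i < n \<Longrightarrow> j < n \<Longrightarrow> norm (g i j) \<le> M"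
    "\<And>i j. i < n \<Longrightarrow> j < n \<Longrightarrow> norm (f i j - g i j) \<le> M * \<delta>"
  shows "norm (fdet n f - fdet n g) \<le> fact n * (M ^ n * (real n * \<delta>))"
proof -
  have "norm (fdet n f - fdet n g) \<le> (\<Sum>p\<in>{p. p permutes {0..<n}}. M ^ n * (real n * \<delta>))"
    unfolding fdet_leibniz sum_subtractf[symmetric]
  proof (rule sum_norm_le)
    fix p assume "p \<in> {p. p permutes {0..<n}}"
    hence p: "p permutes {0..<n}" by simp
    have pn: "p i < n" if "i < n" for i using permutes_in_image[OF p, of i] that by simp
    have "norm (signof p * (\<Prod>i=0..<n. f i (p i)) - signof p * (\<Prod>i=0..<n. g i (p i)))
        = norm ((\<Prod>i=0..<n. f i (p i)) - (\<Prod>i=0..<n. g i (p i)))"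
      by (auto simp: sign_def norm_minus_commute)
    also have "\<dots> \<le> M ^ n * (real n * \<delta>)"
      by (rule norm_prod_diff_le) (use assms pn in auto)
    finally show "norm (signof p * (\<Prod>i=0..<n. f i (p i)) - signof p * (\<Prod>i=0..<n. g i (p i))) \<le> M ^ n * (real n * \<delta>)" .
  qed
  also have "\<dots> = fact n * (M ^ n * (real n * \<delta>))"
    by (simp add: card_permutations[where n = n] del: mult_eq_0_iff)
  finally show ?thesis .
qed

lemma fdet_Ints:
  assumes "\<And>i j. i < n \<Longrightarrow> j < n \<Longrightarrow> f i j \<in> \<int>"
  shows "fdet n f \<in> (\<int> :: 'a :: comm_ring_1 set)"
  unfolding fdet_leibniz
proof (intro Ints_sum Ints_mult Ints_prod)
  fix p i assume p: "p \<in> {p. p permutes {0..<n}}" and i: "i \<in> {0..<n}"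
  thus "f i (p i) \<in> \<int>" using permutes_in_image[of p "{0..<n}" i] assms by auto
qed (auto simp: sign_def)

text \<open>Pairs (k, l) with k < K and l < L are coded as k L + l, which numbers the products of a
  k-th power and an l-th exponential by the rows of one matrix.\<close>

lemma sum_lessThan_mult:
  fixes f :: "nat \<Rightarrow> 'a :: comm_monoid_add"
  shows "(\<Sum>i<K * L. f i) = (\<Sum>l<L. \<Sum>k<K. f (k * L + l))"
proof -
  have "(\<Sum>i<K * L. f i) = (\<Sum>(l,k)\<in>{..<L} \<times> {..<K}. f (k * L + l))"
  proof (rule sum.reindex_bij_witness[of _ "\<lambda>(l,k). k * L + l" "\<lambda>i. (i mod L, i div L)"])
    fix i assume i: "i \<in> {..<K * L}"
    hence "L > 0" by (cases L) auto
    thus "(i mod L, i div L) \<in> {..<L} \<times> {..<K}" using i by (auto simp: less_mult_imp_div_less)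
  next
    fix b assume "b \<in> {..<L} \<times> {..<K}"
    then obtain l k where b: "b = (l, k)" "l < L" "k < K" by auto
    have "k * L + l < k * L + L" using b by simp
    also have "\<dots> = Suc k * L" by simp
    also have "\<dots> \<le> K * L" using b by (intro mult_le_mono1) auto
    finally show "(case b of (l, k) \<Rightarrow> k * L + l) \<in> {..<K * L}" using b by simp
  qed auto
  thus ?thesis by (simp add: sum.cartesian_product)
qed

lemma fdet_of_real: "fdet n (\<lambda>i j. complex_of_real (f i j)) = complex_of_real (fdet n f)"
  unfolding fdet_leibniz of_real_sum by (rule sum.cong) (auto simp: sign_def)

text \<open>If \<open>\<beta>\<close> is replaced by \<open>b \<alpha> / a\<close>, the integers \<open>(\<rho> a + \<sigma> b) ^ k (p ^ \<rho> r ^ \<sigma>) ^ l\<close> become the values of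
  \<open>(a z) ^ k p powr (l z)\<close> at the points \<open>\<rho> + \<sigma> b / a\<close>. Their determinant is thus close to an
  interpolation determinant and smaller than \<open>1\<close>, although the zero estimate makes it a nonzero
  integer for a suitable choice of points.\<close>
lemma linear_form_two_logs_core:
  fixes p r a b K L R :: nat and rad \<delta> :: real
  defines "N \<equiv> K * L" and "\<alpha> \<equiv> ln (real p)" and "\<beta> \<equiv> ln (real r)"
  assumes pr: "p > 1" "r > 1" and a: "a > 0" and KL: "K > 0" "L > 0" "R > 0" "K * L \<le> R * R" "L \<le> R"
    and small: "\<bar>real a * \<beta> - real b * \<alpha>\<bar> \<le> \<delta>"
    and inj: "inj_on (\<lambda>(\<rho>,\<sigma>). \<rho> * a + \<sigma> * b) ({..<R} \<times> {..<R})"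
    and rad: "real (R + L) + real R * real b / real a \<le> rad"
    and h1: "real K * ln (real a * (13 * rad)) + real L * \<alpha> * (13 * rad) \<le> real N / 4"
    and h2: "ln (real N) \<le> real N / 16" and N16: "N \<ge> 16"
    and h3: "4 * real N ^ (N + 1) * 3 ^ N * exp (real N ^ 2 / 4) * (real L * real R * \<delta>) < 1"
  shows False
proof -
  have \<alpha>0: "\<alpha> > 0" using pr by (simp add: \<alpha>_def)
  have \<delta>0: "\<delta> \<ge> 0" using small by linarith
  have rad_ge1: "rad \<ge> 1"
  proof -
    have "real R * real b / real a \<ge> 0" by simp
    moreover have "real (R + L) \<ge> 1" using KL by linarith
    ultimately show ?thesis using rad by linarith
  qed
  have arad: "real a * (13 * rad) \<ge> 1"
    using mult_mono[of 1 "real a" 1 "13 * rad"] a rad_ge1 by simp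
  define Bm where "Bm = (real a * (13 * rad)) ^ K * exp (\<alpha> * real L * (13 * rad))"
  have Bm0: "Bm > 0"
  proof -
    have "(real a * (13 * rad)) ^ K > 0" using arad by (intro zero_less_power) linarith
    thus ?thesis unfolding Bm_def by (intro mult_pos_pos) auto
  qed
  have Bm_le: "Bm \<le> exp (real N / 4)"
  proof -
    have "Bm = exp (real K * ln (real a * (13 * rad)) + real L * \<alpha> * (13 * rad))"
      using arad by (simp add: Bm_def exp_add exp_of_nat_mult mult_ac)
    thus ?thesis using h1 by simp
  qed
  \<comment> \<open>The zero estimate evaluates at (\<rho> + i, \<sigma>) with i < L, so the first
    coordinate needs the range R + L, while distinct abscissae are required only for \<rho>,
    \<sigma> < R.\<close>
  define X where "X = {..<R + L} \<times> {..<R}"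
  define g :: "nat \<Rightarrow> nat \<times> nat \<Rightarrow> real" where
    "g = (\<lambda>i (\<rho>,\<sigma>). real (\<rho> * a + \<sigma> * b) ^ (i div L) * (real p ^ \<rho> * real r ^ \<sigma>) ^ (i mod L))"
  have "\<exists>x. (\<forall>j<N. x j \<in> X) \<and> fdet N (\<lambda>i j. g i (x j)) \<noteq> 0"
  proof (rule exists_nonzero_minor)
    fix c :: "nat \<Rightarrow> real" assume c: "\<And>x. x \<in> X \<Longrightarrow> (\<Sum>i<N. c i * g i x) = 0"
    define P where "P = (\<lambda>l. \<Sum>k<K. Polynomial.monom (c (k * L + l)) k)"
    define Z where "Z = (\<lambda>(\<rho>,\<sigma>). (real (\<rho> * a + \<sigma> * b), real p ^ \<rho> * real r ^ \<sigma>)) ` ({..<R} \<times> {..<R})"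
    have fstZ: "fst ` Z = real ` (\<lambda>(\<rho>,\<sigma>). \<rho> * a + \<sigma> * b) ` ({..<R} \<times> {..<R})"
      unfolding Z_def image_image by (rule image_cong) auto
    have P0: "P l = 0" if "l < L" for l
    proof (rule polynomial_exponential_zero_estimate[where P = P and \<eta> = "real p" and a = "real a" and Z = Z and K = K and L = L])
      show "real p > 1" using pr by simp
      show "finite (fst ` Z)" by (simp add: Z_def)
      have "card (fst ` Z) = R * R"
        unfolding fstZ by (subst card_image[OF inj_on_of_nat], subst card_image[OF inj]) (auto simp: card_cartesian_product)
      thus "K * L \<le> card (fst ` Z)" using KL by simp
      show "K > 0" "l < L" by fact+
      show "y \<noteq> 0" if "(x, y) \<in> Z" for x y using that pr by (auto simp: Z_def)
      show "degree (P l') < K" for l'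
      proof (rule degree_lessI)
        show "\<forall>k\<ge>K. poly.coeff (P l') k = 0" by (auto simp: P_def coeff_sum)
      qed (use KL in auto)
      fix x y i assume "(x, y) \<in> Z" and i: "i < L"
      then obtain \<rho> \<sigma> where xy: "x = real (\<rho> * a + \<sigma> * b)" "y = real p ^ \<rho> * real r ^ \<sigma>" "\<rho> < R" "\<sigma> < R"
        by (auto simp: Z_def)
      have mem: "(\<rho> + i, \<sigma>) \<in> X" using xy i by (auto simp: X_def)
      have "(\<Sum>l<L. poly (P l) (x + real i * real a) * (real p ^ i * y) ^ l)
          = (\<Sum>l<L. \<Sum>k<K. c (k * L + l) * g (k * L + l) (\<rho> + i, \<sigma>))"
      proof (rule sum.cong)
        fix l assume l: "l \<in> {..<L}"
        have "x + real i * real a = real ((\<rho> + i) * a + \<sigma> * b)" using xy by (simp add: algebra_simps)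
        moreover have "real p ^ i * y = real p ^ (\<rho> + i) * real r ^ \<sigma>" using xy by (simp add: power_add)
        ultimately show "poly (P l) (x + real i * real a) * (real p ^ i * y) ^ l = (\<Sum>k<K. c (k * L + l) * g (k * L + l) (\<rho> + i, \<sigma>))"
          using l by (simp add: P_def poly_sum poly_monom g_def sum_distrib_right sum_distrib_left mult_ac del: of_nat_add of_nat_mult)
      qed auto
      also have "\<dots> = (\<Sum>i'<N. c i' * g i' (\<rho> + i, \<sigma>))"
        unfolding N_def by (rule sum_lessThan_mult[symmetric])
      also have "\<dots> = 0" by (rule c[OF mem])
      finally show "(\<Sum>l<L. poly (P l) (x + real i * real a) * (real p ^ i * y) ^ l) = 0" .
    qed
    show "\<forall>i<N. c i = 0"
    proof (intro allI impI)
      fix i assume i: "i < N"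
      have il: "i mod L < L" "i div L < K" using i KL by (auto simp: N_def less_mult_imp_div_less)
      have "poly.coeff (P (i mod L)) (i div L) = c ((i div L) * L + i mod L)"
        using il by (simp add: P_def coeff_sum)
      thus "c i = 0" using P0[OF il(1)] by simp
    qed
  qed
  then obtain x where x: "\<And>j. j < N \<Longrightarrow> x j \<in> X" and nz: "fdet N (\<lambda>i j. g i (x j)) \<noteq> 0" by blast
  define d where "d = fdet N (\<lambda>i j. g i (x j))"
  have "d \<in> \<int>"
    unfolding d_def by (rule fdet_Ints) (auto simp: g_def split: prod.split)
  hence d1: "\<bar>d\<bar> \<ge> 1" using nz by (auto simp: d_def Ints_def)
  define f :: "nat \<Rightarrow> complex \<Rightarrow> complex" where
    "f = (\<lambda>i z. (of_nat a * z) ^ (i div L) * exp (of_real (\<alpha> * real (i mod L)) * z))"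
  define y :: "nat \<Rightarrow> complex" where
    "y = (\<lambda>j. of_real (real (fst (x j)) + real (snd (x j)) * real b / real a))"
  have ynorm: "norm (y j) \<le> rad" if "j < N" for j
  proof -
    have m: "fst (x j) < R + L" "snd (x j) < R" using x[OF that] by (auto simp: X_def)
    have "norm (y j) = real (fst (x j)) + real (snd (x j)) * real b / real a"
      by (simp only: y_def norm_of_real) auto
    also have "\<dots> \<le> real (R + L) + real R * real b / real a"
      using m a by (intro add_mono divide_right_mono mult_right_mono) auto
    finally show ?thesis using rad by linarith
  qed
  have fB: "norm (f i z) \<le> Bm" if i: "i < N" and z: "norm z \<le> 13 * rad" for i z
  proof -
    have il: "i mod L < L" "i div L < K" using i KL by (auto simp: N_def less_mult_imp_div_less)
    have "norm (of_nat a * z) \<le> real a * (13 * rad)" unfolding norm_mult norm_of_nat using z by (intro mult_left_mono) auto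
    hence "norm ((of_nat a * z) ^ (i div L)) \<le> (real a * (13 * rad)) ^ (i div L)"
      unfolding norm_power by (intro power_mono) auto
    also have "\<dots> \<le> (real a * (13 * rad)) ^ K" using arad il by (intro power_increasing) auto
    finally have 1: "norm ((of_nat a * z) ^ (i div L)) \<le> (real a * (13 * rad)) ^ K" .
    have "norm (exp (of_real (\<alpha> * real (i mod L)) * z)) \<le> exp (norm (of_real (\<alpha> * real (i mod L)) * z))"
      by (rule norm_exp)
    also have "\<dots> \<le> exp (\<alpha> * real L * (13 * rad))"
    proof -
      have "norm (of_real (\<alpha> * real (i mod L)) * z) = \<alpha> * real (i mod L) * norm z"
        using \<alpha>0 by (simp add: norm_mult)
      also have "\<dots> \<le> \<alpha> * real L * (13 * rad)"
        using \<alpha>0 il z by (intro mult_mono) auto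
      finally show ?thesis by simp
    qed
    finally have 2: "norm (exp (of_real (\<alpha> * real (i mod L)) * z)) \<le> exp (\<alpha> * real L * (13 * rad))" .
    have "0 \<le> (real a * (13 * rad)) ^ K" by (rule zero_le_power) (use arad in linarith)
    from mult_mono[OF 1 2 this norm_ge_zero] show ?thesis unfolding f_def Bm_def norm_mult .
  qed
  \<comment> \<open>Points in the disc of radius \<open>rad\<close> and bounds on the disc of radius
    \<open>13 * rad\<close> make the ratio 4 r / (\<rho> - r) equal to 1 / 3, which is at most exp
    (-1).\<close>
  have bound1: "norm (fdet N (\<lambda>i j. f i (y j))) \<le> fact N * (\<Prod>i<N. Bm) * (4 * rad / (13 * rad - rad)) ^ (N * (N - 1) div 2)"
    by (rule interpolation_determinant_bound) (use ynorm fB rad_ge1 in \<open>auto simp: f_def intro!: holomorphic_intros\<close>)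
  define \<epsilon> where "\<epsilon> = real L * real R * \<delta>"
  have \<epsilon>1: "\<epsilon> \<le> 1" and \<epsilon>0: "\<epsilon> \<ge> 0"
  proof -
    show "\<epsilon> \<ge> 0" using \<delta>0 by (simp add: \<epsilon>_def)
    have "1 \<le> 4 * real N ^ (N + 1) * 3 ^ N * exp (real N ^ 2 / 4)"
      using N16 by (intro one_le_mult_iff[THEN iffD2] mult_ge1_I one_le_power) auto
    hence "1 * \<epsilon> \<le> 4 * real N ^ (N + 1) * 3 ^ N * exp (real N ^ 2 / 4) * \<epsilon>"
      using \<open>\<epsilon> \<ge> 0\<close> by (intro mult_right_mono)
    thus "\<epsilon> \<le> 1" using h3 by (simp add: \<epsilon>_def)
  qed
  have gf: "norm (complex_of_real (g i (x j)) - f i (y j)) \<le> (3 * Bm) * \<epsilon> \<and> norm (complex_of_real (g i (x j))) \<le> 3 * Bm"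
    if i: "i < N" and j: "j < N" for i j
  proof -
    obtain \<rho> \<sigma> where xj: "x j = (\<rho>, \<sigma>)" by (cases "x j")
    have m: "\<rho> < R + L" "\<sigma> < R" using x[OF j] xj by (auto simp: X_def)
    have il: "i mod L < L" "i div L < K" using i KL by (auto simp: N_def less_mult_imp_div_less)
    define l where "l = i mod L"
    \<comment> \<open>The exact discrepancy of the exponents when \<beta> is replaced by b \<alpha>
      / a: \<open>g i (x j)\<close> is \<open>f i (y j)\<close> times its exponential.\<close>
    define lam where "lam = real l * real \<sigma> * (\<beta> - \<alpha> * real b / real a)"
    have yj: "y j = of_real (real \<rho> + real \<sigma> * real b / real a)" by (simp add: y_def xj)
    have fr: "f i (y j) = of_real ((real (\<rho> * a + \<sigma> * b)) ^ (i div L) * exp (\<alpha> * real l * (real \<rho> + real \<sigma> * real b / real a)))"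
    proof -
      have "of_nat a * y j = complex_of_real (real (\<rho> * a + \<sigma> * b))"
        unfolding yj using a by (simp add: field_simps)
      thus ?thesis unfolding f_def yj l_def by (simp flip: exp_of_real)
    qed
    have pw: "(real p ^ \<rho> * real r ^ \<sigma>) ^ l = exp (\<alpha> * real l * (real \<rho> + real \<sigma> * real b / real a)) * exp lam"
    proof -
      have "real p ^ \<rho> * real r ^ \<sigma> = exp (\<alpha> * real \<rho> + \<beta> * real \<sigma>)"
        using pr by (simp add: exp_add \<alpha>_def \<beta>_def exp_of_nat2_mult)
      hence "(real p ^ \<rho> * real r ^ \<sigma>) ^ l = exp (real l * (\<alpha> * real \<rho> + \<beta> * real \<sigma>))"
        by (simp add: exp_of_nat_mult)
      also have "real l * (\<alpha> * real \<rho> + \<beta> * real \<sigma>) = \<alpha> * real l * (real \<rho> + real \<sigma> * real b / real a) + lam"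
        using a by (simp add: lam_def field_simps)
      finally show ?thesis by (simp add: exp_add)
    qed
    have gr: "complex_of_real (g i (x j)) = f i (y j) * of_real (exp lam)"
      unfolding fr g_def xj l_def[symmetric] using pw by (simp add: l_def)
    have lam: "\<bar>lam\<bar> \<le> \<epsilon>"
    proof -
      have "\<bar>\<beta> - \<alpha> * real b / real a\<bar> = \<bar>real a * \<beta> - real b * \<alpha>\<bar> / real a"
      proof -
        have "\<beta> - \<alpha> * real b / real a = (real a * \<beta> - real b * \<alpha>) / real a"
          using a by (simp add: field_simps)
        thus ?thesis by simp
      qed
      also have "\<dots> \<le> \<delta> / 1" using small a \<delta>0 by (intro frac_le) auto
      finally have "\<bar>\<beta> - \<alpha> * real b / real a\<bar> \<le> \<delta>" by simp
      thus ?thesis unfolding lam_def abs_mult \<epsilon>_def using il m by (intro mult_mono) (auto simp: l_def)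
    qed
    have e1: "\<bar>exp lam - 1\<bar> \<le> 3 * \<epsilon>"
    proof -
      have "norm (exp lam - 1) \<le> exp \<bar>lam\<bar> * \<bar>lam\<bar>"
      proof -
        have pos: "exp t - 1 \<le> exp t * t" for t :: real
        proof -
          have "1 - t \<le> exp (-t)" using exp_ge_add_one_self[of "-t"] by simp
          hence "exp t * (1 - t) \<le> exp t * exp (-t)" by (intro mult_left_mono) auto
          thus ?thesis by (simp add: algebra_simps flip: exp_add)
        qed
        show ?thesis
        proof (cases "lam \<ge> 0")
          case True
          thus ?thesis using pos[of lam] by simp
        next
          case False
          have "1 - exp lam \<le> 1 * \<bar>lam\<bar>" using exp_ge_add_one_self[of lam] False by linarith
          also have "\<dots> \<le> exp \<bar>lam\<bar> * \<bar>lam\<bar>" by (intro mult_right_mono) auto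
          finally show ?thesis using False by simp
        qed
      qed
      also have "\<dots> \<le> 3 * \<epsilon>"
      proof (rule mult_mono)
        have "exp \<bar>lam\<bar> \<le> exp 1" using lam \<epsilon>1 by simp
        thus "exp \<bar>lam\<bar> \<le> 3" using exp_le by linarith
      qed (use lam in auto)
      finally show ?thesis by simp
    qed
    have fBm: "norm (f i (y j)) \<le> Bm" using fB[OF i] ynorm[OF j] rad_ge1 by simp
    have "norm (complex_of_real (g i (x j)) - f i (y j)) = norm (f i (y j)) * \<bar>exp lam - 1\<bar>"
    proof -
      have "complex_of_real (g i (x j)) - f i (y j) = f i (y j) * of_real (exp lam - 1)"
        unfolding gr by (simp add: algebra_simps)
      thus ?thesis by (simp only: norm_mult norm_of_real)
    qed
    also have "\<dots> \<le> Bm * (3 * \<epsilon>)" using fBm e1 by (intro mult_mono) (use Bm0 in auto)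
    finally have A: "norm (complex_of_real (g i (x j)) - f i (y j)) \<le> (3 * Bm) * \<epsilon>" by simp
    have "exp lam \<le> exp 1" using lam \<epsilon>1 by simp
    hence "exp lam \<le> 3" using exp_le by linarith
    hence "norm (complex_of_real (g i (x j))) \<le> Bm * 3"
      unfolding gr norm_mult norm_of_real by (intro mult_mono fBm) (use Bm0 in auto)
    with A show ?thesis by simp
  qed
  have bound2: "norm (fdet N (\<lambda>i j. complex_of_real (g i (x j))) - fdet N (\<lambda>i j. f i (y j)))
      \<le> fact N * ((3 * Bm) ^ N * (real N * \<epsilon>))"
  proof (rule fdet_diff_bound)
    show "norm (f i (y j)) \<le> 3 * Bm" if "i < N" "j < N" for i j
      using fB[OF that(1), of "y j"] ynorm[OF that(2)] rad_ge1 Bm0 by linarith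
  qed (use gf Bm0 in auto)
  have fN: "fact N \<le> real N ^ N" using fact_le_power[of N, where ?'a = real] by simp
  have NN: "real N ^ N = exp (real N * ln (real N))" using N16 by (simp add: exp_of_nat_mult)
  have BN: "Bm ^ N \<le> exp (real N ^ 2 / 4)"
  proof -
    have "Bm ^ N \<le> exp (real N / 4) ^ N" using Bm_le Bm0 by (intro power_mono) auto
    also have "\<dots> = exp (real N ^ 2 / 4)" by (simp add: power2_eq_square flip: exp_of_nat_mult)
    finally show ?thesis .
  qed
  \<comment> \<open>The interpolation gains about exp (- N^2 / 2), against exp (N^2 / 4) from the
    bounds on the entries and at most exp (N^2 / 16) from the factorial.\<close>
  have t1: "fact N * (\<Prod>i<N. Bm) * (4 * rad / (13 * rad - rad)) ^ (N * (N - 1) div 2) \<le> exp (-1)"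
  proof -
    define m where "m = N * (N - 1) div 2"
    have m: "real m = real N * (real N - 1) / 2"
    proof -
      have "2 dvd N * (N - 1)" by (cases "even N") (auto simp: N16)
      hence "real m = real (N * (N - 1)) / 2" unfolding m_def by (subst real_of_nat_div) auto
      thus ?thesis using N16 by (simp add: of_nat_diff)
    qed
    have "4 * rad / (13 * rad - rad) = 1 / 3" using rad_ge1 by (simp add: field_simps)
    hence q: "(4 * rad / (13 * rad - rad)) ^ m \<le> exp (- real m)"
    proof -
      have "(1 / 3 :: real) \<le> exp (-1)" using exp_le by (simp add: exp_minus field_simps)
      hence "(1 / 3 :: real) ^ m \<le> exp (-1) ^ m" by (intro power_mono) auto
      thus ?thesis unfolding \<open>4 * rad / (13 * rad - rad) = 1 / 3\<close> by (simp flip: exp_of_nat_mult)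
    qed
    have "fact N * (\<Prod>i<N. Bm) * (4 * rad / (13 * rad - rad)) ^ m \<le> exp (real N * ln (real N)) * exp (real N ^ 2 / 4) * exp (- real m)"
      using fN NN BN q Bm0 rad_ge1 by (intro mult_mono) auto
    also have "\<dots> = exp (real N * ln (real N) + real N ^ 2 / 4 - real m)"
      by (simp flip: exp_add)
    also have "\<dots> \<le> exp (-1)"
    proof -
      have "real N * ln (real N) \<le> real N * (real N / 16)" using h2 by (intro mult_left_mono) auto
      moreover have "real N * real N \<ge> 16 * real N" using N16 by (intro mult_right_mono) auto
      moreover have "real N \<ge> 16" using N16 by simp
      moreover have "real m = real N * real N / 2 - real N / 2" by (simp add: m algebra_simps diff_divide_distrib)
      moreover have "real N * (real N / 16) = real N * real N / 16" by simp
      ultimately show ?thesis unfolding power2_eq_square exp_le_cancel_iff by linarith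
    qed
    finally show ?thesis unfolding m_def .
  qed
  have t2: "fact N * ((3 * Bm) ^ N * (real N * \<epsilon>)) < 1 / 4"
  proof -
    have "fact N * ((3 * Bm) ^ N * (real N * \<epsilon>)) = fact N * 3 ^ N * Bm ^ N * (real N * \<epsilon>)"
      by (simp add: power_mult_distrib)
    also have "\<dots> \<le> real N ^ N * 3 ^ N * exp (real N ^ 2 / 4) * (real N * \<epsilon>)"
      using fN BN Bm0 \<epsilon>0 by (intro mult_mono) auto
    also have "\<dots> = (real N ^ (N + 1) * 3 ^ N * exp (real N ^ 2 / 4)) * \<epsilon>" by simp
    finally have "fact N * ((3 * Bm) ^ N * (real N * \<epsilon>)) \<le> (real N ^ (N + 1) * 3 ^ N * exp (real N ^ 2 / 4)) * \<epsilon>" .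
    moreover have "4 * ((real N ^ (N + 1) * 3 ^ N * exp (real N ^ 2 / 4)) * \<epsilon>) < 1"
      using h3 by (simp only: \<epsilon>_def mult.assoc)
    ultimately show ?thesis by linarith
  qed
  have "1 \<le> norm (fdet N (\<lambda>i j. complex_of_real (g i (x j))))"
    unfolding fdet_of_real using d1 by (simp add: d_def)
  also have "\<dots> \<le> norm (fdet N (\<lambda>i j. f i (y j))) + norm (fdet N (\<lambda>i j. complex_of_real (g i (x j))) - fdet N (\<lambda>i j. f i (y j)))"
    by (metis add.commute diff_add_cancel norm_triangle_ineq)
  also have "\<dots> < exp (-1) + 1 / 4" using bound1 bound2 t1 t2 by linarith
  also have "exp (-1) \<le> (1 / 2 :: real)" using exp_ge_add_one_self[of 1] by (simp add: exp_minus field_simps)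
  finally show False by simp
qed

text \<open>For large a, take L of order ln a, K = c^2 L, R = c L and \<delta> = exp (- \<epsilon>
  a) in \<open>linear_form_two_logs_core\<close>. All losses there are at most exp (O(N^2)) with N =
  K L of order (ln a)^2, so exp (- \<epsilon> a) beats them. For each of the finitely many remaining
  a > 0 the form has a positive minimum, because r ^ a = p ^ b is impossible for distinct primes,
  and the constant absorbs these minima.\<close>

lemma linear_form_two_logs:
  fixes p r :: nat and \<epsilon> :: real
  assumes p: "prime p" and r: "prime r" and pr: "p \<noteq> r" and \<epsilon>: "\<epsilon> > 0"
  obtains C where "C > 0" "\<And>a b :: nat. a > 0 \<Longrightarrow> C * exp (- \<epsilon> * real a) \<le> \<bar>real a * ln (real r) - real b * ln (real p)\<bar>"
proof -
  define \<alpha> where "\<alpha> = ln (real p)"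
  define \<beta> where "\<beta> = ln (real r)"
  have p1: "p > 1" and r1: "r > 1" using prime_gt_1_nat[OF p] prime_gt_1_nat[OF r] by auto
  have \<alpha>: "\<alpha> > 0" and \<beta>: "\<beta> > 0" using p1 r1 by (auto simp: \<alpha>_def \<beta>_def)
  have neq: "r ^ n \<noteq> p ^ m" if "n > 0" for m n
    using p r pr that by (metis dvd_power prime_dvd_power primes_dvd_imp_eq)
  define \<theta> where "\<theta> = \<beta> / \<alpha>"
  have \<theta>: "\<theta> > 0" using \<alpha> \<beta> by (simp add: \<theta>_def)
  have ln2: "\<alpha> \<ge> 1 / 2"
  proof -
    have "ln (1 / 2 :: real) \<le> 1 / 2 - 1" by (rule ln_le_minus_one) simp
    hence "1 / 2 \<le> ln (2 :: real)" by (simp add: ln_div)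
    also have "\<dots> \<le> \<alpha>" using p1 by (simp add: \<alpha>_def)
    finally show ?thesis .
  qed
  \<comment> \<open>Here 104 is 8 times 13: the growth of the exponentials on the disc of radius 13
    rad then uses at most half of the budget N / 4, and the powers use the other half.\<close>
  define c where "c = nat \<lceil>104 * \<alpha> * (\<theta> + 4)\<rceil> + 16"
  have c: "real c \<ge> 104 * \<alpha> * (\<theta> + 4)" "c \<ge> 16" by (auto simp: c_def) linarith+
  have large: "\<forall>\<^sub>F a :: nat in sequentially. \<forall>b::nat. \<not> \<bar>real a * \<beta> - real b * \<alpha>\<bar> \<le> exp (- \<epsilon> * real a)"
  proof -
    \<comment> \<open>The factor 16 gives ln a <= L / 16; with the same bound for ln (13 rad) this
      keeps K ln (13 a rad) at most K L / 8.\<close>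
    define L where "L = (\<lambda>a::nat. nat \<lceil>16 * ln (real a)\<rceil>)"
    have limL: "filterlim (\<lambda>a. real (L a)) at_top sequentially"
    proof (rule filterlim_at_top_mono)
      show "filterlim (\<lambda>a::nat. 16 * ln (real a)) at_top sequentially" by real_asymp
      show "\<forall>\<^sub>F a in sequentially. 16 * ln (real a) \<le> real (L a)"
        by (rule always_eventually) (auto simp: L_def intro: order_trans[OF le_of_int_ceiling])
    qed
    have e1: "\<forall>\<^sub>F x :: real in at_top. ln (13 * (real c * (\<theta> + 4) * x)) \<le> x / 16"
    proof -
      have "real c * (\<theta> + 4) > 0" using c \<theta> by (intro mult_pos_pos) auto
      thus ?thesis by real_asymp
    qed
    have e2: "\<forall>\<^sub>F x :: real in at_top. ln (real c ^ 2 * x ^ 2) \<le> real c ^ 2 * x ^ 2 / 16"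
    proof -
      have "real c > 0" using c by simp
      thus ?thesis by real_asymp
    qed
    have e4: "\<forall>\<^sub>F x :: real in at_top. 4 * (real c ^ 2 * (17 * ln x) ^ 2) ^ 2 < \<epsilon> * x"
    proof -
      have "real c > 0" using c by simp
      thus ?thesis using \<epsilon> by real_asymp
    qed
    have e5: "\<forall>\<^sub>F x :: real in at_top. real c * (17 * ln x) * (1 + \<alpha> + \<beta>) < \<epsilon> * x"
    proof -
      have "1 + \<alpha> + \<beta> > 0" "real c > 0" using \<alpha> \<beta> c by auto
      thus ?thesis using \<epsilon> by real_asymp
    qed
    have e6: "\<forall>\<^sub>F a :: nat in sequentially. ln (real a) \<ge> 1" by real_asymp
    note ev = eventually_compose_filterlim[OF e1 limL] eventually_compose_filterlim[OF e2 limL]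
      eventually_compose_filterlim[OF e4 filterlim_real_sequentially] eventually_compose_filterlim[OF e5 filterlim_real_sequentially] e6
      eventually_gt_at_top[of "0::nat"]
    show ?thesis using ev
    proof eventually_elim
      case (elim a)
      define l where "l = L a"
      have a: "a > 0" by fact
      have l_ge: "real l \<ge> 16 * ln (real a)" by (simp add: l_def L_def) linarith
      have l_le: "real l \<le> 17 * ln (real a)" using elim(5) by (simp add: l_def L_def) linarith
      have l16: "l \<ge> 16" using l_ge elim(5) by linarith
      show ?case
      proof (rule allI, rule notI)
        fix b :: nat assume small: "\<bar>real a * \<beta> - real b * \<alpha>\<bar> \<le> exp (- \<epsilon> * real a)"
        define N where "N = (c ^ 2 * l) * l"
        define R where "R = c * l"
        have Nr: "real N = real c ^ 2 * real l ^ 2" by (simp add: N_def power2_eq_square)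
        have ex1: "exp (- \<epsilon> * real a) \<le> 1" using \<epsilon> by simp
        \<comment> \<open>The assumed smallness ties b to a, so that \<open>rad\<close> can be
          chosen as a multiple of L.\<close>
        have ba: "real b / real a \<le> \<theta> + 2"
        proof -
          have "real b * \<alpha> \<le> real a * \<beta> + 1" using small ex1 by linarith
          hence "real b \<le> real a * \<theta> + 1 / \<alpha>" using \<alpha> by (simp add: \<theta>_def field_simps)
          also have "1 / \<alpha> \<le> 2" using ln2 \<alpha> by (simp add: field_simps)
          also have "(2 :: real) \<le> real a * 2" using a by simp
          finally show ?thesis using a by (simp add: field_simps)
        qed
        have N16: "N \<ge> 256"
        proof -
          have "16 * 16 \<le> c * l" using c l16 by (intro mult_mono) auto
          also have "c * l \<le> (c * l) * (c * l)" by (rule le_square)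
          finally show ?thesis by (simp add: N_def power2_eq_square mult_ac)
        qed
        have N4: "4 * real N ^ 2 < \<epsilon> * real a"
        proof -
          have "real N \<le> real c ^ 2 * (17 * ln (real a)) ^ 2" unfolding Nr using l_le
            by (intro mult_left_mono power_mono) auto
          hence "real N ^ 2 \<le> (real c ^ 2 * (17 * ln (real a)) ^ 2) ^ 2" by (intro power_mono) auto
          with elim(3) show ?thesis by linarith
        qed
        define rad where "rad = real c * (\<theta> + 4) * real l"
        show False
        proof (rule linear_form_two_logs_core[where p = p and r = r and a = a and b = b and K = "c ^ 2 * l" and L = l and R = R and rad = rad and \<delta> = "exp (- \<epsilon> * real a)"])
          show "1 < p" "1 < r" "0 < a" by fact+
          show "0 < c ^ 2 * l" "0 < l" "0 < R" "c ^ 2 * l * l \<le> R * R" "l \<le> R"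
            using c l16 by (auto simp: R_def power2_eq_square)
          show "\<bar>real a * ln (real r) - real b * ln (real p)\<bar> \<le> exp (- \<epsilon> * real a)"
            using small by (simp add: \<alpha>_def \<beta>_def)
          show "inj_on (\<lambda>(\<rho>, \<sigma>). \<rho> * a + \<sigma> * b) ({..<R} \<times> {..<R})"
          proof -
            \<comment> \<open>A coincidence of two values yields m a = n b with 0 < n < R, so n
              \<beta> - m \<alpha> is at most R exp (- \<epsilon> a) in absolute value. But r ^ n
              and p ^ m are distinct integers and differ by at least 1, which forces the form to be
              at least exp (- R (\<alpha> + \<beta>)). This trivial bound suffices because R is only
              of order ln a.\<close>
            have key: False if "\<sigma> < \<sigma>'" "\<sigma>' < R" "\<rho> < R" "\<rho> * a + \<sigma> * b = \<rho>' * a + \<sigma>' * b" for \<rho> \<sigma> \<rho>' \<sigma>' :: nat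
            proof -
              define n where "n = \<sigma>' - \<sigma>"
              have n: "n > 0" "n < R" using that by (auto simp: n_def)
              have s': "\<sigma>' = \<sigma> + n" using that by (simp add: n_def)
              have eq: "\<rho> * a = \<rho>' * a + n * b" using that(4) by (simp add: s' add_mult_distrib)
              hence "\<rho>' * a \<le> \<rho> * a" by linarith
              hence "\<rho>' \<le> \<rho>" using a by simp
              define m where "m = \<rho> - \<rho>'"
              have m: "m < R" "\<rho> = \<rho>' + m" using that \<open>\<rho>' \<le> \<rho>\<close> by (auto simp: m_def)
              have nm: "m * a = n * b" using eq unfolding m(2) by (simp add: add_mult_distrib)
              have nmr: "real m * real a = real n * real b" using nm by (metis of_nat_mult)
              have "real a * \<bar>real n * \<beta> - real m * \<alpha>\<bar> = \<bar>real n * (real a * \<beta>) - (real m * real a) * \<alpha>\<bar>"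
              proof -
                have "real n * (real a * \<beta>) - (real m * real a) * \<alpha> = real a * (real n * \<beta> - real m * \<alpha>)"
                  by (simp only: right_diff_distrib mult_ac)
                thus ?thesis by (simp only: abs_mult abs_of_nat)
              qed
              also have "\<dots> = real n * \<bar>real a * \<beta> - real b * \<alpha>\<bar>"
              proof -
                have "real n * (real a * \<beta>) - (real n * real b) * \<alpha> = real n * (real a * \<beta> - real b * \<alpha>)"
                  by (simp only: right_diff_distrib mult_ac)
                thus ?thesis by (simp only: nmr abs_mult abs_of_nat)
              qed
              also have "\<dots> \<le> real R * exp (- \<epsilon> * real a)" using small n by (intro mult_mono) auto
              finally have "real a * \<bar>real n * \<beta> - real m * \<alpha>\<bar> \<le> real R * exp (- \<epsilon> * real a)" .
              moreover have step: "1 * \<bar>real n * \<beta> - real m * \<alpha>\<bar> \<le> real a * \<bar>real n * \<beta> - real m * \<alpha>\<bar>"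
              proof (rule mult_right_mono)
                show "1 \<le> real a" using a by simp
              qed (rule abs_ge_zero)
              ultimately have up: "\<bar>real n * \<beta> - real m * \<alpha>\<bar> \<le> real R * exp (- \<epsilon> * real a)"
                unfolding mult_1 by (meson order_trans)
              have expdiff: "\<bar>exp u - exp v\<bar> \<le> \<bar>u - v\<bar> * exp w" if "u \<le> w" "v \<le> w" for u v w :: real
              proof -
                have *: "exp u - exp v \<le> (u - v) * exp u" for u v :: real
                proof -
                  have "1 + (v - u) \<le> exp (v - u)" by (rule exp_ge_add_one_self)
                  hence "(1 + (v - u)) * exp u \<le> exp (v - u) * exp u" by (intro mult_right_mono) auto
                  thus ?thesis by (simp add: algebra_simps flip: exp_add)
                qed
                show ?thesis
                proof (cases "v \<le> u")
                  case True
                  have "\<bar>exp u - exp v\<bar> = exp u - exp v" using True by simp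
                  also have "\<dots> \<le> (u - v) * exp u" by (rule *)
                  also have "\<dots> \<le> (u - v) * exp w" using True that by (intro mult_left_mono) auto
                  finally show ?thesis using True by simp
                next
                  case False
                  have "\<bar>exp u - exp v\<bar> = exp v - exp u" using False by simp
                  also have "\<dots> \<le> (v - u) * exp v" by (rule *)
                  also have "\<dots> \<le> (v - u) * exp w" using False that by (intro mult_left_mono) auto
                  finally show ?thesis using False by simp
                qed
              qed
              have "1 \<le> \<bar>real (r ^ n) - real (p ^ m)\<bar>"
              proof -
                have "int (r ^ n) \<noteq> int (p ^ m)" using neq[OF n(1)] by (metis of_nat_eq_iff)
                hence "1 \<le> \<bar>int (r ^ n) - int (p ^ m)\<bar>" by linarith
                hence "real_of_int 1 \<le> real_of_int \<bar>int (r ^ n) - int (p ^ m)\<bar>" by (subst of_int_le_iff)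
                thus ?thesis by simp
              qed
              also have "\<bar>real (r ^ n) - real (p ^ m)\<bar> = \<bar>exp (real n * \<beta>) - exp (real m * \<alpha>)\<bar>"
                using p1 r1 by (simp add: exp_of_nat_mult \<alpha>_def \<beta>_def)
              also have "\<dots> \<le> \<bar>real n * \<beta> - real m * \<alpha>\<bar> * exp (real R * (\<alpha> + \<beta>))"
              proof (rule expdiff)
                have "real n * \<beta> \<le> real R * (\<alpha> + \<beta>)" using n \<alpha> \<beta> by (intro mult_mono) auto
                thus "real n * \<beta> \<le> real R * (\<alpha> + \<beta>)" .
                show "real m * \<alpha> \<le> real R * (\<alpha> + \<beta>)" using m \<alpha> \<beta> by (intro mult_mono) auto
              qed
              also have "\<dots> \<le> (real R * exp (- \<epsilon> * real a)) * exp (real R * (\<alpha> + \<beta>))"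
                using up by (intro mult_right_mono) auto
              also have "\<dots> \<le> (exp (real R) * exp (- \<epsilon> * real a)) * exp (real R * (\<alpha> + \<beta>))"
              proof (intro mult_right_mono)
                show "real R \<le> exp (real R)" using exp_ge_add_one_self[of "real R"] by linarith
              qed auto
              also have "\<dots> = exp (real R * (1 + \<alpha> + \<beta>) - \<epsilon> * real a)"
                by (simp add: algebra_simps flip: exp_add)
              finally have "\<epsilon> * real a \<le> real R * (1 + \<alpha> + \<beta>)" by simp
              also have "\<dots> \<le> real c * (17 * ln (real a)) * (1 + \<alpha> + \<beta>)"
                unfolding R_def of_nat_mult using l_le \<alpha> \<beta> by (intro mult_right_mono mult_left_mono) auto
              finally show False using elim(4) by linarith
            qed
            show ?thesis
            proof (rule inj_onI)
              fix s t :: "nat \<times> nat"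
              assume st: "s \<in> {..<R} \<times> {..<R}" "t \<in> {..<R} \<times> {..<R}"
                "(case s of (\<rho>, \<sigma>) \<Rightarrow> \<rho> * a + \<sigma> * b) = (case t of (\<rho>, \<sigma>) \<Rightarrow> \<rho> * a + \<sigma> * b)"
              obtain \<rho> \<sigma> \<rho>' \<sigma>' where eqs: "s = (\<rho>, \<sigma>)" "t = (\<rho>', \<sigma>')" by (cases s, cases t) auto
              have h: "\<rho> < R" "\<sigma> < R" "\<rho>' < R" "\<sigma>' < R" "\<rho> * a + \<sigma> * b = \<rho>' * a + \<sigma>' * b"
                using st by (auto simp: eqs)
              have "\<not> \<sigma> < \<sigma>'" using key[of \<sigma> \<sigma>' \<rho> \<rho>'] h by auto
              moreover have "\<not> \<sigma>' < \<sigma>" using key[of \<sigma>' \<sigma> \<rho>' \<rho>] h by auto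
              ultimately have "\<sigma> = \<sigma>'" by simp
              with h a show "s = t" by (simp add: eqs)
            qed
          qed
          show "real (R + l) + real R * real b / real a \<le> rad"
          proof -
            have "real R * real b / real a = real c * real l * (real b / real a)" by (simp add: R_def)
            also have "\<dots> \<le> real c * real l * (\<theta> + 2)" using ba by (intro mult_left_mono) auto
            finally have 1: "real R * real b / real a \<le> real c * real l * (\<theta> + 2)" .
            have "1 * real l \<le> real c * real l" by (intro mult_right_mono) (use c in auto)
            with 1 show ?thesis by (simp add: rad_def R_def algebra_simps)
          qed
          have rad_pos: "rad > 0" using c \<theta> l16 by (auto simp: rad_def intro!: mult_pos_pos)
          show "real (c\<^sup>2 * l) * ln (real a * (13 * rad)) + real l * ln (real p) * (13 * rad) \<le> real (c\<^sup>2 * l * l) / 4"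
          proof -
            have "ln (real a * (13 * rad)) = ln (real a) + ln (13 * rad)"
              using a rad_pos by (intro ln_mult_pos) auto
            also have "\<dots> \<le> real l / 16 + real l / 16"
              using elim(1) l_ge by (simp add: rad_def l_def)
            finally have "real (c\<^sup>2 * l) * ln (real a * (13 * rad)) \<le> real (c\<^sup>2 * l) * (real l / 8)"
              by (intro mult_left_mono) auto
            moreover have "real l * \<alpha> * (13 * rad) = (104 * \<alpha> * (\<theta> + 4)) * (real c * real l * real l) / 8"
              by (simp add: rad_def)
            moreover have "(104 * \<alpha> * (\<theta> + 4)) * (real c * real l * real l) \<le> real c * (real c * real l * real l)"
              using c by (intro mult_right_mono) auto
            moreover have "real (c\<^sup>2 * l) * (real l / 8) = real c * (real c * real l * real l) / 8"
              by (simp add: power2_eq_square)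
            moreover have "real (c\<^sup>2 * l * l) / 4 = real c * (real c * real l * real l) / 4"
              by (simp add: power2_eq_square)
            ultimately show ?thesis unfolding \<alpha>_def[symmetric] by linarith
          qed
          show "ln (real (c\<^sup>2 * l * l)) \<le> real (c\<^sup>2 * l * l) / 16"
            using elim(2) by (simp add: l_def power2_eq_square mult_ac)
          show "16 \<le> c\<^sup>2 * l * l" using N16 by (simp add: N_def)
          have "4 * real N ^ (N + 1) * 3 ^ N * exp (real N ^ 2 / 4) * (real l * real R * exp (- \<epsilon> * real a)) < 1"
          proof -
            have "real l * real R \<le> real N"
            proof -
              have "l * (c * l) \<le> c * (c * l) * l"
                using c by simp
              thus ?thesis unfolding N_def R_def power2_eq_square by (metis mult.assoc of_nat_le_iff of_nat_mult)
            qed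
            also have NeN: "real N \<le> exp (real N)" using exp_ge_add_one_self[of "real N"] by linarith
            finally have lR: "real l * real R \<le> exp (real N)" .
            have "real N ^ (N + 1) \<le> exp (real N) ^ (N + 1)" using NeN by (intro power_mono) auto
            also have "\<dots> = exp (real N ^ 2 + real N)"
              by (simp add: power2_eq_square algebra_simps flip: exp_of_nat_mult exp_add)
            finally have NN: "real N ^ (N + 1) \<le> exp (real N ^ 2 + real N)" .
            have "(3 :: real) \<le> exp 2" using exp_ge_add_one_self[of 2] by linarith
            hence "(3 :: real) ^ N \<le> exp 2 ^ N" by (intro power_mono) auto
            also have "\<dots> = exp (2 * real N)" by (simp add: mult.commute flip: exp_of_nat_mult)
            finally have 3: "(3 :: real) ^ N \<le> exp (2 * real N)" .
            have 4: "(4 :: real) \<le> exp 3" using exp_ge_add_one_self[of 3] by linarith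
            have "4 * real N ^ (N + 1) * 3 ^ N * exp (real N ^ 2 / 4) * (real l * real R * exp (- \<epsilon> * real a))
              \<le> exp 3 * exp (real N ^ 2 + real N) * exp (2 * real N) * exp (real N ^ 2 / 4) * (exp (real N) * exp (- \<epsilon> * real a))"
              using lR NN 3 4 by (intro mult_mono) auto
            also have "\<dots> = exp (3 + (real N ^ 2 + real N) + 2 * real N + real N ^ 2 / 4 + (real N - \<epsilon> * real a))"
              by (simp only: flip: exp_add) simp
            also have "\<dots> < exp 0"
            proof -
              have "real N * real N \<ge> 256 * real N" using N16 by (intro mult_right_mono) auto
              hence "3 + (real N ^ 2 + real N) + 2 * real N + real N ^ 2 / 4 + real N \<le> 4 * real N ^ 2"
                using N16 unfolding power2_eq_square by linarith
              thus ?thesis unfolding exp_less_cancel_iff using N4 by linarith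
            qed
            finally show ?thesis by simp
          qed
          thus "4 * real (c\<^sup>2 * l * l) ^ (c\<^sup>2 * l * l + 1) * 3 ^ (c\<^sup>2 * l * l) * exp (real (c\<^sup>2 * l * l) ^ 2 / 4) * (real l * real R * exp (- \<epsilon> * real a)) < 1"
            by (simp only: N_def)
        qed
      qed
    qed
  qed
  then obtain a0 where a0: "\<And>a b :: nat. a \<ge> a0 \<Longrightarrow> exp (- \<epsilon> * real a) < \<bar>real a * \<beta> - real b * \<alpha>\<bar>"
    unfolding eventually_sequentially not_le by blast
  \<comment> \<open>Beyond \<open>B\<close> the form is at least 1 in absolute value, so only
    finitely many b compete for the minimum.\<close>
  have single: "\<exists>c>0. \<forall>b::nat. c \<le> \<bar>real a * \<beta> - real b * \<alpha>\<bar>" if a: "a > 0" for a :: nat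
  proof -
    define B where "B = nat \<lceil>(real a * \<beta> + 1) / \<alpha>\<rceil>"
    define S where "S = insert 1 ((\<lambda>b. \<bar>real a * \<beta> - real b * \<alpha>\<bar>) ` {..B})"
    have S: "finite S" "S \<noteq> {}" by (auto simp: S_def)
    have "Min S > 0"
    proof (subst Min_gr_iff[OF S], rule ballI)
      fix s assume "s \<in> S"
      moreover have "real a * \<beta> \<noteq> real b * \<alpha>" for b :: nat
      proof
        assume "real a * \<beta> = real b * \<alpha>"
        hence "exp (real a * \<beta>) = exp (real b * \<alpha>)" by simp
        hence "real (r ^ a) = real (p ^ b)" using p1 r1 by (simp add: exp_of_nat_mult \<alpha>_def \<beta>_def)
        thus False using neq[OF a, of b] by (metis of_nat_eq_iff)
      qed
      ultimately show "0 < s" by (auto simp: S_def)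
    qed
    moreover have "Min S \<le> \<bar>real a * \<beta> - real b * \<alpha>\<bar>" for b :: nat
    proof (cases "b \<le> B")
      case True
      thus ?thesis by (intro Min_le) (auto simp: S_def)
    next
      case False
      hence "(real a * \<beta> + 1) / \<alpha> \<le> real b" unfolding B_def by linarith
      hence "real a * \<beta> + 1 \<le> real b * \<alpha>" using \<alpha> by (simp add: field_simps)
      hence "1 \<le> \<bar>real a * \<beta> - real b * \<alpha>\<bar>" by linarith
      moreover have "Min S \<le> 1" by (intro Min_le) (auto simp: S_def)
      ultimately show ?thesis by linarith
    qed
    ultimately show ?thesis by blast
  qed
  then obtain h where h: "\<And>a. a > 0 \<Longrightarrow> h a > 0" "\<And>a b :: nat. a > 0 \<Longrightarrow> h a \<le> \<bar>real a * \<beta> - real b * \<alpha>\<bar>"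
    by metis
  define S where "S = insert 1 (h ` {1..a0})"
  have S: "finite S" "S \<noteq> {}" by (auto simp: S_def)
  have C0: "Min S > 0" by (subst Min_gr_iff[OF S]) (auto simp: S_def intro: h(1))
  show ?thesis
  proof (rule that[of "Min S"])
    show "Min S > 0" by fact
    fix a b :: nat assume a: "a > 0"
    show "Min S * exp (- \<epsilon> * real a) \<le> \<bar>real a * ln (real r) - real b * ln (real p)\<bar>"
    proof (cases "a \<ge> a0")
      case True
      have "Min S \<le> 1" by (intro Min_le) (auto simp: S_def)
      hence "Min S * exp (- \<epsilon> * real a) \<le> 1 * exp (- \<epsilon> * real a)" by (intro mult_right_mono) auto
      also have "\<dots> \<le> \<bar>real a * \<beta> - real b * \<alpha>\<bar>" using a0[OF True, of b] by simp
      finally show ?thesis by (simp add: \<alpha>_def \<beta>_def)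
    next
      case False
      have "Min S \<le> h a" using False a by (intro Min_le) (auto simp: S_def)
      moreover have "Min S * exp (- \<epsilon> * real a) \<le> Min S * 1" using C0 \<epsilon> by (intro mult_left_mono) auto
      ultimately show ?thesis using h(2)[OF a, of b] by (simp add: \<alpha>_def \<beta>_def)
    qed
  qed
qed

section \<open>Fourier series and the theta transformation\<close>

text \<open>The argument is complex so that Fourier coefficients of entire functions can be treated
  with complex derivatives and removable singularities.\<close>

definition efun :: "int \<Rightarrow> complex \<Rightarrow> complex" where
  "efun k z = exp (2 * of_real pi * \<i> * of_int k * z)"

lemma efun_add: "efun k (z + w) = efun k z * efun k w"
  by (simp add: efun_def exp_add ring_distribs)

lemma efun_add_left: "efun (k + l) z = efun k z * efun l z"
  by (simp add: efun_def ring_distribs flip: exp_add)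

lemma efun_0 [simp]: "efun 0 z = 1" "efun k 0 = 1"
  by (simp_all add: efun_def)

lemma efun_nonzero [simp]: "efun k z \<noteq> 0"
  by (simp add: efun_def)

lemma efun_of_int [simp]: "efun k (of_int n) = 1"
proof -
  have "efun k (of_int n) = exp (complex_of_real (2 * pi * real_of_int (k * n)) * \<i>)" by (simp add: efun_def mult_ac)
  also have "\<dots> = 1" unfolding exp_eq_1 by (auto intro!: exI[of _ "k * n"])
  finally show ?thesis .
qed

lemma efun_1 [simp]: "efun k 1 = 1"
  using efun_of_int[of k 1] by simp

lemma norm_efun_of_real [simp]: "norm (efun k (of_real x)) = 1"
proof -
  have "efun k (of_real x) = exp (\<i> * of_real (2 * pi * real_of_int k * x))"
    by (simp add: efun_def mult_ac)
  thus ?thesis by (simp only: norm_exp_i_times)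
qed

lemma efun_minus: "efun (- k) z = inverse (efun k z)"
  by (simp add: efun_def exp_minus)

lemma holomorphic_efun [holomorphic_intros]: "f holomorphic_on S \<Longrightarrow> (\<lambda>z. efun k (f z)) holomorphic_on S"
  unfolding efun_def by (intro holomorphic_intros)

lemma continuous_on_efun [continuous_intros]: "continuous_on S f \<Longrightarrow> continuous_on S (\<lambda>z. efun k (f z))"
  unfolding efun_def by (intro continuous_intros)

lemma efun_deriv: "(efun k has_field_derivative (2 * of_real pi * \<i> * of_int k) * efun k z) (at z within S)"
  unfolding efun_def by (auto intro!: derivative_eq_intros)

lemma efun_eq_1_iff: "efun 1 z = 1 \<longleftrightarrow> z \<in> \<int>"
proof
  assume "efun 1 z = 1"
  then obtain n :: int where n: "2 * of_real pi * \<i> * z = of_int (2 * n) * of_real pi * \<i>"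
    unfolding efun_def exp_eq_1 by (auto simp: complex_eq_iff)
  hence "z = of_int n" by simp
  thus "z \<in> \<int>" by simp
qed (auto elim: Ints_cases)

text \<open>Integration by parts; the boundary terms cancel by periodicity.\<close>
lemma fourier_coeff_by_parts:
  fixes G :: "complex \<Rightarrow> complex"
  assumes G: "G holomorphic_on S" and S: "open S" "\<And>x::real. x \<in> {-1/2..1/2} \<Longrightarrow> of_real x \<in> S"
    and per: "G (1/2) = G (-1/2)"
  shows "integral {-1/2..1/2} (\<lambda>x::real. deriv G (of_real x) * efun (-k) (of_real x)) =
         2 * of_real pi * \<i> * of_int k * integral {-1/2..1/2} (\<lambda>x. G (of_real x) * efun (-k) (of_real x))"
proof -
  let ?c = "2 * of_real pi * \<i> * of_int (-k) :: complex"
  define P where "P = (\<lambda>x::real. G (of_real x) * efun (-k) (of_real x))"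
  have contG: "continuous_on {-1/2..1/2} (\<lambda>x::real. G (of_real x))"
    using holomorphic_on_imp_continuous_on[OF G] S(2)
    by (auto intro!: continuous_on_compose2[of S G] continuous_intros)
  have contG': "continuous_on {-1/2..1/2} (\<lambda>x::real. deriv G (of_real x))"
    using holomorphic_on_imp_continuous_on[OF holomorphic_deriv[OF G S(1)]] S(2)
    by (auto intro!: continuous_on_compose2[of S "deriv G"] continuous_intros)
  have i1: "(\<lambda>x::real. deriv G (of_real x) * efun (-k) (of_real x)) integrable_on {-1/2..1/2}"
    by (intro integrable_continuous_interval continuous_intros contG')
  have i2: "P integrable_on {-1/2..1/2}"
    unfolding P_def by (intro integrable_continuous_interval continuous_intros contG)
  have der: "(P has_vector_derivative (deriv G (of_real x) * efun (-k) (of_real x) + ?c * P x)) (at x within {-1/2..1/2})"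
    if "x \<in> {-1/2..1/2}" for x :: real
  proof -
    have d1: "(G has_field_derivative deriv G (of_real x)) (at (of_real x))"
      using holomorphic_derivI[OF G S(1) S(2)[OF that]] .
    have "((\<lambda>z. G z * efun (-k) z) has_field_derivative
        (deriv G (of_real x) * efun (-k) (of_real x) + ?c * P x)) (at (of_real x))"
      by (rule derivative_eq_intros d1 efun_deriv)+ (simp add: P_def)
    from has_vector_derivative_real_field[OF this] show ?thesis
      by (simp add: P_def[abs_def])
  qed
  have "((\<lambda>x. deriv G (of_real x) * efun (-k) (of_real x) + ?c * P x) has_integral (P (1/2) - P (-1/2))) {-1/2..1/2}"
    by (rule fundamental_theorem_of_calculus) (use der in auto)
  moreover have "((\<lambda>x. deriv G (of_real x) * efun (-k) (of_real x) + ?c * P x) has_integral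
     (integral {-1/2..1/2} (\<lambda>x::real. deriv G (of_real x) * efun (-k) (of_real x)) + ?c * integral {-1/2..1/2} P)) {-1/2..1/2}"
    using i1 i2 by (intro has_integral_add has_integral_mult_right integrable_integral)
  ultimately have "integral {-1/2..1/2} (\<lambda>x::real. deriv G (of_real x) * efun (-k) (of_real x)) + ?c * integral {-1/2..1/2} P = P (1/2) - P (-1/2)"
    using has_integral_unique by blast
  moreover have "P (1/2) = P (-1/2)"
  proof -
    have "efun (-k) (1/2) = efun (-k) (-1/2 + 1)" by simp
    also have "\<dots> = efun (-k) (-1/2)" by (subst efun_add) simp
    finally show ?thesis using per by (simp add: P_def)
  qed
  ultimately show ?thesis unfolding P_def by (simp add: eq_neg_iff_add_eq_0)
qed

text \<open>The Riemann-Lebesgue lemma: one integration by parts gives the rate O(1 / |k|). The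
  index is a general sequence because the telescoped series needs the limit along K as well as along
  - K - 1.\<close>

lemma fourier_coeff_tendsto_0:
  fixes G :: "complex \<Rightarrow> complex"
  assumes G: "G holomorphic_on S" and S: "open S" "\<And>x::real. x \<in> {-1/2..1/2} \<Longrightarrow> of_real x \<in> S"
    and per: "G (1/2) = G (-1/2)" and k: "filterlim (\<lambda>n. \<bar>real_of_int (k n)\<bar>) at_top F"
  shows "((\<lambda>n. integral {-1/2..1/2} (\<lambda>x::real. G (of_real x) * efun (- k n) (of_real x))) \<longlongrightarrow> 0) F"
proof -
  have contG': "continuous_on {-1/2..1/2} (\<lambda>x::real. deriv G (of_real x))"
    using holomorphic_on_imp_continuous_on[OF holomorphic_deriv[OF G S(1)]] S(2)
    by (auto intro!: continuous_on_compose2[of S "deriv G"] continuous_intros)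
  have "compact ((\<lambda>x::real. deriv G (of_real x)) ` {-1/2..1/2})"
    by (intro compact_continuous_image contG') auto
  from compact_imp_bounded[OF this] obtain M where "\<forall>x\<in>{-1/2..1/2}. norm (deriv G (of_real (x::real))) \<le> M"
    unfolding bounded_iff by auto
  hence M: "norm (deriv G (of_real x)) \<le> M" if "x \<in> {-1/2..1/2}" for x :: real using that by blast
  have bound: "norm (integral {-1/2..1/2} (\<lambda>x::real. G (of_real x) * efun (-j) (of_real x))) \<le> M / (2 * pi) * inverse \<bar>real_of_int j\<bar>"
    if "j \<noteq> 0" for j
  proof -
    have "norm (integral {-1/2..1/2} (\<lambda>x::real. deriv G (of_real x) * efun (-j) (of_real x))) \<le> M * (1/2 - (-1/2))"
    proof (rule integral_bound)
      show "continuous_on {-1/2..1/2} (\<lambda>x::real. deriv G (of_real x) * efun (-j) (of_real x))"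
        by (intro continuous_intros contG')
      show "norm (deriv G (of_real x) * efun (-j) (of_real x)) \<le> M" if "x \<in> {-1/2..1/2}" for x :: real
        using M[OF that] by (simp add: norm_mult)
    qed simp
    moreover have "norm (integral {-1/2..1/2} (\<lambda>x::real. deriv G (of_real x) * efun (-j) (of_real x))) =
        2 * pi * \<bar>real_of_int j\<bar> * norm (integral {-1/2..1/2} (\<lambda>x::real. G (of_real x) * efun (-j) (of_real x)))"
      by (subst fourier_coeff_by_parts[OF G S per]) (simp_all add: norm_mult)
    ultimately show ?thesis using that by (simp add: field_simps)
  qed
  have lim: "((\<lambda>n. M / (2 * pi) * inverse \<bar>real_of_int (k n)\<bar>) \<longlongrightarrow> M / (2 * pi) * 0) F"
    by (intro tendsto_intros tendsto_inverse_0_at_top[OF k])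
  have "\<forall>\<^sub>F n in F. \<bar>real_of_int (k n)\<bar> \<ge> 1"
    using k unfolding filterlim_at_top by blast
  hence "\<forall>\<^sub>F n in F. norm (integral {-1/2..1/2} (\<lambda>x::real. G (of_real x) * efun (- k n) (of_real x))) \<le> M / (2 * pi) * inverse \<bar>real_of_int (k n)\<bar>"
    by eventually_elim (rule bound, auto)
  thus ?thesis using Lim_null_comparison lim by fastforce
qed

text \<open>Writing \<open>F - F 0 = (e - 1) G\<close> with \<open>e x = exp (2 \<pi> \<i> x)\<close>, the \<open>k\<close>-th Fourier coefficient of
  \<open>F - F 0\<close> is the difference of two consecutive coefficients of \<open>G\<close>, so the symmetric
  partial sums telescope.\<close>
theorem fourier_series_at_0:
  fixes F :: "complex \<Rightarrow> complex"
  assumes F: "F holomorphic_on UNIV" and per: "\<And>z. F (z + 1) = F z"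
  shows "(\<lambda>K::nat. \<Sum>k=-int K..int K. integral {-1/2..1/2} (\<lambda>x::real. F (of_real x) * efun (-k) (of_real x))) \<longlonglongrightarrow> F 0"
proof -
  \<comment> \<open>\<open>F1\<close> and \<open>E1\<close> are F - F 0 and efun 1 - 1 divided by z,
    with the removable singularity filled in. Their quotient is holomorphic on the strip |Re z| < 1,
    in which 0 is the only integer.\<close>
  define F1 where "F1 = (\<lambda>z. if z = 0 then deriv F 0 else (F z - F 0) / (z - 0))"
  define E1 where "E1 = (\<lambda>z. if z = 0 then deriv (efun 1) 0 else (efun 1 z - efun 1 0) / (z - 0))"
  have F1h: "F1 holomorphic_on UNIV" unfolding F1_def by (rule pole_lemma[OF F]) auto
  have "(\<lambda>z. efun 1 z) holomorphic_on UNIV" by (intro holomorphic_intros)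
  hence E1h: "E1 holomorphic_on UNIV" unfolding E1_def by (rule pole_lemma) auto
  define S where "S = {z. Re z < 1} \<inter> {z. Re z > -1}"
  have S: "open S" unfolding S_def by (intro open_Int open_halfspace_Re_lt open_halfspace_Re_gt)
  have Sx: "of_real x \<in> S" if "x \<in> {-1/2..1/2}" for x :: real using that by (auto simp: S_def)
  have E10: "E1 z \<noteq> 0" if "z \<in> S" for z
  proof (cases "z = 0")
    case True
    have "deriv (efun 1) 0 = 2 * of_real pi * \<i>"
      by (rule DERIV_imp_deriv) (rule DERIV_cong[OF efun_deriv], simp)
    thus ?thesis by (simp add: E1_def True)
  next
    case False
    have "z \<notin> \<int>"
    proof
      assume "z \<in> \<int>"
      then obtain n where "z = of_int n" by (elim Ints_cases)
      with that False show False by (auto simp: S_def)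
    qed
    thus ?thesis using False by (auto simp: E1_def efun_eq_1_iff)
  qed
  define G where "G = (\<lambda>z. F1 z / E1 z)"
  have Gh: "G holomorphic_on S" unfolding G_def
    by (intro holomorphic_intros holomorphic_on_subset[OF F1h] holomorphic_on_subset[OF E1h]) (use E10 in auto)
  have FG: "F z = F 0 + G z * (efun 1 z - 1)" if "z \<in> S" for z
    using E10[OF that] by (cases "z = 0") (auto simp: G_def F1_def E1_def)
  have F2: "F (1/2) = F (-1/2)" using per[of "-1/2"] by simp
  have Ghalf: "G (1/2) = G (-1/2)"
  proof -
    have e: "efun 1 (1/2) = efun 1 (-1/2)" using efun_add[of 1 "-1/2" 1] by simp
    have "(1/2::complex) \<in> S" "(-1/2::complex) \<in> S" by (auto simp: S_def)
    from FG[OF this(1)] FG[OF this(2)] have "G (1/2) * (efun 1 (1/2) - 1) = G (-1/2) * (efun 1 (1/2) - 1)"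
      using F2 e by simp
    moreover have "(1/2::complex) \<notin> \<int>"
    proof
      assume "(1/2::complex) \<in> \<int>"
      then obtain n :: int where "(1/2::complex) = of_int n" by (elim Ints_cases)
      hence "Re (1/2::complex) = Re (of_int n)" by (rule arg_cong)
      hence "real_of_int (2 * n) = 1" by simp
      hence "2 * n = 1" by linarith
      thus False by presburger
    qed
    hence "efun 1 (1/2) - 1 \<noteq> 0" by (simp add: efun_eq_1_iff)
    ultimately show ?thesis by simp
  qed
  define \<gamma> where "\<gamma> = (\<lambda>k. integral {-1/2..1/2} (\<lambda>x::real. G (of_real x) * efun (-k) (of_real x)))"
  have contG: "continuous_on {-1/2..1/2} (\<lambda>x::real. G (of_real x))"
    using holomorphic_on_imp_continuous_on[OF Gh] Sx
    by (auto intro!: continuous_on_compose2[of S G] continuous_intros)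
  have iG: "(\<lambda>x::real. G (of_real x) * efun j (of_real x)) integrable_on {-1/2..1/2}" for j
    by (intro integrable_continuous_interval continuous_intros contG)
  have ie: "(\<lambda>x::real. F 0 * efun j (of_real x)) integrable_on {-1/2..1/2}" for j
    by (intro integrable_continuous_interval continuous_intros)
  have e_int: "integral {-1/2..1/2} (\<lambda>x::real. F 0 * efun (-k) (of_real x)) = (if k = 0 then F 0 else 0)" for k
  proof (cases "k = 0")
    case False
    have "integral {-1/2..1/2} (\<lambda>x::real. deriv (\<lambda>z. F 0) (of_real x) * efun (-k) (of_real x)) =
         2 * of_real pi * \<i> * of_int k * integral {-1/2..1/2} (\<lambda>x::real. F 0 * efun (-k) (of_real x))"
      by (rule fourier_coeff_by_parts[of _ UNIV]) (auto intro: holomorphic_intros)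
    thus ?thesis using False by simp
  qed simp
  have dk: "integral {-1/2..1/2} (\<lambda>x::real. F (of_real x) * efun (-k) (of_real x)) =
      (if k = 0 then F 0 else 0) + (\<gamma> (k - 1) - \<gamma> k)" for k
  proof -
    have "integral {-1/2..1/2} (\<lambda>x::real. F (of_real x) * efun (-k) (of_real x)) =
      integral {-1/2..1/2} (\<lambda>x::real. F 0 * efun (-k) (of_real x) + (G (of_real x) * efun (-(k-1)) (of_real x) - G (of_real x) * efun (-k) (of_real x)))"
    proof (rule integral_cong)
      fix x :: real assume "x \<in> {-1/2..1/2}"
      have "efun (-(k-1)) (of_real x) = efun 1 (of_real x) * efun (-k) (of_real x)"
        by (subst efun_add_left[symmetric]) simp
      thus "F (of_real x) * efun (-k) (of_real x) = F 0 * efun (-k) (of_real x) + (G (of_real x) * efun (-(k-1)) (of_real x) - G (of_real x) * efun (-k) (of_real x))"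
        by (subst FG[OF Sx[OF \<open>x \<in> _\<close>]]) (simp add: algebra_simps)
    qed
    also have "\<dots> = (if k = 0 then F 0 else 0) + (\<gamma> (k - 1) - \<gamma> k)"
      unfolding \<gamma>_def e_int[symmetric]
      by (subst Henstock_Kurzweil_Integration.integral_add integral_diff; (intro integrable_diff iG ie)?)+ simp
    finally show ?thesis .
  qed
  have part: "(\<Sum>k=-int K..int K. integral {-1/2..1/2} (\<lambda>x::real. F (of_real x) * efun (-k) (of_real x)))
     = F 0 + (\<gamma> (- int K - 1) - \<gamma> (int K))" for K :: nat
  proof -
    have "(\<Sum>k=-int K..int K. \<gamma> (k - 1) - \<gamma> k) = \<gamma> (- int K - 1) - \<gamma> (int K)"
    proof (induction K)
      case (Suc K)
      have "{- int (Suc K)..int (Suc K)} = insert (- int K - 1) (insert (int K + 1) {-int K..int K})" by auto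
      thus ?case using Suc by (simp add: ac_simps)
    qed simp
    moreover have "(\<Sum>k=-int K..int K. if k = 0 then F 0 else 0) = F 0" by simp
    ultimately show ?thesis unfolding dk sum.distrib by simp
  qed
  have g1: "(\<lambda>K. \<gamma> (- int K - 1)) \<longlonglongrightarrow> 0"
    unfolding \<gamma>_def
  proof (rule fourier_coeff_tendsto_0[OF Gh S Sx Ghalf])
    show "filterlim (\<lambda>n. \<bar>real_of_int (- int n - 1)\<bar>) at_top sequentially"
      by (rule filterlim_at_top_mono[OF filterlim_real_sequentially]) auto
  qed
  have g2: "(\<lambda>K. \<gamma> (int K)) \<longlonglongrightarrow> 0"
    unfolding \<gamma>_def
  proof (rule fourier_coeff_tendsto_0[OF Gh S Sx Ghalf])
    show "filterlim (\<lambda>n. \<bar>real_of_int (int n)\<bar>) at_top sequentially"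
      by (rule filterlim_at_top_mono[OF filterlim_real_sequentially]) auto
  qed
  have "(\<lambda>K. F 0 + (\<gamma> (- int K - 1) - \<gamma> (int K))) \<longlonglongrightarrow> F 0 + (0 - 0)"
    by (intro tendsto_intros g1 g2)
  thus ?thesis unfolding part by simp
qed

text \<open>After scaling by sqrt (2 \<pi> s) the integral becomes the characteristic function of
  the standard normal distribution, whose value at t is exp (- t^2 / 2).\<close>

lemma gaussian_fourier:
  assumes s: "s > 0"
  shows "integrable lborel (\<lambda>x::real. complex_of_real (exp (- pi * s * x\<^sup>2)) * efun (-k) (of_real x))"
    and "(LINT x|lborel. complex_of_real (exp (- pi * s * x\<^sup>2)) * efun (-k) (of_real x)) = of_real (exp (- pi * of_int k ^ 2 / s) / sqrt s)"
proof -
  define c where "c = sqrt (2 * pi * s)"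
  have c: "c > 0" using s by (simp add: c_def)
  have c2: "c\<^sup>2 = 2 * pi * s" using s by (simp add: c_def)
  define t where "t = - 2 * pi * of_int k / c"
  let ?f = "\<lambda>x::real. complex_of_real (std_normal_density x) * iexp (t * x)"
  have int1: "integrable lborel ?f"
  proof (rule Bochner_Integration.integrable_bound)
    show "integrable lborel (\<lambda>x. std_normal_density x)" by simp
    show "AE x in lborel. norm (?f x) \<le> norm (std_normal_density x)" by (simp add: norm_mult)
  qed simp
  have val1: "(LINT x|lborel. ?f x) = of_real (exp (- t\<^sup>2 / 2))"
  proof -
    have "(LINT x|lborel. ?f x) = char std_normal_distribution t"
      unfolding char_def by (subst integral_density) (auto simp: scaleR_conv_of_real)
    thus ?thesis by (simp add: char_std_normal_distribution)
  qed
  have eq: "?f (0 + c * x) = of_real (1 / sqrt (2 * pi)) * (complex_of_real (exp (- pi * s * x\<^sup>2)) * efun (-k) (of_real x))" for x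
  proof -
    have "std_normal_density (c * x) = 1 / sqrt (2 * pi) * exp (- pi * s * x\<^sup>2)"
      by (simp add: std_normal_density_def power_mult_distrib c2)
    moreover have "iexp (t * (c * x)) = efun (-k) (of_real x)"
      using c by (simp add: t_def efun_def mult_ac)
    ultimately show ?thesis by simp
  qed
  have "integrable lborel (\<lambda>x. ?f (0 + c * x))"
    by (rule lborel_integrable_real_affine[OF int1]) (use c in simp)
  hence "integrable lborel (\<lambda>x. of_real (1 / sqrt (2 * pi)) * (complex_of_real (exp (- pi * s * x\<^sup>2)) * efun (-k) (of_real x)))"
    unfolding eq .
  thus int: "integrable lborel (\<lambda>x::real. complex_of_real (exp (- pi * s * x\<^sup>2)) * efun (-k) (of_real x))"
  proof -
    assume "integrable lborel (\<lambda>x. of_real (1 / sqrt (2 * pi)) * (complex_of_real (exp (- pi * s * x\<^sup>2)) * efun (-k) (of_real x)))"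
    from integrable_mult_right[of "complex_of_real (sqrt (2 * pi))", OF this]
    show ?thesis by (simp add: mult.assoc[symmetric] del: of_real_exp)
  qed
  have "(LINT x|lborel. ?f x) = c *\<^sub>R (LINT x|lborel. ?f (0 + c * x))"
    using c lborel_integral_real_affine[of c ?f 0] by simp
  also have "(LINT x|lborel. ?f (0 + c * x)) = of_real (1 / sqrt (2 * pi)) * (LINT x|lborel. complex_of_real (exp (- pi * s * x\<^sup>2)) * efun (-k) (of_real x))"
    unfolding eq using int by (subst integral_mult_right_zero) simp
  finally have "of_real (exp (- t\<^sup>2 / 2)) = of_real (sqrt s) * (LINT x|lborel. complex_of_real (exp (- pi * s * x\<^sup>2)) * efun (-k) (of_real x))"
    unfolding val1 by (simp add: c_def real_sqrt_mult scaleR_conv_of_real)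
  moreover have "t\<^sup>2 / 2 = pi * of_int k ^ 2 / s"
  proof -
    have "t\<^sup>2 = (2 * pi * of_int k) ^ 2 / c\<^sup>2" by (simp add: t_def power_divide)
    thus ?thesis unfolding c2 using s by (simp add: power2_eq_square)
  qed
  ultimately show "(LINT x|lborel. complex_of_real (exp (- pi * s * x\<^sup>2)) * efun (-k) (of_real x)) = of_real (exp (- pi * of_int k ^ 2 / s) / sqrt s)"
    using s by (simp add: field_simps)
qed


text \<open>Symmetric intervals are cofinal among the finite sets of integers; this turns unordered
  sums into the symmetric partial sums that the Fourier theorem produces.\<close>

lemma filterlim_symmetric_int_intervals:
  "filterlim (\<lambda>K::nat. {-int K..int K}) (finite_subsets_at_top UNIV) sequentially"
  unfolding filterlim_finite_subsets_at_top
proof safe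
  fix X :: "int set" assume X: "finite X"
  have "\<forall>\<^sub>F K in sequentially. \<forall>x\<in>X. nat \<bar>x\<bar> \<le> K"
    using X by (auto simp: eventually_ball_finite_distrib intro: eventually_ge_at_top)
  thus "\<forall>\<^sub>F K in sequentially. finite {- int K..int K} \<and> X \<subseteq> {- int K..int K} \<and> {- int K..int K} \<subseteq> UNIV"
    by eventually_elim (force simp: nat_le_iff abs_le_iff)
qed

lemma has_sum_int_symmetric:
  fixes f :: "int \<Rightarrow> 'a :: {comm_monoid_add, topological_space}"
  assumes "(f has_sum S) UNIV"
  shows "(\<lambda>K::nat. \<Sum>k=-int K..int K. f k) \<longlonglongrightarrow> S"
  using assms filterlim_symmetric_int_intervals unfolding has_sum_def by (rule filterlim_compose)

lemma summable_on_int_geometric: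
  fixes q :: real
  assumes "0 < q" "q < 1"
  shows "(\<lambda>m::int. q ^ nat \<bar>m\<bar>) summable_on UNIV"
proof -
  have 1: "(\<lambda>n::nat. q ^ n) summable_on UNIV"
    by (rule norm_summable_imp_summable_on) (use assms in \<open>auto intro!: summable_geometric\<close>)
  have "(\<lambda>m::int. q ^ nat \<bar>m\<bar>) summable_on range int"
    by (subst summable_on_reindex) (use 1 in \<open>auto simp: o_def\<close>)
  moreover have "(\<lambda>m::int. q ^ nat \<bar>m\<bar>) summable_on range (\<lambda>n. - int n)"
    by (subst summable_on_reindex) (use 1 in \<open>auto simp: o_def inj_on_def\<close>)
  ultimately have "(\<lambda>m::int. q ^ nat \<bar>m\<bar>) summable_on (range int \<union> range (\<lambda>n. - int n))"
    by (rule summable_on_union)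
  moreover have "range int \<union> range (\<lambda>n. - int n) = UNIV"
  proof -
    have "x \<in> range int \<union> range (\<lambda>n. - int n)" for x
      by (cases x rule: int_cases2) auto
    thus ?thesis by blast
  qed
  ultimately show ?thesis by simp
qed

section \<open>The periodised Gaussian and Poisson summation\<close>

definition gauss :: "real \<Rightarrow> complex \<Rightarrow> complex" where
  "gauss s z = exp (- (of_real (pi * s) * z\<^sup>2))"

text \<open>Completing the square gives Re ((z + m)^2) >= m^2 / 2 - B^2. Replacing m^2 by |m| serves
  only to obtain a geometric majorant, uniform on discs.\<close>

lemma norm_gauss_le:
  assumes s: "s > 0" and z: "norm z \<le> B"
  shows "norm (gauss s (z + of_int m)) \<le> exp (pi * s * B\<^sup>2) * exp (- pi * s / 2) ^ nat \<bar>m\<bar>"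
proof -
  define x y where "x = Re z" and "y = Im z"
  have B: "x\<^sup>2 + y\<^sup>2 \<le> B\<^sup>2"
  proof -
    have "(norm z)\<^sup>2 \<le> B\<^sup>2" using z by (intro power_mono) auto
    thus ?thesis by (simp add: cmod_power2 x_def y_def)
  qed
  have m2: "real (nat \<bar>m\<bar>) \<le> real_of_int m ^ 2"
  proof -
    have "\<bar>m\<bar> \<le> m\<^sup>2" by (metis abs_ge_zero abs_le_square_iff abs_of_nonneg int_one_le_iff_zero_less linorder_not_less mult_le_cancel_left1 power2_abs power2_eq_square zero_le_square less_eq_int_code(1) order_le_less)
    hence "real_of_int \<bar>m\<bar> \<le> real_of_int (m\<^sup>2)" by (subst of_int_le_iff)
    thus ?thesis by simp
  qed
  have re: "Re ((z + of_int m)\<^sup>2) = (x + of_int m)\<^sup>2 - y\<^sup>2"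
    by (simp add: x_def y_def power2_eq_square)
  have "real_of_int m ^ 2 / 2 \<le> (x + of_int m)\<^sup>2 + x\<^sup>2"
    using zero_le_power2[of "2 * x + of_int m"] by (simp add: power2_eq_square algebra_simps)
  hence "real (nat \<bar>m\<bar>) / 2 - B\<^sup>2 \<le> Re ((z + of_int m)\<^sup>2)" using m2 B unfolding re by linarith
  hence "pi * s * (real (nat \<bar>m\<bar>) / 2 - B\<^sup>2) \<le> pi * s * Re ((z + of_int m)\<^sup>2)"
    using s by (intro mult_left_mono) auto
  hence "exp (- (pi * s * Re ((z + of_int m)\<^sup>2))) \<le> exp (pi * s * B\<^sup>2 + real (nat \<bar>m\<bar>) * (- pi * s / 2))"
    by (simp add: algebra_simps)
  also have "\<dots> = exp (pi * s * B\<^sup>2) * exp (- pi * s / 2) ^ nat \<bar>m\<bar>"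
    by (simp only: exp_add exp_of_nat_mult)
  finally show ?thesis by (simp add: gauss_def)
qed

lemma gauss_summable_int:
  assumes "s > 0"
  shows "(\<lambda>m::int. norm (gauss s (z + of_int m))) summable_on UNIV"
proof (rule summable_on_comparison_test[where f = "\<lambda>m. exp (pi * s * (norm z)\<^sup>2) * exp (- pi * s / 2) ^ nat \<bar>m\<bar>"])
  show "(\<lambda>m::int. exp (pi * s * (norm z)\<^sup>2) * exp (- pi * s / 2) ^ nat \<bar>m\<bar>) summable_on UNIV"
    by (intro summable_on_cmult_right summable_on_int_geometric) (use assms in auto)
qed (use norm_gauss_le[OF assms order.refl] in auto)

lemma gauss_deriv: "((\<lambda>z. gauss s (z + c)) has_field_derivative (- 2 * of_real (pi * s) * (z + c) * gauss s (z + c))) (at z)"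
  unfolding gauss_def by (auto intro!: derivative_eq_intros simp: algebra_simps)

text \<open>Half of the exponent absorbs the linear factor: |x| <= 1 + x^2 is at most a constant
  times exp (\<pi> s x^2 / 2).\<close>

lemma gauss_summable_int':
  fixes a :: real
  assumes s: "s > 0"
  shows "(\<lambda>m::int. norm ((of_real a + of_int m) * gauss s (of_real a + of_int m))) summable_on UNIV"
proof (rule summable_on_comparison_test)
  show "(\<lambda>m::int. (1 + 2 / (pi * s)) * norm (gauss (s / 2) (of_real a + of_int m))) summable_on UNIV"
    by (intro summable_on_cmult_right gauss_summable_int) (use s in auto)
  fix m :: int
  define x where "x = a + of_int m"
  have g: "norm (gauss t (of_real a + of_int m)) = exp (- (pi * t * x\<^sup>2))" for t
    by (simp add: gauss_def x_def power2_eq_square)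
  have e: "norm (complex_of_real a + of_int m) = \<bar>x\<bar>"
    unfolding x_def by (metis norm_of_real of_real_add of_real_of_int_eq real_norm_def)
  define w where "w = pi * (s / 2) * x\<^sup>2"
  have "\<bar>x\<bar> \<le> 1 + x\<^sup>2"
    using zero_le_power2[of "\<bar>x\<bar> - 1/2"] by (simp add: power2_eq_square algebra_simps)
  also have "\<dots> = 1 + 2 / (pi * s) * w" using s by (simp add: w_def)
  also have "\<dots> \<le> exp w + 2 / (pi * s) * exp w"
  proof (intro add_mono mult_left_mono)
    have "w \<ge> 0" using s by (simp add: w_def)
    thus "1 \<le> exp w" by simp
    show "w \<le> exp w" using exp_ge_add_one_self[of w] by linarith
  qed (use s in auto)
  finally have "\<bar>x\<bar> * exp (- 2 * w) \<le> ((1 + 2 / (pi * s)) * exp w) * exp (- 2 * w)"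
    by (intro mult_right_mono) (auto simp: algebra_simps)
  also have "\<dots> = (1 + 2 / (pi * s)) * exp (- w)"
    by (simp flip: exp_add)
  finally show "norm ((of_real a + of_int m) * gauss s (of_real a + of_int m)) \<le> (1 + 2 / (pi * s)) * norm (gauss (s / 2) (of_real a + of_int m))"
    unfolding norm_mult g e by (simp add: w_def)
qed auto

text \<open>The unfolding step of Poisson summation: \<open>efun\<close> has period 1, so the
  shifted integrals tile an interval that grows to the real line.\<close>

lemma integral_gauss_partial:
  fixes a s :: real and M :: nat
  shows "(\<Sum>m=-int M..int M. integral {-1/2..1/2} (\<lambda>x::real. gauss s (of_real a + of_real x + of_int m) * efun (-k) (of_real x)))
     = integral {-1/2 - real M..1/2 + real M} (\<lambda>x::real. gauss s (of_real a + of_real x) * efun (-k) (of_real x))"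
proof -
  define g where "g = (\<lambda>x::real. gauss s (of_real a + of_real x) * efun (-k) (of_real x))"
  have contg: "continuous_on A g" for A unfolding g_def gauss_def by (intro continuous_intros)
  have intg: "g integrable_on {c..d}" for c d by (intro integrable_continuous_interval contg)
  have shift: "integral {-1/2..1/2} (\<lambda>x::real. gauss s (of_real a + of_real x + of_int m) * efun (-k) (of_real x)) =
     integral {of_int m - 1/2..of_int m + 1/2} g" for m :: int
  proof -
    have "integral {-1/2..1/2} (g \<circ> (\<lambda>x. x + of_int m)) = integral {-1/2 + of_int m..1/2 + of_int m} g"
      by (rule integral_shift[OF contg])
    moreover have "g \<circ> (\<lambda>x. x + of_int m) = (\<lambda>x::real. gauss s (of_real a + of_real x + of_int m) * efun (-k) (of_real x))"
      by (auto simp: g_def o_def efun_add add_ac)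
    ultimately show ?thesis by (simp add: add.commute)
  qed
  show ?thesis unfolding shift g_def[symmetric]
  proof (induction M)
    case (Suc M)
    have "{- int (Suc M)..int (Suc M)} = insert (- int M - 1) (insert (int M + 1) {-int M..int M})" by auto
    hence "(\<Sum>m=-int (Suc M)..int (Suc M). integral {of_int m - 1/2..of_int m + 1/2} g) =
      integral {- real M - 1 - 1/2..- real M - 1 + 1/2} g + (integral {real M + 1 - 1/2..real M + 1 + 1/2} g + integral {-1/2 - real M..1/2 + real M} g)"
      using Suc by simp
    also have "integral {real M + 1 - 1/2..real M + 1 + 1/2} g + integral {-1/2 - real M..1/2 + real M} g
       = integral {-1/2 - real M..1/2 + real M} g + integral {1/2 + real M..real M + 1 + 1/2} g"
      by (simp add: algebra_simps)
    also have "\<dots> = integral {-1/2 - real M..real M + 1 + 1/2} g"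
      by (rule Henstock_Kurzweil_Integration.integral_combine) (use intg in auto)
    also have "- real M - 1 + 1/2 = -1/2 - real M" by simp
    also have "integral {- real M - 1 - 1/2..-1/2 - real M} g + integral {-1/2 - real M..real M + 1 + 1/2} g = integral {- real M - 1 - 1/2..real M + 1 + 1/2} g"
      by (rule Henstock_Kurzweil_Integration.integral_combine) (use intg in auto)
    finally show ?case by (simp add: algebra_simps)
  qed (simp add: add.commute)
qed


context
  fixes s :: real
  assumes s: "s > 0"
begin

definition gauss_period :: "complex \<Rightarrow> complex" where
  "gauss_period z = (\<Sum>\<^sub>\<infinity>m::int. gauss s (z + of_int m))"

lemma gauss_period_has_sum: "((\<lambda>m::int. gauss s (z + of_int m)) has_sum gauss_period z) UNIV"
  unfolding gauss_period_def
  by (rule has_sum_infsum, rule abs_summable_summable, rule gauss_summable_int[OF s])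

lemma gauss_period_uniform_limit:
  "uniform_limit (cball 0 B) (\<lambda>K z. \<Sum>m=-int K..int K. gauss s (z + of_int m)) gauss_period sequentially"
proof -
  have "uniform_limit (cball 0 B) (\<lambda>X z. \<Sum>m\<in>X. gauss s (z + of_int m)) gauss_period (finite_subsets_at_top UNIV)"
  proof (rule Weierstrass_m_test_general')
    show "(\<lambda>m::int. exp (pi * s * B\<^sup>2) * exp (- pi * s / 2) ^ nat \<bar>m\<bar>) summable_on UNIV"
      by (intro summable_on_cmult_right summable_on_int_geometric) (use s in auto)
  qed (use norm_gauss_le[OF s] gauss_period_has_sum in auto)
  thus ?thesis by (rule filterlim_compose) (rule filterlim_symmetric_int_intervals)
qed

text \<open>Termwise differentiation of a locally uniform limit. The derivative brings in the factor
  z + m, as required for odd characters, whose theta series carry an extra factor n.\<close>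

lemma gauss_period_deriv:
  "\<exists>F'. \<forall>z. (gauss_period has_field_derivative F' z) (at z) \<and>
      (\<lambda>K::nat. \<Sum>m=-int K..int K. - 2 * of_real (pi * s) * (z + of_int m) * gauss s (z + of_int m)) \<longlonglongrightarrow> F' z"
proof -
  have "\<exists>F'. \<forall>z\<in>UNIV. (gauss_period has_field_derivative F' z) (at z) \<and>
      (\<lambda>K::nat. \<Sum>m=-int K..int K. - 2 * of_real (pi * s) * (z + of_int m) * gauss s (z + of_int m)) \<longlonglongrightarrow> F' z"
  proof (rule has_complex_derivative_uniform_sequence)
    fix K :: nat and z :: complex
    show "((\<lambda>z. \<Sum>m=-int K..int K. gauss s (z + of_int m)) has_field_derivative
       (\<Sum>m=-int K..int K. - 2 * of_real (pi * s) * (z + of_int m) * gauss s (z + of_int m))) (at z)"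
      by (intro DERIV_sum gauss_deriv)
  next
    fix z :: complex
    have "cball z 1 \<subseteq> cball 0 (norm z + 1)"
      by (auto simp: dist_norm) (metis add.commute add_le_cancel_right diff_le_eq norm_minus_commute norm_triangle_ineq2 order_trans add_mono_thms_linordered_semiring(1) order_refl diff_add_cancel)
    from uniform_limit_on_subset[OF gauss_period_uniform_limit this]
    show "\<exists>d>0. cball z d \<subseteq> UNIV \<and> uniform_limit (cball z d) (\<lambda>K z. \<Sum>m=-int K..int K. gauss s (z + of_int m)) gauss_period sequentially"
      by (intro exI[of _ 1]) auto
  qed auto
  thus ?thesis by auto
qed

lemma gauss_period_holomorphic: "gauss_period holomorphic_on UNIV"
  using gauss_period_deriv unfolding holomorphic_on_def field_differentiable_def by (metis UNIV_I)

lemma gauss_period_periodic: "gauss_period (z + 1) = gauss_period z"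
proof -
  have "((\<lambda>m::int. gauss s (z + of_int (m + 1))) has_sum gauss_period z) UNIV"
    using gauss_period_has_sum[of z]
    by (subst has_sum_reindex_bij_betw[of "\<lambda>m. m + 1" UNIV UNIV "\<lambda>m. gauss s (z + of_int m)"])
       (auto intro!: bij_betwI[of _ _ _ "\<lambda>m. m - 1"])
  moreover have "((\<lambda>m::int. gauss s (z + of_int (m + 1))) has_sum gauss_period (z + 1)) UNIV"
    using gauss_period_has_sum[of "z + 1"] by (simp add: add_ac)
  ultimately show ?thesis using has_sum_unique by blast
qed

lemma gauss_full_integral:
  fixes a :: real and k :: int
  defines "g \<equiv> \<lambda>x::real. gauss s (of_real a + of_real x) * efun (-k) (of_real x)"
  shows "integrable lborel g"
    and "(LINT x|lborel. g x) = efun k (of_real a) * of_real (exp (- pi * of_int k ^ 2 / s) / sqrt s)"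
proof -
  define h where "h = (\<lambda>x::real. complex_of_real (exp (- pi * s * x\<^sup>2)) * efun (-k) (of_real x))"
  note h = gaussian_fourier[OF s, of k, folded h_def]
  have gh: "g = (\<lambda>x. efun k (of_real a) * h (a + 1 * x))"
  proof
    fix x
    have "gauss s (of_real a + of_real x) = of_real (exp (- pi * s * (a + x)\<^sup>2))"
      by (simp add: gauss_def exp_of_real[symmetric])
    moreover have "efun (-k) (of_real x) = efun k (of_real a) * efun (-k) (of_real (a + x))"
      by (simp add: efun_add efun_minus)
    ultimately show "g x = efun k (of_real a) * h (a + 1 * x)" by (simp add: g_def h_def)
  qed
  have i: "integrable lborel (\<lambda>x. h (a + 1 * x))"
    by (rule lborel_integrable_real_affine[OF h(1)]) simp
  thus "integrable lborel g" unfolding gh by simp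
  have "(LINT x|lborel. h (a + 1 * x)) = (LINT x|lborel. h x)"
    using lborel_integral_real_affine[of 1 h a] by simp
  thus "(LINT x|lborel. g x) = efun k (of_real a) * of_real (exp (- pi * of_int k ^ 2 / s) / sqrt s)"
    unfolding gh h(2)[symmetric] by simp
qed

text \<open>Uniform convergence on the unit interval exchanges sum and integral, unfolding turns the
  partial sums into integrals over growing intervals, and dominated convergence leads to the Fourier
  transform of the Gaussian on the whole line.\<close>

lemma gauss_period_fourier_coeff:
  fixes a :: real
  shows "integral {-1/2..1/2} (\<lambda>x::real. gauss_period (of_real a + of_real x) * efun (-k) (of_real x))
     = efun k (of_real a) * of_real (exp (- pi * of_int k ^ 2 / s) / sqrt s)"
proof -
  define g where "g = (\<lambda>x::real. gauss s (of_real a + of_real x) * efun (-k) (of_real x))"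
  note g = gauss_full_integral[of a k, folded g_def]
  define f where "f = (\<lambda>m::int. \<lambda>x::real. gauss s (of_real a + of_real x + of_int m) * efun (-k) (of_real x))"
  have u: "uniform_limit {-1/2..1/2} (\<lambda>X x. \<Sum>m\<in>X. f m x) (\<lambda>x::real. gauss_period (of_real a + of_real x) * efun (-k) (of_real x)) (finite_subsets_at_top UNIV)"
  proof (rule Weierstrass_m_test_general')
    show "(\<lambda>m::int. exp (pi * s * (\<bar>a\<bar> + 1/2)\<^sup>2) * exp (- pi * s / 2) ^ nat \<bar>m\<bar>) summable_on UNIV"
      by (intro summable_on_cmult_right summable_on_int_geometric) (use s in auto)
    fix m :: int and x :: real assume x: "x \<in> {-1/2..1/2}"
    have "norm (complex_of_real a + of_real x) = \<bar>a + x\<bar>" by (metis norm_of_real of_real_add)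
    also have "\<dots> \<le> \<bar>a\<bar> + 1/2" using x by auto
    finally show "norm (f m x) \<le> exp (pi * s * (\<bar>a\<bar> + 1/2)\<^sup>2) * exp (- pi * s / 2) ^ nat \<bar>m\<bar>"
      unfolding f_def norm_mult using norm_gauss_le[OF s, of "of_real a + of_real x" "\<bar>a\<bar> + 1/2" m] by simp
  next
    fix x :: real
    show "((\<lambda>m. f m x) has_sum (gauss_period (of_real a + of_real x) * efun (-k) (of_real x))) UNIV"
      unfolding f_def by (intro has_sum_cmult_left gauss_period_has_sum)
  qed
  have u': "uniform_limit {-1/2..1/2} (\<lambda>K x. \<Sum>m=-int K..int K. f m x) (\<lambda>x::real. gauss_period (of_real a + of_real x) * efun (-k) (of_real x)) sequentially"
    using u filterlim_symmetric_int_intervals by (rule filterlim_compose)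
  have contf: "continuous_on A (f m)" for A m unfolding f_def gauss_def by (intro continuous_intros)
  obtain I J where IJ: "\<And>K::nat. ((\<lambda>x. \<Sum>m=-int K..int K. f m x) has_integral I K) {-1/2..1/2}"
    "((\<lambda>x::real. gauss_period (of_real a + of_real x) * efun (-k) (of_real x)) has_integral J) {-1/2..1/2}" "I \<longlonglongrightarrow> J"
    by (rule uniform_limit_integral[OF u']) (auto intro!: continuous_intros contf)
  have I: "I K = integral {-1/2 - real K..1/2 + real K} g" for K
  proof -
    have "I K = integral {-1/2..1/2} (\<lambda>x. \<Sum>m=-int K..int K. f m x)" using IJ(1) by (metis integral_unique)
    also have "\<dots> = (\<Sum>m=-int K..int K. integral {-1/2..1/2} (f m))"
      by (rule integral_sum) (auto intro!: integrable_continuous_interval contf)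
    also have "\<dots> = integral {-1/2 - real K..1/2 + real K} g"
      unfolding f_def g_def by (rule integral_gauss_partial)
    finally show ?thesis .
  qed
  have I': "I K = (LINT x|lborel. indicator {-1/2 - real K..1/2 + real K} x *\<^sub>R g x)" for K
  proof -
    have "set_integrable lborel {-1/2 - real K..1/2 + real K} g"
      unfolding set_integrable_def using g(1) by (intro integrable_mult_indicator) auto
    from set_borel_integral_eq_integral(2)[OF this] show ?thesis by (simp add: I set_lebesgue_integral_def)
  qed
  have "(\<lambda>K. (LINT x|lborel. indicator {-1/2 - real K..1/2 + real K} x *\<^sub>R g x)) \<longlonglongrightarrow> (LINT x|lborel. g x)"
  proof (rule integral_dominated_convergence[where w = "\<lambda>x. norm (g x)"])
    show "AE x in lborel. (\<lambda>K. indicator {-1/2 - real K..1/2 + real K} x *\<^sub>R g x) \<longlonglongrightarrow> g x"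
    proof (rule AE_I2)
      fix x :: real
      have "\<forall>\<^sub>F K in sequentially. K \<ge> nat \<lceil>\<bar>x\<bar>\<rceil>" by (rule eventually_ge_at_top)
      hence "\<forall>\<^sub>F K in sequentially. indicator {-1/2 - real K..1/2 + real K} x *\<^sub>R g x = g x"
      proof eventually_elim
        case (elim K)
        have "\<bar>x\<bar> \<le> real (nat \<lceil>\<bar>x\<bar>\<rceil>)" by (rule real_nat_ceiling_ge)
        also have "\<dots> \<le> real K" using elim by (simp only: of_nat_le_iff)
        finally have "x \<in> {-1/2 - real K..1/2 + real K}" by auto
        thus ?case by simp
      qed
      thus "(\<lambda>K. indicator {-1/2 - real K..1/2 + real K} x *\<^sub>R g x) \<longlonglongrightarrow> g x"
        by (rule tendsto_eventually)
    qed
    show "AE x in lborel. norm (indicator {-1/2 - real K..1/2 + real K} x *\<^sub>R g x) \<le> norm (g x)" for K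
      by (rule AE_I2) (auto simp: indicator_def)
    show "g \<in> borel_measurable lborel" using g(1) by simp
    show "(\<lambda>x. indicator {-1/2 - real K..1/2 + real K} x *\<^sub>R g x) \<in> borel_measurable lborel" for K
      using g(1) by simp
    show "integrable lborel (\<lambda>x. norm (g x))" using g(1) by simp
  qed
  hence "I \<longlonglongrightarrow> (LINT x|lborel. g x)" unfolding I'[abs_def, symmetric] by (simp flip: I')
  with IJ(3) have "J = (LINT x|lborel. g x)" using LIMSEQ_unique by blast
  thus ?thesis using IJ(2) g(2) by (simp add: integral_unique)
qed

text \<open>Poisson summation: the Fourier theorem at 0 for the periodised Gaussian translated by
  a.\<close>

lemma theta_shift_even:
  fixes a :: real
  shows "(\<lambda>K::nat. \<Sum>k=-int K..int K. efun k (of_real a) * of_real (exp (- pi * of_int k ^ 2 / s) / sqrt s))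
     \<longlonglongrightarrow> gauss_period (of_real a)"
proof -
  have "(\<lambda>K::nat. \<Sum>k=-int K..int K. integral {-1/2..1/2} (\<lambda>x::real. gauss_period (of_real a + of_real x) * efun (-k) (of_real x))) \<longlonglongrightarrow> gauss_period (of_real a + 0)"
  proof (rule fourier_series_at_0)
    show "(\<lambda>z. gauss_period (of_real a + z)) holomorphic_on UNIV"
      by (rule holomorphic_on_compose_gen[of _ _ gauss_period UNIV, unfolded o_def])
         (auto intro!: holomorphic_intros gauss_period_holomorphic)
    show "gauss_period (of_real a + (z + 1)) = gauss_period (of_real a + z)" for z
      using gauss_period_periodic[of "of_real a + z"] by (simp add: add_ac)
  qed
  thus ?thesis by (simp only: gauss_period_fourier_coeff add_0_right)
qed

text \<open>The same for the derivative of the periodised Gaussian, where integration by parts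
  multiplies the k-th coefficient by 2 \<pi> i k. The limit \<open>D\<close> is the value of that
  derivative at a; it stays anonymous because only the equality of the two limits is used.\<close>

lemma theta_shift_odd:
  fixes a :: real
  shows "\<exists>D. (\<lambda>K::nat. \<Sum>k=-int K..int K. 2 * of_real pi * \<i> * of_int k * (efun k (of_real a) * of_real (exp (- pi * of_int k ^ 2 / s) / sqrt s)))
     \<longlonglongrightarrow> D \<and>
     (\<lambda>K::nat. \<Sum>m=-int K..int K. - 2 * of_real (pi * s) * (of_real a + of_int m) * gauss s (of_real a + of_int m)) \<longlonglongrightarrow> D"
proof -
  obtain F' where F': "\<And>z. (gauss_period has_field_derivative F' z) (at z)"
    "\<And>z. (\<lambda>K::nat. \<Sum>m=-int K..int K. - 2 * of_real (pi * s) * (z + of_int m) * gauss s (z + of_int m)) \<longlonglongrightarrow> F' z"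
    using gauss_period_deriv by blast
  define H where "H = (\<lambda>z. gauss_period (of_real a + z))"
  have Hh: "H holomorphic_on UNIV" unfolding H_def
    by (rule holomorphic_on_compose_gen[of _ _ gauss_period UNIV, unfolded o_def])
       (auto intro!: holomorphic_intros gauss_period_holomorphic)
  have Hper: "H (z + 1) = H z" for z
    using gauss_period_periodic[of "of_real a + z"] by (simp add: H_def add_ac)
  have Hd: "(H has_field_derivative F' (of_real a + z)) (at z)" for z
    unfolding H_def using F'(1)[of "of_real a + z"] DERIV_shift[of gauss_period "F' (of_real a + z)" z "of_real a"]
    by (simp add: add.commute)
  hence dH: "deriv H = (\<lambda>z. F' (of_real a + z))" using DERIV_imp_deriv by blast
  have Hdper: "deriv H (z + 1) = deriv H z" for z
  proof -
    have "((\<lambda>z. H (z + 1)) has_field_derivative deriv H (z + 1)) (at z)"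
      using Hd[of "z + 1"] unfolding dH by (subst (asm) DERIV_shift) (simp add: add_ac)
    hence "(H has_field_derivative deriv H (z + 1)) (at z)" by (simp add: Hper)
    thus ?thesis using DERIV_imp_deriv by metis
  qed
  have "(\<lambda>K::nat. \<Sum>k=-int K..int K. integral {-1/2..1/2} (\<lambda>x::real. deriv H (of_real x) * efun (-k) (of_real x))) \<longlonglongrightarrow> deriv H 0"
    by (rule fourier_series_at_0) (auto intro!: holomorphic_deriv Hh Hdper)
  moreover have "integral {-1/2..1/2} (\<lambda>x::real. deriv H (of_real x) * efun (-k) (of_real x)) =
      2 * of_real pi * \<i> * of_int k * (efun k (of_real a) * of_real (exp (- pi * of_int k ^ 2 / s) / sqrt s))" for k
  proof -
    have "H (1/2) = H (-1/2)" using Hper[of "-1/2"] by simp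
    hence "integral {-1/2..1/2} (\<lambda>x::real. deriv H (of_real x) * efun (-k) (of_real x)) =
      2 * of_real pi * \<i> * of_int k * integral {-1/2..1/2} (\<lambda>x::real. H (of_real x) * efun (-k) (of_real x))"
      by (intro fourier_coeff_by_parts[OF Hh]) auto
    thus ?thesis unfolding H_def gauss_period_fourier_coeff .
  qed
  ultimately have "(\<lambda>K::nat. \<Sum>k=-int K..int K. 2 * of_real pi * \<i> * of_int k * (efun k (of_real a) * of_real (exp (- pi * of_int k ^ 2 / s) / sqrt s)))
     \<longlonglongrightarrow> F' (of_real a)" by (simp add: dH)
  with F'(2)[of "of_real a"] show ?thesis by blast
qed

end

section \<open>Primitive characters and their Gauss sums\<close>

locale char_mod =
  fixes q :: nat and chi :: "nat \<Rightarrow> complex"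
  assumes q3: "q \<ge> 3" and prim: "primitive_dirichlet_char q chi"
begin

lemma dchar: "dirichlet_char q chi"
  using prim by (simp add: primitive_dirichlet_char_def)

lemma q_pos [simp]: "q > 0"
  using q3 by simp

lemma chi_mult: "chi (m * n) = chi m * chi n"
  using dchar by (simp add: dirichlet_char_def)

lemma chi_1 [simp]: "chi 1 = 1" "chi (Suc 0) = 1"
  using dchar by (simp_all add: dirichlet_char_def)

lemma chi_eq_0_iff: "chi n = 0 \<longleftrightarrow> \<not> coprime n q"
  using dchar by (simp add: dirichlet_char_def)

lemma chi_power: "chi (n ^ k) = chi n ^ k"
  by (induction k) (simp_all add: chi_mult)

lemma chi_add_mult: "chi (n + k * q) = chi n"
proof (induction k)
  case (Suc k)
  have "chi (n + k * q + q) = chi (n + k * q)" using dchar unfolding dirichlet_char_def by blast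
  thus ?case using Suc by (simp add: add_ac)
qed simp

lemma chi_mod [simp]: "chi (n mod q) = chi n"
  using chi_add_mult[of "n mod q" "n div q"] by simp

lemma chi_0 [simp]: "chi 0 = 0"
  using q3 by (simp add: chi_eq_0_iff)

lemma chi_power_totient:
  assumes "coprime n q"
  shows "chi n ^ totient q = 1"
proof -
  have "[n ^ totient q = 1] (mod q)" by (rule euler_theorem) fact
  hence "n ^ totient q mod q = 1 mod q" by (simp add: cong_def)
  hence "chi (n ^ totient q) = chi 1" by (metis chi_mod)
  thus ?thesis by (simp add: chi_power)
qed

lemma norm_chi_coprime: "coprime n q \<Longrightarrow> norm (chi n) = 1"
proof -
  assume "coprime n q"
  hence "norm (chi n) ^ totient q = 1" by (metis chi_power_totient norm_one norm_power)
  thus "norm (chi n) = 1" by (intro power_eq_imp_eq_base[of _ "totient q" 1]) (auto simp: totient_gt_0_iff)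
qed

lemma norm_chi_le: "norm (chi n) \<le> 1"
  using norm_chi_coprime[of n] chi_eq_0_iff[of n] by (cases "coprime n q") auto

lemma cnj_chi_mult: "coprime n q \<Longrightarrow> cnj (chi n) * chi n = 1"
  using norm_chi_coprime[of n] by (metis complex_norm_square mult.commute of_real_1 power_one)

lemma char_mod_cnj: "char_mod q (\<lambda>n. cnj (chi n))"
proof
  show "primitive_dirichlet_char q (\<lambda>n. cnj (chi n))"
    using prim by (simp add: primitive_dirichlet_char_def dirichlet_char_def)
qed (rule q3)

lemma chi_neg1_cases: "chi (q - 1) = 1 \<or> chi (q - 1) = -1"
proof -
  have "(q - 1) * (q - 1) = 1 + (q - 2) * q"
  proof -
    obtain k where "q = k + 2" using q3 by (metis add.commute le_Suc_ex numeral_2_eq_2 numeral_3_eq_3 Suc_leD)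
    thus ?thesis by simp
  qed
  hence "chi (q - 1) * chi (q - 1) = 1" by (metis chi_1(1) chi_add_mult chi_mult)
  thus ?thesis by (simp add: square_eq_1_iff)
qed

lemma chi_neg1: "chi (q - 1) = (-1) ^ kappa q chi"
  using chi_neg1_cases by (auto simp: kappa_def)

lemma kappa_cases: "kappa q chi = 0 \<or> kappa q chi = 1"
  by (simp add: kappa_def)

lemma kappa_cnj: "kappa q (\<lambda>n. cnj (chi n)) = kappa q chi"
  using chi_neg1_cases by (auto simp: kappa_def)

text \<open>Characters are functions on the natural numbers here, whereas Poisson summation runs
  over all integers; periodicity provides the extension.\<close>

definition chiZ :: "int \<Rightarrow> complex" where
  "chiZ k = chi (nat (k mod int q))"

lemma chiZ_of_nat [simp]: "chiZ (int n) = chi n"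
  by (simp add: chiZ_def flip: zmod_int)

lemma chiZ_0 [simp]: "chiZ 0 = 0"
  using chiZ_of_nat[of 0] by simp

text \<open>Modulo q, - k equals (q - 1) k, and \<chi>(q - 1) plays the role of \<chi>(-1).\<close>

lemma chiZ_minus: "chiZ (- k) = (-1) ^ kappa q chi * chiZ k"
proof -
  define r where "r = nat (k mod int q)"
  have r: "int r = k mod int q" by (simp add: r_def)
  have "(- k) mod int q = (int (q - 1) * int r) mod int q"
  proof -
    have e: "int (q - 1) * int r = - int r + int r * int q" using q3 by (simp add: of_nat_diff algebra_simps)
    have "(int (q - 1) * int r) mod int q = (- int r) mod int q" by (simp only: e mod_mult_self1)
    also have "\<dots> = (- k) mod int q" unfolding r by (rule mod_minus_eq)
    finally show ?thesis by simp
  qed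
  hence "chiZ (-k) = chi (((q - 1) * r) mod q)"
    unfolding chiZ_def by (simp flip: of_nat_mult zmod_int)
  also have "\<dots> = chi (q - 1) * chi r" by (simp add: chi_mult)
  also have "\<dots> = (-1) ^ kappa q chi * chi r" by (simp only: chi_neg1)
  finally show ?thesis by (simp only: chiZ_def r_def)
qed

lemma norm_chiZ_le: "norm (chiZ k) \<le> 1"
  unfolding chiZ_def by (rule norm_chi_le)

lemma chiZ_progression: "b < q \<Longrightarrow> chiZ (int b + m * int q) = chi b"
  by (simp add: chiZ_def)

definition ee :: "nat \<Rightarrow> complex" where
  "ee n = exp (2 * of_real pi * \<i> * of_nat n / of_nat q)"

lemma ee_add: "ee (m + n) = ee m * ee n"
  by (simp add: ee_def exp_add add_divide_distrib ring_distribs)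

lemma ee_multiple [simp]: "ee (k * q) = 1"
proof -
  have "ee (k * q) = exp (2 * of_real pi * \<i> * of_nat k)" using q3 by (simp add: ee_def mult_ac)
  thus ?thesis using efun_of_int[of "int k" 1] by (simp add: efun_def mult_ac)
qed

lemma ee_mod [simp]: "ee (n mod q) = ee n"
  using ee_add[of "n mod q" "n div q * q"] by simp

text \<open>Multiplication by n permutes the residues modulo q.\<close>

lemma sum_coprime_mult:
  fixes h :: "nat \<Rightarrow> complex"
  assumes per: "\<And>b. h (b mod q) = h b" and n: "coprime n q"
  shows "(\<Sum>b<q. h (n * b)) = (\<Sum>b<q. h b)"
proof -
  have inj: "inj_on (\<lambda>b. (n * b) mod q) {..<q}"
  proof (rule inj_onI)
    fix x y assume "x \<in> {..<q}" "y \<in> {..<q}" "(n * x) mod q = (n * y) mod q"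
    hence "[n * x = n * y] (mod q)" by (simp add: cong_def)
    hence "[x = y] (mod q)" using n by (subst (asm) cong_mult_lcancel_nat) (auto simp: coprime_commute)
    thus "x = y" using \<open>x \<in> _\<close> \<open>y \<in> _\<close> by (simp add: cong_def)
  qed
  have "(\<lambda>b. (n * b) mod q) ` {..<q} = {..<q}"
    by (rule endo_inj_surj) (use inj q3 in auto)
  hence "(\<Sum>b<q. h b) = (\<Sum>b<q. h ((n * b) mod q))"
    using sum.reindex[OF inj, of h] by (simp add: o_def)
  thus ?thesis by (simp add: per)
qed

lemma gauss_sum_alt: "gauss_sum q chi = (\<Sum>b<q. chi b * ee b)"
proof -
  have "gauss_sum q chi = (\<Sum>b\<in>{1..q}. chi b * ee b)"
    unfolding gauss_sum_def ee_def by (simp add: mult_ac)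
  also have "{1..q} = insert q {1..<q}" using q3 by auto
  also have "(\<Sum>b\<in>insert q {1..<q}. chi b * ee b) = chi q * ee q + (\<Sum>b\<in>{1..<q}. chi b * ee b)" by simp
  also have "chi q * ee q = chi 0 * ee 0" by (metis chi_mod ee_mod mod_self)
  also have "\<dots> + (\<Sum>b\<in>{1..<q}. chi b * ee b) = (\<Sum>b\<in>insert 0 {1..<q}. chi b * ee b)" by simp
  also have "insert 0 {1..<q} = {..<q}" using q3 by auto
  finally show ?thesis .
qed

text \<open>This is where primitivity enters. For k coprime to q, the substitution of k b for b
  suffices. Otherwise q' = q / gcd (k, q) is a proper divisor of q, and primitivity provides n
  coprime to q with n = 1 (mod q') and \<chi>(n) different from 1. Replacing b by n b does not
  change \<open>ee (k * b)\<close>, so the sum equals \<chi>(n) times itself and vanishes, as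
  \<chi>(k) does.\<close>

lemma gauss_sum_separable: "(\<Sum>b<q. chi b * ee (k * b)) = cnj (chi k) * gauss_sum q chi"
proof (cases "coprime k q")
  case True
  have "chi k * (\<Sum>b<q. chi b * ee (k * b)) = (\<Sum>b<q. chi (k * b) * ee (k * b))"
    by (simp add: sum_distrib_left chi_mult mult_ac)
  also have "\<dots> = (\<Sum>b<q. chi b * ee b)"
    by (rule sum_coprime_mult[where h = "\<lambda>b. chi b * ee b"]) (use True in auto)
  finally have "cnj (chi k) * (chi k * (\<Sum>b<q. chi b * ee (k * b))) = cnj (chi k) * gauss_sum q chi"
    by (simp add: gauss_sum_alt)
  thus ?thesis using cnj_chi_mult[OF True] by (simp flip: mult.assoc)
next
  case False
  define d where "d = gcd k q"
  have d: "d dvd q" "d dvd k" "d > 1"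
  proof -
    show "d dvd q" "d dvd k" by (simp_all add: d_def)
    have "d \<noteq> 1" using False unfolding d_def coprime_iff_gcd_eq_1 .
    moreover have "d \<noteq> 0" using q3 by (simp add: d_def)
    ultimately show "d > 1" by linarith
  qed
  obtain q' where q': "q = d * q'" using d by (elim dvdE)
  obtain k' where k': "k = d * k'" using d by (elim dvdE)
  have "q' > 0" using q' q3 by (cases q') auto
  hence "q' < q" using d by (simp add: q')
  then obtain n where n: "coprime n q" "n mod q' = 1 mod q'" "chi n \<noteq> 1"
  proof -
    have "q' dvd q" by (simp add: q')
    thus ?thesis using prim \<open>q' < q\<close> that unfolding primitive_dirichlet_char_def by blast
  qed
  have "[n = 1] (mod q')" using n by (simp add: cong_def)
  hence "[d * (k' * n) = d * (k' * 1)] (mod d * q')" by (intro cong_cmult_leftI cong_scalar_left)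
  hence "[k * n = k * 1] (mod q)" by (simp only: k' q' mult.assoc)
  hence kn: "ee (k * n * b) = ee (k * b)" for b
  proof -
    have "[k * n * b = k * b] (mod q)" using cong_scalar_right[OF \<open>[k * n = k * 1] (mod q)\<close>, of b] by simp
    hence "(k * n * b) mod q = (k * b) mod q" by (simp add: cong_def)
    thus ?thesis by (metis ee_mod)
  qed
  have "chi n * (\<Sum>b<q. chi b * ee (k * b)) = (\<Sum>b<q. chi (n * b) * ee (k * (n * b)))"
    using kn by (simp add: sum_distrib_left chi_mult mult_ac)
  also have "\<dots> = (\<Sum>b<q. chi b * ee (k * b))"
  proof (rule sum_coprime_mult[where h = "\<lambda>b. chi b * ee (k * b)"])
    show "chi (b mod q) * ee (k * (b mod q)) = chi b * ee (k * b)" for b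
      by (metis chi_mod ee_mod mod_mult_right_eq)
  qed fact
  finally have "(\<Sum>b<q. chi b * ee (k * b)) = 0" using n(3) by (metis mult_cancel_right2)
  thus ?thesis using False chi_eq_0_iff[of k] by simp
qed

lemma gauss_sum_efun:
  "(\<Sum>b<q. chi b * efun k (of_real (real b / real q))) = cnj (chiZ k) * gauss_sum q chi"
proof -
  define k' where "k' = nat (k mod int q)"
  have k': "k = int k' + (k div int q) * int q" by (simp add: k'_def)
  have "efun k (of_real (real b / real q)) = ee (k' * b)" for b
  proof -
    have "efun k (of_real (real b / real q)) = efun (int k') (of_real (real b / real q)) * efun ((k div int q) * int q) (of_real (real b / real q))"
      by (subst k') (rule efun_add_left)
    also have "efun ((k div int q) * int q) (of_real (real b / real q)) = efun (k div int q) (of_int (int b))"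
      using q3 by (simp add: efun_def mult_ac)
    also have "\<dots> = 1" by (rule efun_of_int)
    also have "efun (int k') (of_real (real b / real q)) = ee (k' * b)"
      by (simp add: efun_def ee_def mult_ac)
    finally show ?thesis by simp
  qed
  thus ?thesis by (simp add: gauss_sum_separable chiZ_def k'_def)
qed

section \<open>Theta series of a character and their transformation\<close>

definition theta_term :: "real \<Rightarrow> int \<Rightarrow> complex" where
  "theta_term t n = chiZ n * of_int n ^ kappa q chi * gauss (t / real q) (of_int n)"

lemma summable_int_gauss:
  assumes s: "s > 0" and k: "k = 0 \<or> k = (1::nat)"
  shows "(\<lambda>n::int. norm (of_int n ^ k * gauss s (of_int n))) summable_on UNIV"
  using k
proof
  assume "k = 0" thus ?thesis using gauss_summable_int[OF s, of 0] by simp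
next
  assume "k = 1" thus ?thesis using gauss_summable_int'[OF s, of 0] by simp
qed

lemma theta_term_abs_summable:
  assumes t: "t > 0"
  shows "(\<lambda>n. norm (theta_term t n)) summable_on UNIV"
proof (rule summable_on_comparison_test)
  show "(\<lambda>n::int. norm (of_int n ^ kappa q chi * gauss (t / real q) (of_int n))) summable_on UNIV"
    by (rule summable_int_gauss) (use t kappa_cases in auto)
  show "norm (theta_term t n) \<le> norm (of_int n ^ kappa q chi * gauss (t / real q) (of_int n))" for n
    unfolding theta_term_def norm_mult using norm_chiZ_le[of n]
    by (simp add: mult.assoc mult_left_le_one_le)
qed auto

text \<open>The factor n ^ \<kappa> compensates the parity of the character, so that the sum over
  all integers is twice the sum over the positive ones.\<close>

lemma theta_term_minus: "theta_term t (- n) = theta_term t n"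
proof -
  have "(-1) ^ kappa q chi * (-1) ^ kappa q chi = (1::complex)"
    by (simp flip: power_mult_distrib)
  hence "theta_term t (-n) = ((-1) ^ kappa q chi * (-1) ^ kappa q chi) * theta_term t n"
    unfolding theta_term_def chiZ_minus of_int_minus power_minus[of "of_int n"]
    by (simp add: gauss_def mult_ac)
  also have "(-1) ^ kappa q chi * (-1) ^ kappa q chi = (1::complex)"
    by (simp flip: power_mult_distrib)
  finally show ?thesis by simp
qed

definition theta :: "real \<Rightarrow> complex" where
  "theta t = (\<Sum>\<^sub>\<infinity>n\<in>{0<..}. chi n * of_nat n ^ kappa q chi * of_real (exp (- pi * real n ^ 2 * t / real q)))"

lemma theta_term_nat: "theta_term t (int n) = chi n * of_nat n ^ kappa q chi * of_real (exp (- pi * real n ^ 2 * t / real q))"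
  by (simp add: theta_term_def gauss_def exp_of_real[symmetric] mult_ac)

lemma theta_int:
  assumes t: "t > 0"
  shows "(theta_term t has_sum (2 * theta t)) UNIV"
proof -
  have summ: "theta_term t summable_on UNIV"
    by (rule abs_summable_summable) (rule theta_term_abs_summable[OF t])
  have 1: "(theta_term t has_sum theta t) (int ` {0<..})"
  proof (subst has_sum_reindex)
    have "(theta_term t \<circ> int) summable_on {0<..}"
      by (subst summable_on_reindex[symmetric]) (auto intro: summable_on_subset_banach[OF summ])
    hence "((theta_term t \<circ> int) has_sum infsum (theta_term t \<circ> int) {0<..}) {0<..}" by (rule has_sum_infsum)
    thus "((theta_term t \<circ> int) has_sum theta t) {0<..}"
      unfolding theta_def o_def theta_term_nat .
  qed auto
  have 2: "(theta_term t has_sum theta t) (uminus ` int ` {0<..})"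
    by (subst has_sum_reindex) (use 1 in \<open>auto simp: o_def theta_term_minus\<close>)
  have "(theta_term t has_sum (theta t + theta t)) (int ` {0<..} \<union> uminus ` int ` {0<..})"
    by (rule has_sum_Un_disjoint[OF 1 2]) auto
  moreover have "theta_term t n = 0" if "n \<notin> int ` {0<..} \<union> uminus ` int ` {0<..}" for n
  proof -
    have "n = 0"
    proof (cases n rule: int_cases2)
      case (nonneg m)
      have "int m \<in> int ` {0<..}" if "m > 0" using that by (intro imageI) auto
      with that nonneg show ?thesis by (cases "m = 0") auto
    next
      case (nonpos m)
      have "- int m \<in> uminus ` int ` {0<..}" if "m > 0" using that by (intro imageI) auto
      with that nonpos show ?thesis by (cases "m = 0") auto
    qed
    thus ?thesis by (simp add: theta_term_def)
  qed
  ultimately have "(theta_term t has_sum (theta t + theta t)) UNIV"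
    by (subst has_sum_cong_neutral[where T = "int ` {0<..} \<union> uminus ` int ` {0<..}" and g = "theta_term t"]) auto
  thus ?thesis by simp
qed

text \<open>Writing n = b + m q splits the sum into residue classes, on which the character is
  constant. Each class is a Gaussian sum with parameter t q shifted by b / q, the form to which
  Poisson summation applies.\<close>

lemma theta_classes:
  assumes t: "t > 0"
  shows "2 * theta t = (\<Sum>b<q. chi b * of_nat q ^ kappa q chi *
     (\<Sum>\<^sub>\<infinity>m::int. (of_real (real b / real q) + of_int m) ^ kappa q chi * gauss (t * real q) (of_real (real b / real q) + of_int m)))"
proof -
  define f where "f = (\<lambda>(b::nat, m::int). int b + m * int q)"
  have bij: "bij_betw f ({..<q} \<times> UNIV) UNIV"
    by (rule bij_betwI[of _ _ _ "\<lambda>n. (nat (n mod int q), n div int q)"])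
       (auto simp: f_def nat_less_iff)
  have "(\<lambda>x. theta_term t (f x)) summable_on ({..<q} \<times> UNIV)"
    by (subst summable_on_reindex_bij_betw[OF bij]) (rule abs_summable_summable[OF theta_term_abs_summable[OF t]])
  hence summ: "(\<lambda>(b, m). theta_term t (f (b, m))) summable_on (Sigma {..<q} (\<lambda>_. UNIV))" by (simp add: case_prod_unfold)
  have "2 * theta t = infsum (theta_term t) UNIV"
    using theta_int[OF t] by (simp add: infsumI)
  also have "\<dots> = (\<Sum>\<^sub>\<infinity>x\<in>{..<q} \<times> UNIV. theta_term t (f x))"
    by (rule infsum_reindex_bij_betw[OF bij, symmetric])
  also have "\<dots> = (\<Sum>\<^sub>\<infinity>b\<in>{..<q}. \<Sum>\<^sub>\<infinity>m. theta_term t (f (b, m)))"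
    using infsum_Sigma'_banach[OF summ] by (simp add: case_prod_unfold)
  also have "\<dots> = (\<Sum>b<q. \<Sum>\<^sub>\<infinity>m. theta_term t (f (b, m)))" by simp
  also have "\<dots> = (\<Sum>b<q. chi b * of_nat q ^ kappa q chi *
     (\<Sum>\<^sub>\<infinity>m::int. (of_real (real b / real q) + of_int m) ^ kappa q chi * gauss (t * real q) (of_real (real b / real q) + of_int m)))"
  proof (rule sum.cong)
    fix b assume b: "b \<in> {..<q}"
    have "theta_term t (f (b, m)) = chi b * of_nat q ^ kappa q chi * ((of_real (real b / real q) + of_int m) ^ kappa q chi * gauss (t * real q) (of_real (real b / real q) + of_int m))" for m
    proof -
      have e: "of_int (f (b, m)) = of_nat q * (of_real (real b / real q) + of_int m :: complex)"
        using q3 by (simp add: f_def field_simps)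
      have "gauss (t / real q) (of_int (f (b, m))) = gauss (t * real q) (of_real (real b / real q) + of_int m)"
      proof -
        have "of_real (pi * (t / real q)) * (of_nat q * w)\<^sup>2 = of_real (pi * (t * real q)) * w\<^sup>2" for w :: complex
          using q3 by (simp add: power2_eq_square)
        thus ?thesis unfolding gauss_def e by (simp only:)
      qed
      thus ?thesis using b unfolding theta_term_def
        by (simp add: chiZ_progression f_def[of] e[unfolded f_def prod.case] power_mult_distrib mult_ac del: of_int_add of_int_mult)
    qed
    thus "(\<Sum>\<^sub>\<infinity>m. theta_term t (f (b, m))) = chi b * of_nat q ^ kappa q chi *
     (\<Sum>\<^sub>\<infinity>m::int. (of_real (real b / real q) + of_int m) ^ kappa q chi * gauss (t * real q) (of_real (real b / real q) + of_int m))"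
      by (simp only: infsum_cmult_right')
  qed auto
  finally show ?thesis .
qed

text \<open>One statement for both parities. In the odd case the factor 2 \<pi> i j of the Fourier
  side is divided by - 2 \<pi> s, the factor from differentiating the Gaussian, which leaves - i j /
  s.\<close>

lemma theta_shift_limit:
  fixes a s :: real
  assumes s: "s > 0" and k: "k = 0 \<or> k = (1::nat)"
  shows "(\<lambda>K::nat. \<Sum>j=-int K..int K. efun j (of_real a) * ((-\<i>) ^ k * of_int j ^ k * of_real (exp (- pi * of_int j ^ 2 / s) / (sqrt s * s ^ k))))
    \<longlonglongrightarrow> (\<Sum>\<^sub>\<infinity>m::int. (of_real a + of_int m) ^ k * gauss s (of_real a + of_int m))"
  using k
proof
  assume "k = 0"
  thus ?thesis using theta_shift_even[OF s, of a] by (simp add: gauss_period_def[OF s])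
next
  assume k: "k = 1"
  obtain D where D: "(\<lambda>K::nat. \<Sum>k=-int K..int K. 2 * of_real pi * \<i> * of_int k * (efun k (of_real a) * of_real (exp (- pi * of_int k ^ 2 / s) / sqrt s))) \<longlonglongrightarrow> D"
     "(\<lambda>K::nat. \<Sum>m=-int K..int K. - 2 * of_real (pi * s) * (of_real a + of_int m) * gauss s (of_real a + of_int m)) \<longlonglongrightarrow> D"
    using theta_shift_odd[OF s, of a] by blast
  have "((\<lambda>m::int. (of_real a + of_int m) * gauss s (of_real a + of_int m)) has_sum
     (\<Sum>\<^sub>\<infinity>m::int. (of_real a + of_int m) * gauss s (of_real a + of_int m))) UNIV"
    by (rule has_sum_infsum, rule abs_summable_summable, rule gauss_summable_int'[OF s])
  hence "(\<lambda>K::nat. - 2 * of_real (pi * s) * (\<Sum>m=-int K..int K. (of_real a + of_int m) * gauss s (of_real a + of_int m))) \<longlonglongrightarrow>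
     - 2 * of_real (pi * s) * (\<Sum>\<^sub>\<infinity>m::int. (of_real a + of_int m) * gauss s (of_real a + of_int m))"
    by (intro tendsto_intros has_sum_int_symmetric)
  hence "D = - 2 * of_real (pi * s) * (\<Sum>\<^sub>\<infinity>m::int. (of_real a + of_int m) * gauss s (of_real a + of_int m))"
    using D(2) by (intro LIMSEQ_unique[OF D(2)]) (simp add: sum_distrib_left mult.assoc)
  moreover have "(\<lambda>K::nat. (\<Sum>k=-int K..int K. 2 * of_real pi * \<i> * of_int k * (efun k (of_real a) * of_real (exp (- pi * of_int k ^ 2 / s) / sqrt s))) / (- 2 * of_real (pi * s))) \<longlonglongrightarrow> D / (- 2 * of_real (pi * s))"
    using s by (intro tendsto_intros D) auto
  ultimately have lim: "(\<lambda>K::nat. (\<Sum>k=-int K..int K. 2 * of_real pi * \<i> * of_int k * (efun k (of_real a) * of_real (exp (- pi * of_int k ^ 2 / s) / sqrt s))) / (- 2 * of_real (pi * s)))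
     \<longlonglongrightarrow> (\<Sum>\<^sub>\<infinity>m::int. (of_real a + of_int m) * gauss s (of_real a + of_int m))"
    using s by simp
  have eqj: "2 * of_real pi * \<i> * of_int j * (efun j (of_real a) * of_real (exp (- pi * of_int j ^ 2 / s) / sqrt s)) / (- 2 * of_real (pi * s))
      = efun j (of_real a) * ((-\<i>) ^ k * of_int j ^ k * of_real (exp (- pi * of_int j ^ 2 / s) / (sqrt s * s ^ k)))" for j
    using s by (simp add: k field_simps)
  show ?thesis using lim unfolding sum_divide_distrib eqj by (simp only: k power_one_right)
qed

text \<open>Poisson summation in every residue class produces, at each frequency j, the sum over b
  of \<chi>(b) exp (2 \<pi> i j b / q); by separability this is the Gauss sum times the conjugate
  character at j. Working with symmetric partial sums, only finite sums have to be
  interchanged.\<close>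

theorem theta_transformation:
  assumes t: "t > 0"
  shows "theta t = root_number q chi * of_real (1 / (sqrt t * t ^ kappa q chi)) * char_mod.theta q (\<lambda>n. cnj (chi n)) (1 / t)"
proof -
  interpret C: char_mod q "\<lambda>n. cnj (chi n)" by (rule char_mod_cnj)
  define k where "k = kappa q chi"
  define s where "s = t * real q"
  have s: "s > 0" using t q3 by (simp add: s_def)
  have kc: "k = 0 \<or> k = 1" using kappa_cases by (simp add: k_def)
  define W where "W = (\<lambda>j::int. (-\<i>) ^ k * of_int j ^ k * complex_of_real (exp (- pi * of_int j ^ 2 / s) / (sqrt s * s ^ k)))"
  have lim1: "(\<lambda>K::nat. \<Sum>b<q. chi b * of_nat q ^ k * (\<Sum>j=-int K..int K. efun j (of_real (real b / real q)) * W j)) \<longlonglongrightarrow> 2 * theta t"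
    unfolding theta_classes[OF t] k_def[symmetric] s_def[symmetric] W_def
    by (intro tendsto_intros theta_shift_limit s kc)
  \<comment> \<open>Collects the Gauss sum and all powers of q and s; (- i) ^ \<kappa> = 1 / i ^
    \<kappa> will turn it into the root number.\<close>
  define cst where "cst = of_nat q ^ k * gauss_sum q chi * (-\<i>) ^ k * of_real (1 / (sqrt s * s ^ k))"
  have eq: "(\<Sum>b<q. chi b * of_nat q ^ k * (\<Sum>j=-int K..int K. efun j (of_real (real b / real q)) * W j))
     = (\<Sum>j=-int K..int K. cst * C.theta_term (1 / t) j)" for K :: nat
  proof -
    have "(\<Sum>b<q. chi b * of_nat q ^ k * (\<Sum>j=-int K..int K. efun j (of_real (real b / real q)) * W j))
      = (\<Sum>b<q. \<Sum>j=-int K..int K. of_nat q ^ k * W j * (chi b * efun j (of_real (real b / real q))))"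
      by (simp add: sum_distrib_left mult_ac)
    also have "\<dots> = (\<Sum>j=-int K..int K. \<Sum>b<q. of_nat q ^ k * W j * (chi b * efun j (of_real (real b / real q))))"
      by (rule sum.swap)
    also have "\<dots> = (\<Sum>j=-int K..int K. of_nat q ^ k * W j * (cnj (chiZ j) * gauss_sum q chi))"
      unfolding sum_distrib_left[symmetric] gauss_sum_efun ..
    also have "\<dots> = (\<Sum>j=-int K..int K. cst * C.theta_term (1 / t) j)"
    proof (rule sum.cong)
      fix j
      have "gauss (1 / t / real q) (of_int j) = complex_of_real (exp (- pi * of_int j ^ 2 / s))"
        using t by (simp add: gauss_def s_def exp_of_real[symmetric])
      thus "of_nat q ^ k * W j * (cnj (chiZ j) * gauss_sum q chi) = cst * C.theta_term (1 / t) j"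
        unfolding C.theta_term_def C.chiZ_def W_def cst_def chiZ_def kappa_cnj k_def[symmetric]
        by (simp add: mult_ac)
    qed auto
    finally show ?thesis .
  qed
  have "(\<lambda>K::nat. \<Sum>j=-int K..int K. cst * C.theta_term (1 / t) j) \<longlonglongrightarrow> cst * (2 * C.theta (1 / t))"
    unfolding sum_distrib_left[symmetric]
    by (intro tendsto_intros has_sum_int_symmetric C.theta_int) (use t in auto)
  with lim1 have "2 * theta t = cst * (2 * C.theta (1 / t))"
    unfolding eq using LIMSEQ_unique by blast
  hence "theta t = cst * C.theta (1 / t)" by simp
  moreover have "cst = root_number q chi * of_real (1 / (sqrt t * t ^ k))"
  proof -
    have "real q = sqrt (real q) * sqrt (real q)" by simp
    have 1: "(-\<i>) ^ k = 1 / \<i> ^ k" using kc by auto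
    have 2: "of_nat q ^ k * complex_of_real (1 / (sqrt s * s ^ k)) = of_real (1 / (sqrt t * t ^ k)) / of_real (sqrt (real q))"
      using q3 t by (simp add: s_def real_sqrt_mult power_mult_distrib field_simps)
    have "cst = gauss_sum q chi * (-\<i>) ^ k * (of_nat q ^ k * complex_of_real (1 / (sqrt s * s ^ k)))"
      by (simp add: cst_def mult_ac)
    also have "\<dots> = root_number q chi * of_real (1 / (sqrt t * t ^ k))"
      unfolding 1 2 root_number_def k_def[symmetric] by simp
    finally show ?thesis .
  qed
  ultimately show ?thesis by (simp add: k_def)
qed

end

section \<open>Series of incomplete Gamma functions\<close>

definition gkern :: "real \<Rightarrow> complex \<Rightarrow> real \<Rightarrow> complex" where
  "gkern x z t = of_real t powr (z - 1) / of_real (exp (x * t))"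

text \<open>This is x powr (-z) \<Gamma>(z, x), normalised so that substituting x t for t gives the
  integral of \<open>gkern x z\<close> over [1, \<infinity>), a range that does not depend on
  x.\<close>

definition upper_part :: "real \<Rightarrow> complex \<Rightarrow> complex" where
  "upper_part x z = of_real (1 / x) powr z * inc_Gamma z x"

text \<open>Defined by subtraction and not as an integral over (0, 1), so that the splitting of each
  term makes sense for every z; the integral converges only for Re z > 0.\<close>

definition lower_part :: "real \<Rightarrow> complex \<Rightarrow> complex" where
  "lower_part x z = of_real (1 / x) powr z * Gamma z - upper_part x z"

lemma norm_gkern: "t > 0 \<Longrightarrow> norm (gkern x z t) = t powr (Re z - 1) * exp (- (x * t))"
  by (simp add: gkern_def norm_divide norm_powr_real_powr exp_minus field_simps)

lemma gkern_measurable: "gkern x z \<in> borel_measurable borel"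
  unfolding gkern_def by measurable

lemma gkern_integrable_pos:
  assumes "x > 0" "Re z > 0"
  shows "gkern x z absolutely_integrable_on {0<..}"
  unfolding gkern_def by (rule absolutely_integrable_Gamma_integral) (use assms in auto)

text \<open>For t >= 1 a larger real exponent dominates, and a positive one is covered by the Gamma
  integral.\<close>

lemma gkern_integrable:
  assumes x: "x > 0"
  shows "gkern x z absolutely_integrable_on {1..}"
proof -
  define M where "M = \<bar>Re z\<bar> + 1"
  have "gkern x (of_real M) absolutely_integrable_on {0<..}"
    by (rule gkern_integrable_pos) (use x in \<open>auto simp: M_def\<close>)
  hence int: "gkern x (of_real M) absolutely_integrable_on {1..}"
    by (rule set_integrable_subset) auto
  show ?thesis
  proof (rule set_integrable_bound[OF int])
    show "set_borel_measurable lebesgue {1..} (gkern x z)"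
      using gkern_measurable[of x z] unfolding set_borel_measurable_def
      by (intro borel_measurable_scaleR borel_measurable_indicator measurable_completion) auto
    show "AE t in lebesgue. t \<in> {1..} \<longrightarrow> norm (gkern x z t) \<le> norm (gkern x (of_real M) t)"
    proof (intro AE_I2 impI)
      fix t :: real assume "t \<in> {1..}"
      hence t: "t \<ge> 1" by simp
      have "t powr (Re z - 1) \<le> t powr (M - 1)" using t by (intro powr_mono) (auto simp: M_def)
      thus "norm (gkern x z t) \<le> norm (gkern x (of_real M) t)"
        using t by (simp add: norm_gkern)
    qed
  qed
qed

lemma of_real_powr_scale:
  assumes "x > 0" "t > 0"
  shows "complex_of_real (x * t) powr w = of_real x powr w * of_real t powr w"
  using assms by (simp add: powr_times_real)

lemma inverse_powr_cancel:
  assumes "x > 0"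
  shows "complex_of_real (1 / x) powr z * of_real x powr z = 1"
proof -
  have "complex_of_real (1 / x) powr z * of_real x powr z = of_real (1 / x * x) powr z"
    by (subst of_real_powr_scale) (use assms in auto)
  thus ?thesis using assms by simp
qed

lemma scale_integral:
  fixes S :: "real set"
  assumes x: "x > 0" and S: "S \<in> sets lebesgue" "S \<subseteq> {0<..}" and int: "gkern x z absolutely_integrable_on S"
  shows "of_real (1 / x) powr z * integral ((*) x ` S) (gkern 1 z) = integral S (gkern x z)"
proof -
  have e: "\<bar>x\<bar> *\<^sub>R gkern 1 z (x * t) = of_real x powr z * gkern x z t" if "t \<in> S" for t
  proof -
    have t: "t > 0" using S that by auto
    have "gkern 1 z (x * t) = of_real x powr (z - 1) * gkern x z t"
      unfolding gkern_def by (subst of_real_powr_scale) (use x t in auto)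
    moreover have "of_real x * of_real x powr (z - 1) = complex_of_real x powr z"
      using x by (simp add: powr_diff)
    ultimately show ?thesis using x by (simp add: scaleR_conv_of_real flip: mult.assoc)
  qed
  have "(\<lambda>t. \<bar>x\<bar> *\<^sub>R gkern 1 z (x * t)) absolutely_integrable_on S \<and>
      integral S (\<lambda>t. \<bar>x\<bar> *\<^sub>R gkern 1 z (x * t)) = of_real x powr z * integral S (gkern x z)"
  proof
    have "(\<lambda>t. of_real x powr z * gkern x z t) absolutely_integrable_on S"
      using int by (rule set_integrable_mult_right)
    thus "(\<lambda>t. \<bar>x\<bar> *\<^sub>R gkern 1 z (x * t)) absolutely_integrable_on S"
      by (subst set_integrable_cong[OF refl refl e])
    show "integral S (\<lambda>t. \<bar>x\<bar> *\<^sub>R gkern 1 z (x * t)) = of_real x powr z * integral S (gkern x z)"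
      by (subst integral_cong[OF e]) simp_all
  qed
  hence "integral ((*) x ` S) (gkern 1 z) = of_real x powr z * integral S (gkern x z)"
    by (subst (asm) has_absolute_integral_change_of_variables_real)
       (use x S in \<open>auto intro!: derivative_eq_intros inj_onI\<close>)
  thus ?thesis using inverse_powr_cancel[OF x, of z] by (simp flip: mult.assoc)
qed

lemma upper_part_integral:
  assumes x: "x > 0"
  shows "upper_part x z = integral {1..} (gkern x z)"
proof -
  have "(*) x ` {1..} = {x..}"
  proof safe
    fix t assume "x \<le> t"
    thus "t \<in> (*) x ` {1..}" using x by (intro image_eqI[of _ _ "t / x"]) auto
  qed (use x in auto)
  moreover have "inc_Gamma z x = integral {x..} (gkern 1 z)"
    unfolding inc_Gamma_def gkern_def by (intro integral_cong) (simp add: exp_minus field_simps)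
  ultimately show ?thesis
    using scale_integral[OF x _ _ gkern_integrable[OF x], of z] unfolding upper_part_def by (auto simp: subset_iff)
qed

lemma full_integral:
  assumes x: "x > 0" and z: "Re z > 0"
  shows "of_real (1 / x) powr z * Gamma z = integral {0<..} (gkern x z)"
proof -
  have "(*) x ` {0<..} = {0<..}"
  proof safe
    fix t :: real assume "0 < t"
    thus "t \<in> (*) x ` {0<..}" using x by (intro image_eqI[of _ _ "t / x"]) auto
  qed (use x in auto)
  moreover have "Gamma z = integral {0<..} (gkern 1 z)"
    using Gamma_integral_complex'[OF z] by (simp add: integral_unique gkern_def[abs_def])
  ultimately show ?thesis
    using scale_integral[OF x _ _ gkern_integrable_pos[OF x z]] by auto
qed

lemma lower_part_integral:
  assumes x: "x > 0" and z: "Re z > 0"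
  shows "gkern x z absolutely_integrable_on {0<..<1}"
    and "lower_part x z = integral {0<..<1} (gkern x z)"
proof -
  show i1: "gkern x z absolutely_integrable_on {0<..<1}"
    by (rule set_integrable_subset[OF gkern_integrable_pos[OF x z]]) auto
  have "(gkern x z has_integral (integral {0<..<1} (gkern x z) + integral {1..} (gkern x z))) ({0<..<1} \<union> {1..})"
    using i1 gkern_integrable[OF x, of z]
  proof (intro has_integral_Un integrable_integral set_lebesgue_integral_eq_integral(1))
    have "{0<..<1} \<inter> {1..} = ({} :: real set)" by auto
    thus "negligible ({0<..<1} \<inter> {1..} :: real set)" by simp
  qed
  also have "{0<..<1} \<union> {1..} = {0<..(1::real)} \<union> {1..}" by auto
  also have "\<dots> = {0<..}" by auto
  finally show "lower_part x z = integral {0<..<1} (gkern x z)"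
    unfolding lower_part_def full_integral[OF x z] upper_part_integral[OF x] by (simp add: integral_unique)
qed

lemma norm_integral_le:
  fixes f :: "real \<Rightarrow> complex"
  assumes "f absolutely_integrable_on S"
  shows "norm (integral S f) \<le> integral S (\<lambda>t. norm (f t))"
  using assms set_integral_norm_bound[OF assms] set_integrable_norm[OF assms]
  by (simp add: set_lebesgue_integral_eq_integral)

lemma gkern_norm_integrable:
  assumes "gkern x z absolutely_integrable_on S"
  shows "(\<lambda>t. norm (gkern x z t)) integrable_on S"
  using assms by (simp add: absolutely_integrable_on_def)

text \<open>For t >= 1 and x >= x0 one has 2 x t >= x0 t + x, so half of the exponent is left as exp
  (- x / 2) while the other half keeps the integral convergent, uniformly in x and in Re z <= M. The
  integral of the norm is bounded too, for the exchange of sums and integrals.\<close>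

lemma norm_upper_part_le:
  assumes x0: "x0 > 0"
  shows "\<exists>C\<ge>0. \<forall>x z. x \<ge> x0 \<longrightarrow> Re z \<le> M \<longrightarrow> norm (upper_part x z) \<le> C * exp (- x / 2) \<and>
    integral {1..} (\<lambda>t. norm (gkern x z t)) \<le> C * exp (- x / 2)"
proof -
  define C where "C = integral {1..} (\<lambda>t. norm (gkern (x0 / 2) (of_real M) t))"
  have i0: "gkern (x0 / 2) (of_real M) absolutely_integrable_on {1..}"
    by (rule gkern_integrable) (use x0 in auto)
  have C0: "C \<ge> 0" unfolding C_def by (rule integral_nonneg[OF gkern_norm_integrable[OF i0]]) auto
  have "norm (upper_part x z) \<le> C * exp (- x / 2) \<and> integral {1..} (\<lambda>t. norm (gkern x z t)) \<le> C * exp (- x / 2)"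
    if x: "x \<ge> x0" and z: "Re z \<le> M" for x z
  proof -
  have ix: "gkern x z absolutely_integrable_on {1..}" by (rule gkern_integrable) (use x x0 in auto)
  have le: "norm (upper_part x z) \<le> integral {1..} (\<lambda>t. norm (gkern x z t))"
    using norm_integral_le[OF ix] x x0 by (simp add: upper_part_integral)
  have "integral {1..} (\<lambda>t. norm (gkern x z t)) \<le> integral {1..} (\<lambda>t. norm (gkern (x0 / 2) (of_real M) t) * exp (- x / 2))"
  proof (rule integral_le)
    show "(\<lambda>t. norm (gkern x z t)) integrable_on {1..}" by (rule gkern_norm_integrable[OF ix])
    show "(\<lambda>t. norm (gkern (x0 / 2) (of_real M) t) * exp (- x / 2)) integrable_on {1..}"
      by (intro integrable_on_mult_left gkern_norm_integrable[OF i0])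
    fix t :: real assume "t \<in> {1..}"
    hence t: "t \<ge> 1" by simp
    have "x0 * t + x \<le> x * t + x * t" using x x0 t by (intro add_mono mult_right_mono) (auto simp: mult_le_cancel_left1)
    hence "- (x * t) \<le> - (x0 * t / 2) + (- x / 2)" by linarith
    hence "exp (- (x * t)) \<le> exp (- (x0 * t / 2) + (- x / 2))" by simp
    hence "exp (- (x * t)) \<le> exp (- (x0 / 2 * t)) * exp (- x / 2)" by (simp only: exp_add) simp
    moreover have "t powr (Re z - 1) \<le> t powr (M - 1)" using t z by (intro powr_mono) auto
    ultimately have "t powr (Re z - 1) * exp (- (x * t)) \<le> t powr (M - 1) * (exp (- (x0 / 2 * t)) * exp (- x / 2))"
      by (intro mult_mono) auto
    thus "norm (gkern x z t) \<le> norm (gkern (x0 / 2) (of_real M) t) * exp (- x / 2)"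
      using t by (simp add: norm_gkern)
  qed
  also have "\<dots> = C * exp (- x / 2)" by (simp add: C_def)
  finally have "integral {1..} (\<lambda>t. norm (gkern x z t)) \<le> C * exp (- x / 2)" .
  with le show ?thesis by linarith
  qed
  with C0 show ?thesis by blast
qed

text \<open>On (0, 1) the modulus of t powr (z - 1) decreases as Re z grows, so the real exponent a
  is the worst case; enlarging the range to (0, \<infinity>) gives a complete Gamma
  integral.\<close>

lemma norm_lower_part_le:
  assumes x: "x > 0" and a: "a > 0" and z: "Re z \<ge> a"
  shows "integral {0<..<1} (\<lambda>t. norm (gkern x z t)) \<le> (1 / x) powr a * Gamma a"
    and "norm (lower_part x z) \<le> (1 / x) powr a * Gamma a"
proof -
  have z0: "Re z > 0" using a z by linarith
  have a0: "Re (complex_of_real a) > 0" using a by simp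
  note i = lower_part_integral(1)[OF x z0]
  have ia: "gkern x (of_real a) absolutely_integrable_on {0<..}" by (rule gkern_integrable_pos[OF x a0])
  have ia1: "gkern x (of_real a) absolutely_integrable_on {0<..<1}" by (rule set_integrable_subset[OF ia]) auto
  have le: "norm (lower_part x z) \<le> integral {0<..<1} (\<lambda>t. norm (gkern x z t))"
    unfolding lower_part_integral(2)[OF x z0] by (rule norm_integral_le[OF i])
  have "integral {0<..<1} (\<lambda>t. norm (gkern x z t)) \<le> integral {0<..<1} (\<lambda>t. norm (gkern x (of_real a) t))"
  proof (rule integral_le)
    fix t :: real assume "t \<in> {0<..<1}"
    hence t: "0 < t" "t < 1" by auto
    have "t powr (Re z - 1) \<le> t powr (a - 1)" using t z by (intro powr_mono') auto
    thus "norm (gkern x z t) \<le> norm (gkern x (of_real a) t)" using t by (simp add: norm_gkern)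
  qed (intro gkern_norm_integrable i ia1)+
  also have "\<dots> \<le> integral {0<..} (\<lambda>t. norm (gkern x (of_real a) t))"
    by (rule integral_subset_le) (use gkern_norm_integrable[OF ia] gkern_norm_integrable[OF ia1] in auto)
  also have "\<dots> = integral {0<..} (\<lambda>t. Re (gkern x (of_real a) t))"
  proof (rule integral_cong)
    fix t :: real assume "t \<in> {0<..}"
    hence t: "t > 0" by simp
    have "gkern x (of_real a) t = of_real (t powr (a - 1) / exp (x * t))"
    proof -
      have "complex_of_real a - 1 = of_real (a - 1)" by simp
      hence "complex_of_real t powr (of_real a - 1) = of_real (t powr (a - 1))"
        using t by (simp only: powr_of_real less_imp_le)
      thus ?thesis by (simp add: gkern_def)
    qed
    thus "norm (gkern x (of_real a) t) = Re (gkern x (of_real a) t)"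
      by (simp only: norm_of_real Re_complex_of_real) simp
  qed
  also have "\<dots> = Re (integral {0<..} (gkern x (of_real a)))"
    using has_integral_Re[OF integrable_integral[OF set_lebesgue_integral_eq_integral(1)[OF ia]]]
    by (rule integral_unique)
  also have "\<dots> = (1 / x) powr a * Gamma a"
    unfolding full_integral[OF x a0, symmetric] using x by (simp add: powr_of_real Gamma_complex_of_real del: of_real_divide)
  finally show "integral {0<..<1} (\<lambda>t. norm (gkern x z t)) \<le> (1 / x) powr a * Gamma a" .
  with le show "norm (lower_part x z) \<le> (1 / x) powr a * Gamma a" by linarith
qed

text \<open>Integrate the derivative of - t powr z exp (- x t) over [1, \<infinity>). The purpose is
  decay: dividing by z bounds the upper part at z by 1 / |z| times quantities that stay bounded for
  Re z bounded above.\<close>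

lemma upper_part_rec:
  assumes x: "x > 0"
  shows "z * upper_part x z = of_real x * upper_part x (z + 1) - of_real (exp (- x))"
proof -
  define F where "F = (\<lambda>t::real. - (of_real t powr z / of_real (exp (x * t))))"
  define f where "f = (\<lambda>t::real. of_real x * gkern x (z + 1) t - z * gkern x z t)"
  have int: "f absolutely_integrable_on {1..}" unfolding f_def
    by (intro set_integral_diff(1) set_integrable_mult_right gkern_integrable x)
  have fm: "f \<in> borel_measurable borel" unfolding f_def gkern_def by measurable
  have intl: "set_integrable lborel {1..} f"
    using int fm unfolding set_integrable_def
    by (subst (asm) integrable_completion) (auto intro!: borel_measurable_scaleR borel_measurable_indicator)
  have int': "set_integrable lborel (einterval (ereal 1) \<infinity>) f"
    by (rule set_integrable_subset[OF intl]) (auto simp: einterval_def)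
  have der: "(F has_vector_derivative f t) (at t)" if "t > 0" for t
  proof -
    have d1: "((\<lambda>w. w powr z) has_field_derivative z * of_real t powr (z - 1)) (at (complex_of_real t))"
      by (rule has_field_derivative_powr) (use that in \<open>auto simp: complex_nonpos_Reals_iff\<close>)
    have d2: "((\<lambda>w. exp (of_real x * w)) has_field_derivative exp (of_real x * of_real t) * of_real x) (at (complex_of_real t))"
      by (auto intro!: derivative_eq_intros)
    have "((\<lambda>w. - (w powr z / exp (of_real x * w))) has_field_derivative
        - ((z * of_real t powr (z - 1) * exp (of_real x * of_real t) - of_real t powr z * (exp (of_real x * of_real t) * of_real x)) / (exp (of_real x * of_real t) * exp (of_real x * of_real t)))) (at (complex_of_real t))"
      by (intro DERIV_minus DERIV_divide d1 d2) simp
    also have "- ((z * of_real t powr (z - 1) * exp (of_real x * of_real t) - of_real t powr z * (exp (of_real x * of_real t) * of_real x)) / (exp (of_real x * of_real t) * exp (of_real x * of_real t))) = f t"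
    proof -
      define e where "e = exp (complex_of_real x * of_real t)"
      have "e \<noteq> 0" "e = of_real (exp (x * t))" by (simp_all add: e_def flip: exp_of_real)
      thus ?thesis unfolding e_def[symmetric] by (simp add: f_def gkern_def field_simps)
    qed
    finally have "((\<lambda>w. - (w powr z / exp (of_real x * w))) has_field_derivative f t) (at (complex_of_real t))" .
    from has_vector_derivative_real_field[OF this] show ?thesis
      by (simp add: F_def exp_of_real[symmetric])
  qed
  have lim: "(F \<longlongrightarrow> 0) at_top"
  proof (rule tendsto_norm_zero_cancel)
    have "((\<lambda>t::real. t powr Re z * exp (- (x * t))) \<longlongrightarrow> 0) at_top"
      using x by real_asymp
    moreover have "\<forall>\<^sub>F t in at_top. t powr Re z * exp (- (x * t)) = norm (F t)"
      using eventually_gt_at_top[of 0]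
      by eventually_elim (simp add: F_def norm_divide norm_powr_real_powr exp_minus field_simps)
    ultimately show "((\<lambda>t. norm (F t)) \<longlongrightarrow> 0) at_top" by (rule Lim_transform_eventually)
  qed
  have "(LBINT t=ereal 1..\<infinity>. f t) = 0 - F 1"
  proof (rule interval_integral_FTC_integrable)
    show "(F has_vector_derivative f t) (at t)" if "ereal 1 < ereal t" for t
      using der[of t] that by simp
    show "isCont f t" if "ereal 1 < ereal t" for t
      using that unfolding f_def gkern_def
      by (intro continuous_intros) (auto simp: complex_nonpos_Reals_iff)
    show "set_integrable lborel (einterval (ereal 1) \<infinity>) f" by fact
    have "isCont F 1" using der[of 1] by (auto intro: has_vector_derivative_continuous)
    hence "(F \<longlongrightarrow> F 1) (at_right 1)" by (auto simp: isCont_def intro: tendsto_within_subset)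
    thus "((F \<circ> real_of_ereal) \<longlongrightarrow> F 1) (at_right (ereal 1))"
      by (simp add: ereal_tendsto_simps)
    show "((F \<circ> real_of_ereal) \<longlongrightarrow> 0) (at_left \<infinity>)"
      using lim by (simp add: ereal_tendsto_simps)
  qed auto
  moreover have "(LBINT t=ereal 1..\<infinity>. f t) = integral {1..} f"
  proof -
    have "(LBINT t=ereal 1..\<infinity>. f t) = (LINT t:{1<..}|lborel. f t)"
      by (simp add: interval_lebesgue_integral_def einterval_def greaterThan_def)
    also have "\<dots> = (LINT t:{1..}|lborel. f t)"
    proof (rule set_integral_cong_set[symmetric])
      show "set_borel_measurable lborel {1..} f" "set_borel_measurable lborel {1<..} f"
        using fm by (auto simp: set_borel_measurable_def)
      show "AE t in (lborel :: real measure). t \<in> {1<..} \<longleftrightarrow> t \<in> {1..}"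
        using AE_lborel_singleton[of "1::real"] by eventually_elim auto
    qed
    also have "\<dots> = integral {1..} f" by (rule set_borel_integral_eq_integral(2)[OF intl])
    finally show ?thesis .
  qed
  moreover have "integral {1..} f = of_real x * integral {1..} (gkern x (z + 1)) - z * integral {1..} (gkern x z)"
    unfolding f_def using gkern_integrable[OF x]
    by (subst integral_diff) (auto intro!: set_lebesgue_integral_eq_integral(1) set_integrable_mult_right)
  moreover have "F 1 = - of_real (exp (- x))" by (simp add: F_def exp_minus field_simps)
  ultimately show ?thesis unfolding upper_part_integral[OF x] by (simp add: algebra_simps)
qed

text \<open>Subtract the recursion of the upper part from Gamma (z + 1) = z Gamma z; the boundary
  term changes its sign.\<close>

lemma lower_part_rec:
  assumes x: "x > 0" and z: "z \<notin> \<int>\<^sub>\<le>\<^sub>0"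
  shows "z * lower_part x z = of_real x * lower_part x (z + 1) + of_real (exp (- x))"
proof -
  have "of_real x * (of_real (1 / x) powr (z + 1) * Gamma (z + 1)) = z * (of_real (1 / x) powr z * Gamma z)"
    using x Gamma_plus1[OF z] by (simp add: powr_add)
  thus ?thesis unfolding lower_part_def using upper_part_rec[OF x, of z] by (simp add: algebra_simps)
qed

text \<open>Integrals over [1, 1 + n] are holomorphic by differentiation under the integral sign. On
  the unit disc around z the tails are dominated by the real exponent Re z + 1, which makes the
  convergence uniform.\<close>

lemma upper_part_holomorphic:
  assumes x: "x > 0"
  shows "upper_part x holomorphic_on UNIV"
proof (rule holomorphic_uniform_sequence)
  define P where "P = (\<lambda>(n::nat) z. integral {1..1 + real n} (gkern x z))"
  show "P n holomorphic_on UNIV" for n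
  proof -
    have "(\<lambda>z. integral (cbox 1 (1 + real n)) (gkern x z)) holomorphic_on UNIV"
    proof (rule leibniz_rule_holomorphic)
      show "((\<lambda>z. gkern x z t) has_field_derivative (of_real (ln t) * gkern x z t)) (at z within UNIV)"
        if "t \<in> cbox 1 (1 + real n)" for z t
      proof -
        have "gkern x z t = exp ((z - 1) * of_real (ln t)) / of_real (exp (x * t))" for z
          using that by (auto simp: gkern_def powr_def Ln_of_real)
        thus ?thesis by (auto intro!: derivative_eq_intros)
      qed
      show "gkern x z integrable_on cbox 1 (1 + real n)" for z
        unfolding gkern_def
        by (intro integrable_continuous continuous_intros) (auto simp: complex_nonpos_Reals_iff)
      show "continuous_on (UNIV \<times> cbox 1 (1 + real n)) (\<lambda>(z, t). of_real (ln t) * gkern x z t)"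
        unfolding gkern_def case_prod_unfold
        by (intro continuous_intros) (auto simp: complex_nonpos_Reals_iff)
    qed auto
    thus ?thesis by (simp add: P_def)
  qed
  fix z :: complex assume "z \<in> UNIV"
  define M where "M = Re z + 1"
  have iM: "gkern x (of_real M) absolutely_integrable_on {1..}" by (rule gkern_integrable[OF x])
  define G where "G = (\<lambda>t. norm (gkern x (of_real M) t))"
  have G: "G integrable_on {1..}" unfolding G_def by (rule gkern_norm_integrable[OF iM])
  have GI: "set_integrable lebesgue {1..} G" unfolding G_def by (rule set_integrable_norm[OF iM])
  have bound: "norm (P n w - upper_part x w) \<le> integral {1..} G - integral {1..1 + real n} G"
    if w: "Re w \<le> M" for n w
  proof -
    have iw: "gkern x w absolutely_integrable_on {1..}" by (rule gkern_integrable[OF x])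
    have iw2: "gkern x w absolutely_integrable_on {1 + real n..}" by (rule set_integrable_subset[OF iw]) auto
    have G2: "G integrable_on {1 + real n..}" "G integrable_on {1..1+real n}"
      using set_integrable_subset[OF GI, of "{1 + real n..}"] set_integrable_subset[OF GI, of "{1..1 + real n}"]
      by (auto intro: set_lebesgue_integral_eq_integral(1))
    have iw3: "gkern x w integrable_on {1..1 + real n}"
      using set_integrable_subset[OF iw, of "{1..1 + real n}"] by (auto intro: set_lebesgue_integral_eq_integral(1))
    have un: "{1..1 + real n} \<union> {1 + real n..} = {1..}" by auto
    have neg: "negligible ({1..1 + real n} \<inter> {1 + real n..})"
    proof -
      have "{1..1 + real n} \<inter> {1 + real n..} = {1 + real n}" by auto
      thus ?thesis by simp
    qed
    have "(gkern x w has_integral (integral {1..1 + real n} (gkern x w) + integral {1 + real n..} (gkern x w))) ({1..1 + real n} \<union> {1 + real n..})"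
      by (intro has_integral_Un neg integrable_integral iw3 set_lebesgue_integral_eq_integral(1)[OF iw2])
    hence e1: "upper_part x w - P n w = integral {1 + real n..} (gkern x w)"
      unfolding un upper_part_integral[OF x] P_def by (simp add: integral_unique)
    have "(G has_integral (integral {1..1 + real n} G + integral {1 + real n..} G)) ({1..1 + real n} \<union> {1 + real n..})"
      by (intro has_integral_Un neg integrable_integral G2)
    hence e2: "integral {1..} G - integral {1..1 + real n} G = integral {1 + real n..} G"
      unfolding un by (simp add: integral_unique)
    have "norm (integral {1 + real n..} (gkern x w)) \<le> integral {1 + real n..} (\<lambda>t. norm (gkern x w t))"
      by (rule norm_integral_le[OF iw2])
    also have "\<dots> \<le> integral {1 + real n..} G"
    proof (rule integral_le)
      fix t assume "t \<in> {1 + real n..}"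
      hence t: "t \<ge> 1" by simp
      have "t powr (Re w - 1) \<le> t powr (M - 1)" using t w by (intro powr_mono) auto
      thus "norm (gkern x w t) \<le> G t" using t by (simp add: norm_gkern G_def)
    qed (use gkern_norm_integrable[OF iw2] G2 in auto)
    finally show ?thesis unfolding e2[symmetric] e1[symmetric] by (simp add: norm_minus_commute)
  qed
  have lim: "(\<lambda>n. integral {1..} G - integral {1..1 + real n} G) \<longlonglongrightarrow> 0"
  proof -
    have "(\<lambda>n. LINT t|lebesgue. indicator {1..1 + real n} t *\<^sub>R G t) \<longlonglongrightarrow> (LINT t|lebesgue. indicator {1..} t *\<^sub>R G t)"
    proof (rule integral_dominated_convergence[where w = "\<lambda>t. indicator {1..} t *\<^sub>R G t"])
      show "integrable lebesgue (\<lambda>t. indicator {1..} t *\<^sub>R G t)" using GI by (simp add: set_integrable_def)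
      thus "(\<lambda>t. indicator {1..} t *\<^sub>R G t) \<in> borel_measurable lebesgue" by simp
      show "(\<lambda>t. indicator {1..1 + real n} t *\<^sub>R G t) \<in> borel_measurable lebesgue" for n
        using set_integrable_subset[OF GI, of "{1..1 + real n}"] by (auto simp: set_integrable_def)
      show "AE t in lebesgue. (\<lambda>n. indicator {1..1 + real n} t *\<^sub>R G t) \<longlonglongrightarrow> indicator {1..} t *\<^sub>R G t"
      proof (rule AE_I2)
        fix t :: real
        have "\<forall>\<^sub>F n in sequentially. n \<ge> nat \<lceil>\<bar>t\<bar>\<rceil>" by (rule eventually_ge_at_top)
        hence "\<forall>\<^sub>F n in sequentially. indicator {1..1 + real n} t *\<^sub>R G t = indicator {1..} t *\<^sub>R G t"
        proof eventually_elim
          case (elim n)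
          have "\<bar>t\<bar> \<le> real (nat \<lceil>\<bar>t\<bar>\<rceil>)" by (rule real_nat_ceiling_ge)
          also have "\<dots> \<le> real n" using elim by (simp only: of_nat_le_iff)
          finally have "t \<le> 1 + real n" by linarith
          thus ?case by (auto simp: indicator_def)
        qed
        thus "(\<lambda>n. indicator {1..1 + real n} t *\<^sub>R G t) \<longlonglongrightarrow> indicator {1..} t *\<^sub>R G t"
          by (rule tendsto_eventually)
      qed
      show "AE t in lebesgue. norm (indicator {1..1 + real n} t *\<^sub>R G t) \<le> indicator {1..} t *\<^sub>R G t" for n
        by (rule AE_I2) (auto simp: indicator_def G_def)
    qed
    moreover have "(LINT t|lebesgue. indicator {1..} t *\<^sub>R G t) = integral {1..} G"
      using set_lebesgue_integral_eq_integral(2)[OF GI] by (simp add: set_lebesgue_integral_def)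
    moreover have "(LINT t|lebesgue. indicator {1..1 + real n} t *\<^sub>R G t) = integral {1..1 + real n} G" for n
    proof -
      have "set_integrable lebesgue {1..1 + real n} G" by (rule set_integrable_subset[OF GI]) auto
      from set_lebesgue_integral_eq_integral(2)[OF this] show ?thesis by (simp add: set_lebesgue_integral_def)
    qed
    ultimately have "(\<lambda>n. integral {1..1 + real n} G) \<longlonglongrightarrow> integral {1..} G" by simp
    from tendsto_diff[OF tendsto_const[of "integral {1..} G"] this] show ?thesis by simp
  qed
  have "uniform_limit (cball z 1) P (upper_part x) sequentially"
    unfolding uniform_limit_iff
  proof safe
    fix e :: real assume "e > 0"
    hence "\<forall>\<^sub>F n in sequentially. integral {1..} G - integral {1..1 + real n} G < e"
      using order_tendstoD(2)[OF lim] by blast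
    thus "\<forall>\<^sub>F n in sequentially. \<forall>w\<in>cball z 1. dist (P n w) (upper_part x w) < e"
    proof eventually_elim
      case (elim n)
      show ?case
      proof
        fix w assume "w \<in> cball z 1"
        hence "norm (w - z) \<le> 1" by (simp add: dist_norm norm_minus_commute)
        hence "Re w \<le> M" using complex_Re_le_cmod[of "w - z"] by (simp add: M_def)
        from bound[OF this, of n] elim show "dist (P n w) (upper_part x w) < e" by (simp add: dist_norm)
      qed
    qed
  qed
  thus "\<exists>d>0. cball z d \<subseteq> UNIV \<and> uniform_limit (cball z d) P (upper_part x) sequentially"
    by (intro exI[of _ 1]) auto
qed auto

section \<open>Series with bounded coefficients, used for the character and for its restriction to
  smooth numbers\<close>

locale coeff_seq =
  fixes q k :: nat and c :: "nat \<Rightarrow> complex"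
  assumes q0: "q > 0" and c0: "c 0 = 0" and c_le: "norm (c n) \<le> 1"
begin

definition xn :: "nat \<Rightarrow> real" where
  "xn n = real n ^ 2 * pi / real q"

lemma xn_pos: "n > 0 \<Longrightarrow> xn n > 0"
  using q0 by (simp add: xn_def)

lemma xn_ge: "n > 0 \<Longrightarrow> xn n \<ge> pi / real q"
proof -
  assume "n > 0"
  hence "1 * pi \<le> real n ^ 2 * pi" by (intro mult_right_mono) auto
  thus ?thesis unfolding xn_def by (intro divide_right_mono) auto
qed

lemma summable_poly_exp:
  assumes "a > 0"
  shows "summable (\<lambda>n. real n ^ m * exp (- (a * xn n)))"
proof (rule summable_comparison_test_bigo)
  show "summable (\<lambda>n. norm (1 / real n ^ 2))"
    using inverse_power_summable[of 2, where ?'a = real] by (simp add: field_simps)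
  define b where "b = a * pi / real q"
  have b: "b > 0" using assms q0 by (simp add: b_def)
  have "(\<lambda>n. real n ^ m * exp (- (b * real n ^ 2))) \<in> O(\<lambda>n. 1 / real n ^ 2)"
    using b by real_asymp
  thus "(\<lambda>n. real n ^ m * exp (- (a * xn n))) \<in> O(\<lambda>n. 1 / real n ^ 2)"
    by (simp add: b_def xn_def mult_ac)
qed

text \<open>The argument of the Gamma factor, with \<open>k\<close> in the role of
  \<kappa>(\<chi>).\<close>

definition zz :: "complex \<Rightarrow> complex" where "zz s = (of_nat k + s) / 2"

definition Eterm :: "complex \<Rightarrow> nat \<Rightarrow> complex" where
  "Eterm s n = c n * of_nat n ^ k * upper_part (xn n) (zz s)"

definition E :: "complex \<Rightarrow> complex" where
  "E s = (\<Sum>n. Eterm s n)"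

lemma norm_coeff_le: "norm (c n * of_nat n ^ k) \<le> real n ^ k"
  unfolding norm_mult norm_power norm_of_nat using c_le[of n] by (simp add: mult_left_le_one_le)

lemma Eterm_bound:
  obtains C where "C \<ge> 0" "\<And>s n. Re s \<le> M \<Longrightarrow> norm (Eterm s n) \<le> C * (real n ^ k * exp (- (1 / 2 * xn n)))"
proof -
  have "pi / real q > 0" using q0 by simp
  from norm_upper_part_le[OF this, of "(real k + M) / 2"] obtain C where C: "C \<ge> 0"
    "\<And>x z. x \<ge> pi / real q \<Longrightarrow> Re z \<le> (real k + M) / 2 \<Longrightarrow> norm (upper_part x z) \<le> C * exp (- x / 2)" by blast
  show ?thesis
  proof (rule that[OF C(1)])
    fix s n assume s: "Re s \<le> M"
    show "norm (Eterm s n) \<le> C * (real n ^ k * exp (- (1 / 2 * xn n)))"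
    proof (cases "n = 0")
      case True thus ?thesis using C(1) by (simp add: Eterm_def c0)
    next
      case False
      have "norm (upper_part (xn n) (zz s)) \<le> C * exp (- xn n / 2)"
        by (rule C(2)) (use False s in \<open>auto simp: xn_ge zz_def\<close>)
      hence "norm (c n * of_nat n ^ k) * norm (upper_part (xn n) (zz s)) \<le> real n ^ k * (C * exp (- xn n / 2))"
        by (intro mult_mono norm_coeff_le) auto
      thus ?thesis unfolding Eterm_def norm_mult by (simp add: mult_ac)
    qed
  qed
qed

lemma Eterm_summable: "summable (\<lambda>n. norm (Eterm s n))"
proof -
  obtain C where C: "C \<ge> 0" "\<And>s' n. Re s' \<le> Re s \<Longrightarrow> norm (Eterm s' n) \<le> C * (real n ^ k * exp (- (1 / 2 * xn n)))"
    using Eterm_bound[of "Re s"] by blast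
  show ?thesis
  proof (rule summable_comparison_test')
    show "summable (\<lambda>n. C * (real n ^ k * exp (- (1 / 2 * xn n))))"
      by (intro summable_mult summable_poly_exp) simp
    show "norm (norm (Eterm s n)) \<le> C * (real n ^ k * exp (- (1 / 2 * xn n)))" for n using C(2)[of s n] by simp
  qed
qed

lemma Eterm_holomorphic: "(\<lambda>s. Eterm s n) holomorphic_on UNIV"
proof (cases "n = 0")
  case False
  have "(\<lambda>s. upper_part (xn n) (zz s)) holomorphic_on UNIV"
    by (rule holomorphic_on_compose_gen[of _ _ "upper_part (xn n)" UNIV, unfolded o_def])
       (use False in \<open>auto simp: zz_def intro!: holomorphic_intros upper_part_holomorphic xn_pos\<close>)
  thus ?thesis unfolding Eterm_def by (intro holomorphic_intros)
qed (simp add: Eterm_def c0)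

lemma E_holomorphic: "E holomorphic_on UNIV"
proof (rule holomorphic_uniform_sequence)
  show "(\<lambda>s. \<Sum>n<N. Eterm s n) holomorphic_on UNIV" for N
    by (intro holomorphic_intros Eterm_holomorphic)
  fix s :: complex assume "s \<in> UNIV"
  obtain C where C: "C \<ge> 0" "\<And>s' n. Re s' \<le> Re s + 1 \<Longrightarrow> norm (Eterm s' n) \<le> C * (real n ^ k * exp (- (1 / 2 * xn n)))"
    using Eterm_bound[of "Re s + 1"] by blast
  have "uniform_limit (cball s 1) (\<lambda>N s. \<Sum>n<N. Eterm s n) (\<lambda>s. \<Sum>n. Eterm s n) sequentially"
  proof (rule Weierstrass_m_test)
    show "summable (\<lambda>n. C * (real n ^ k * exp (- (1 / 2 * xn n))))"
      by (intro summable_mult summable_poly_exp) simp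
    fix n w assume "w \<in> cball s 1"
    hence "norm (w - s) \<le> 1" by (simp add: dist_norm norm_minus_commute)
    hence "Re w \<le> Re s + 1" using complex_Re_le_cmod[of "w - s"] by simp
    thus "norm (Eterm w n) \<le> C * (real n ^ k * exp (- (1 / 2 * xn n)))" by (rule C(2))
  qed
  thus "\<exists>d>0. cball s d \<subseteq> UNIV \<and> uniform_limit (cball s d) (\<lambda>N s. \<Sum>n<N. Eterm s n) E sequentially"
    unfolding E_def by (intro exI[of _ 1]) auto
qed auto

text \<open>The recursion trades \<open>zz s\<close> for \<open>zz s + 1\<close> and gains 1 / |zz
  s| at the price of a factor of size n^2. The exponential decay of the upper parts in n makes this
  price harmless as long as Re s is bounded above.\<close>

lemma E_bound:
  obtains C where "C \<ge> 0" "\<And>s. Re s \<le> M \<Longrightarrow> zz s \<noteq> 0 \<Longrightarrow> norm (E s) \<le> C / norm (zz s)"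
proof -
  have "pi / real q > 0" using q0 by simp
  from norm_upper_part_le[OF this, of "(real k + M) / 2 + 1"] obtain C where C: "C \<ge> 0"
    "\<And>x z. x \<ge> pi / real q \<Longrightarrow> Re z \<le> (real k + M) / 2 + 1 \<Longrightarrow> norm (upper_part x z) \<le> C * exp (- x / 2)" by blast
  define b where "b = (\<lambda>n. C * (pi / real q) * (real n ^ (k + 2) * exp (- (1 / 2 * xn n))) + real n ^ k * exp (- (1 * xn n)))"
  have b: "summable b" unfolding b_def
    by (intro summable_add summable_mult summable_poly_exp) auto
  have bn: "norm (Eterm s n) \<le> b n * (1 / norm (zz s))" if s: "Re s \<le> M" "zz s \<noteq> 0" for s n
  proof (cases "n = 0")
    case True
    thus ?thesis using C by (simp add: Eterm_def c0 b_def)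
  next
    case False
    have "norm (upper_part (xn n) (zz s + 1)) \<le> C * exp (- xn n / 2)"
      by (rule C(2)) (use False s in \<open>auto simp: xn_ge zz_def\<close>)
    hence u: "xn n * norm (upper_part (xn n) (zz s + 1)) \<le> xn n * (C * exp (- xn n / 2))"
      using xn_pos[of n] False by (intro mult_left_mono) auto
    have "zz s * upper_part (xn n) (zz s) = of_real (xn n) * upper_part (xn n) (zz s + 1) - of_real (exp (- xn n))"
      by (rule upper_part_rec) (use False in \<open>simp add: xn_pos\<close>)
    hence "norm (zz s * upper_part (xn n) (zz s)) \<le> norm (of_real (xn n) * upper_part (xn n) (zz s + 1)) + norm (complex_of_real (exp (- xn n)))"
      by (simp only: norm_triangle_ineq4)
    also have "\<dots> \<le> xn n * (C * exp (- xn n / 2)) + exp (- xn n)"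
      using u xn_pos[of n] False by (simp add: norm_mult)
    finally have 1: "norm (zz s) * norm (upper_part (xn n) (zz s)) \<le> xn n * (C * exp (- xn n / 2)) + exp (- xn n)"
      by (simp add: norm_mult)
    have "norm (zz s) * norm (Eterm s n) = norm (c n * of_nat n ^ k) * (norm (zz s) * norm (upper_part (xn n) (zz s)))"
      by (simp add: Eterm_def norm_mult mult_ac)
    also have "\<dots> \<le> real n ^ k * (xn n * (C * exp (- xn n / 2)) + exp (- xn n))"
      by (intro mult_mono norm_coeff_le 1) auto
    also have "\<dots> = b n" by (simp add: b_def xn_def power_add power2_eq_square algebra_simps)
    finally show ?thesis using s by (simp add: field_simps)
  qed
  show ?thesis
  proof (rule that)
    show "suminf b \<ge> 0" by (rule suminf_nonneg[OF b]) (use C in \<open>auto simp: b_def xn_def\<close>)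
    fix s assume s: "Re s \<le> M" "zz s \<noteq> 0"
    have "norm (E s) \<le> (\<Sum>n. norm (Eterm s n))" unfolding E_def by (rule summable_norm[OF Eterm_summable])
    also have "\<dots> \<le> (\<Sum>n. b n * (1 / norm (zz s)))"
      by (rule suminf_le[OF bn[OF s] Eterm_summable summable_mult2[OF b]])
    also have "\<dots> = suminf b * (1 / norm (zz s))" by (rule suminf_mult2[OF b, symmetric])
    finally show "norm (E s) \<le> suminf b / norm (zz s)" by simp
  qed
qed

definition G :: "complex \<Rightarrow> complex" where
  "G s = of_real (real q / pi) powr zz s * Gamma (zz s)"

definition Dterm :: "complex \<Rightarrow> nat \<Rightarrow> complex" where
  "Dterm s n = c n / of_nat n powr s"

lemma norm_nat_powr: "n > 0 \<Longrightarrow> norm (of_nat n powr s :: complex) = real n powr Re s"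
  using norm_powr_real_powr[of "of_nat n" s] by simp

lemma Dterm_summable:
  assumes "Re s > 1"
  shows "summable (\<lambda>n. norm (Dterm s n))"
proof (rule summable_comparison_test')
  show "summable (\<lambda>n. real n powr (- Re s))" using assms by (simp add: summable_real_powr_iff)
  show "norm (norm (Dterm s n)) \<le> real n powr (- Re s)" for n
    using c_le[of n] by (cases "n = 0") (auto simp: Dterm_def c0 norm_divide norm_nat_powr powr_minus divide_simps)
qed

definition Hterm :: "complex \<Rightarrow> nat \<Rightarrow> complex" where
  "Hterm s n = c n * of_nat n ^ k * lower_part (xn n) (zz s)"

text \<open>Since 2 zz s = k + s, the power of n hidden in \<open>xn n\<close> consists of n powr
  (-s) and a part that cancels n ^ k. This matches incomplete Gamma terms with the terms of the
  Dirichlet series.\<close>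

lemma nat_pow_powr:
  assumes n: "n > 0"
  shows "of_nat n ^ k * of_real (1 / xn n) powr zz s = of_real (real q / pi) powr zz s * (1 / of_nat n powr s)"
proof -
  have x: "1 / xn n = (1 / real n) ^ 2 * (real q / pi)" using n by (simp add: xn_def field_simps)
  have "complex_of_real (1 / xn n) powr zz s = of_real ((1 / real n) ^ 2) powr zz s * of_real (real q / pi) powr zz s"
    unfolding x using n q0 by (subst of_real_powr_scale) auto
  also have "complex_of_real ((1 / real n) ^ 2) powr zz s = of_nat n powr (- (2 * zz s))"
  proof -
    have "Ln (complex_of_real ((1 / real n) ^ 2)) = of_real (ln ((1 / real n) ^ 2))"
      using n by (subst Ln_of_real) auto
    also have "ln ((1 / real n) ^ 2) = - (2 * ln (real n))" using n by (simp add: ln_realpow ln_div)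
    also have "complex_of_real (- (2 * ln (real n))) = - 2 * Ln (of_nat n)"
      using n by (simp add: Ln_of_nat)
    finally show ?thesis using n unfolding powr_def by (simp add: mult_ac)
  qed
  also have "(of_nat n :: complex) powr (- (2 * zz s)) = 1 / (of_nat n ^ k * of_nat n powr s)"
  proof -
    have "- (2 * zz s) = - of_nat k - s" by (simp add: zz_def field_simps)
    thus ?thesis using n by (simp add: powr_diff powr_minus powr_nat' divide_simps)
  qed
  finally show ?thesis using n by simp
qed

text \<open>The splitting of Gamma at \<open>xn n\<close>. It holds even at the poles of Gamma,
  since the default value there occurs on both sides.\<close>

lemma split_term: "G s * Dterm s n = Eterm s n + Hterm s n"
proof (cases "n = 0")
  case False
  have "Eterm s n + Hterm s n = c n * (of_nat n ^ k * of_real (1 / xn n) powr zz s) * Gamma (zz s)"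
    by (simp add: Eterm_def Hterm_def lower_part_def algebra_simps)
  also have "\<dots> = G s * Dterm s n"
    using nat_pow_powr[of n s] False by (simp add: G_def Dterm_def)
  finally show ?thesis ..
qed (simp add: Eterm_def Hterm_def Dterm_def c0)

lemma Hterm_sums:
  assumes "Re s > 1"
  shows "(\<lambda>n. Hterm s n) sums (G s * suminf (Dterm s) - E s)"
proof -
  have "(\<lambda>n. G s * Dterm s n - Eterm s n) sums (G s * suminf (Dterm s) - E s)"
    unfolding E_def
    by (intro sums_diff sums_mult summable_sums summable_norm_cancel[OF Eterm_summable] summable_norm_cancel[OF Dterm_summable[OF assms]])
  thus ?thesis by (simp add: split_term)
qed

text \<open>The counterpart of \<open>E_bound\<close> for Re s >= 2. One step of the recursion for
  the lower parts gains 1 / |zz s| and costs a factor \<open>xn n\<close> of size n^2. This is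
  affordable: Re (zz s + 1) is at least a = k / 2 + 2, and n ^ k times \<open>xn n\<close> times the
  power -a of \<open>xn n\<close> has size n^(-2).\<close>

lemma H_bound:
  obtains C where "C \<ge> 0" "\<And>s. Re s \<ge> 2 \<Longrightarrow> norm (G s * suminf (Dterm s) - E s) \<le> C / norm (zz s)"
proof -
  define a where "a = real k / 2 + 2"
  have a: "a > 0" by (simp add: a_def)
  define K where "K = (pi / real q) * (real q / pi) powr a * Gamma a"
  have K: "K \<ge> 0" using a by (simp add: K_def Gamma_real_nonneg)
  define b where "b = (\<lambda>n. K * (1 / real n ^ 2) + real n ^ k * exp (- (1 * xn n)))"
  have b: "summable b" unfolding b_def
    using inverse_power_summable[of 2, where ?'a = real]
    by (intro summable_add summable_mult summable_poly_exp) (auto simp: field_simps)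
  have bn: "norm (Hterm s n) \<le> b n * (1 / norm (zz s))" if s: "Re s \<ge> 2" for s n
  proof (cases "n = 0")
    case True
    thus ?thesis using K by (simp add: Hterm_def c0 b_def)
  next
    case False
    hence n: "n > 0" by simp
    have re: "Re (zz s) > 0" using s by (simp add: zz_def)
    hence z: "zz s \<notin> \<int>\<^sub>\<le>\<^sub>0" "zz s \<noteq> 0" by (auto elim!: nonpos_Ints_cases)
    have "norm (lower_part (xn n) (zz s + 1)) \<le> (1 / xn n) powr a * Gamma a"
      by (rule norm_lower_part_le) (use n s a in \<open>auto simp: xn_pos zz_def a_def\<close>)
    hence u: "xn n * norm (lower_part (xn n) (zz s + 1)) \<le> xn n * ((1 / xn n) powr a * Gamma a)"
      using xn_pos[of n] n by (intro mult_left_mono) auto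
    have "zz s * lower_part (xn n) (zz s) = of_real (xn n) * lower_part (xn n) (zz s + 1) + of_real (exp (- xn n))"
      by (rule lower_part_rec) (use n z in \<open>auto simp: xn_pos\<close>)
    hence "norm (zz s * lower_part (xn n) (zz s)) \<le> norm (of_real (xn n) * lower_part (xn n) (zz s + 1)) + norm (complex_of_real (exp (- xn n)))"
      by (simp only: norm_triangle_ineq)
    also have "\<dots> \<le> xn n * ((1 / xn n) powr a * Gamma a) + exp (- xn n)"
      using u xn_pos[of n] n by (simp add: norm_mult)
    finally have 1: "norm (zz s) * norm (lower_part (xn n) (zz s)) \<le> xn n * ((1 / xn n) powr a * Gamma a) + exp (- xn n)"
      by (simp add: norm_mult)
    have "norm (zz s) * norm (Hterm s n) = norm (c n * of_nat n ^ k) * (norm (zz s) * norm (lower_part (xn n) (zz s)))"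
      by (simp add: Hterm_def norm_mult mult_ac)
    also have "\<dots> \<le> real n ^ k * (xn n * ((1 / xn n) powr a * Gamma a) + exp (- xn n))"
      by (intro mult_mono norm_coeff_le 1) auto
    also have "\<dots> = b n"
    proof -
      have e1: "(1 / xn n) powr a = (real q / pi) powr a * real n powr (- (2 * a))"
      proof -
        have "1 / xn n = (real q / pi) * (real n powr (-2))" using n by (simp add: xn_def powr_minus field_simps)
        hence "(1 / xn n) powr a = (real q / pi) powr a * (real n powr (-2)) powr a"
          using n q0 by (simp only: powr_mult)
        thus ?thesis by (simp add: powr_powr)
      qed
      have e2: "real n powr (- (2 * a)) = 1 / (real n ^ k * real n ^ 4)"
      proof -
        have "- (2 * a) = - real (k + 4)" by (simp add: a_def)
        hence "real n powr (- (2 * a)) = 1 / real n powr real (k + 4)" by (simp only: powr_minus_divide)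
        also have "real n powr real (k + 4) = real n ^ (k + 4)" using n by (subst powr_realpow) auto
        finally show ?thesis by (simp add: power_add)
      qed
      have "real n ^ k * (xn n * ((1 / xn n) powr a * Gamma a)) = K * (1 / real n ^ 2)"
        unfolding e1 e2 using n by (simp add: K_def xn_def field_simps power2_eq_square numeral_eq_Suc)
      thus ?thesis by (simp add: b_def distrib_left)
    qed
    finally show ?thesis using z by (simp add: field_simps)
  qed
  show ?thesis
  proof (rule that)
    show "suminf b \<ge> 0" by (rule suminf_nonneg[OF b]) (use K in \<open>auto simp: b_def\<close>)
    fix s assume s: "Re s \<ge> 2"
    have summ: "summable (\<lambda>n. norm (Hterm s n))"
      by (rule summable_comparison_test'[OF summable_mult2[OF b, of "1 / norm (zz s)"]]) (use bn[OF s] in auto)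
    have "G s * suminf (Dterm s) - E s = suminf (Hterm s)"
      using Hterm_sums[of s] s by (simp add: sums_iff)
    also have "norm \<dots> \<le> (\<Sum>n. norm (Hterm s n))" by (rule summable_norm[OF summ])
    also have "\<dots> \<le> (\<Sum>n. b n * (1 / norm (zz s)))"
      by (rule suminf_le[OF bn[OF s] summ summable_mult2[OF b]])
    also have "\<dots> = suminf b * (1 / norm (zz s))" by (rule suminf_mult2[OF b, symmetric])
    finally show "norm (G s * suminf (Dterm s) - E s) \<le> suminf b / norm (zz s)" by simp
  qed
qed

definition theta_sum :: "real \<Rightarrow> complex" where
  "theta_sum t = (\<Sum>n. c n * of_nat n ^ k * of_real (exp (- (xn n * t))))"

lemma theta_sum_summable:
  assumes "t > 0"
  shows "summable (\<lambda>n. norm (c n * of_nat n ^ k * of_real (exp (- (xn n * t)))))"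
proof (rule summable_comparison_test')
  show "summable (\<lambda>n. real n ^ k * exp (- (t * xn n)))" by (rule summable_poly_exp[OF assms])
  show "norm (norm (c n * of_nat n ^ k * of_real (exp (- (xn n * t))))) \<le> real n ^ k * exp (- (t * xn n))" for n
    using mult_right_mono[OF norm_coeff_le[of n], of "exp (- (t * xn n))"] by (simp add: norm_mult mult_ac)
qed

text \<open>Exchange of sum and integral in one form for the ranges (0, 1) and [1, \<infinity>);
  summability of the integrals of the norms is the condition.\<close>

lemma mellin_sum:
  assumes S: "S \<in> sets lebesgue" "S \<subseteq> {0<..}"
    and int: "\<And>n. n > 0 \<Longrightarrow> gkern (xn n) z absolutely_integrable_on S"
    and summ: "summable (\<lambda>n. real n ^ k * integral S (\<lambda>t. norm (gkern (xn n) z t)))"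
  shows "(\<lambda>n. c n * of_nat n ^ k * integral S (gkern (xn n) z)) sums integral S (\<lambda>t. theta_sum t * of_real t powr (z - 1))"
    and "(\<lambda>t. theta_sum t * of_real t powr (z - 1)) absolutely_integrable_on S"
proof -
  define f where "f = (\<lambda>n t. indicator S t *\<^sub>R (c n * of_nat n ^ k * gkern (xn n) z t))"
  have fi: "integrable lebesgue (f n)" for n
  proof (cases "n = 0")
    case True
    hence "f n = (\<lambda>t. 0)" by (auto simp: f_def c0)
    thus ?thesis by simp
  next
    case False
    have "(\<lambda>t. c n * of_nat n ^ k * gkern (xn n) z t) absolutely_integrable_on S"
      by (intro set_integrable_mult_right int) (use False in auto)
    thus ?thesis by (simp add: f_def set_integrable_def)
  qed
  have sumt: "(\<lambda>n. c n * of_nat n ^ k * gkern (xn n) z t) sums (theta_sum t * of_real t powr (z - 1))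
      \<and> summable (\<lambda>n. norm (c n * of_nat n ^ k * gkern (xn n) z t))" if "t \<in> S" for t
  proof -
    have t: "t > 0" using that S by auto
    have e: "c n * of_nat n ^ k * gkern (xn n) z t = c n * of_nat n ^ k * of_real (exp (- (xn n * t))) * of_real t powr (z - 1)" for n
      by (simp add: gkern_def exp_minus field_simps)
    show ?thesis unfolding e theta_sum_def
      using summable_mult2[OF theta_sum_summable[OF t], of "norm (complex_of_real t powr (z - 1))"]
      by (intro conjI sums_mult2 summable_sums summable_norm_cancel[OF theta_sum_summable[OF t]]) (simp add: norm_mult)
  qed
  have 2: "AE t in lebesgue. summable (\<lambda>n. norm (f n t))"
  proof (rule AE_I2)
    fix t show "summable (\<lambda>n. norm (f n t))" using sumt[of t] by (cases "t \<in> S") (auto simp: f_def)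
  qed
  have fint: "(LINT t|lebesgue. f n t) = c n * of_nat n ^ k * integral S (gkern (xn n) z)" for n
  proof (cases "n = 0")
    case True
    thus ?thesis by (simp add: f_def c0)
  next
    case False
    have "(LINT t|lebesgue. f n t) = (LINT t:S|lebesgue. c n * of_nat n ^ k * gkern (xn n) z t)"
      unfolding f_def set_lebesgue_integral_def ..
    also have "\<dots> = c n * of_nat n ^ k * (LINT t:S|lebesgue. gkern (xn n) z t)"
      by (rule set_integral_mult_right)
    also have "(LINT t:S|lebesgue. gkern (xn n) z t) = integral S (gkern (xn n) z)"
      by (rule set_lebesgue_integral_eq_integral(2)[OF int]) (use False in auto)
    finally show ?thesis .
  qed
  have 3: "summable (\<lambda>n. (LINT t|lebesgue. norm (f n t)))"
  proof (rule summable_comparison_test'[OF summ])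
    fix n
    show "norm (LINT t|lebesgue. norm (f n t)) \<le> real n ^ k * integral S (\<lambda>t. norm (gkern (xn n) z t))"
    proof (cases "n = 0")
      case True
      have "integral S (\<lambda>t. norm (gkern (xn n) z t)) \<ge> 0"
        by (cases "(\<lambda>t. norm (gkern (xn n) z t)) integrable_on S") (auto intro: integral_nonneg simp: not_integrable_integral)
      thus ?thesis by (simp add: f_def c0 True)
    next
      case False
      have "(LINT t|lebesgue. norm (f n t)) = (LINT t:S|lebesgue. norm (c n * of_nat n ^ k) * norm (gkern (xn n) z t))"
        unfolding set_lebesgue_integral_def
        by (rule Bochner_Integration.integral_cong) (auto simp: f_def norm_mult indicator_def)
      also have "\<dots> = norm (c n * of_nat n ^ k) * (LINT t:S|lebesgue. norm (gkern (xn n) z t))"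
        by (rule set_integral_mult_right)
      also have "(LINT t:S|lebesgue. norm (gkern (xn n) z t)) = integral S (\<lambda>t. norm (gkern (xn n) z t))"
        by (rule set_lebesgue_integral_eq_integral(2)[OF set_integrable_norm[OF int]]) (use False in auto)
      finally have e: "(LINT t|lebesgue. norm (f n t)) = norm (c n * of_nat n ^ k) * integral S (\<lambda>t. norm (gkern (xn n) z t))" .
      have nn: "integral S (\<lambda>t. norm (gkern (xn n) z t)) \<ge> 0"
        by (rule integral_nonneg[OF gkern_norm_integrable[OF int]]) (use False in auto)
      show ?thesis unfolding e using nn mult_right_mono[OF norm_coeff_le nn, of n] by simp
    qed
  qed
  have lim: "(\<Sum>n. f n t) = indicator S t *\<^sub>R (theta_sum t * of_real t powr (z - 1))" for t
    using sumt[of t] by (cases "t \<in> S") (auto simp: f_def sums_iff)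
  have i: "integrable lebesgue (\<lambda>t. indicator S t *\<^sub>R (theta_sum t * of_real t powr (z - 1)))"
    using integrable_suminf[OF fi 2 3] unfolding lim .
  thus ai: "(\<lambda>t. theta_sum t * of_real t powr (z - 1)) absolutely_integrable_on S"
    by (simp add: set_integrable_def)
  have "(\<lambda>n. LINT t|lebesgue. f n t) sums (LINT t|lebesgue. (\<Sum>n. f n t))"
    by (rule sums_integral[OF fi 2 3])
  thus "(\<lambda>n. c n * of_nat n ^ k * integral S (gkern (xn n) z)) sums integral S (\<lambda>t. theta_sum t * of_real t powr (z - 1))"
    unfolding fint lim using set_lebesgue_integral_eq_integral(2)[OF ai] by (simp add: set_lebesgue_integral_def)
qed

lemma E_mellin:
  "E s = integral {1..} (\<lambda>t. theta_sum t * of_real t powr (zz s - 1))"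
  "(\<lambda>t. theta_sum t * of_real t powr (zz s - 1)) absolutely_integrable_on {1..}"
proof -
  have "pi / real q > 0" using q0 by simp
  from norm_upper_part_le[OF this, of "Re (zz s)"] obtain C where C: "C \<ge> 0"
    "\<And>x z. x \<ge> pi / real q \<Longrightarrow> Re z \<le> Re (zz s) \<Longrightarrow> integral {1..} (\<lambda>t. norm (gkern x z t)) \<le> C * exp (- x / 2)" by blast
  have summ: "summable (\<lambda>n. real n ^ k * integral {1..} (\<lambda>t. norm (gkern (xn n) (zz s) t)))"
  proof (rule summable_comparison_test'[of _ 1])
    show "summable (\<lambda>n. C * (real n ^ k * exp (- (1 / 2 * xn n))))"
      by (intro summable_mult summable_poly_exp) simp
    fix n :: nat assume n: "n \<ge> 1"
    have "integral {1..} (\<lambda>t. norm (gkern (xn n) (zz s) t)) \<ge> 0"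
      by (rule integral_nonneg[OF gkern_norm_integrable[OF gkern_integrable]]) (use n xn_pos in auto)
    moreover have "integral {1..} (\<lambda>t. norm (gkern (xn n) (zz s) t)) \<le> C * exp (- xn n / 2)"
      by (rule C(2)) (use n xn_ge in auto)
    ultimately show "norm (real n ^ k * integral {1..} (\<lambda>t. norm (gkern (xn n) (zz s) t))) \<le> C * (real n ^ k * exp (- (1 / 2 * xn n)))"
      using mult_left_mono[of "integral {1..} (\<lambda>t. norm (gkern (xn n) (zz s) t))" "C * exp (- xn n / 2)" "real n ^ k"] by (simp add: mult_ac)
  qed
  have "(\<lambda>n. c n * of_nat n ^ k * integral {1..} (gkern (xn n) (zz s))) sums integral {1..} (\<lambda>t. theta_sum t * of_real t powr (zz s - 1))"
    by (rule mellin_sum(1)[OF _ _ _ summ]) (auto intro!: gkern_integrable xn_pos)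
  moreover have "c n * of_nat n ^ k * integral {1..} (gkern (xn n) (zz s)) = Eterm s n" for n
    using upper_part_integral[of "xn n"] xn_pos[of n] by (cases "n = 0") (auto simp: c0 Eterm_def)
  ultimately show "E s = integral {1..} (\<lambda>t. theta_sum t * of_real t powr (zz s - 1))"
    unfolding E_def by (simp add: sums_iff)
  show "(\<lambda>t. theta_sum t * of_real t powr (zz s - 1)) absolutely_integrable_on {1..}"
    by (rule mellin_sum(2)[OF _ _ _ summ]) (auto intro!: gkern_integrable xn_pos)
qed

text \<open>The bound for the n-th integral times n ^ k is a constant times n powr (- Re s), so the
  exchange rests on the same absolute convergence as the Dirichlet series.\<close>

lemma H_mellin:
  assumes s: "Re s > 1"
  shows "G s * suminf (Dterm s) - E s = integral {0<..<1} (\<lambda>t. theta_sum t * of_real t powr (zz s - 1))"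
    and "(\<lambda>t. theta_sum t * of_real t powr (zz s - 1)) absolutely_integrable_on {0<..<1}"
proof -
  define a where "a = Re (zz s)"
  have a: "a > 0" "2 * a = real k + Re s" using s by (auto simp: a_def zz_def)
  have rez: "Re (zz s) > 0" using a by (simp add: a_def)
  have bd: "integral {0<..<1} (\<lambda>t. norm (gkern (xn n) (zz s) t)) \<le> (1 / xn n) powr a * Gamma a" if "n > 0" for n
    by (rule norm_lower_part_le(1)) (use a that xn_pos in \<open>auto simp: a_def\<close>)
  have summ: "summable (\<lambda>n. real n ^ k * integral {0<..<1} (\<lambda>t. norm (gkern (xn n) (zz s) t)))"
  proof (rule summable_comparison_test'[of _ 1])
    show "summable (\<lambda>n. ((real q / pi) powr a * Gamma a) * real n powr (- Re s))"
      using s by (intro summable_mult) (simp add: summable_real_powr_iff)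
    fix n :: nat assume n: "n \<ge> 1"
    have "integral {0<..<1} (\<lambda>t. norm (gkern (xn n) (zz s) t)) \<ge> 0"
      by (rule integral_nonneg[OF gkern_norm_integrable[OF lower_part_integral(1)]]) (use n xn_pos rez in auto)
    hence "norm (real n ^ k * integral {0<..<1} (\<lambda>t. norm (gkern (xn n) (zz s) t))) \<le> real n ^ k * ((1 / xn n) powr a * Gamma a)"
      using bd[of n] n by (auto intro!: mult_left_mono)
    also have "\<dots> = ((real q / pi) powr a * Gamma a) * real n powr (- Re s)"
    proof -
      have "1 / xn n = (real q / pi) * (real n powr (-2))" using n by (simp add: xn_def powr_minus field_simps)
      hence "(1 / xn n) powr a = (real q / pi) powr a * (real n powr (-2)) powr a"
        using n q0 by (simp only: powr_mult)
      also have "(real n powr (-2)) powr a = real n powr (- real k - Re s)"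
        unfolding powr_powr using a(2) by simp
      also have "\<dots> = real n powr (- Re s) / real n ^ k"
        using n by (simp add: powr_diff powr_minus powr_realpow field_simps)
      finally show ?thesis using n by simp
    qed
    finally show "norm (real n ^ k * integral {0<..<1} (\<lambda>t. norm (gkern (xn n) (zz s) t))) \<le> ((real q / pi) powr a * Gamma a) * real n powr (- Re s)" .
  qed
  have "(\<lambda>n. c n * of_nat n ^ k * integral {0<..<1} (gkern (xn n) (zz s))) sums integral {0<..<1} (\<lambda>t. theta_sum t * of_real t powr (zz s - 1))"
    by (rule mellin_sum(1)[OF _ _ _ summ]) (use rez in \<open>auto intro!: lower_part_integral(1) xn_pos\<close>)
  moreover have "c n * of_nat n ^ k * integral {0<..<1} (gkern (xn n) (zz s)) = Hterm s n" for n
    using lower_part_integral(2)[of "xn n" "zz s"] xn_pos[of n] rez by (cases "n = 0") (auto simp: c0 Hterm_def)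
  ultimately show "G s * suminf (Dterm s) - E s = integral {0<..<1} (\<lambda>t. theta_sum t * of_real t powr (zz s - 1))"
    using Hterm_sums[OF s] by (simp add: sums_iff)
  show "(\<lambda>t. theta_sum t * of_real t powr (zz s - 1)) absolutely_integrable_on {0<..<1}"
    by (rule mellin_sum(2)[OF _ _ _ summ]) (use rez in \<open>auto intro!: lower_part_integral(1) xn_pos\<close>)
qed

end

section \<open>The completed L-function\<close>

lemma eventually_notin_locally_finite:
  fixes Z :: "complex set"
  assumes "\<And>R. finite (Z \<inter> cball 0 R)"
  shows "\<forall>\<^sub>F w in at s. w \<notin> Z"
proof -
  have "\<not> s islimpt (Z \<inter> cball 0 (norm s + 1))" by (rule islimpt_finite) (rule assms)
  hence "\<forall>\<^sub>F w in at s. w \<notin> Z \<inter> cball 0 (norm s + 1)" by (simp add: islimpt_iff_eventually)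
  moreover have "\<forall>\<^sub>F w in at s. w \<in> ball s 1" by (rule eventually_at_in_open') auto
  ultimately show ?thesis
  proof eventually_elim
    case (elim w)
    have "norm w \<le> norm s + norm (w - s)" by (metis add.commute diff_add_cancel norm_triangle_ineq)
    moreover have "norm (w - s) < 1" using elim by (simp add: dist_norm norm_minus_commute)
    ultimately show ?case using elim by auto
  qed
qed

lemma finite_nonpos_Ints_cball: "finite (\<int>\<^sub>\<le>\<^sub>0 \<inter> cball (0::complex) R)"
proof (rule finite_subset)
  show "\<int>\<^sub>\<le>\<^sub>0 \<inter> cball (0::complex) R \<subseteq> (\<lambda>n. - of_nat n) ` {..nat \<lceil>R\<rceil>}"
  proof
    fix z :: complex assume z: "z \<in> \<int>\<^sub>\<le>\<^sub>0 \<inter> cball 0 R"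
    then obtain n where n: "z = - of_nat n" by (auto elim!: nonpos_Ints_cases')
    hence "real n \<le> R" using z by simp
    hence "n \<le> nat \<lceil>R\<rceil>" by linarith
    thus "z \<in> (\<lambda>n. - of_nat n) ` {..nat \<lceil>R\<rceil>}" using n by auto
  qed
qed auto

context char_mod
begin

lemma coeff_chi: "coeff_seq q chi"
  by standard (simp_all add: norm_chi_le)

sublocale A: coeff_seq q "kappa q chi" chi
  by (rule coeff_chi)

lemma theta_eq_theta_sum: "theta t = A.theta_sum t" if "t > 0"
proof -
  have "((\<lambda>n. chi n * of_nat n ^ kappa q chi * of_real (exp (- (A.xn n * t)))) has_sum A.theta_sum t) UNIV"
    unfolding A.theta_sum_def by (rule norm_summable_imp_has_sum[OF A.theta_sum_summable[OF that] summable_sums[OF summable_norm_cancel[OF A.theta_sum_summable[OF that]]]])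
  hence "((\<lambda>n. chi n * of_nat n ^ kappa q chi * of_real (exp (- (A.xn n * t)))) has_sum A.theta_sum t) {0<..}"
    by (subst (asm) has_sum_cong_neutral[where T = "{0<..}" and g = "\<lambda>n. chi n * of_nat n ^ kappa q chi * of_real (exp (- (A.xn n * t)))"]) auto
  moreover have "- pi * real n ^ 2 * t / real q = - (A.xn n * t)" for n by (simp add: A.xn_def)
  ultimately show ?thesis unfolding theta_def by (simp add: infsumI)
qed

text \<open>Riemann's argument: the upper parts add up to a Mellin integral of theta over [1,
  \<infinity>), the lower parts to one over (0, 1). Inversion of t together with the theta
  transformation turns the latter into the integral for the conjugate character at 1 - s. The
  right-hand side is entire and will supply the continuation beyond Re s > 1.\<close>

lemma functional_equation:
  assumes s: "Re s > 1"
  shows "A.G s * suminf (A.Dterm s) =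
     A.E s + root_number q chi * coeff_seq.E q (kappa q chi) (\<lambda>n. cnj (chi n)) (1 - s)"
proof -
  interpret C: char_mod q "\<lambda>n. cnj (chi n)" by (rule char_mod_cnj)
  interpret B: coeff_seq q "kappa q chi" "\<lambda>n. cnj (chi n)"
    using C.coeff_chi by (simp add: kappa_cnj)
  define k where "k = kappa q chi"
  define f where "f = (\<lambda>t::real. A.theta_sum t * of_real t powr (A.zz s - 1))"
  have img: "inverse ` {1<..} = {0<..<(1::real)}"
  proof safe
    fix t :: real assume "t \<in> {0<..<1}"
    thus "t \<in> inverse ` {1<..}" by (intro image_eqI[of _ _ "inverse t"]) (auto simp: one_less_inverse_iff)
  qed (auto simp: inverse_less_1_iff)
  have h: "(\<lambda>t. \<bar>- (inverse t ^ 2)\<bar> *\<^sub>R f (inverse t)) absolutely_integrable_on {1<..} \<and>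
      integral {1<..} (\<lambda>t. \<bar>- (inverse t ^ 2)\<bar> *\<^sub>R f (inverse t)) = integral {0<..<1} f"
  proof (subst has_absolute_integral_change_of_variables_real)
    show "(inverse has_field_derivative - (inverse x ^ 2)) (at x within {1<..})" if "x \<in> {1<..}" for x :: real
      using that by (auto intro!: derivative_eq_intros simp: power2_eq_square)
    show "inj_on inverse {(1::real)<..}" by (auto intro: inj_onI)
    show "f absolutely_integrable_on inverse ` {1<..} \<and> integral (inverse ` {1<..}) f = integral {0<..<1} f"
      unfolding img f_def using A.H_mellin(2)[OF s] by simp
  qed auto
  \<comment> \<open>Exponent count: the Jacobian gives -2, the transformation of theta 1/2 +
    \<kappa>, and the power of the inverse of t the negative of \<open>A.zz s - 1\<close>; their sum
    is \<open>B.zz (1 - s) - 1\<close>.\<close>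
  have e: "\<bar>- (inverse t ^ 2)\<bar> *\<^sub>R f (inverse t) = root_number q chi * (B.theta_sum t * of_real t powr (B.zz (1 - s) - 1))"
    if t: "t \<in> {1<..}" for t :: real
  proof -
    have t0: "t > 0" using t by auto
    have th: "A.theta_sum (inverse t) = root_number q chi * of_real (sqrt t * t ^ k) * B.theta_sum t"
    proof -
      have "A.theta_sum (inverse t) = theta (inverse t)" using t0 by (simp add: theta_eq_theta_sum)
      also have "\<dots> = root_number q chi * of_real (1 / (sqrt (inverse t) * inverse t ^ k)) * C.theta (1 / inverse t)"
        unfolding k_def by (rule theta_transformation) (use t0 in auto)
      also have "C.theta (1 / inverse t) = B.theta_sum t"
      proof -
        have "1 / inverse t = t" by (simp add: divide_inverse)
        thus ?thesis using C.theta_eq_theta_sum[of t] t0 by (simp only: kappa_cnj)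
      qed
      also have "1 / (sqrt (inverse t) * inverse t ^ k) = sqrt t * t ^ k"
        unfolding real_sqrt_inverse by (simp add: power_inverse divide_inverse)
      finally show ?thesis .
    qed
    have L: "Ln (complex_of_real t) = of_real (ln t)" using t0 by (rule Ln_of_real)
    have Li: "Ln (complex_of_real (inverse t)) = - of_real (ln t)" using t0 by (simp add: Ln_of_real ln_inverse flip: of_real_inverse)
    have p1: "complex_of_real (inverse t) powr (A.zz s - 1) = exp ((A.zz s - 1) * - of_real (ln t))"
      unfolding powr_def Li using t0 by simp
    have p2: "complex_of_real t powr (B.zz (1 - s) - 1) = exp ((B.zz (1 - s) - 1) * of_real (ln t))"
      unfolding powr_def L using t0 by simp
    have p3: "complex_of_real (sqrt t * t ^ k) = exp (of_real (ln t) * (1/2 + of_nat k))"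
    proof -
      have "sqrt t * t ^ k = exp (ln t * (1/2)) * exp (ln t * real k)"
        using t0 powr_half_sqrt[of t] powr_realpow[of t k] by (simp add: powr_def mult_ac)
      also have "\<dots> = exp (ln t * (1/2 + real k))" by (simp add: distrib_left exp_add)
      finally show ?thesis by (simp flip: exp_of_real)
    qed
    have p4: "complex_of_real \<bar>- (inverse t ^ 2)\<bar> = exp (- 2 * of_real (ln t))"
    proof -
      have "inverse t ^ 2 = exp (- 2 * ln t)" using t0 by (simp add: exp_minus exp_double power_inverse)
      thus ?thesis by (simp flip: exp_of_real)
    qed
    have "\<bar>- (inverse t ^ 2)\<bar> *\<^sub>R f (inverse t) = root_number q chi * B.theta_sum t *
        (exp (- 2 * of_real (ln t)) * exp (of_real (ln t) * (1/2 + of_nat k)) * exp ((A.zz s - 1) * - of_real (ln t)))"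
      unfolding f_def th scaleR_conv_of_real p4 p1 p3 by (simp only: mult_ac)
    also have "exp (- 2 * of_real (ln t)) * exp (of_real (ln t) * (1/2 + of_nat k)) * exp ((A.zz s - 1) * - of_real (ln t))
       = exp ((B.zz (1 - s) - 1) * complex_of_real (ln t))"
    proof -
      have "- 2 * l + l * (1/2 + of_nat k) + (A.zz s - 1) * - l = (B.zz (1 - s) - 1) * l" for l
        by (simp add: A.zz_def B.zz_def k_def field_simps)
      thus ?thesis by (simp only: exp_add[symmetric])
    qed
    finally show ?thesis unfolding p2 by (simp only: mult_ac)
  qed
  have "A.G s * suminf (A.Dterm s) - A.E s = integral {1<..} (\<lambda>t. \<bar>- (inverse t ^ 2)\<bar> *\<^sub>R f (inverse t))"
    using h A.H_mellin(1)[OF s] by (simp add: f_def)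
  also have "\<dots> = integral {1<..} (\<lambda>t. root_number q chi * (B.theta_sum t * of_real t powr (B.zz (1 - s) - 1)))"
    by (rule integral_cong) (rule e)
  also have "\<dots> = root_number q chi * integral {1<..} (\<lambda>t. B.theta_sum t * of_real t powr (B.zz (1 - s) - 1))"
    by simp
  also have "integral {1<..} (\<lambda>t. B.theta_sum t * of_real t powr (B.zz (1 - s) - 1)) = integral {1..} (\<lambda>t. B.theta_sum t * of_real t powr (B.zz (1 - s) - 1))"
    by (rule integral_subset_negligible) (auto intro: negligible_subset[of "{1}"])
  also have "\<dots> = B.E (1 - s)" by (rule B.E_mellin(1)[symmetric])
  finally show ?thesis by (simp add: algebra_simps)
qed

definition xi_entire :: "complex \<Rightarrow> complex" where
  "xi_entire s = A.E s + root_number q chi * coeff_seq.E q (kappa q chi) (\<lambda>n. cnj (chi n)) (1 - s)"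

lemma coeff_cnj: "coeff_seq q (\<lambda>n. cnj (chi n))"
  by standard (simp_all add: norm_chi_le)

lemma xi_entire_holomorphic: "xi_entire holomorphic_on UNIV"
proof -
  interpret B: coeff_seq q "kappa q chi" "\<lambda>n. cnj (chi n)" by (rule coeff_cnj)
  have "(\<lambda>s. B.E (1 - s)) holomorphic_on UNIV"
    by (rule holomorphic_on_compose_gen[of _ _ B.E UNIV, unfolded o_def])
       (auto intro!: holomorphic_intros B.E_holomorphic)
  thus ?thesis unfolding xi_entire_def
    by (intro holomorphic_intros A.E_holomorphic)
qed

lemma gfac_eq: "gfac q chi s = A.G s"
  by (simp add: gfac_def A.G_def A.zz_def add.commute)

text \<open>The Gamma factor is divided out through the entire function \<open>rGamma\<close>, so
  that no singularities arise.\<close>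

definition L_entire :: "complex \<Rightarrow> complex" where
  "L_entire s = xi_entire s * rGamma (A.zz s) * of_real (real q / pi) powr (- A.zz s)"

text \<open>\<open>dirichlet_L\<close> is a definite description: the candidate has to satisfy both
  of its conditions, and uniqueness is the identity theorem, starting from the half-plane of
  convergence.\<close>

lemma dirichlet_L_eq: "dirichlet_L chi = L_entire"
  unfolding dirichlet_L_def
proof (rule the_equality)
  have qpi: "complex_of_real (real q / pi) \<noteq> 0" by simp
  have Lh: "L_entire holomorphic_on UNIV"
    unfolding L_entire_def A.zz_def by (auto intro!: holomorphic_intros xi_entire_holomorphic)
  have sums: "(\<lambda>n. chi (Suc n) / of_nat (Suc n) powr s) sums L_entire s" if s: "1 < Re s" for s
  proof -
    have "A.zz s \<notin> \<int>\<^sub>\<le>\<^sub>0"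
    proof
      assume "A.zz s \<in> \<int>\<^sub>\<le>\<^sub>0"
      hence "Re (A.zz s) \<le> 0" by (auto elim!: nonpos_Ints_cases)
      thus False using s by (simp add: A.zz_def)
    qed
    hence "Gamma (A.zz s) * rGamma (A.zz s) = 1" by (simp add: rGamma_inverse_Gamma Gamma_eq_zero_iff)
    moreover have "of_real (real q / pi) powr A.zz s * of_real (real q / pi) powr (- A.zz s) = (1::complex)"
      using qpi by (simp add: powr_minus del: of_real_divide)
    ultimately have "A.G s * rGamma (A.zz s) * of_real (real q / pi) powr (- A.zz s) = 1"
      unfolding A.G_def by (metis mult.assoc mult.commute mult.right_neutral)
    moreover have "L_entire s = (A.G s * rGamma (A.zz s) * of_real (real q / pi) powr (- A.zz s)) * suminf (A.Dterm s)"
      unfolding L_entire_def xi_entire_def functional_equation[OF s, symmetric] by (simp only: mult_ac)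
    ultimately have "L_entire s = suminf (A.Dterm s)" by simp
    moreover have "A.Dterm s sums suminf (A.Dterm s)"
      by (rule summable_sums[OF summable_norm_cancel[OF A.Dterm_summable[OF s]]])
    ultimately show ?thesis
      using sums_Suc_iff[of "A.Dterm s" "suminf (A.Dterm s)"] by (simp add: A.Dterm_def)
  qed
  show "L_entire holomorphic_on UNIV \<and> (\<forall>s. 1 < Re s \<longrightarrow> (\<lambda>n. chi (Suc n) / of_nat (Suc n) powr s) sums L_entire s)"
    using Lh sums by blast
  fix f assume f: "f holomorphic_on UNIV \<and> (\<forall>s. 1 < Re s \<longrightarrow> (\<lambda>n. chi (Suc n) / of_nat (Suc n) powr s) sums f s)"
  show "f = L_entire"
  proof
    fix z
    show "f z = L_entire z"
    proof (rule analytic_continuation_open[of "{s. Re s > 1}" UNIV f L_entire])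
      show "{s. Re s > 1} \<noteq> {}" by (auto intro!: exI[of _ 2])
      show "f s = L_entire s" if "s \<in> {s. Re s > 1}" for s
        using that f sums sums_unique2 by blast
    qed (use f Lh in \<open>auto simp: open_halfspace_Re_gt\<close>)
  qed
qed

lemma eventually_zz_notin: "\<forall>\<^sub>F w in at s. A.zz w \<notin> \<int>\<^sub>\<le>\<^sub>0"
proof -
  have "\<forall>\<^sub>F w in at s. w \<notin> {w. A.zz w \<in> \<int>\<^sub>\<le>\<^sub>0}"
  proof (rule eventually_notin_locally_finite)
    fix R
    have "{w. A.zz w \<in> \<int>\<^sub>\<le>\<^sub>0} \<inter> cball 0 R \<subseteq> (\<lambda>z. 2 * z - of_nat (kappa q chi)) ` (\<int>\<^sub>\<le>\<^sub>0 \<inter> cball 0 (real (kappa q chi) + R))"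
    proof
      fix w assume w: "w \<in> {w. A.zz w \<in> \<int>\<^sub>\<le>\<^sub>0} \<inter> cball 0 R"
      have "norm (A.zz w) \<le> norm (of_nat (kappa q chi) + w)" by (simp add: A.zz_def norm_divide)
      also have "\<dots> \<le> real (kappa q chi) + R" using w norm_triangle_ineq[of "of_nat (kappa q chi)" w] by simp
      finally show "w \<in> (\<lambda>z. 2 * z - of_nat (kappa q chi)) ` (\<int>\<^sub>\<le>\<^sub>0 \<inter> cball 0 (real (kappa q chi) + R))"
        using w by (intro image_eqI[of _ _ "A.zz w"]) (auto simp: A.zz_def field_simps)
    qed
    thus "finite ({w. A.zz w \<in> \<int>\<^sub>\<le>\<^sub>0} \<inter> cball 0 R)"
      by (rule finite_subset) (intro finite_imageI finite_nonpos_Ints_cball)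
  qed
  thus ?thesis by simp
qed

text \<open>Away from the poles of Gamma the factors \<open>Gamma\<close> and \<open>rGamma\<close>
  cancel. The poles are isolated, so \<open>remove_sings\<close> yields the values of the entire
  function there as well.\<close>

theorem xi_eq: "xi q chi s = A.E s + root_number q chi * coeff_seq.E q (kappa q chi) (\<lambda>n. cnj (chi n)) (1 - s)"
proof -
  have "((\<lambda>w. gfac q chi w * dirichlet_L chi w) \<longlongrightarrow> xi_entire s) (at s)"
  proof (rule Lim_transform_eventually)
    show "(xi_entire \<longlongrightarrow> xi_entire s) (at s)"
      using holomorphic_on_imp_continuous_on[OF xi_entire_holomorphic] by (auto simp: continuous_on_def)
    show "\<forall>\<^sub>F w in at s. xi_entire w = gfac q chi w * dirichlet_L chi w"
      using eventually_zz_notin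
    proof eventually_elim
      case (elim w)
      have "of_real (real q / pi) powr A.zz w * of_real (real q / pi) powr (- A.zz w) = (1::complex)"
        by (simp add: powr_minus del: of_real_divide)
      moreover have "Gamma (A.zz w) * rGamma (A.zz w) = 1" using elim by (simp add: rGamma_inverse_Gamma Gamma_eq_zero_iff)
      moreover have "gfac q chi w * dirichlet_L chi w = xi_entire w * (Gamma (A.zz w) * rGamma (A.zz w)) * (of_real (real q / pi) powr A.zz w * of_real (real q / pi) powr (- A.zz w))"
        unfolding gfac_eq dirichlet_L_eq L_entire_def A.G_def by (simp only: mult_ac)
      ultimately show ?case by simp
    qed
  qed
  thus ?thesis unfolding xi_def xi_entire_def[symmetric] by (rule remove_sings_eqI)
qed

end

section \<open>The truncated Euler product\<close>

definition smooth_set :: "nat set \<Rightarrow> nat set" where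
  "smooth_set P = {n. n > 0 \<and> (\<forall>p. prime p \<longrightarrow> p dvd n \<longrightarrow> p \<in> P)}"

lemma smooth_set_empty: "smooth_set {} = {1}"
proof -
  have "n = 1" if "n \<in> smooth_set {}" for n
    using that prime_factor_nat[of n] by (auto simp: smooth_set_def)
  thus ?thesis by (auto simp: smooth_set_def)
qed

lemma smooth_set_insert_bij:
  assumes p: "prime p" and pP: "p \<notin> P"
  shows "bij_betw (\<lambda>(k, m). p ^ k * m) (UNIV \<times> smooth_set P) (smooth_set (insert p P))"
proof (rule bij_betwI[of _ _ _ "\<lambda>n. (multiplicity p n, n div p ^ multiplicity p n)"])
  have p0: "p > 0" using p by (rule prime_gt_0_nat)
  show "(\<lambda>(k, m). p ^ k * m) \<in> UNIV \<times> smooth_set P \<rightarrow> smooth_set (insert p P)"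
  proof safe
    fix k m :: nat assume m: "m \<in> smooth_set P"
    have "r \<in> insert p P" if r: "prime r" "r dvd p ^ k * m" for r
    proof -
      have "r dvd p ^ k \<or> r dvd m" using r by (simp add: prime_dvd_mult_iff)
      thus ?thesis
      proof
        assume "r dvd p ^ k"
        hence "r dvd p" using r prime_dvd_power by blast
        hence "r = p" using r p primes_dvd_imp_eq by blast
        thus ?thesis by simp
      next
        assume "r dvd m" thus ?thesis using m r by (auto simp: smooth_set_def)
      qed
    qed
    thus "p ^ k * m \<in> smooth_set (insert p P)" using m p0 by (auto simp: smooth_set_def)
  qed
  show "(\<lambda>n. (multiplicity p n, n div p ^ multiplicity p n)) \<in> smooth_set (insert p P) \<rightarrow> UNIV \<times> smooth_set P"
  proof
    fix n assume n: "n \<in> smooth_set (insert p P)"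
    hence n0: "n > 0" by (simp add: smooth_set_def)
    define m where "m = n div p ^ multiplicity p n"
    have nm: "n = p ^ multiplicity p n * m" by (simp add: m_def multiplicity_dvd)
    have m0: "m > 0" using nm n0 by (cases "m = 0") auto
    have npm: "\<not> p dvd m"
      unfolding m_def using n0 p by (intro multiplicity_decompose) auto
    have "r \<in> P" if r: "prime r" "r dvd m" for r
    proof -
      have "r dvd n" using r nm by (metis dvd_mult)
      hence "r \<in> insert p P" using n r by (auto simp: smooth_set_def)
      thus ?thesis using r npm by auto
    qed
    thus "(multiplicity p n, n div p ^ multiplicity p n) \<in> UNIV \<times> smooth_set P"
      using m0 by (auto simp: smooth_set_def m_def)
  qed
  fix n assume n: "n \<in> smooth_set (insert p P)"
  show "(case (multiplicity p n, n div p ^ multiplicity p n) of (k, m) \<Rightarrow> p ^ k * m) = n"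
    by (simp add: multiplicity_dvd)
next
  have p0: "p > 0" using p by (rule prime_gt_0_nat)
  fix x :: "nat \<times> nat" assume "x \<in> UNIV \<times> smooth_set P"
  then obtain k m where x: "x = (k, m)" "m \<in> smooth_set P" by auto
  have m: "m > 0" "\<not> p dvd m" using x p pP by (auto simp: smooth_set_def)
  have "multiplicity p (p ^ k * m) = k"
    by (rule multiplicity_eqI) (use m p0 in auto)
  thus "(multiplicity p (case x of (k, m) \<Rightarrow> p ^ k * m), (case x of (k, m) \<Rightarrow> p ^ k * m) div p ^ multiplicity p (case x of (k, m) \<Rightarrow> p ^ k * m)) = x"
    using x p0 by simp
qed

text \<open>Induction on the set of primes: a new prime p contributes a geometric series through n =
  p ^ k m. Unconditional summability over all positive integers justifies the rearrangement into a
  double sum.\<close>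

lemma finite_euler_product:
  fixes f :: "nat \<Rightarrow> complex"
  assumes mult: "\<And>m n. m > 0 \<Longrightarrow> n > 0 \<Longrightarrow> f (m * n) = f m * f n" and f1: "f 1 = 1"
    and summ: "f summable_on {0<..}" and lt1: "\<And>p. prime p \<Longrightarrow> norm (f p) < 1"
    and P: "finite P" "\<And>p. p \<in> P \<Longrightarrow> prime p"
  shows "(f has_sum (\<Prod>p\<in>P. inverse (1 - f p))) (smooth_set P)"
  using P
proof (induction P)
  case empty
  show ?case unfolding smooth_set_empty using has_sum_finite[of "{1::nat}" f] f1 by simp
next
  case (insert p P)
  hence p: "prime p" "p > 0" by (auto simp: prime_gt_0_nat)
  have pow: "f (p ^ k) = f p ^ k" for k
  proof (induction k)
    case (Suc k)
    have "f (p * p ^ k) = f p * f (p ^ k)" by (rule mult) (use p in auto)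
    thus ?case using Suc by simp
  qed (use f1 in simp)
  let ?h = "\<lambda>(k, m). p ^ k * m"
  note bij = smooth_set_insert_bij[OF p(1) insert.hyps(2)]
  have sub: "smooth_set (insert p P) \<subseteq> {0<..}" by (auto simp: smooth_set_def)
  have "f summable_on smooth_set (insert p P)" by (rule summable_on_subset_banach[OF summ sub])
  hence s2: "(\<lambda>x. f (?h x)) summable_on (UNIV \<times> smooth_set P)"
    by (subst summable_on_reindex_bij_betw[OF bij])
  have IH: "(f has_sum (\<Prod>p\<in>P. inverse (1 - f p))) (smooth_set P)" by (rule insert.IH) (use insert.prems in auto)
  have "((\<lambda>x. f (?h x)) has_sum (inverse (1 - f p) * (\<Prod>p\<in>P. inverse (1 - f p)))) (Sigma UNIV (\<lambda>_. smooth_set P))"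
  proof (rule has_sum_SigmaI)
    fix k :: nat assume "k \<in> UNIV"
    have "((\<lambda>m. f p ^ k * f m) has_sum f p ^ k * (\<Prod>p\<in>P. inverse (1 - f p))) (smooth_set P)"
      by (intro has_sum_cmult_right IH)
    moreover have "f (?h (k, m)) = f p ^ k * f m" if "m \<in> smooth_set P" for m
      using mult[of "p ^ k" m] that p by (simp add: pow smooth_set_def)
    ultimately show "((\<lambda>m. f (?h (k, m))) has_sum f p ^ k * (\<Prod>p\<in>P. inverse (1 - f p))) (smooth_set P)"
      by (subst has_sum_cong) auto
  next
    have "((\<lambda>k. f p ^ k) has_sum (1 / (1 - f p))) UNIV"
      by (intro norm_summable_imp_has_sum geometric_sums lt1 p)
         (use lt1[OF p(1)] in \<open>auto simp: norm_power intro!: summable_geometric\<close>)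
    thus "((\<lambda>k. f p ^ k * (\<Prod>p\<in>P. inverse (1 - f p))) has_sum inverse (1 - f p) * (\<Prod>p\<in>P. inverse (1 - f p))) UNIV"
      unfolding inverse_eq_divide[of "1 - f p"] by (intro has_sum_cmult_left)
  qed (use s2 in simp)
  hence "(f has_sum (inverse (1 - f p) * (\<Prod>p\<in>P. inverse (1 - f p)))) (smooth_set (insert p P))"
    by (subst (asm) has_sum_reindex_bij_betw[OF bij])
  thus ?case using insert.hyps by simp
qed

section \<open>Laurent coefficients, residues and principal parts\<close>

lemma fps_inverse_X_minus_const:
  fixes b :: complex
  assumes "b \<noteq> 0"
  shows "inverse (fps_X - fps_const b) = Abs_fps (\<lambda>n. - 1 / b ^ Suc n)"
proof (rule fps_inverse_unique)
  show "(fps_X - fps_const b) * Abs_fps (\<lambda>n. - 1 / b ^ Suc n) = 1"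
  proof (rule fps_ext)
    fix n show "fps_nth ((fps_X - fps_const b) * Abs_fps (\<lambda>n. - 1 / b ^ Suc n)) n = fps_nth 1 n"
      using assms by (cases n) (auto simp: algebra_simps)
  qed
qed

text \<open>With b = w - \<rho>, the geometric series of 1 / (x - b), whose coefficients are - 1 /
  b^(n + 1), is multiplied by the Laurent series of f. The coefficient of 1 / x collects the
  coefficients of f of negative index i with weights - b^i, which is minus the principal part at w.
  In this way the residue theorem reaches principal parts of any order.\<close>

lemma residue_over_linear:
  assumes F: "(\<lambda>x. f (\<rho> + x)) has_laurent_expansion F" and w: "w \<noteq> \<rho>"
  shows "residue (\<lambda>s. f s / (s - w)) \<rho> = - principal_part f \<rho> w"
proof -
  define b where "b = w - \<rho>"
  have b: "b \<noteq> 0" using w by (simp add: b_def)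
  define H where "H = inverse (fps_X - fps_const b)"
  have Hn: "fps_nth H n = - 1 / b ^ Suc n" for n
    unfolding H_def fps_inverse_X_minus_const[OF b] by simp
  have "(\<lambda>x. x - b) has_fps_expansion (fps_X - fps_const b)" by (intro fps_expansion_intros)
  hence "(\<lambda>x. inverse (x - b)) has_fps_expansion H" unfolding H_def
    by (rule has_fps_expansion_inverse) (use b in auto)
  hence Hl: "(\<lambda>x. inverse (x - b)) has_laurent_expansion fps_to_fls H" by (rule has_laurent_expansion_fps)
  have "(\<lambda>x. f (\<rho> + x) * inverse (x - b)) has_laurent_expansion F * fps_to_fls H"
    by (rule has_laurent_expansion_mult[OF F Hl])
  moreover have "f (\<rho> + x) * inverse (x - b) = f (\<rho> + x) / ((\<rho> + x) - w)" for x
    by (simp add: b_def divide_inverse algebra_simps)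
  ultimately have "residue (\<lambda>s. f s / (s - w)) \<rho> = fls_residue (F * fps_to_fls H)"
    by (intro has_laurent_expansion_residue) simp
  also have "\<dots> = fls_nth (F * fps_to_fls H) (-1)" by (simp add: fls_residue_def)
  also have "\<dots> = (\<Sum>i=fls_subdegree F..-1 - fls_subdegree (fps_to_fls H). fls_nth F i * fls_nth (fps_to_fls H) (-1 - i))"
    by (rule fls_times_nth(2))
  also have "fls_subdegree (fps_to_fls H) = 0"
    using Hn[of 0] b by (simp add: fls_subdegree_fls_to_fps subdegree_eq_0)
  also have "(\<Sum>i=fls_subdegree F..-1 - 0. fls_nth F i * fls_nth (fps_to_fls H) (-1 - i)) = (\<Sum>i\<in>{fls_subdegree F..<0}. - (fls_nth F i * b powi i))"
  proof (rule sum.cong)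
    fix i assume i: "i \<in> {fls_subdegree F..<0}"
    have "fls_nth (fps_to_fls H) (-1 - i) = fps_nth H (nat (-1 - i))" using i by simp
    also have "\<dots> = - 1 / b ^ Suc (nat (-1 - i))" by (rule Hn)
    also have "Suc (nat (-1 - i)) = nat (- i)" using i by auto
    also have "- 1 / b ^ nat (- i) = - (b powi i)" using i by (simp add: power_int_def inverse_eq_divide power_one_over)
    finally show "fls_nth F i * fls_nth (fps_to_fls H) (-1 - i) = - (fls_nth F i * b powi i)" by simp
  qed auto
  also have "\<dots> = - principal_part f \<rho> w"
    unfolding principal_part_def laurent_expansion_eqI[OF F] Let_def by (simp add: sum_negf b_def)
  finally show ?thesis .
qed

lemma principal_part_not_pole:
  assumes F: "(\<lambda>x. f (\<rho> + x)) has_laurent_expansion F" and "\<not> is_pole f \<rho>"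
  shows "principal_part f \<rho> w = 0"
proof -
  have "fls_subdegree F \<ge> 0" using is_pole_fls_subdegree_iff[OF F] assms(2) by simp
  thus ?thesis unfolding principal_part_def laurent_expansion_eqI[OF F] Let_def by simp
qed

text \<open>Existence of the limit forces all Laurent coefficients of index below -1 to vanish. The
  limit c may be 0, so points that are not poles are covered too.\<close>

lemma principal_part_simple:
  assumes F: "(\<lambda>x. f (\<rho> + x)) has_laurent_expansion F" and lim: "((\<lambda>s. (s - \<rho>) * f s) \<longlongrightarrow> c) (at \<rho>)"
  shows "principal_part f \<rho> w = c / (w - \<rho>)"
proof -
  define G where "G = fls_X * F"
  have "(\<lambda>x. x * f (\<rho> + x)) has_laurent_expansion G"
    unfolding G_def by (intro laurent_expansion_intros F)
  hence G: "(\<lambda>x. ((\<rho> + x) - \<rho>) * f (\<rho> + x)) has_laurent_expansion G" by simp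
  have "\<not> is_pole (\<lambda>s. (s - \<rho>) * f s) \<rho>"
    using lim by (meson is_pole_def not_tendsto_and_filterlim_at_infinity at_neq_bot)
  hence sub: "fls_subdegree G \<ge> 0" using is_pole_fls_subdegree_iff[of "\<lambda>s. (s - \<rho>) * f s" \<rho> G] G by simp
  from has_laurent_expansion_imp_tendsto[of "\<lambda>s. (s - \<rho>) * f s" \<rho> G] G sub
  have "((\<lambda>s. (s - \<rho>) * f s) \<longlongrightarrow> fls_nth G 0) (at \<rho>)" by simp
  hence c: "fls_nth G 0 = c" using lim tendsto_unique[OF at_neq_bot] by blast
  have Gn: "fls_nth G n = fls_nth F (n - 1)" for n by (simp add: G_def fls_X_times_conv_shift)
  have F1: "fls_nth F (-1) = c" using Gn[of 0] c by simp
  have Fneg: "fls_nth F n = 0" if "n < -1" for n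
    using Gn[of "n + 1"] sub that by (simp add: fls_eq0_below_subdegree)
  have "principal_part f \<rho> w = (\<Sum>k\<in>{fls_subdegree F..<0}. fls_nth F k * (w - \<rho>) powi k)"
    unfolding principal_part_def laurent_expansion_eqI[OF F] Let_def ..
  also have "\<dots> = (\<Sum>k\<in>{-1}. fls_nth F k * (w - \<rho>) powi k)"
  proof (rule sum.mono_neutral_cong)
    show "fls_nth F i * (w - \<rho>) powi i = 0" if "i \<in> {-1} - {fls_subdegree F..<0}" for i
      using that by (auto intro!: fls_eq0_below_subdegree)
    show "fls_nth F i * (w - \<rho>) powi i = 0" if "i \<in> {fls_subdegree F..<0} - {-1}" for i
      using that Fneg[of i] by auto
  qed auto
  also have "\<dots> = c / (w - \<rho>)" by (simp add: F1 power_int_minus divide_inverse)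
  finally show ?thesis .
qed

section \<open>Size of Gamma on vertical lines, and distance of exponentials from 1\<close>

lemma norm_Gamma_le:
  assumes z: "Re z > 0"
  shows "norm (Gamma z) \<le> Gamma (Re z)"
proof -
  define g where "g = (\<lambda>(z::complex) (t::real). of_real t powr (z - 1) / complex_of_real (exp t))"
  have int: "g z absolutely_integrable_on {0<..}" unfolding g_def
    by (rule absolutely_integrable_Gamma_integral'[OF z])
  have nrm: "norm (g z t) = t powr (Re z - 1) / exp t" if "t > 0" for t
    using that by (simp add: g_def norm_divide norm_powr_real_powr)
  have "Gamma z = integral {0<..} (g z)" unfolding g_def
    using Gamma_integral_complex'[OF z] by (simp add: integral_unique)
  hence "norm (Gamma z) = norm (LINT t:{0<..}|lebesgue. g z t)"
    using set_lebesgue_integral_eq_integral(2)[OF int] by simp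
  also have "\<dots> \<le> (LINT t:{0<..}|lebesgue. norm (g z t))" by (rule set_integral_norm_bound[OF int])
  also have "\<dots> = integral {0<..} (\<lambda>t. norm (g z t))"
    by (rule set_lebesgue_integral_eq_integral(2)[OF set_integrable_norm[OF int]])
  also have "\<dots> = integral {0<..} (\<lambda>t. t powr (Re z - 1) / exp t)"
    by (rule integral_cong) (use nrm in auto)
  also have "\<dots> = integral {0..} (\<lambda>t. t powr (Re z - 1) / exp t)"
    by (rule integral_subset_negligible) (auto intro: negligible_subset[of "{0}"])
  also have "\<dots> = Gamma (Re z)" using Gamma_integral_real[OF z] by (rule integral_unique)
  finally show ?thesis .
qed

text \<open>The reflection formula gives |Gamma (i y)|^2 = \<pi> / (|y| |sinh (\<pi> y)|); the lower
  bound d for |y| keeps the argument away from the pole at 0.\<close>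

lemma Gamma_imag_decay:
  assumes d: "d > 0" and y: "\<bar>y\<bar> \<ge> d"
  shows "norm (Gamma (\<i> * of_real y)) \<le> sqrt (2 * pi / (d * (1 - exp (- (2 * pi * d))))) * exp (- (pi * \<bar>y\<bar> / 2))"
proof -
  define z where "z = \<i> * complex_of_real y"
  have y0: "y \<noteq> 0" using d y by auto
  have c: "cnj (Gamma z) = Gamma (- z)" by (subst cnj_Gamma) (simp add: z_def)
  have "of_real ((norm (Gamma z))\<^sup>2) = - of_real pi / (z * sin (of_real pi * z))"
    unfolding complex_norm_square c by (rule Gamma_reflection_complex')
  hence "norm (complex_of_real ((norm (Gamma z))\<^sup>2)) = norm (- of_real pi / (z * sin (of_real pi * z)))" by simp
  hence n: "(norm (Gamma z))\<^sup>2 = pi / (\<bar>y\<bar> * norm (sin (of_real pi * z)))"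
    by (simp add: norm_divide norm_mult z_def del: of_real_power)
  define D where "D = 1 - exp (- (2 * pi * d))"
  have D: "D > 0" using d by (simp add: D_def)
  have s: "norm (sin (of_real pi * z)) \<ge> exp (pi * \<bar>y\<bar>) * D / 2"
  proof -
    define v where "v = pi * y"
    have "sin (of_real pi * z) = sin (\<i> * of_real v)" by (simp add: z_def v_def mult_ac)
    also have "\<dots> = \<i> * of_real ((exp v - exp (- v)) / 2)"
      by (simp add: sin_i_times exp_of_real exp_minus)
    finally have "norm (sin (of_real pi * z)) = \<bar>exp v - exp (- v)\<bar> / 2"
      by (simp only: norm_mult norm_ii norm_of_real) simp
    also have "\<bar>exp v - exp (- v)\<bar> = exp \<bar>v\<bar> - exp (- \<bar>v\<bar>)"
      by (cases "v \<ge> 0") auto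
    also have "\<bar>v\<bar> = pi * \<bar>y\<bar>" by (simp add: v_def abs_mult)
    also have "exp (pi * \<bar>y\<bar>) - exp (- (pi * \<bar>y\<bar>)) = exp (pi * \<bar>y\<bar>) * (1 - exp (- (2 * pi * \<bar>y\<bar>)))"
      by (simp add: right_diff_distrib flip: exp_add)
    finally have e: "norm (sin (of_real pi * z)) = exp (pi * \<bar>y\<bar>) * (1 - exp (- (2 * pi * \<bar>y\<bar>))) / 2" .
    have "exp (pi * \<bar>y\<bar>) * D \<le> exp (pi * \<bar>y\<bar>) * (1 - exp (- (2 * pi * \<bar>y\<bar>)))"
      unfolding D_def using y by (intro mult_left_mono) auto
    thus ?thesis unfolding e by simp
  qed
  have sp: "0 < exp (pi * \<bar>y\<bar>) * D / 2" using D by simp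
  have "(norm (Gamma z))\<^sup>2 \<le> pi / (d * (exp (pi * \<bar>y\<bar>) * D / 2))"
    unfolding n using y d by (intro divide_left_mono mult_mono s mult_pos_pos less_le_trans[OF sp s] sp) (use D in auto)
  also have "\<dots> = 2 * pi / (d * D) * exp (- (pi * \<bar>y\<bar>))" using d D by (simp add: exp_minus field_simps)
  also have "\<dots> = (sqrt (2 * pi / (d * D)) * exp (- (pi * \<bar>y\<bar> / 2)))\<^sup>2"
    using d D by (simp add: power_mult_distrib flip: exp_double)
  finally show ?thesis unfolding z_def D_def
    by (rule power2_le_imp_le) (use d D in \<open>auto simp: D_def\<close>)
qed

text \<open>The reflection formula gives |Gamma (1/2 + i y)|^2 = \<pi> / cosh (\<pi> y). For s on
  the imaginary axis the argument of Gamma has real part \<kappa> / 2, so this line serves odd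
  characters, and the imaginary axis even ones.\<close>

lemma Gamma_half_decay:
  "norm (Gamma (1/2 + \<i> * of_real y)) \<le> sqrt (2 * pi) * exp (- (pi * \<bar>y\<bar> / 2))"
proof -
  define z where "z = 1/2 + \<i> * complex_of_real y"
  have c: "cnj (Gamma z) = Gamma (1 - z)" by (subst cnj_Gamma) (simp add: z_def)
  have "of_real ((norm (Gamma z))\<^sup>2) = of_real pi / sin (of_real pi * z)"
    unfolding complex_norm_square c by (rule Gamma_reflection_complex)
  hence "norm (complex_of_real ((norm (Gamma z))\<^sup>2)) = norm (of_real pi / sin (of_real pi * z))" by simp
  hence n: "(norm (Gamma z))\<^sup>2 = pi / norm (sin (of_real pi * z))"
    by (simp add: norm_divide del: of_real_power)
  have s: "norm (sin (of_real pi * z)) \<ge> exp (pi * \<bar>y\<bar>) / 2"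
  proof -
    define v where "v = pi * y"
    have "sin (of_real pi * z) = sin (of_real pi / 2 + \<i> * of_real v)"
      by (simp add: z_def v_def algebra_simps)
    also have "\<dots> = cos (\<i> * of_real v)"
      by (simp add: sin_add)
    also have "\<dots> = of_real ((exp v + exp (- v)) / 2)"
      by (simp add: cos_i_times exp_of_real exp_minus)
    finally have "norm (sin (of_real pi * z)) = \<bar>(exp v + exp (- v)) / 2\<bar>"
      by (simp only: norm_of_real)
    also have "\<dots> = (exp v + exp (- v)) / 2" by (intro abs_of_nonneg) (simp add: add_nonneg_nonneg)
    finally have e: "norm (sin (of_real pi * z)) = (exp v + exp (- v)) / 2" .
    have "\<bar>v\<bar> = pi * \<bar>y\<bar>" by (simp add: v_def abs_mult)
    moreover have "exp \<bar>v\<bar> \<le> exp v + exp (- v)" by (cases "v \<ge> 0") auto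
    ultimately show ?thesis unfolding e by simp
  qed
  have "(norm (Gamma z))\<^sup>2 \<le> pi / (exp (pi * \<bar>y\<bar>) / 2)"
    unfolding n using s by (intro divide_left_mono mult_pos_pos) (auto intro: less_le_trans[of _ "exp (pi * \<bar>y\<bar>) / 2"])
  also have "\<dots> = 2 * pi * exp (- (pi * \<bar>y\<bar>))" by (simp add: exp_minus field_simps)
  also have "\<dots> = (sqrt (2 * pi) * exp (- (pi * \<bar>y\<bar> / 2)))\<^sup>2"
    by (simp add: power_mult_distrib flip: exp_double)
  finally show ?thesis unfolding z_def by (rule power2_le_imp_le) auto
qed

text \<open>The Taylor bound of third order gives |sin x| >= |x| / 2 for |x| <= 8/5, a range that
  contains \<pi> / 2.\<close>

lemma abs_sin_pi_ge:
  assumes "\<bar>t\<bar> \<le> 1 / 2"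
  shows "\<bar>sin (pi * t)\<bar> \<ge> \<bar>t\<bar>"
proof -
  define x where "x = pi * t"
  have x: "\<bar>x\<bar> \<le> 8 / 5"
  proof -
    have "\<bar>x\<bar> = pi * \<bar>t\<bar>" by (simp add: x_def abs_mult)
    also have "\<dots> \<le> (16 / 5) * (1 / 2)" using assms pi_less_4 pi_approx by (intro mult_mono) auto
    finally show ?thesis by simp
  qed
  have "\<bar>sin x - (\<Sum>m<3. sin_coeff m * x ^ m)\<bar> \<le> inverse (fact 3) * \<bar>x\<bar> ^ 3"
    by (rule Maclaurin_sin_bound)
  hence s: "\<bar>sin x - x\<bar> \<le> \<bar>x\<bar> ^ 3 / 6" by (simp add: sin_coeff_def numeral_eq_Suc fact_numeral)
  have "\<bar>x\<bar> ^ 3 = \<bar>x\<bar> * \<bar>x\<bar> ^ 2" by (simp add: numeral_eq_Suc)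
  also have "\<dots> \<le> \<bar>x\<bar> * (8 / 5) ^ 2" using x by (intro mult_left_mono power_mono) auto
  finally have "\<bar>x\<bar> ^ 3 / 6 \<le> \<bar>x\<bar> / 2" by (simp add: power2_eq_square)
  hence "\<bar>sin x\<bar> \<ge> \<bar>x\<bar> / 2" using s by linarith
  moreover have "\<bar>t\<bar> \<le> \<bar>x\<bar> / 2"
  proof -
    have "2 * \<bar>t\<bar> \<le> pi * \<bar>t\<bar>" using pi_gt3 by (intro mult_right_mono) auto
    thus ?thesis by (simp add: x_def abs_mult)
  qed
  ultimately show ?thesis by (simp add: x_def)
qed

text \<open>The chord from 1 to exp (2 \<pi> i x) has length 2 |sin (\<pi> t)|, where t is the
  offset of x from its nearest integer b.\<close>

lemma norm_one_minus_exp_ge: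
  fixes x :: real
  obtains b :: int where "\<bar>x - of_int b\<bar> \<le> 1 / 2" "norm (1 - exp (\<i> * of_real (2 * pi * x))) \<ge> \<bar>x - of_int b\<bar>"
proof -
  define b where "b = round x"
  define t where "t = x - of_int b"
  have t: "\<bar>t\<bar> \<le> 1 / 2" unfolding t_def b_def using of_int_round_abs_le[of x] by (simp add: abs_minus_commute)
  have "exp (\<i> * of_real (2 * pi * x)) = exp (\<i> * of_real (2 * pi * t)) * efun b 1"
    unfolding efun_def t_def exp_add[symmetric] by (simp add: algebra_simps)
  hence e: "exp (\<i> * of_real (2 * pi * x)) = exp (\<i> * of_real (2 * pi * t))" by simp
  have "norm (1 - exp (\<i> * of_real (2 * pi * t))) = 2 * \<bar>sin (2 * pi * t / 2)\<bar>"
    using dist_exp_i_1[of "2 * pi * t"] by (simp add: norm_minus_commute)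
  also have "\<dots> \<ge> \<bar>t\<bar>" using abs_sin_pi_ge[OF t] by simp
  finally show ?thesis using that[of b] t e by (simp add: t_def)
qed

section \<open>The Euler factors for primes up to u and their zeros\<close>

locale trunc = char_mod +
  fixes u :: real
  assumes u2: "u \<ge> 2"
begin

definition P :: "nat set" where "P = {p. prime p \<and> real p \<le> u}"

lemma finite_P: "finite P"
proof (rule finite_subset)
  show "P \<subseteq> {..nat \<lfloor>u\<rfloor>}" using u2 by (auto simp: P_def le_nat_iff le_floor_iff)
qed auto

lemma P_prime: "p \<in> P \<Longrightarrow> prime p"
  by (simp add: P_def)

lemma P_gt1: "p \<in> P \<Longrightarrow> p > 1"
  by (rule prime_gt_1_nat) (rule P_prime)

lemma P_ln: "p \<in> P \<Longrightarrow> ln (real p) > 0"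
  by (rule ln_gt_zero) (use P_gt1[of p] in simp)

lemma smooth_iff: "n \<in> smooth_set P \<longleftrightarrow> n > 0 \<and> \<not> has_large_prime_factor u n"
  by (auto simp: smooth_set_def P_def has_large_prime_factor_def not_less)

definition chi_smooth :: "nat \<Rightarrow> complex" where
  "chi_smooth n = (if n \<in> smooth_set P then chi n else 0)"

sublocale S: coeff_seq q "kappa q chi" chi_smooth
  by standard (auto simp: chi_smooth_def smooth_set_def norm_chi_le)

text \<open>An exponent that annihilates all nonzero values of the character: raising
  \<open>ef p s\<close> to this power removes \<chi>(p) and leaves a pure exponential.\<close>

definition nn :: nat where "nn = totient q"

lemma nn_pos: "nn > 0"
  by (simp add: nn_def totient_gt_0_iff)

definition ef :: "nat \<Rightarrow> complex \<Rightarrow> complex" where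
  "ef p s = chi p * of_nat p powr (- s)"

lemma L_trunc_eq: "L_trunc u chi s = (\<Prod>p\<in>P. inverse (1 - ef p s))"
  by (simp add: L_trunc_def P_def ef_def)

lemma xi_trunc_eq: "xi_trunc q u chi s = A.G s * (\<Prod>p\<in>P. inverse (1 - ef p s))"
  by (simp add: xi_trunc_def gfac_eq L_trunc_eq)

lemma ef_exp: "p > 0 \<Longrightarrow> ef p s = chi p * exp (- (s * of_real (ln (real p))))"
  by (simp add: ef_def powr_def Ln_of_nat)

lemma euler_Re_gt_1:
  assumes s: "Re s > 1"
  shows "(\<Prod>p\<in>P. inverse (1 - ef p s)) = suminf (S.Dterm s)"
proof -
  define f where "f = (\<lambda>n. chi n * of_nat n powr (- s))"
  have D: "f n = A.Dterm s n" for n by (simp add: f_def A.Dterm_def powr_minus divide_inverse)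
  have "(f has_sum (\<Prod>p\<in>P. inverse (1 - f p))) (smooth_set P)"
  proof (rule finite_euler_product)
    fix m n :: nat assume "m > 0" "n > 0"
    moreover from this have "Ln (of_nat (m * n)) = Ln (of_nat m) + Ln (of_nat n)"
      by (subst (1 2 3) Ln_of_nat) (auto simp: ln_mult)
    ultimately have "of_nat (m * n) powr (- s) = of_nat m powr (- s) * (of_nat n powr (- s) :: complex)"
      by (simp add: powr_def ring_distribs del: of_nat_mult flip: exp_add)
    thus "f (m * n) = f m * f n" by (simp add: f_def chi_mult)
  next
    show "f 1 = 1" by (simp add: f_def)
    have "f summable_on UNIV" unfolding D[abs_def]
      by (rule norm_summable_imp_summable_on[OF A.Dterm_summable[OF s]])
    thus "f summable_on {0<..}" by (rule summable_on_subset_banach) auto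
    fix p :: nat assume "prime p"
    hence p: "p > 1" by (rule prime_gt_1_nat)
    have "norm (f p) \<le> 1 * real p powr (- Re s)"
      unfolding f_def norm_mult using norm_chi_le[of p] p by (intro mult_mono) (auto simp: A.norm_nat_powr)
    also have "\<dots> < 1" using p s by (simp add: powr_less_one)
    finally show "norm (f p) < 1" .
  qed (use finite_P P_prime in auto)
  hence "(S.Dterm s has_sum (\<Prod>p\<in>P. inverse (1 - f p))) UNIV"
    by (subst has_sum_cong_neutral[where T = "smooth_set P" and g = f]) (auto simp: D S.Dterm_def A.Dterm_def chi_smooth_def)
  from has_sum_imp_sums[OF this] show ?thesis by (simp add: sums_iff f_def ef_def)
qed

lemma xi_trunc_Re_gt_1: "Re s > 1 \<Longrightarrow> xi_trunc q u chi s = A.G s * suminf (S.Dterm s)"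
  by (simp add: xi_trunc_eq euler_Re_gt_1)

definition Zp :: "nat \<Rightarrow> complex set" where "Zp p = {s. ef p s = 1}"
definition ZG :: "complex set" where "ZG = {s. A.zz s \<in> \<int>\<^sub>\<le>\<^sub>0}"
text \<open>\<open>Z\<close> contains every pole of \<open>\<xi>\<^sub>u\<close>; at the points of \<open>Z\<close> that are not poles the principal part
  vanishes, so they do no harm.\<close>
definition Z :: "complex set" where "Z = ZG \<union> (\<Union>p\<in>P. Zp p)"

text \<open>The points at which the \<open>nn\<close>-th power of p powr (-s) is 1. They include all
  zeros of \<open>1 - ef p\<close>, but because of the phase \<chi>(p) need not all be such zeros,
  so membership in \<open>Zp p\<close> remains a separate condition.\<close>

definition pt :: "nat \<Rightarrow> int \<Rightarrow> complex" where
  "pt p a = \<i> * of_real (2 * pi * of_int a / (real nn * ln (real p)))"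

lemma ef_power_nn:
  assumes p: "p > 0" "coprime p q"
  shows "ef p s ^ nn = exp (- (of_nat nn * s * of_real (ln (real p))))"
proof -
  have "ef p s ^ nn = chi p ^ nn * exp (- (s * of_real (ln (real p)))) ^ nn"
    using p by (simp add: ef_exp power_mult_distrib)
  also have "chi p ^ nn = 1" using p by (simp add: nn_def chi_power_totient)
  also have "exp (- (s * of_real (ln (real p)))) ^ nn = exp (of_nat nn * (- (s * of_real (ln (real p)))))"
    by (rule exp_of_nat_mult[symmetric])
  finally show ?thesis by (simp add: mult_ac)
qed

lemma Zp_coprime: "s \<in> Zp p \<Longrightarrow> coprime p q"
  using chi_eq_0_iff[of p] by (auto simp: Zp_def ef_def)

lemma Zp_pt:
  assumes p: "p \<in> P" and s: "s \<in> Zp p"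
  obtains a where "s = pt p a"
proof -
  have "p > 0" using P_gt1[OF p] by simp
  hence "exp (- (of_nat nn * s * of_real (ln (real p)))) = 1"
    using ef_power_nn[of p s] Zp_coprime[OF s] s by (simp add: Zp_def)
  then obtain n :: int where n: "- (of_nat nn * s * of_real (ln (real p))) = complex_of_real (of_int (2 * n) * pi) * \<i>"
    unfolding exp_eq_1 by (auto simp: complex_eq_iff)
  have "of_nat nn * complex_of_real (ln (real p)) \<noteq> 0" using nn_pos P_ln[OF p] by auto
  moreover have "(of_nat nn * complex_of_real (ln (real p))) * s = (of_nat nn * complex_of_real (ln (real p))) * pt p (- n)"
  proof -
    have "(of_nat nn * complex_of_real (ln (real p))) * pt p (- n) = - (complex_of_real (of_int (2 * n) * pi) * \<i>)"
      using nn_pos P_ln[OF p] by (simp add: pt_def)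
    thus ?thesis unfolding n[symmetric] by (simp only: minus_minus mult_ac)
  qed
  ultimately have "s = pt p (- n)" by (metis mult_left_cancel)
  thus ?thesis using that by blast
qed

lemma norm_pt: "p \<in> P \<Longrightarrow> norm (pt p a) = 2 * pi / (real nn * ln (real p)) * \<bar>of_int a\<bar>"
  using P_ln[of p] nn_pos unfolding pt_def norm_mult norm_ii norm_of_real by (simp add: abs_mult)

lemma finite_pt_cball:
  assumes p: "p \<in> P"
  shows "finite (range (pt p) \<inter> cball 0 R)"
proof (rule finite_subset)
  define w where "w = 2 * pi / (real nn * ln (real p))"
  have w: "w > 0" using P_ln[OF p] nn_pos by (simp add: w_def)
  show "range (pt p) \<inter> cball 0 R \<subseteq> pt p ` {- \<lceil>R / w\<rceil>..\<lceil>R / w\<rceil>}"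
  proof
    fix z assume z: "z \<in> range (pt p) \<inter> cball 0 R"
    then obtain a where a: "z = pt p a" "norm (pt p a) \<le> R" by auto
    hence "w * \<bar>of_int a\<bar> \<le> R" using norm_pt[OF p, of a] by (simp add: w_def)
    hence "\<bar>real_of_int a\<bar> \<le> R / w" using w by (simp add: field_simps)
    hence "a \<in> {- \<lceil>R / w\<rceil>..\<lceil>R / w\<rceil>}" by (simp add: abs_le_iff) linarith
    thus "z \<in> pt p ` {- \<lceil>R / w\<rceil>..\<lceil>R / w\<rceil>}" using a by blast
  qed
qed auto

lemma ZG_form: "s \<in> ZG \<Longrightarrow> \<exists>j::nat. s = - of_nat (kappa q chi + 2 * j)"
proof -
  assume "s \<in> ZG"
  then obtain j where "A.zz s = - of_nat j" by (auto simp: ZG_def elim!: nonpos_Ints_cases')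
  moreover have "s = 2 * A.zz s - of_nat (kappa q chi)" by (simp add: A.zz_def field_simps)
  ultimately have "s = - of_nat (kappa q chi + 2 * j)" by simp
  thus ?thesis by blast
qed

lemma finite_ZG_cball: "finite (ZG \<inter> cball 0 R)"
proof (rule finite_subset)
  show "ZG \<inter> cball 0 R \<subseteq> (\<lambda>n. - of_nat n) ` {..nat \<lceil>R\<rceil>}"
  proof
    fix z assume z: "z \<in> ZG \<inter> cball 0 R"
    then obtain n :: nat where n: "z = - of_nat n" using ZG_form by blast
    hence "real n \<le> R" using z by simp
    hence "n \<le> nat \<lceil>R\<rceil>" by linarith
    thus "z \<in> (\<lambda>n. - of_nat n) ` {..nat \<lceil>R\<rceil>}" using n by auto
  qed
qed auto

lemma finite_Z_cball: "finite (Z \<inter> cball 0 R)"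
proof -
  have "Z \<inter> cball 0 R \<subseteq> (ZG \<inter> cball 0 R) \<union> (\<Union>p\<in>P. range (pt p) \<inter> cball 0 R)"
  proof
    fix s assume s: "s \<in> Z \<inter> cball 0 R"
    show "s \<in> (ZG \<inter> cball 0 R) \<union> (\<Union>p\<in>P. range (pt p) \<inter> cball 0 R)"
    proof (cases "s \<in> ZG")
      case False
      then obtain p where p: "p \<in> P" "s \<in> Zp p" using s by (auto simp: Z_def)
      then obtain a where "s = pt p a" using Zp_pt by blast
      thus ?thesis using s p by auto
    qed (use s in auto)
  qed
  moreover have "finite ((ZG \<inter> cball 0 R) \<union> (\<Union>p\<in>P. range (pt p) \<inter> cball 0 R))"
    by (rule finite_UnI[OF finite_ZG_cball finite_UN_I[OF finite_P finite_pt_cball]])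
  ultimately show ?thesis by (rule finite_subset)
qed

text \<open>Passing to \<open>nn\<close>-th powers enlarges the distance from 1 by at most the
  factor \<open>nn\<close> and reduces to exp (2 \<pi> i x) with x = - a ln r / ln p. Up to signs,
  the distance of x from its nearest integer b is |a ln r - b ln p| / ln p. For r dividing q the
  Euler factor is constantly 1.\<close>

lemma ef_lower_bound:
  assumes p: "p \<in> P" and r: "r \<in> P" and pr: "p \<noteq> r" and \<epsilon>: "\<epsilon> > 0"
  shows "\<exists>C>0. \<forall>a. a \<noteq> 0 \<longrightarrow> norm (1 - ef r (pt p a)) \<ge> C * exp (- \<epsilon> * \<bar>real_of_int a\<bar>)"
proof (cases "coprime r q")
  case False
  hence "chi r = 0" by (simp add: chi_eq_0_iff)
  thus ?thesis using \<epsilon> by (intro exI[of _ 1]) (auto simp: ef_def)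
next
  case True
  obtain C where C: "C > 0" "\<And>a b :: nat. a > 0 \<Longrightarrow> C * exp (- \<epsilon> * real a) \<le> \<bar>real a * ln (real r) - real b * ln (real p)\<bar>"
    using linear_form_two_logs[OF P_prime[OF p] P_prime[OF r] pr \<epsilon>] by blast
  define lp where "lp = ln (real p)"
  define lr where "lr = ln (real r)"
  have lp: "lp > 0" and lr: "lr > 0" using P_ln p r by (auto simp: lp_def lr_def)
  have "C / (lp * real nn) * exp (- \<epsilon> * \<bar>real_of_int a\<bar>) \<le> norm (1 - ef r (pt p a))" if a: "a \<noteq> 0" for a
  proof -
    define x where "x = - (real_of_int a * lr / lp)"
    obtain b where b: "\<bar>x - of_int b\<bar> \<le> 1 / 2" "norm (1 - exp (\<i> * of_real (2 * pi * x))) \<ge> \<bar>x - of_int b\<bar>"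
      by (rule norm_one_minus_exp_ge)
    have r0: "r > 0" using P_gt1[OF r] by simp
    have "ef r (pt p a) ^ nn = exp (- (of_nat nn * pt p a * of_real lr))"
      unfolding lr_def by (rule ef_power_nn[OF r0 True])
    also have "- (of_nat nn * pt p a * of_real lr) = \<i> * of_real (2 * pi * x)"
      using nn_pos lp by (simp add: pt_def x_def lp_def[symmetric])
    finally have pw: "ef r (pt p a) ^ nn = exp (\<i> * of_real (2 * pi * x))" .
    have n1: "norm (ef r (pt p a)) = 1"
      using norm_chi_coprime[OF True] r0 by (simp add: ef_exp norm_mult pt_def)
    have "norm (ef r (pt p a) ^ nn - 1 ^ nn) \<le> real nn * norm (ef r (pt p a) - 1)"
      by (rule norm_power_diff) (use n1 in auto)
    hence "norm (1 - exp (\<i> * of_real (2 * pi * x))) \<le> real nn * norm (1 - ef r (pt p a))"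
      by (simp add: pw norm_minus_commute)
    with b(2) have main: "\<bar>x - of_int b\<bar> \<le> real nn * norm (1 - ef r (pt p a))" by linarith
    define a' where "a' = nat \<bar>a\<bar>"
    have a': "real a' = \<bar>real_of_int a\<bar>" "a' > 0" using a by (auto simp: a'_def)
    \<comment> \<open>\<open>linear_form_two_logs\<close> is stated for natural numbers, so signs
      are normalised. A negative b' would have distance at least 1 from the positive number a' ln r
      / ln p and could not come from rounding.\<close>
    define b' where "b' = (if a > 0 then - b else b)"
    have xb: "\<bar>x - of_int b\<bar> = \<bar>real a' * lr / lp - of_int b'\<bar>"
    proof (cases "a > 0")
      case True
      hence "real a' = of_int a" using a' by simp
      moreover have "of_int b' = - real_of_int b" using True by (simp add: b'_def)
      ultimately have "x - of_int b = - (real a' * lr / lp - of_int b')" by (simp add: x_def)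
      thus ?thesis by (simp only: abs_minus_cancel)
    next
      case False
      hence "real a' = - of_int a" using a' a by simp
      thus ?thesis using False by (simp add: x_def b'_def)
    qed
    have b'0: "b' \<ge> 0"
    proof (rule ccontr)
      assume "\<not> b' \<ge> 0"
      hence "real_of_int b' \<le> -1" by linarith
      moreover have "real a' * lr / lp \<ge> 0" using lp lr by simp
      ultimately have "\<bar>real a' * lr / lp - of_int b'\<bar> \<ge> 1" by linarith
      thus False using b(1) xb by linarith
    qed
    have "C * exp (- \<epsilon> * real a') \<le> \<bar>real a' * lr - real (nat b') * lp\<bar>"
      unfolding lp_def lr_def by (rule C(2)) (use a' in auto)
    also have "\<dots> = lp * \<bar>real a' * lr / lp - of_int b'\<bar>"
    proof -
      have "real a' * lr - real (nat b') * lp = lp * (real a' * lr / lp - of_int b')"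
        using lp b'0 by (simp add: field_simps)
      thus ?thesis using lp by (simp add: abs_mult)
    qed
    also have "\<dots> \<le> lp * (real nn * norm (1 - ef r (pt p a)))"
      using main lp unfolding xb by (intro mult_left_mono) auto
    finally show ?thesis using lp nn_pos a' by (simp add: field_simps)
  qed
  moreover have "C / (lp * real nn) > 0" using C lp nn_pos by simp
  ultimately show ?thesis by blast
qed

lemma ef_holomorphic [holomorphic_intros]: "p \<in> P \<Longrightarrow> ef p holomorphic_on A"
proof -
  assume "p \<in> P"
  hence "p > 0" using P_gt1[of p] by simp
  hence "ef p = (\<lambda>s. chi p * exp (- (s * of_real (ln (real p)))))" by (auto simp: ef_exp)
  thus ?thesis by (simp add: holomorphic_intros)
qed

lemma G_holomorphic: "A.G holomorphic_on (- ZG)"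
proof -
  have "(\<lambda>s. Gamma (A.zz s)) holomorphic_on (- ZG)"
    by (rule holomorphic_on_compose_gen[of _ _ Gamma "- \<int>\<^sub>\<le>\<^sub>0", unfolded o_def])
       (auto simp: ZG_def A.zz_def intro!: holomorphic_intros)
  moreover have "(\<lambda>s. complex_of_real (real q / pi) powr A.zz s) holomorphic_on (- ZG)"
    unfolding A.zz_def by (auto intro!: holomorphic_intros)
  ultimately have "(\<lambda>s. complex_of_real (real q / pi) powr A.zz s * Gamma (A.zz s)) holomorphic_on (- ZG)"
    by (intro holomorphic_on_mult)
  thus ?thesis by (simp add: A.G_def[abs_def])
qed

lemma xi_trunc_holomorphic: "xi_trunc q u chi holomorphic_on (- Z)"
proof -
  have "(\<lambda>s. A.G s * (\<Prod>p\<in>P. inverse (1 - ef p s))) holomorphic_on (- Z)"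
    by (intro holomorphic_intros holomorphic_on_subset[OF G_holomorphic]) (auto simp: Z_def Zp_def)
  thus ?thesis by (simp add: xi_trunc_eq[abs_def])
qed

text \<open>Gamma enters as the inverse of the entire function \<open>rGamma\<close>. Meromorphy on
  the whole plane provides a Laurent expansion at every point, including 0, where the order of the
  pole is not determined.\<close>

lemma xi_trunc_meromorphic: "xi_trunc q u chi meromorphic_on UNIV"
proof -
  have an: "f analytic_on UNIV" if "f holomorphic_on UNIV" for f :: "complex \<Rightarrow> complex"
    using that by (simp add: analytic_on_open)
  have "(\<lambda>s. rGamma (A.zz s)) holomorphic_on UNIV" unfolding A.zz_def by (auto intro!: holomorphic_intros)
  hence "(\<lambda>s. inverse (rGamma (A.zz s))) meromorphic_on UNIV"
    by (intro meromorphic_on_inverse analytic_on_imp_meromorphic_on an)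
  hence g: "(\<lambda>s. Gamma (A.zz s)) meromorphic_on UNIV" by (simp add: rGamma_inverse_Gamma)
  have p: "(\<lambda>s. complex_of_real (real q / pi) powr A.zz s) meromorphic_on UNIV"
    unfolding A.zz_def by (intro analytic_on_imp_meromorphic_on an) (auto intro!: holomorphic_intros)
  have e: "(\<lambda>s. inverse (1 - ef p s)) meromorphic_on UNIV" if "p \<in> P" for p
    by (intro meromorphic_on_inverse analytic_on_imp_meromorphic_on an holomorphic_intros that)
  have "(\<lambda>s. (complex_of_real (real q / pi) powr A.zz s * Gamma (A.zz s)) * (\<Prod>p\<in>P. inverse (1 - ef p s))) meromorphic_on UNIV"
    by (intro meromorphic_on_mult meromorphic_on_prod p g e)
  thus ?thesis by (simp add: xi_trunc_eq[abs_def] A.G_def)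
qed

lemma xi_trunc_laurent: "(\<lambda>x. xi_trunc q u chi (\<rho> + x)) has_laurent_expansion laurent_expansion (xi_trunc q u chi) \<rho>"
  using xi_trunc_meromorphic unfolding meromorphic_on_def by (metis UNIV_I laurent_expansion_eqI)

end

section \<open>Summability of the principal parts\<close>

context trunc
begin

definition xiu :: "complex \<Rightarrow> complex" where "xiu = xi_trunc q u chi"

lemma xiu_eq: "xiu s = A.G s * (\<Prod>p\<in>P. inverse (1 - ef p s))"
  by (simp add: xiu_def xi_trunc_eq)

lemma xiu_laurent: "(\<lambda>x. xiu (\<rho> + x)) has_laurent_expansion laurent_expansion xiu \<rho>"
  unfolding xiu_def by (rule xi_trunc_laurent)

lemma closed_subset_Z:
  assumes "S \<subseteq> Z"
  shows "closed S"
  unfolding closed_limpt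
proof (intro allI impI)
  fix s assume "s islimpt S"
  moreover have "\<forall>\<^sub>F w in at s. w \<notin> S"
    by (rule eventually_notin_locally_finite) (rule finite_subset[OF _ finite_Z_cball], use assms in auto)
  ultimately show "s \<in> S" by (simp add: islimpt_iff_eventually)
qed

lemma closed_Z: "closed Z"
  by (rule closed_subset_Z) simp

lemma xiu_holomorphic: "xiu holomorphic_on (- Z)"
  unfolding xiu_def by (rule xi_trunc_holomorphic)

lemma xiu_not_pole: "s \<notin> Z \<Longrightarrow> \<not> is_pole xiu s"
proof -
  assume "s \<notin> Z"
  hence "isCont xiu s"
    using holomorphic_on_imp_continuous_on[OF xiu_holomorphic] closed_Z
    by (auto simp: continuous_on_eq_continuous_at open_Compl)
  thus "\<not> is_pole xiu s"
    unfolding is_pole_def isCont_def using not_tendsto_and_filterlim_at_infinity at_neq_bot by blast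
qed

lemma norm_const_powr: "norm (complex_of_real (real q / pi) powr z) = (real q / pi) powr Re z"
  by (subst norm_powr_real_powr) auto

lemma isCont_const_powr: "isCont (\<lambda>s. complex_of_real (real q / pi) powr A.zz s) s"
proof -
  define b where "b = complex_of_real (real q / pi)"
  have "b \<noteq> 0" using q_pos by (simp add: b_def)
  hence "(\<lambda>s. b powr A.zz s) = (\<lambda>s. exp (A.zz s * Ln b))" by (auto simp: powr_def)
  moreover have "isCont (\<lambda>s. exp (A.zz s * Ln b)) s"
    unfolding A.zz_def by (intro continuous_intros) auto
  ultimately show ?thesis by (simp only: b_def)
qed

text \<open>At these points \<open>A.zz\<close> has real part \<kappa> / 2 and imaginary part v a.
  The value a = 0 is left out, since Gamma has a pole there for even characters.\<close>

lemma G_pt_bound: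
  assumes p: "p \<in> P"
  shows "\<exists>C\<ge>0. \<exists>\<gamma>>0. \<forall>a. a \<noteq> 0 \<longrightarrow> norm (A.G (pt p a)) \<le> C * exp (- \<gamma> * \<bar>real_of_int a\<bar>)"
proof -
  define v where "v = pi / (real nn * ln (real p))"
  have v: "v > 0" using P_ln[OF p] nn_pos by (simp add: v_def)
  define C1 where "C1 = sqrt (2 * pi / (v * (1 - exp (- (2 * pi * v)))))"
  define C where "C = (real q / pi) powr (real (kappa q chi) / 2) * (C1 + sqrt (2 * pi))"
  have C1: "C1 \<ge> 0" unfolding C1_def using v by (intro real_sqrt_ge_zero divide_nonneg_nonneg mult_nonneg_nonneg) auto
  have "norm (A.G (pt p a)) \<le> C * exp (- (pi * v / 2) * \<bar>real_of_int a\<bar>)" if a: "a \<noteq> 0" for a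
  proof -
    define y where "y = v * of_int a"
    have y: "\<bar>y\<bar> = v * \<bar>of_int a\<bar>" using v by (simp add: y_def abs_mult)
    have "1 \<le> \<bar>real_of_int a\<bar>" using a by linarith
    hence yv: "\<bar>y\<bar> \<ge> v" using v unfolding y by (simp add: mult_le_cancel_left1)
    have zz: "A.zz (pt p a) = of_nat (kappa q chi) / 2 + \<i> * of_real y"
      by (simp add: A.zz_def pt_def y_def v_def add_divide_distrib)
    have "norm (Gamma (A.zz (pt p a))) \<le> (C1 + sqrt (2 * pi)) * exp (- (pi * \<bar>y\<bar> / 2))"
    proof -
      consider "kappa q chi = 0" | "kappa q chi = 1" by (cases "kappa q chi = 0") (auto simp: kappa_def split: if_splits)
      thus ?thesis
      proof cases
        case 1
        hence "norm (Gamma (A.zz (pt p a))) \<le> C1 * exp (- (pi * \<bar>y\<bar> / 2))"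
          unfolding zz C1_def using Gamma_imag_decay[OF v yv] by simp
        also have "\<dots> \<le> (C1 + sqrt (2 * pi)) * exp (- (pi * \<bar>y\<bar> / 2))" by (intro mult_right_mono) auto
        finally show ?thesis .
      next
        case 2
        hence "norm (Gamma (A.zz (pt p a))) \<le> sqrt (2 * pi) * exp (- (pi * \<bar>y\<bar> / 2))"
          unfolding zz using Gamma_half_decay[of y] by simp
        also have "\<dots> \<le> (C1 + sqrt (2 * pi)) * exp (- (pi * \<bar>y\<bar> / 2))" using C1 by (intro mult_right_mono) auto
        finally show ?thesis .
      qed
    qed
    hence "norm (A.G (pt p a)) \<le> (real q / pi) powr Re (A.zz (pt p a)) * ((C1 + sqrt (2 * pi)) * exp (- (pi * \<bar>y\<bar> / 2)))"
      unfolding A.G_def norm_mult norm_const_powr by (intro mult_left_mono) auto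
    also have "Re (A.zz (pt p a)) = real (kappa q chi) / 2" unfolding zz by simp
    also have "- (pi * \<bar>y\<bar> / 2) = - (pi * v / 2) * \<bar>real_of_int a\<bar>" by (simp add: y)
    finally show ?thesis by (simp add: C_def mult.assoc)
  qed
  moreover have "C \<ge> 0" using C1 by (simp add: C_def)
  moreover have "pi * v / 2 > 0" using v by simp
  ultimately show ?thesis by blast
qed

lemma ef_deriv:
  assumes p: "p \<in> P"
  shows "(ef p has_field_derivative (- of_real (ln (real p)) * ef p s)) (at s)"
proof -
  have p0: "p > 0" using P_gt1[OF p] by simp
  have "((\<lambda>s. chi p * exp (- (s * of_real (ln (real p))))) has_field_derivative
      (- of_real (ln (real p)) * (chi p * exp (- (s * of_real (ln (real p))))))) (at s)"
    by (auto intro!: derivative_eq_intros)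
  moreover have "ef p = (\<lambda>s. chi p * exp (- (s * of_real (ln (real p)))))" using p0 by (auto simp: ef_exp)
  ultimately show ?thesis by simp
qed

lemma isCont_ef: "p \<in> P \<Longrightarrow> isCont (ef p) s"
  using ef_deriv DERIV_isCont by blast

lemma isCont_G: "s \<notin> ZG \<Longrightarrow> isCont A.G s"
proof -
  assume s: "s \<notin> ZG"
  have "isCont (\<lambda>s. Gamma (A.zz s)) s"
    using s by (intro isCont_Gamma) (auto simp: ZG_def A.zz_def)
  thus ?thesis unfolding A.G_def[abs_def] by (intro isCont_mult isCont_const_powr)
qed

lemma pt_notin_ZG:
  assumes p: "p \<in> P" and a: "a \<noteq> 0"
  shows "pt p a \<notin> ZG"
proof
  assume "pt p a \<in> ZG"
  then obtain j where "pt p a = - of_nat (kappa q chi + 2 * j)" using ZG_form by blast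
  hence "Im (pt p a) = 0" by simp
  thus False using a nn_pos P_ln[OF p] by (simp add: pt_def)
qed

text \<open>At a zero of \<open>1 - ef p\<close> on the imaginary axis other than 0 no further Euler
  factor vanishes, by \<open>ef_lower_bound\<close>, and Gamma is regular. So the pole is simple,
  and the residue contains the inverse of ln p from the derivative of \<open>ef p\<close>. At 0
  several factors may vanish together with a pole of Gamma.\<close>

lemma pp_pt:
  assumes p: "p \<in> P" and a: "a \<noteq> 0" and z: "pt p a \<in> Zp p"
  shows "principal_part xiu (pt p a) w =
     (A.G (pt p a) * (inverse (of_real (ln (real p))) * (\<Prod>r\<in>P-{p}. inverse (1 - ef r (pt p a))))) / (w - pt p a)"
proof (rule principal_part_simple[OF xiu_laurent])
  define \<rho> where "\<rho> = pt p a"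
  have e1: "ef p \<rho> = 1" using z by (simp add: Zp_def \<rho>_def)
  have "((\<lambda>s. (ef p s - ef p \<rho>) / (s - \<rho>)) \<longlongrightarrow> - of_real (ln (real p)) * ef p \<rho>) (at \<rho>)"
    using ef_deriv[OF p, of \<rho>] by (simp add: has_field_derivative_iff)
  hence "((\<lambda>s. - ((ef p s - 1) / (s - \<rho>))) \<longlongrightarrow> - (- of_real (ln (real p)) * 1)) (at \<rho>)"
    unfolding e1 by (intro tendsto_minus)
  hence "((\<lambda>s. inverse (- ((ef p s - 1) / (s - \<rho>)))) \<longlongrightarrow> inverse (of_real (ln (real p)))) (at \<rho>)"
    using P_ln[OF p] by (intro tendsto_inverse) auto
  moreover have "inverse (- ((ef p s - 1) / (s - \<rho>))) = (s - \<rho>) * inverse (1 - ef p s)" for s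
    by (simp add: divide_inverse mult_ac) (metis inverse_minus_eq minus_diff_eq minus_mult_right)
  ultimately have l1: "((\<lambda>s. (s - \<rho>) * inverse (1 - ef p s)) \<longlongrightarrow> inverse (of_real (ln (real p)))) (at \<rho>)" by simp
  have nz: "1 - ef r \<rho> \<noteq> 0" if r: "r \<in> P - {p}" for r
  proof -
    obtain C where "C > 0" "\<And>a. a \<noteq> 0 \<Longrightarrow> norm (1 - ef r (pt p a)) \<ge> C * exp (- 1 * \<bar>real_of_int a\<bar>)"
      using ef_lower_bound[OF p, of r 1] r by auto
    hence "norm (1 - ef r \<rho>) > 0" using a unfolding \<rho>_def by (metis exp_gt_zero less_le_trans mult_pos_pos)
    thus ?thesis by auto
  qed
  have l2: "((\<lambda>s. \<Prod>r\<in>P-{p}. inverse (1 - ef r s)) \<longlongrightarrow> (\<Prod>r\<in>P-{p}. inverse (1 - ef r \<rho>))) (at \<rho>)"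
    using isCont_ef[of _ \<rho>] nz unfolding isCont_def by (intro tendsto_intros) auto
  have l3: "(A.G \<longlongrightarrow> A.G \<rho>) (at \<rho>)"
    using isCont_G[OF pt_notin_ZG[OF p a]] by (simp add: isCont_def \<rho>_def)
  have "((\<lambda>s. A.G s * (((s - \<rho>) * inverse (1 - ef p s)) * (\<Prod>r\<in>P-{p}. inverse (1 - ef r s)))) \<longlongrightarrow>
      A.G \<rho> * (inverse (of_real (ln (real p))) * (\<Prod>r\<in>P-{p}. inverse (1 - ef r \<rho>)))) (at \<rho>)"
    by (intro tendsto_mult l1 l2 l3)
  moreover have "(\<lambda>s. A.G s * (((s - \<rho>) * inverse (1 - ef p s)) * (\<Prod>r\<in>P-{p}. inverse (1 - ef r s)))) = (\<lambda>s. (s - \<rho>) * xiu s)"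
    unfolding xiu_eq prod.remove[OF finite_P p] by (simp only: mult_ac)
  ultimately show "((\<lambda>s. (s - pt p a) * xiu s) \<longlongrightarrow> A.G (pt p a) * (inverse (of_real (ln (real p))) * (\<Prod>r\<in>P-{p}. inverse (1 - ef r (pt p a))))) (at (pt p a))"
    by (simp only: \<rho>_def)
qed

text \<open>For w at distance at least 1 the principal part is at most the residue in modulus: an
  exponentially small value of Gamma times small-divisor factors whose exponential rate can be
  prescribed.\<close>

lemma pp_pt_bound:
  assumes p: "p \<in> P"
  shows "\<exists>C\<ge>0. \<exists>\<gamma>>0. \<forall>a w. a \<noteq> 0 \<longrightarrow> pt p a \<in> Zp p \<longrightarrow> norm (w - pt p a) \<ge> 1 \<longrightarrow>
     norm (principal_part xiu (pt p a) w) \<le> C * exp (- \<gamma> * \<bar>real_of_int a\<bar>)"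
proof -
  obtain CG \<gamma> where CG: "CG \<ge> 0" "\<gamma> > 0" "\<And>a. a \<noteq> 0 \<Longrightarrow> norm (A.G (pt p a)) \<le> CG * exp (- \<gamma> * \<bar>real_of_int a\<bar>)"
    using G_pt_bound[OF p] by blast
  define m where "m = real (card (P - {p}))"
  \<comment> \<open>Each of the m other primes costs exp (\<epsilon> |a|); this choice spends at
    most half of the decay rate \<gamma>, and m + 1 in place of m allows for m = 0.\<close>
  define \<epsilon> where "\<epsilon> = \<gamma> / (2 * (m + 1))"
  have m: "m \<ge> 0" by (simp add: m_def)
  have \<epsilon>: "\<epsilon> > 0" using CG m by (simp add: \<epsilon>_def)
  have \<epsilon>m: "\<epsilon> * m \<le> \<gamma> / 2"
  proof -
    have "\<epsilon> * m \<le> \<epsilon> * (m + 1)" using \<epsilon> by simp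
    also have "\<dots> = \<gamma> / 2" using m by (simp add: \<epsilon>_def field_simps)
    finally show ?thesis .
  qed
  have "\<forall>r\<in>P-{p}. \<exists>C>0. \<forall>a. a \<noteq> 0 \<longrightarrow> norm (1 - ef r (pt p a)) \<ge> C * exp (- \<epsilon> * \<bar>real_of_int a\<bar>)"
    using ef_lower_bound[OF p _ _ \<epsilon>] by auto
  then obtain C where C: "\<And>r. r \<in> P-{p} \<Longrightarrow> C r > 0"
    "\<And>r a. r \<in> P-{p} \<Longrightarrow> a \<noteq> 0 \<Longrightarrow> norm (1 - ef r (pt p a)) \<ge> C r * exp (- \<epsilon> * \<bar>real_of_int a\<bar>)"
    by metis
  define K where "K = CG * inverse (ln (real p)) * (\<Prod>r\<in>P-{p}. inverse (C r))"
  have lp: "ln (real p) > 0" by (rule P_ln[OF p])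
  have prod0: "(\<Prod>r\<in>P-{p}. inverse (C r)) \<ge> 0" by (intro prod_nonneg) (auto intro!: less_imp_le C)
  have "norm (principal_part xiu (pt p a) w) \<le> K * exp (- (\<gamma> / 2) * \<bar>real_of_int a\<bar>)"
    if a: "a \<noteq> 0" and z: "pt p a \<in> Zp p" and w: "norm (w - pt p a) \<ge> 1" for a w
  proof -
    define A' where "A' = \<bar>real_of_int a\<bar>"
    define c where "c = A.G (pt p a) * (inverse (of_real (ln (real p))) * (\<Prod>r\<in>P-{p}. inverse (1 - ef r (pt p a))))"
    have "norm (\<Prod>r\<in>P-{p}. inverse (1 - ef r (pt p a))) = (\<Prod>r\<in>P-{p}. inverse (norm (1 - ef r (pt p a))))"
      by (simp add: prod_norm norm_inverse flip: prod_norm)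
    also have "\<dots> \<le> (\<Prod>r\<in>P-{p}. inverse (C r) * exp (\<epsilon> * A'))"
    proof (rule prod_mono, intro conjI)
      fix r assume r: "r \<in> P - {p}"
      have pos: "C r * exp (- \<epsilon> * A') > 0" using C(1)[OF r] by simp
      have "inverse (norm (1 - ef r (pt p a))) \<le> inverse (C r * exp (- \<epsilon> * A'))"
        using C(2)[OF r a] pos unfolding A'_def by (intro le_imp_inverse_le)
      thus "inverse (norm (1 - ef r (pt p a))) \<le> inverse (C r) * exp (\<epsilon> * A')"
        by (simp add: exp_minus)
    qed auto
    also have "\<dots> = (\<Prod>r\<in>P-{p}. inverse (C r)) * exp (\<epsilon> * m * A')"
      by (simp add: prod.distrib m_def mult_ac flip: exp_of_nat_mult)
    finally have n1: "norm (\<Prod>r\<in>P-{p}. inverse (1 - ef r (pt p a))) \<le> (\<Prod>r\<in>P-{p}. inverse (C r)) * exp (\<epsilon> * m * A')" .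
    have "norm c \<le> (CG * exp (- \<gamma> * A')) * (inverse (ln (real p)) * ((\<Prod>r\<in>P-{p}. inverse (C r)) * exp (\<epsilon> * m * A')))"
      unfolding c_def norm_mult
    proof (intro mult_mono)
      show "norm (A.G (pt p a)) \<le> CG * exp (- \<gamma> * A')" using CG(3)[OF a] by (simp add: A'_def)
      show "norm (inverse (complex_of_real (ln (real p)))) \<le> inverse (ln (real p))" using lp by (simp add: norm_inverse)
    qed (use n1 CG lp prod0 in \<open>auto intro!: mult_nonneg_nonneg\<close>)
    also have "\<dots> = K * exp (- \<gamma> * A' + \<epsilon> * m * A')" by (simp only: K_def exp_add mult_ac)
    also have "\<dots> \<le> K * exp (- (\<gamma> / 2) * A')"
    proof (intro mult_left_mono)
      have "\<epsilon> * m * A' \<le> \<gamma> / 2 * A'" using \<epsilon>m by (intro mult_right_mono) (auto simp: A'_def)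
      thus "exp (- \<gamma> * A' + \<epsilon> * m * A') \<le> exp (- (\<gamma> / 2) * A')" by (simp add: algebra_simps)
      show "0 \<le> K" using CG lp prod0 by (simp add: K_def)
    qed
    finally have nc: "norm c \<le> K * exp (- (\<gamma> / 2) * A')" .
    have "principal_part xiu (pt p a) w = c / (w - pt p a)" unfolding c_def by (rule pp_pt[OF p a z])
    hence "norm (principal_part xiu (pt p a) w) = norm c / norm (w - pt p a)" by (simp add: norm_divide)
    also have "\<dots> \<le> norm c / 1" using w by (intro divide_left_mono) auto
    finally show ?thesis using nc by (simp add: A'_def)
  qed
  moreover have "K \<ge> 0" using CG lp prod0 by (simp add: K_def)
  moreover have "\<gamma> / 2 > 0" using CG by simp
  ultimately show ?thesis by blast
qed

text \<open>Either \<chi>(p) = 0 and the factor is 1, or |ef p s| = p powr (- Re s) >= 2.\<close>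

lemma norm_one_minus_ef_ge:
  assumes p: "p \<in> P" and m: "Re s \<le> -1"
  shows "norm (1 - ef p s) \<ge> 1"
proof (cases "coprime p q")
  case False
  thus ?thesis using chi_eq_0_iff[of p] by (simp add: ef_def)
next
  case True
  have p2: "p \<ge> 2" using P_gt1[OF p] by simp
  have "norm (ef p s) = real p powr (- Re s)"
    using norm_chi_coprime[OF True] p2 by (simp add: ef_def norm_mult A.norm_nat_powr)
  also have "\<dots> \<ge> real p powr 1" using m p2 by (intro powr_mono) auto
  finally have "norm (ef p s) \<ge> 2" using p2 by simp
  thus ?thesis using norm_triangle_ineq2[of "ef p s" 1] by (simp add: norm_minus_commute)
qed

definition gp :: "nat \<Rightarrow> complex" where "gp j = - of_nat (kappa q chi + 2 * j)"

lemma zz_gp: "A.zz (gp j) = - of_nat j"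
  by (simp add: gp_def A.zz_def)

text \<open>The residue (-1)^j / j! of Gamma is doubled because \<open>A.zz\<close> has slope 1/2,
  and all Euler factors have modulus at least 1 at these points, so the bounds are terms of an
  exponential series. The point 0 is left out because it lies on the line of the zeros of the Euler
  factors.\<close>

lemma pp_gp_bound:
  assumes j: "gp j \<noteq> 0" and w: "norm (w - gp j) \<ge> 1"
  shows "norm (principal_part xiu (gp j) w) \<le> 2 * ((pi / real q) ^ j / fact j)"
proof -
  have re: "Re (gp j) \<le> -1"
  proof -
    have "kappa q chi + 2 * j \<noteq> 0" using j by (auto simp: gp_def)
    hence "real (kappa q chi + 2 * j) \<ge> 1" by linarith
    thus ?thesis by (simp add: gp_def)
  qed
  define c where "c = 2 * ((-1) ^ j / fact j) * (of_real (real q / pi) powr A.zz (gp j) * (\<Prod>p\<in>P. inverse (1 - ef p (gp j))))"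
  have lim: "((\<lambda>s. (s - gp j) * xiu s) \<longlongrightarrow> c) (at (gp j))"
  proof -
    have "filterlim A.zz (at (- of_nat j)) (at (gp j))"
    proof (rule filterlim_atI)
      have "(A.zz \<longlongrightarrow> A.zz (gp j)) (at (gp j))" unfolding A.zz_def by (intro tendsto_intros) auto
      thus "(A.zz \<longlongrightarrow> - of_nat j) (at (gp j))" by (simp add: zz_gp)
      have "A.zz s \<noteq> - of_nat j" if "s \<noteq> gp j" for s
      proof
        assume "A.zz s = - of_nat j"
        hence "A.zz s = A.zz (gp j)" by (simp add: zz_gp)
        thus False using that by (simp add: A.zz_def)
      qed
      thus "\<forall>\<^sub>F s in at (gp j). A.zz s \<noteq> - of_nat j" by (simp add: eventually_at_filter)
    qed
    hence l1: "((\<lambda>s. Gamma (A.zz s) * (A.zz s + of_nat j)) \<longlongrightarrow> (-1) ^ j / fact j) (at (gp j))"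
      by (rule filterlim_compose[OF Gamma_residues])
    have l2: "((\<lambda>s. of_real (real q / pi) powr A.zz s) \<longlongrightarrow> complex_of_real (real q / pi) powr A.zz (gp j)) (at (gp j))"
      using isCont_const_powr by (simp only: isCont_def)
    have l3: "((\<lambda>s. \<Prod>p\<in>P. inverse (1 - ef p s)) \<longlongrightarrow> (\<Prod>p\<in>P. inverse (1 - ef p (gp j)))) (at (gp j))"
    proof (intro tendsto_intros)
      fix p assume p: "p \<in> P"
      show "(ef p \<longlongrightarrow> ef p (gp j)) (at (gp j))" using isCont_ef[OF p] by (simp add: isCont_def)
      show "1 - ef p (gp j) \<noteq> 0" using norm_one_minus_ef_ge[OF p re] by auto
    qed
    have "((\<lambda>s. 2 * (Gamma (A.zz s) * (A.zz s + of_nat j)) * (of_real (real q / pi) powr A.zz s * (\<Prod>p\<in>P. inverse (1 - ef p s)))) \<longlongrightarrow> c) (at (gp j))"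
      unfolding c_def by (intro tendsto_mult tendsto_const l1 l2 l3)
    moreover have "2 * (Gamma (A.zz s) * (A.zz s + of_nat j)) * (of_real (real q / pi) powr A.zz s * (\<Prod>p\<in>P. inverse (1 - ef p s))) = (s - gp j) * xiu s" for s
    proof -
      have "s - gp j = 2 * (A.zz s + of_nat j)" by (simp add: A.zz_def gp_def field_simps)
      thus ?thesis unfolding xiu_eq A.G_def by (simp only: mult_ac)
    qed
    ultimately show ?thesis by simp
  qed
  have "norm (\<Prod>p\<in>P. inverse (1 - ef p (gp j))) \<le> (\<Prod>p\<in>P. 1)"
    unfolding prod_norm[symmetric]
  proof (rule prod_mono, intro conjI)
    fix p assume p: "p \<in> P"
    show "norm (inverse (1 - ef p (gp j))) \<le> 1"
      using norm_one_minus_ef_ge[OF p re] by (simp add: norm_inverse inverse_le_1_iff)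
  qed auto
  moreover have "norm (complex_of_real (real q / pi) powr A.zz (gp j)) = (pi / real q) ^ j"
    unfolding norm_const_powr using q_pos by (simp add: zz_gp powr_minus powr_realpow power_divide)
  moreover have "norm (2 * ((-1) ^ j / fact j) :: complex) = 2 / fact j" by (simp add: norm_mult norm_divide norm_power)
  ultimately have "norm c \<le> (2 / fact j) * ((pi / real q) ^ j * 1)"
    unfolding c_def norm_mult[of "2 * ((-1) ^ j / fact j)"] norm_mult[of "_ powr _"] by (intro mult_mono) auto
  hence nc: "norm c \<le> 2 * ((pi / real q) ^ j / fact j)" by simp
  have "norm (principal_part xiu (gp j) w) = norm c / norm (w - gp j)"
    unfolding principal_part_simple[OF xiu_laurent lim] by (simp add: norm_divide)
  also have "\<dots> \<le> norm c / 1" using w by (intro divide_left_mono) auto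
  finally show ?thesis using nc by simp
qed

text \<open>Removing a disc of radius |w| + 1 achieves two things at once: distance at least 1 from
  w, and exclusion of the possibly multiple pole at 0.\<close>

lemma far_point:
  fixes w \<rho> :: complex
  assumes "\<rho> \<notin> cball 0 (norm w + 1)"
  shows "norm (w - \<rho>) \<ge> 1" "\<rho> \<noteq> 0"
  using assms norm_triangle_ineq2[of \<rho> w] by (auto simp: norm_minus_commute)

lemma pp_summable_Zp:
  assumes p: "p \<in> P"
  shows "(\<lambda>\<rho>. principal_part xiu \<rho> w) summable_on (Zp p - cball 0 (norm w + 1))"
proof -
  obtain C \<gamma> where C: "C \<ge> 0" "\<gamma> > 0" "\<And>a w. a \<noteq> 0 \<Longrightarrow> pt p a \<in> Zp p \<Longrightarrow> norm (w - pt p a) \<ge> 1 \<Longrightarrow>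
     norm (principal_part xiu (pt p a) w) \<le> C * exp (- \<gamma> * \<bar>real_of_int a\<bar>)"
    using pp_pt_bound[OF p] by blast
  define B where "B = {a. pt p a \<in> Zp p - cball 0 (norm w + 1)}"
  have img: "Zp p - cball 0 (norm w + 1) = pt p ` B"
  proof (intro equalityI subsetI)
    fix z assume z: "z \<in> Zp p - cball 0 (norm w + 1)"
    then obtain a where "z = pt p a" using Zp_pt[OF p, of z] by blast
    thus "z \<in> pt p ` B" using z unfolding B_def by blast
  qed (auto simp: B_def)
  have inj: "inj_on (pt p) B"
    using nn_pos P_ln[OF p] by (auto simp: inj_on_def pt_def)
  have "(\<lambda>a. principal_part xiu (pt p a) w) summable_on B"
  proof (rule abs_summable_summable, rule summable_on_comparison_test)
    have "(\<lambda>a::int. C * exp (- \<gamma>) ^ nat \<bar>a\<bar>) summable_on UNIV"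
      by (intro summable_on_cmult_right summable_on_int_geometric) (use C in auto)
    thus "(\<lambda>a::int. C * exp (- \<gamma>) ^ nat \<bar>a\<bar>) summable_on B" by (rule summable_on_subset_banach) auto
    fix a assume a: "a \<in> B"
    hence far: "pt p a \<notin> cball 0 (norm w + 1)" and z: "pt p a \<in> Zp p" by (auto simp: B_def)
    have "a \<noteq> 0" using far_point(2)[OF far] by (auto simp: pt_def)
    from C(3)[OF this z far_point(1)[OF far]]
    show "norm (principal_part xiu (pt p a) w) \<le> C * exp (- \<gamma>) ^ nat \<bar>a\<bar>"
      by (simp add: mult.commute flip: exp_of_nat_mult)
  qed auto
  thus ?thesis unfolding img by (subst summable_on_reindex[OF inj]) (simp add: o_def)
qed

lemma pp_summable_ZG: "(\<lambda>\<rho>. principal_part xiu \<rho> w) summable_on (ZG - cball 0 (norm w + 1))"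
proof -
  define B where "B = {j. gp j \<in> ZG - cball 0 (norm w + 1)}"
  have img: "ZG - cball 0 (norm w + 1) = gp ` B"
  proof (intro equalityI subsetI)
    fix z assume z: "z \<in> ZG - cball 0 (norm w + 1)"
    then obtain j where "z = gp j" using ZG_form[of z] unfolding gp_def by blast
    thus "z \<in> gp ` B" using z unfolding B_def by blast
  qed (auto simp: B_def)
  have inj: "inj_on gp B" by (auto simp: inj_on_def gp_def)
  have "(\<lambda>j. principal_part xiu (gp j) w) summable_on B"
  proof (rule abs_summable_summable, rule summable_on_comparison_test)
    have "summable (\<lambda>j. norm (2 * ((pi / real q) ^ j / fact j)))"
      using summable_mult[OF summable_norm_exp[of "pi / real q"], of 2] by (simp add: divide_inverse mult_ac)
    hence "(\<lambda>j. 2 * ((pi / real q) ^ j / fact j)) summable_on UNIV"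
      by (rule norm_summable_imp_summable_on)
    thus "(\<lambda>j. 2 * ((pi / real q) ^ j / fact j)) summable_on B" by (rule summable_on_subset_banach) auto
    fix j assume "j \<in> B"
    hence far: "gp j \<notin> cball 0 (norm w + 1)" by (auto simp: B_def)
    show "norm (principal_part xiu (gp j) w) \<le> 2 * ((pi / real q) ^ j / fact j)"
      by (rule pp_gp_bound[OF far_point(2)[OF far] far_point(1)[OF far]])
  qed auto
  thus ?thesis unfolding img by (subst summable_on_reindex[OF inj]) (simp add: o_def)
qed

lemma summable_on_finite_UN:
  fixes g :: "'a \<Rightarrow> complex"
  assumes "finite I" "\<And>i. i \<in> I \<Longrightarrow> g summable_on S i"
  shows "g summable_on (\<Union>i\<in>I. S i)"
  using assms by (induction I) (auto intro: summable_on_union)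

text \<open>Finitely many points in the disc need no bound, and outside it each of the finitely many
  families is summable. The families may overlap, which does no harm to summability.\<close>

theorem pp_summable: "(\<lambda>\<rho>. principal_part xiu \<rho> w) summable_on Z"
proof -
  define R where "R = norm w + 1"
  have "(\<lambda>\<rho>. principal_part xiu \<rho> w) summable_on ((Z \<inter> cball 0 R) \<union> ((ZG - cball 0 R) \<union> (\<Union>p\<in>P. Zp p - cball 0 R)))"
    unfolding R_def
    by (intro summable_on_union summable_on_finite finite_Z_cball pp_summable_ZG summable_on_finite_UN finite_P pp_summable_Zp)
  moreover have "(Z \<inter> cball 0 R) \<union> ((ZG - cball 0 R) \<union> (\<Union>p\<in>P. Zp p - cball 0 R)) = Z"
    by (auto simp: Z_def)
  ultimately show ?thesis by simp
qed

lemma xi_pp_eq: "xi_pp q u chi w = (\<Sum>\<^sub>\<infinity>\<rho>\<in>Z. principal_part xiu \<rho> w)"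
  unfolding xi_pp_def principal_parts_sum_def xiu_def[symmetric]
  by (rule infsum_cong_neutral) (use xiu_not_pole principal_part_not_pole[OF xiu_laurent] in auto)

end

section \<open>The contour integral\<close>

text \<open>For y = exp (i t) this reads |sin (n t)| <= n |sin t|. It lets a lower bound for the
  imaginary part descend from the \<open>nn\<close>-th power to the number itself.\<close>

lemma abs_Im_power_le:
  fixes y :: complex
  assumes "norm y = 1"
  shows "\<bar>Im (y ^ n)\<bar> \<le> real n * \<bar>Im y\<bar>"
proof (induction n)
  case (Suc n)
  have re: "\<bar>Re (y ^ m)\<bar> \<le> 1" for m using abs_Re_le_cmod[of "y ^ m"] assms by (simp add: norm_power)
  have "\<bar>Im (y ^ Suc n)\<bar> \<le> \<bar>Re (y ^ 1)\<bar> * \<bar>Im (y ^ n)\<bar> + \<bar>Im y\<bar> * \<bar>Re (y ^ n)\<bar>"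
    using abs_triangle_ineq[of "Re y * Im (y ^ n)" "Im y * Re (y ^ n)"] by (simp add: abs_mult)
  also have "\<dots> \<le> 1 * \<bar>Im (y ^ n)\<bar> + \<bar>Im y\<bar> * 1"
    by (intro add_mono mult_mono re order_refl) auto
  also have "\<dots> \<le> real (Suc n) * \<bar>Im y\<bar>" using Suc.IH by (simp add: algebra_simps)
  finally show ?case .
qed simp

lemma abs_sin_diff_le: "\<bar>sin a - sin b\<bar> \<le> \<bar>a - b\<bar>" for a b :: real
proof -
  have "\<bar>sin a - sin b\<bar> = 2 * (\<bar>sin ((a - b) / 2)\<bar> * \<bar>cos ((a + b) / 2)\<bar>)"
    by (simp add: sin_diff_sin abs_mult)
  also have "\<dots> \<le> 2 * (\<bar>(a - b) / 2\<bar> * 1)"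
    by (intro mult_left_mono mult_mono abs_sin_x_le_abs_x) auto
  finally show ?thesis by simp
qed

text \<open>Rotation by cnj y turns the left side into the distance of cnj y from the real number r,
  so the bound does not involve r, which will carry the real part of s.\<close>

lemma norm_one_minus_ge_Im:
  fixes y :: complex and r :: real
  assumes "norm y = 1" "r > 0"
  shows "norm (1 - of_real r * y) \<ge> \<bar>Im y\<bar>"
proof -
  have "norm (1 - of_real r * y) = norm (cnj y * (1 - of_real r * y))"
    using assms by (simp add: norm_mult)
  also have "cnj y * (1 - of_real r * y) = cnj y - of_real r"
    using assms complex_norm_square[of y] by (simp add: algebra_simps)
  also have "norm \<dots> \<ge> \<bar>Im (cnj y - of_real r)\<bar>" by (rule abs_Im_le_cmod)
  finally show ?thesis by simp
qed

lemma half_notin_Ints: "- real n - 1/2 \<notin> \<int>"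
proof
  assume "- real n - 1/2 \<in> \<int>"
  then obtain i :: int where "- real n - 1/2 = of_int i" by (elim Ints_cases)
  hence "real_of_int (2 * (i + int n)) = real_of_int (-1)" by simp
  hence "2 * (i + int n) = -1" by (simp only: of_int_eq_iff)
  thus False by presburger
qed

context trunc
begin

text \<open>The bound depends on s only through its height, as the horizontal sides of the contour
  require. Taking \<open>nn\<close>-th powers removes the phase \<chi>(p), so that one sine per
  prime has to be kept away from 0.\<close>

lemma ef_im_lower_bound:
  assumes p: "p \<in> P" "coprime p q"
  shows "norm (1 - ef p s) \<ge> \<bar>sin (real nn * Im s * ln (real p))\<bar> / real nn"
proof -
  have p0: "p > 0" using P_gt1[OF p(1)] by simp
  define y where "y = chi p * exp (- (\<i> * of_real (Im s * ln (real p))))"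
  define r where "r = exp (- (Re s * ln (real p)))"
  have y: "norm y = 1"
    unfolding y_def using norm_chi_coprime[OF p(2)] by (simp add: norm_mult)
  have "ef p s = of_real r * y"
  proof -
    have "exp (- (s * of_real (ln (real p)))) = exp (of_real (- (Re s * ln (real p))) + - (\<i> * of_real (Im s * ln (real p))))"
      by (rule arg_cong[of _ _ exp]) (simp add: complex_eq_iff)
    thus ?thesis unfolding ef_exp[OF p0] y_def r_def exp_add exp_of_real by simp
  qed
  hence 1: "norm (1 - ef p s) \<ge> \<bar>Im y\<bar>" using norm_one_minus_ge_Im[OF y, of r] by (simp add: r_def)
  have "y ^ nn = exp (of_nat nn * - (\<i> * of_real (Im s * ln (real p))))"
    unfolding y_def power_mult_distrib exp_of_nat_mult using p by (simp add: nn_def chi_power_totient)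
  hence "\<bar>Im (y ^ nn)\<bar> = \<bar>sin (real nn * Im s * ln (real p))\<bar>"
    by (simp add: Im_exp mult_ac)
  with abs_Im_power_le[OF y, of nn] have "\<bar>sin (real nn * Im s * ln (real p))\<bar> \<le> real nn * \<bar>Im y\<bar>" by simp
  hence "\<bar>sin (real nn * Im s * ln (real p))\<bar> / real nn \<le> \<bar>Im y\<bar>" using nn_pos by (simp add: field_simps)
  with 1 show ?thesis by linarith
qed

text \<open>The absolute value covers the upper and the lower side of the rectangle at once, and the
  bound is demanded for every real part.\<close>

definition good_height :: "real \<Rightarrow> real \<Rightarrow> bool" where
  "good_height \<delta> T \<longleftrightarrow> (\<forall>p\<in>P. \<forall>s. \<bar>Im s\<bar> = T \<longrightarrow> norm (1 - ef p s) \<ge> \<delta>)"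

text \<open>With \<open>T = T\<^sub>0 + m M\<close>, where all \<open>m M nn ln p\<close> are close to multiples of \<open>2 \<pi>\<close>, the numbers
  \<open>sin (nn T ln p)\<close> are close to \<open>sin (nn T\<^sub>0 ln p)\<close>; the choice of \<open>T\<^sub>0\<close> puts
  \<open>nn T\<^sub>0 ln p\<close> into \<open>(0, 1]\<close>.\<close>
lemma good_heights:
  obtains \<delta> where "0 < \<delta>" "\<delta> \<le> 1"
    "\<And>M. \<exists>T\<ge>M. good_height \<delta> T"
proof -
  \<comment> \<open>For primes 2 <= p <= u and T0 = 1 / (nn ln u), the angle nn T0 ln p = ln p / ln
    u lies between ln 2 / ln u and 1, where the sine increases; this is the least value it can
    take.\<close>
  define \<sigma> where "\<sigma> = sin (ln 2 / ln u)"
  have lu: "ln u > 0" using u2 by simp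
  have l2: "0 < ln 2 / ln u" "ln 2 / ln u \<le> 1" using u2 lu by auto
  have \<sigma>: "\<sigma> > 0" unfolding \<sigma>_def using l2 pi_gt3 by (intro sin_gt_zero) auto
  have \<sigma>1: "\<sigma> \<le> 1" by (simp add: \<sigma>_def)
  define \<delta> where "\<delta> = \<sigma> / 2 / real nn"
  have nn1: "real nn \<ge> 1" using nn_pos by linarith
  have "\<delta> > 0" using \<sigma> nn_pos by (simp add: \<delta>_def)
  have "\<delta> \<le> \<sigma> / 2 / 1" unfolding \<delta>_def using \<sigma> nn1 by (intro divide_left_mono) auto
  hence d1: "\<delta> \<le> 1" using \<sigma>1 by simp
  \<comment> \<open>Approximation within 1 / N moves the angles by at most 2 \<pi> / N, which costs
    at most half of \<sigma>.\<close>
  obtain N :: nat where N: "N > 0" "4 * pi / \<sigma> < real N"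
    using reals_Archimedean2[of "max 0 (4 * pi / \<sigma>)"] by auto
  have "\<exists>T\<ge>M. good_height \<delta> T" for M
  proof -
    define M' where "M' = max M 0"
    define \<theta> where "\<theta> = (\<lambda>p. M' * real nn * ln (real p) / (2 * pi))"
    \<comment> \<open>The indices are all i up to the ceiling of u and not just the primes, which
      spares an enumeration of \<open>P\<close>. That m is at least 1 makes T at least M'.\<close>
    obtain m k where m: "0 < m" "\<And>i. i < nat \<lceil>u\<rceil> + 1 \<Longrightarrow> \<bar>of_int m * \<theta> i - of_int (k i)\<bar> < 1 / real N"
      using Dirichlet_approx_simult[OF N(1), where n = "nat \<lceil>u\<rceil> + 1" and \<theta> = \<theta>] by metis
    define T where "T = 1 / (real nn * ln u) + of_int m * M'"
    have m1: "real_of_int m \<ge> 1" using m(1) by linarith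
    have "M' \<ge> 0" by (simp add: M'_def)
    hence "1 * M' \<le> of_int m * M'" using m1 by (intro mult_right_mono)
    moreover have "1 / (real nn * ln u) > 0" using lu nn_pos by simp
    moreover have "M \<le> M'" by (simp add: M'_def)
    ultimately have TM: "T \<ge> M" "T > 0" using \<open>M' \<ge> 0\<close> unfolding T_def by linarith+
    have "norm (1 - ef p s) \<ge> \<delta>" if p: "p \<in> P" and s: "\<bar>Im s\<bar> = T" for p s
    proof (cases "coprime p q")
      case False
      hence "ef p s = 0" using chi_eq_0_iff[of p] by (simp add: ef_def)
      thus ?thesis using d1 by simp
    next
      case True
      have pu: "real p \<le> u" using p by (simp add: P_def)
      have p2: "p \<ge> 2" using P_gt1[OF p] by simp
      define \<alpha> where "\<alpha> = ln (real p) / ln u"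
      define e where "e = of_int m * \<theta> p - of_int (k p)"
      have "ln 2 / ln u \<le> \<alpha>" unfolding \<alpha>_def using lu p2 by (intro divide_right_mono) auto
      moreover have "\<alpha> \<le> 1" unfolding \<alpha>_def using lu pu p2 u2 by simp
      ultimately have \<alpha>: "ln 2 / ln u \<le> \<alpha>" "\<alpha> \<le> 1" .
      have sa: "sin \<alpha> \<ge> \<sigma>" unfolding \<sigma>_def
      proof (subst sin_mono_le_eq)
        have "pi / 2 \<ge> 1" using pi_gt3 by simp
        thus "- (pi / 2) \<le> ln 2 / ln u" "ln 2 / ln u \<le> pi / 2" "- (pi / 2) \<le> \<alpha>" "\<alpha> \<le> pi / 2" "ln 2 / ln u \<le> \<alpha>"
          using \<alpha> l2 by linarith+
      qed
      have "p < nat \<lceil>u\<rceil> + 1" using pu by linarith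
      hence e: "\<bar>e\<bar> < 1 / real N" unfolding e_def by (rule m(2))
      have "real nn * T * ln (real p) = \<alpha> + 2 * pi * (of_int m * \<theta> p)"
        using nn_pos lu by (simp add: T_def \<alpha>_def \<theta>_def field_simps)
      also have "\<dots> = (\<alpha> + 2 * pi * e) + 2 * pi * of_int (k p)"
        by (simp add: e_def algebra_simps)
      finally have "sin (real nn * T * ln (real p)) = sin (\<alpha> + 2 * pi * e)"
        by (simp only: sin_add sin_int_2pin cos_int_2pin) simp
      moreover have "\<bar>sin (\<alpha> + 2 * pi * e) - sin \<alpha>\<bar> \<le> 2 * pi * \<bar>e\<bar>"
        using abs_sin_diff_le[of "\<alpha> + 2 * pi * e" \<alpha>] by (simp add: abs_mult)
      moreover have "2 * pi * \<bar>e\<bar> \<le> \<sigma> / 2"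
      proof -
        have "2 * pi * \<bar>e\<bar> \<le> 2 * pi * (1 / real N)" using e by (intro mult_left_mono) auto
        also have "\<dots> \<le> \<sigma> / 2" using N \<sigma> by (simp add: field_simps)
        finally show ?thesis .
      qed
      ultimately have "\<bar>sin (real nn * T * ln (real p))\<bar> \<ge> \<sigma> / 2" using sa by linarith
      moreover have "\<bar>sin (real nn * Im s * ln (real p))\<bar> = \<bar>sin (real nn * T * ln (real p))\<bar>"
      proof (cases "Im s \<ge> 0")
        case False
        hence "Im s = - T" using s by simp
        thus ?thesis by simp
      qed (use s in simp)
      ultimately have "\<delta> \<le> \<bar>sin (real nn * Im s * ln (real p))\<bar> / real nn"
        unfolding \<delta>_def using nn_pos by (intro divide_right_mono) auto
      also have "\<dots> \<le> norm (1 - ef p s)" by (rule ef_im_lower_bound[OF p True])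
      finally show ?thesis .
    qed
    thus ?thesis using TM unfolding good_height_def by blast
  qed
  thus ?thesis using that[OF \<open>\<delta> > 0\<close> d1] by blast
qed

text \<open>Descent from 1/2 <= Re z <= 5/2, where |Gamma z| <= Gamma (Re z), by means of Gamma z =
  Gamma (z + 1) / z. Each step divides by b |z| with b = q / \<pi> >= 3/4. The step into -1/2 <= Re
  z < 1/2 may lose a factor 4; further to the left b |z| >= 1, and nothing more is lost. The
  alternatives in the hypothesis describe the horizontal sides and the left side of the contour;
  half-integral real parts persist under shifts by 1 and stay away from the poles.\<close>

lemma Gamma_strip_bound:
  obtains C where "C \<ge> 0"
    "\<And>z. Re z \<le> 5/2 \<Longrightarrow> \<bar>Im z\<bar> \<ge> 3/2 \<or> Re z - 1/2 \<in> \<int> \<Longrightarrow> norm (complex_of_real (real q / pi) powr z * Gamma z) \<le> C"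
proof -
  define b where "b = real q / pi"
  define g where "g = (\<lambda>z. complex_of_real b powr z * Gamma z)"
  have b: "b \<ge> 3/4"
  proof -
    have "3 * pi \<le> 3 * 4" using pi_less_4 by simp
    also have "\<dots> \<le> real q * 4" using q3 by simp
    finally show ?thesis by (simp add: b_def field_simps)
  qed
  have "continuous_on {1/2..5/2} (\<lambda>x::real. b powr x * Gamma x)"
    using b by (intro continuous_intros continuous_on_Gamma) auto
  hence "bounded ((\<lambda>x::real. b powr x * Gamma x) ` {1/2..5/2})"
    by (intro compact_imp_bounded compact_continuous_image) auto
  then obtain C0 where C0': "\<forall>v\<in>(\<lambda>x::real. b powr x * Gamma x) ` {1/2..5/2}. norm v \<le> C0"
    unfolding bounded_iff by blast
  have C0: "\<bar>b powr x * Gamma x\<bar> \<le> C0" if "1/2 \<le> x" "x \<le> 5/2" for x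
    using C0'[rule_format, OF imageI, of x] that unfolding real_norm_def atLeastAtMost_iff by blast
  have C0p: "C0 \<ge> 0" using C0[of 1] by simp
  have base: "norm (g z) \<le> C0" if "1/2 \<le> Re z" "Re z \<le> 5/2" for z
  proof -
    have "norm (g z) = b powr Re z * norm (Gamma z)"
      unfolding g_def norm_mult b_def norm_const_powr ..
    also have "\<dots> \<le> b powr Re z * Gamma (Re z)"
      using that by (intro mult_left_mono norm_Gamma_le) auto
    also have "\<dots> \<le> C0" using C0[of "Re z"] that by simp
    finally show ?thesis .
  qed
  have step: "norm (g z) = norm (g (z + 1)) / (b * norm z)" if "z \<noteq> 0" "z \<notin> \<int>\<^sub>\<le>\<^sub>0" for z
  proof -
    have "g (z + 1) = (of_real b * z) * g z"
      unfolding g_def using that b by (simp add: Gamma_plus1 powr_add)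
    hence "norm (g (z + 1)) = (b * norm z) * norm (g z)" using b by (simp add: norm_mult)
    thus ?thesis using that b by simp
  qed
  define C where "C = C0 * 4"
  have *: "\<forall>z. Re z \<ge> 1/2 - real m \<longrightarrow> Re z \<le> 5/2 \<longrightarrow> \<bar>Im z\<bar> \<ge> 3/2 \<or> Re z - 1/2 \<in> \<int> \<longrightarrow> norm (g z) \<le> C" for m
  proof (induction m)
    case 0
    thus ?case using base C0p by (force simp: C_def)
  next
    case (Suc m)
    show ?case
    proof (intro allI impI)
      fix z :: complex
      assume z: "1/2 - real (Suc m) \<le> Re z" "Re z \<le> 5/2" "\<bar>Im z\<bar> \<ge> 3/2 \<or> Re z - 1/2 \<in> \<int>"
      have z0: "z \<notin> \<int>\<^sub>\<le>\<^sub>0"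
      proof
        assume "z \<in> \<int>\<^sub>\<le>\<^sub>0"
        then obtain n where n: "z = - of_nat n" by (elim nonpos_Ints_cases')
        thus False using z(3) half_notin_Ints[of n] by simp
      qed
      hence z00: "z \<noteq> 0" by auto
      consider "Re z \<ge> 1/2" | "Re z < 1/2" "Re z \<ge> -1/2" | "Re z < -1/2" by linarith
      thus "norm (g z) \<le> C"
      proof cases
        case 1
        thus ?thesis using base[of z] z C0p by (simp add: C_def)
      next
        case 2
        have nz: "norm z \<ge> 1/2"
        proof (cases "\<bar>Im z\<bar> \<ge> 3/2")
          case True
          thus ?thesis using abs_Im_le_cmod[of z] by linarith
        next
          case False
          then obtain i :: int where i: "Re z - 1/2 = of_int i" using z(3) by (auto elim: Ints_cases)
          have "i < 0" "i \<ge> -1" using 2 i by linarith+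
          hence "i = -1" by simp
          hence "\<bar>Re z\<bar> \<ge> 1/2" using i by simp
          thus ?thesis using abs_Re_le_cmod[of z] by linarith
        qed
        have "1/4 \<le> 3/4 * (1/2 :: real)" by simp
        also have "\<dots> \<le> b * norm z" using nz b by (intro mult_mono) auto
        finally have bz: "1/4 \<le> b * norm z" .
        have "norm (g (z + 1)) / (b * norm z) \<le> C0 / (1/4)"
          using base[of "z + 1"] 2 C0p bz by (intro frac_le) auto
        thus ?thesis unfolding step[OF z00 z0] C_def by simp
      next
        case 3
        have nz: "norm z \<ge> 3/2"
        proof (cases "\<bar>Im z\<bar> \<ge> 3/2")
          case True
          thus ?thesis using abs_Im_le_cmod[of z] by linarith
        next
          case False
          then obtain i :: int where i: "Re z - 1/2 = of_int i" using z(3) by (auto elim: Ints_cases)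
          have "i < -1" using 3 i by linarith
          hence "i \<le> -2" by simp
          hence "Re z \<le> -3/2" using i by linarith
          thus ?thesis using abs_Re_le_cmod[of z] by linarith
        qed
        have "1 \<le> 3/4 * (3/2 :: real)" by simp
        also have "\<dots> \<le> b * norm z" using nz b by (intro mult_mono) auto
        finally have bz: "1 \<le> b * norm z" .
        have "Re (z + 1) - 1/2 \<in> \<int>" if "Re z - 1/2 \<in> \<int>"
          using Ints_add[OF that Ints_1] by (simp add: algebra_simps)
        hence "norm (g (z + 1)) \<le> C" using Suc.IH[rule_format, of "z + 1"] z 3 by auto
        moreover have "norm (g (z + 1)) / (b * norm z) \<le> norm (g (z + 1)) / 1"
          using bz by (intro divide_left_mono) auto
        ultimately show ?thesis unfolding step[OF z00 z0] by simp
      qed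
    qed
  qed
  have "norm (g z) \<le> C" if "Re z \<le> 5/2" "\<bar>Im z\<bar> \<ge> 3/2 \<or> Re z - 1/2 \<in> \<int>" for z
  proof -
    obtain m :: nat where "1/2 - Re z \<le> real m" using real_arch_simple by blast
    hence "1/2 - real m \<le> Re z" by linarith
    thus ?thesis using *[of m] that by blast
  qed
  thus ?thesis using that[of C] C0p by (simp add: g_def b_def C_def)
qed

text \<open>One more use of Gamma (z + 1) = z Gamma z gains the factor 1 / |z|. For Re s <= 2 the
  argument has real part at most 3/2, and after the shift at most 5/2, the limit allowed in
  \<open>Gamma_strip_bound\<close>.\<close>

lemma G_bound:
  obtains C where "C \<ge> 0"
    "\<And>s. Re s \<le> 2 \<Longrightarrow> \<bar>Im (A.zz s)\<bar> \<ge> 3/2 \<or> Re (A.zz s) - 1/2 \<in> \<int> \<Longrightarrow> A.zz s \<noteq> 0 \<Longrightarrow> A.zz s \<notin> \<int>\<^sub>\<le>\<^sub>0 \<Longrightarrow> norm (A.G s) \<le> C / norm (A.zz s)"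
proof -
  obtain C where C: "C \<ge> 0" "\<And>z. Re z \<le> 5/2 \<Longrightarrow> \<bar>Im z\<bar> \<ge> 3/2 \<or> Re z - 1/2 \<in> \<int> \<Longrightarrow> norm (complex_of_real (real q / pi) powr z * Gamma z) \<le> C"
    using Gamma_strip_bound by blast
  define b where "b = real q / pi"
  have b: "b > 0" using q_pos by (simp add: b_def)
  have "norm (A.G s) \<le> (C / b) / norm (A.zz s)"
    if s: "Re s \<le> 2" "\<bar>Im (A.zz s)\<bar> \<ge> 3/2 \<or> Re (A.zz s) - 1/2 \<in> \<int>" "A.zz s \<noteq> 0" "A.zz s \<notin> \<int>\<^sub>\<le>\<^sub>0" for s
  proof -
    define z where "z = A.zz s"
    have "kappa q chi \<le> 1" by (simp add: kappa_def)
    hence "Re z \<le> 3/2" using s by (simp add: z_def A.zz_def)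
    moreover have "Re (z + 1) - 1/2 \<in> \<int>" if "Re z - 1/2 \<in> \<int>"
      using Ints_add[OF that Ints_1] by (simp add: algebra_simps)
    ultimately have "norm (complex_of_real b powr (z + 1) * Gamma (z + 1)) \<le> C"
      unfolding b_def using s by (intro C) (auto simp: z_def)
    also have "complex_of_real b powr (z + 1) * Gamma (z + 1) = (of_real b * z) * A.G s"
      using s b by (simp add: z_def[symmetric] A.G_def b_def[symmetric] powr_add Gamma_plus1 del: of_real_divide)
    finally have "b * norm z * norm (A.G s) \<le> C" using b by (simp add: norm_mult)
    thus ?thesis using b s by (simp add: z_def field_simps)
  qed
  thus ?thesis using that[of "C / b"] C b by simp
qed

definition H :: "complex \<Rightarrow> complex" where "H s = xiu s - S.E s"

text \<open>For Re s >= 2 the difference is the sum of the lower parts and \<open>S.H_bound\<close>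
  applies. For Re s < 2 its ingredients are bounded separately: Gamma by \<open>G_bound\<close>, the
  Euler factors by the good height or by Re s <= -1, and \<open>S.E\<close> by
  \<open>S.E_bound\<close>. The left side is placed where \<open>A.zz\<close> has real part - K -
  1/2 with K the ceiling of T, midway between two poles of Gamma, so its abscissa depends on
  \<kappa>.\<close>

lemma H_boundary_bound:
  assumes \<delta>: "0 < \<delta>" "\<delta> \<le> 1"
  obtains C where "C \<ge> 0"
    "\<And>T s. T \<ge> 3 \<Longrightarrow> good_height \<delta> T \<Longrightarrow>
        Re s = - (2 * real (nat \<lceil>T\<rceil>) + 1 + real (kappa q chi)) \<or> Re s = T \<or> \<bar>Im s\<bar> = T \<Longrightarrow> s \<notin> Z \<and> norm (H s) \<le> C / T"
proof -
  obtain C1 where C1: "C1 \<ge> 0" "\<And>s. Re s \<ge> 2 \<Longrightarrow> norm (A.G s * suminf (S.Dterm s) - S.E s) \<le> C1 / norm (A.zz s)"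
    using S.H_bound by blast
  obtain C2 where C2: "C2 \<ge> 0" "\<And>s. Re s \<le> 2 \<Longrightarrow> A.zz s \<noteq> 0 \<Longrightarrow> norm (S.E s) \<le> C2 / norm (A.zz s)"
    using S.E_bound[of 2] by blast
  obtain C3 where C3: "C3 \<ge> 0" "\<And>s. Re s \<le> 2 \<Longrightarrow> \<bar>Im (A.zz s)\<bar> \<ge> 3/2 \<or> Re (A.zz s) - 1/2 \<in> \<int> \<Longrightarrow> A.zz s \<noteq> 0 \<Longrightarrow> A.zz s \<notin> \<int>\<^sub>\<le>\<^sub>0 \<Longrightarrow> norm (A.G s) \<le> C3 / norm (A.zz s)"
    using G_bound by blast
  define D where "D = (1 / \<delta>) ^ card P"
  have D: "D \<ge> 0" using \<delta> by (simp add: D_def)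
  define C where "C = 2 * (C1 + (C2 + C3 * D))"
  have C: "C \<ge> 0" using C1 C2 C3 D by (simp add: C_def)
  have k1: "kappa q chi \<le> 1" by (simp add: kappa_def)
  show ?thesis
  proof (rule that[OF C])
    fix T s
    assume T: "T \<ge> 3" and good: "good_height \<delta> T"
      and s: "Re s = - (2 * real (nat \<lceil>T\<rceil>) + 1 + real (kappa q chi)) \<or> Re s = T \<or> \<bar>Im s\<bar> = T"
    define K where "K = nat \<lceil>T\<rceil>"
    have KT: "real K \<ge> T" unfolding K_def by linarith
    have rez: "Re (A.zz s) = (real (kappa q chi) + Re s) / 2" and imz: "Im (A.zz s) = Im s / 2"
      by (simp_all add: A.zz_def)
    have zT: "norm (A.zz s) \<ge> T / 2"
    proof -
      have "\<bar>Re (A.zz s)\<bar> \<ge> T / 2 \<or> \<bar>Im (A.zz s)\<bar> \<ge> T / 2"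
        using s KT T unfolding rez imz K_def[symmetric] by auto
      thus ?thesis using abs_Re_le_cmod[of "A.zz s"] abs_Im_le_cmod[of "A.zz s"] by linarith
    qed
    have z0: "A.zz s \<noteq> 0" using zT T by auto
    have le: "X / norm (A.zz s) \<le> 2 * X / T" if "X \<ge> 0" for X
    proof -
      have "X / norm (A.zz s) \<le> X / (T / 2)" using that zT T by (intro divide_left_mono) (auto intro!: mult_pos_pos)
      thus ?thesis by (simp add: mult.commute)
    qed
    have ef: "norm (1 - ef p s) \<ge> \<delta>" if p: "p \<in> P" "Re s < 3" for p
    proof (cases "\<bar>Im s\<bar> = T")
      case False
      hence "Re s = - (2 * real K + 1 + real (kappa q chi))" using s that T by (auto simp: K_def)
      hence "Re s \<le> -1" by simp
      thus ?thesis using norm_one_minus_ef_ge[OF p(1)] \<delta> by fastforce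
    qed (use good p in \<open>simp add: good_height_def\<close>)
    show "s \<notin> Z \<and> norm (H s) \<le> C / T"
    proof (cases "Re s \<ge> 2")
      case True
      have "s \<notin> ZG" using True ZG_form[of s] by auto
      moreover have "s \<notin> Zp p" if p: "p \<in> P" for p
      proof
        assume "s \<in> Zp p"
        then obtain a where "s = pt p a" using Zp_pt[OF p] by blast
        thus False using True by (simp add: pt_def)
      qed
      ultimately have "s \<notin> Z" by (auto simp: Z_def)
      moreover have "norm (H s) \<le> C1 / norm (A.zz s)"
        using C1(2)[OF True] True by (simp add: H_def xiu_def xi_trunc_Re_gt_1)
      hence "norm (H s) \<le> 2 * C1 / T" using le[OF C1(1)] by simp
      moreover have "2 * C1 / T \<le> C / T" unfolding C_def using C2 C3 D T by (intro divide_right_mono) auto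
      ultimately show ?thesis by simp
    next
      case False
      have hz: "\<bar>Im (A.zz s)\<bar> \<ge> 3/2 \<or> Re (A.zz s) - 1/2 \<in> \<int>"
      proof (cases "\<bar>Im s\<bar> = T")
        case False
        hence "Re s = - (2 * real K + 1 + real (kappa q chi))" using s \<open>\<not> Re s \<ge> 2\<close> T by (auto simp: K_def)
        hence "Re (A.zz s) - 1/2 = - of_nat (K + 1)" unfolding rez by (simp add: field_simps)
        also have "\<dots> \<in> \<int>" by (intro Ints_minus Ints_of_nat)
        finally show ?thesis ..
      qed (use T imz in auto)
      have zn: "A.zz s \<notin> \<int>\<^sub>\<le>\<^sub>0"
      proof
        assume "A.zz s \<in> \<int>\<^sub>\<le>\<^sub>0"
        then obtain n where n: "A.zz s = - of_nat n" by (elim nonpos_Ints_cases')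
        thus False using hz half_notin_Ints[of n] by simp
      qed
      have re2: "Re s \<le> 2" "Re s < 3" using False by auto
      have "s \<notin> Zp p" if "p \<in> P" for p using ef[OF that re2(2)] \<delta> by (auto simp: Zp_def)
      hence "s \<notin> Z" using zn by (auto simp: Z_def ZG_def)
      moreover have "norm (H s) \<le> C / T"
      proof -
        have "norm (\<Prod>p\<in>P. inverse (1 - ef p s)) = (\<Prod>p\<in>P. inverse (norm (1 - ef p s)))"
          by (simp add: norm_inverse flip: prod_norm)
        also have "\<dots> \<le> (\<Prod>p\<in>P. 1 / \<delta>)"
        proof (rule prod_mono, intro conjI)
          fix p assume "p \<in> P"
          hence "norm (1 - ef p s) \<ge> \<delta>" using re2 by (intro ef)
          thus "inverse (norm (1 - ef p s)) \<le> 1 / \<delta>" using \<delta> by (simp add: inverse_eq_divide frac_le)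
        qed auto
        also have "\<dots> = D" by (simp add: D_def)
        finally have L: "norm (\<Prod>p\<in>P. inverse (1 - ef p s)) \<le> D" .
        have "norm (xiu s) \<le> (C3 / norm (A.zz s)) * D"
          unfolding xiu_eq norm_mult using C3 z0 zn hz re2 by (intro mult_mono L C3(2)) auto
        hence "norm (xiu s) \<le> (C3 * D) / norm (A.zz s)" by simp
        also have "\<dots> \<le> 2 * (C3 * D) / T" using C3 D by (intro le) auto
        finally have n1: "norm (xiu s) \<le> 2 * (C3 * D) / T" .
        have "norm (S.E s) \<le> 2 * C2 / T" using C2(2)[OF re2(1) z0] le[OF C2(1)] by simp
        moreover have "norm (H s) \<le> norm (xiu s) + norm (S.E s)" unfolding H_def by (rule norm_triangle_ineq4)
        ultimately have "norm (H s) \<le> 2 * (C3 * D) / T + 2 * C2 / T" using n1 by linarith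
        also have "\<dots> = 2 * (C2 + C3 * D) / T" by (simp add: add_divide_distrib)
        also have "\<dots> \<le> C / T" unfolding C_def using C1 T by (intro divide_right_mono) auto
        finally show ?thesis .
      qed
      ultimately show ?thesis ..
    qed
  qed
qed

end

section \<open>The residue theorem on large rectangles\<close>

lemma norm_contour_integral_rectpath_le:
  assumes g: "continuous_on (path_image (rectpath a b)) g"
    and ab: "Re a \<le> Re b" "Im a \<le> Im b"
    and B: "B \<ge> 0" "\<And>x. x \<in> path_image (rectpath a b) \<Longrightarrow> norm (g x) \<le> B"
  shows "norm (contour_integral (rectpath a b) g) \<le> B * (2 * (Re b - Re a) + 2 * (Im b - Im a))"
proof -
  define a2 a4 where "a2 = Complex (Re b) (Im a)" and "a4 = Complex (Re a) (Im b)"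
  have eq: "rectpath a b = linepath a a2 +++ linepath a2 b +++ linepath b a4 +++ linepath a4 a"
    by (simp add: rectpath_def Let_def a2_def a4_def)
  have img: "path_image (rectpath a b) = closed_segment a a2 \<union> closed_segment a2 b \<union> closed_segment b a4 \<union> closed_segment a4 a"
    unfolding eq by (simp add: path_image_join Un_assoc)
  have int: "g contour_integrable_on (linepath x y)" if "closed_segment x y \<subseteq> path_image (rectpath a b)" for x y
    by (rule contour_integrable_continuous_linepath) (rule continuous_on_subset[OF g that])
  have sub: "closed_segment a a2 \<subseteq> path_image (rectpath a b)" "closed_segment a2 b \<subseteq> path_image (rectpath a b)"
    "closed_segment b a4 \<subseteq> path_image (rectpath a b)" "closed_segment a4 a \<subseteq> path_image (rectpath a b)"
    unfolding img by auto
  have le: "norm (contour_integral (linepath x y) g) \<le> B * norm (y - x)" if "closed_segment x y \<subseteq> path_image (rectpath a b)" for x y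
    by (rule contour_integral_bound_linepath[OF int[OF that] B(1)]) (use that in \<open>auto intro!: B(2)\<close>)
  have "contour_integral (rectpath a b) g = contour_integral (linepath a a2) g + (contour_integral (linepath a2 b) g
      + (contour_integral (linepath b a4) g + contour_integral (linepath a4 a) g))"
    unfolding eq using int[OF sub(1)] int[OF sub(2)] int[OF sub(3)] int[OF sub(4)] by simp
  hence "norm (contour_integral (rectpath a b) g) \<le> norm (contour_integral (linepath a a2) g) + (norm (contour_integral (linepath a2 b) g)
      + (norm (contour_integral (linepath b a4) g) + norm (contour_integral (linepath a4 a) g)))"
    by (simp only:) (intro order_trans[OF norm_triangle_ineq] add_left_mono order_refl)
  also have "\<dots> \<le> B * norm (a2 - a) + (B * norm (b - a2) + (B * norm (a4 - b) + B * norm (a - a4)))"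
    by (intro add_mono le sub)
  also have "norm (a2 - a) = Re b - Re a"
    using ab by (simp add: a2_def cmod_def)
  also have "norm (b - a2) = Im b - Im a"
    using ab by (simp add: a2_def cmod_def)
  also have "norm (a4 - b) = Re b - Re a"
    using ab by (simp add: a4_def cmod_def)
  also have "norm (a - a4) = Im b - Im a"
    using ab by (simp add: a4_def cmod_def)
  finally show ?thesis by (simp add: algebra_simps)
qed

context trunc
begin

lemma H_holomorphic: "H holomorphic_on (- Z)"
  unfolding H_def[abs_def]
  by (intro holomorphic_intros xiu_holomorphic holomorphic_on_subset[OF S.E_holomorphic]) auto

text \<open>Since \<open>S.E\<close> is entire, only \<open>xiu\<close> contributes to the
  residue.\<close>

lemma residue_H_over_linear:
  assumes w: "w \<notin> Z" and \<rho>: "\<rho> \<in> Z"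
  shows "residue (\<lambda>s. H s / (s - w)) \<rho> = - principal_part xiu \<rho> w"
proof -
  define U where "U = - (insert w (Z - {\<rho>}))"
  have U: "open U" unfolding U_def
    by (intro open_Compl closed_insert closed_subset_Z) auto
  have w\<rho>: "w \<noteq> \<rho>" using w \<rho> by auto
  have \<rho>U: "\<rho> \<in> U" using w\<rho> by (simp add: U_def)
  have hf: "(\<lambda>s. xiu s / (s - w)) holomorphic_on U - {\<rho>}"
    by (intro holomorphic_intros holomorphic_on_subset[OF xiu_holomorphic]) (auto simp: U_def)
  have hE: "(\<lambda>s. S.E s / (s - w)) holomorphic_on U"
    by (intro holomorphic_intros holomorphic_on_subset[OF S.E_holomorphic]) (auto simp: U_def)
  have "residue (\<lambda>s. xiu s / (s - w) - S.E s / (s - w)) \<rho> = residue (\<lambda>s. xiu s / (s - w)) \<rho> - residue (\<lambda>s. S.E s / (s - w)) \<rho>"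
    by (rule residue_diff[OF U \<rho>U hf]) (rule holomorphic_on_subset[OF hE], auto)
  also have "residue (\<lambda>s. S.E s / (s - w)) \<rho> = 0" by (rule residue_holo[OF U \<rho>U hE])
  also have "residue (\<lambda>s. xiu s / (s - w)) \<rho> = - principal_part xiu \<rho> w"
    by (rule residue_over_linear[OF xiu_laurent w\<rho>])
  finally show ?thesis by (simp add: H_def diff_divide_distrib)
qed

text \<open>The kernel contributes H w at s = w and minus the principal part at every enclosed point
  of \<open>Z\<close>. Points of \<open>Z\<close> in the surrounding disc but outside the rectangle
  have winding number 0.\<close>

lemma rect_residues:
  assumes w: "w \<notin> Z" "w \<in> box a b" and bd: "path_image (rectpath a b) \<inter> Z = {}"
  shows "contour_integral (rectpath a b) (\<lambda>s. H s / (s - w)) = 2 * pi * \<i> * (H w - (\<Sum>\<rho>\<in>Z \<inter> box a b. principal_part xiu \<rho> w))"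
    and "finite (Z \<inter> box a b)"
proof -
  have ab: "Re a < Re b" "Im a < Im b" using w(2) by (auto simp: in_box_complex_iff)
  obtain R where R: "R > 0" "cbox a b \<subseteq> ball 0 R"
    using bounded_subset_ballD[OF bounded_cbox, of a b 0] by auto
  have sub: "box a b \<subseteq> cbox a b" by (rule box_subset_cbox)
  have fin: "finite (Z \<inter> ball 0 R)" by (rule finite_subset[OF _ finite_Z_cball[of R]]) auto
  show finb: "finite (Z \<inter> box a b)" by (rule finite_subset[OF _ fin]) (use R sub in auto)
  define g where "g = (\<lambda>s. H s / (s - w))"
  define pts where "pts = insert w (Z \<inter> ball 0 R)"
  have img: "path_image (rectpath a b) = cbox a b - box a b"
    using ab by (intro path_image_rectpath_cbox_minus_box) auto
  have hol: "g holomorphic_on ball 0 R - pts"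
    unfolding g_def by (intro holomorphic_intros holomorphic_on_subset[OF H_holomorphic]) (auto simp: pts_def)
  have "contour_integral (rectpath a b) g = 2 * pi * \<i> * (\<Sum>p\<in>pts. winding_number (rectpath a b) p * residue g p)"
  proof (rule Residue_theorem)
    show "path_image (rectpath a b) \<subseteq> ball 0 R - pts" using bd w R unfolding pts_def img by auto
    show "\<forall>z. z \<notin> ball 0 R \<longrightarrow> winding_number (rectpath a b) z = 0"
      using R ab by (intro allI impI winding_number_rectpath_outside) auto
  qed (use hol fin in \<open>auto simp: pts_def\<close>)
  also have "(\<Sum>p\<in>pts. winding_number (rectpath a b) p * residue g p) = (\<Sum>p\<in>insert w (Z \<inter> box a b). residue g p)"
  proof (rule sum.mono_neutral_cong_right)
    show "finite pts" using fin by (simp add: pts_def)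
    show "insert w (Z \<inter> box a b) \<subseteq> pts" using R sub by (auto simp: pts_def)
    show "\<forall>i\<in>pts - insert w (Z \<inter> box a b). winding_number (rectpath a b) i * residue g i = 0"
    proof
      fix i assume i: "i \<in> pts - insert w (Z \<inter> box a b)"
      hence "i \<in> Z" "i \<notin> box a b" by (auto simp: pts_def)
      hence "i \<notin> cbox a b" using bd unfolding img by auto
      thus "winding_number (rectpath a b) i * residue g i = 0"
        using winding_number_rectpath_outside[of a b i] ab by simp
    qed
    fix x assume "x \<in> insert w (Z \<inter> box a b)"
    hence "x \<in> box a b" using w by auto
    thus "winding_number (rectpath a b) x * residue g x = residue g x" by (simp add: winding_number_rectpath)
  qed
  also have "\<dots> = residue g w + (\<Sum>p\<in>Z \<inter> box a b. residue g p)"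
    using finb w by (subst sum.insert) auto
  also have "residue g w = H w"
    unfolding g_def by (rule residue_simple[OF _ _ H_holomorphic]) (use w closed_Z in auto)
  also have "(\<Sum>p\<in>Z \<inter> box a b. residue g p) = (\<Sum>p\<in>Z \<inter> box a b. - principal_part xiu p w)"
    unfolding g_def by (intro sum.cong residue_H_over_linear w) auto
  finally show "contour_integral (rectpath a b) (\<lambda>s. H s / (s - w)) = 2 * pi * \<i> * (H w - (\<Sum>\<rho>\<in>Z \<inter> box a b. principal_part xiu \<rho> w))"
    by (simp add: g_def sum_negf)
qed

text \<open>The perimeter is at most 14 T because A <= 4 T, and the integrand is at most (C / T) /
  (T / 2) because T >= 2 |w| + 2 keeps the contour at distance T / 2 from w. So the error is O(1 /
  T). That X contains all points of \<open>Z\<close> in the ball of radius T makes these sets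
  exhaust \<open>Z\<close>.\<close>

lemma principal_parts_approx:
  assumes w: "w \<notin> Z"
  obtains C where "\<And>M. \<exists>T\<ge>M. T > 0 \<and> (\<exists>X. finite X \<and> X \<subseteq> Z \<and> Z \<inter> ball 0 T \<subseteq> X \<and>
      norm (H w - (\<Sum>\<rho>\<in>X. principal_part xiu \<rho> w)) \<le> C / T)"
proof -
  obtain \<delta> where \<delta>: "0 < \<delta>" "\<delta> \<le> 1" "\<And>M. \<exists>T\<ge>M. good_height \<delta> T"
    using good_heights by metis
  obtain C where C: "C \<ge> 0"
    "\<And>T s. T \<ge> 3 \<Longrightarrow> good_height \<delta> T \<Longrightarrow>
        Re s = - (2 * real (nat \<lceil>T\<rceil>) + 1 + real (kappa q chi)) \<or> Re s = T \<or> \<bar>Im s\<bar> = T \<Longrightarrow> s \<notin> Z \<and> norm (H s) \<le> C / T"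
    using H_boundary_bound[OF \<delta>(1,2)] by blast
  have "\<exists>T\<ge>M. T > 0 \<and> (\<exists>X. finite X \<and> X \<subseteq> Z \<and> Z \<inter> ball 0 T \<subseteq> X \<and>
      norm (H w - (\<Sum>\<rho>\<in>X. principal_part xiu \<rho> w)) \<le> (14 * 2 * C / (2 * pi)) / T)" for M
  proof -
    obtain T where T: "T \<ge> max M (max 3 (2 * norm w + 2))" and good: "good_height \<delta> T"
      using \<delta>(3) by metis
    have T3: "T \<ge> 3" "T \<ge> M" "T \<ge> 2 * norm w + 2" using T by auto
    define A where "A = 2 * real (nat \<lceil>T\<rceil>) + 1 + real (kappa q chi)"
    have "kappa q chi \<le> 1" by (simp add: kappa_def)
    hence A: "A \<ge> T" "A \<le> 4 * T" using T3 unfolding A_def by linarith+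
    define a b where "a = Complex (- A) (- T)" and "b = Complex T T"
    have ab: "Re a \<le> Re b" "Im a \<le> Im b" using A T3 by (auto simp: a_def b_def)
    have ball: "ball 0 T \<subseteq> box a b"
    proof
      fix z assume "z \<in> ball (0::complex) T"
      hence "norm z < T" by simp
      hence "\<bar>Re z\<bar> < T" "\<bar>Im z\<bar> < T" using abs_Re_le_cmod[of z] abs_Im_le_cmod[of z] by linarith+
      thus "z \<in> box a b" using A by (auto simp: in_box_complex_iff a_def b_def)
    qed
    have wb: "w \<in> box a b"
    proof (rule subsetD[OF ball])
      have "norm w < T" using T3 norm_ge_zero[of w] by linarith
      thus "w \<in> ball 0 T" by simp
    qed
    have bdry: "z \<notin> Z \<and> norm (H z) \<le> C / T" "norm (z - w) \<ge> T / 2" if z: "z \<in> path_image (rectpath a b)" for z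
    proof -
      have zz: "Re z = - A \<or> Re z = T \<or> \<bar>Im z\<bar> = T"
        using z T3 unfolding path_image_rectpath[OF ab] by (auto simp: a_def b_def)
      thus "z \<notin> Z \<and> norm (H z) \<le> C / T" using C(2)[OF T3(1) good, of z] by (simp add: A_def)
      have "\<bar>Re z\<bar> \<ge> T \<or> \<bar>Im z\<bar> \<ge> T" using zz A by auto
      hence "norm z \<ge> T" using abs_Re_le_cmod[of z] abs_Im_le_cmod[of z] by linarith
      thus "norm (z - w) \<ge> T / 2" using norm_triangle_ineq2[of z w] T3 by linarith
    qed
    have bd: "path_image (rectpath a b) \<inter> Z = {}" using bdry(1) by blast
    define X where "X = Z \<inter> box a b"
    have cont: "continuous_on (path_image (rectpath a b)) (\<lambda>s. H s / (s - w))"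
    proof (intro continuous_intros ballI)
      show "continuous_on (path_image (rectpath a b)) H"
        by (rule continuous_on_subset[OF holomorphic_on_imp_continuous_on[OF H_holomorphic]]) (use bd in auto)
      fix z assume "z \<in> path_image (rectpath a b)"
      hence "norm (z - w) \<ge> T / 2" by (rule bdry(2))
      thus "z - w \<noteq> 0" using T3 by auto
    qed
    have "norm (contour_integral (rectpath a b) (\<lambda>s. H s / (s - w))) \<le> (C / T) / (T / 2) * (2 * (Re b - Re a) + 2 * (Im b - Im a))"
    proof (rule norm_contour_integral_rectpath_le[OF cont ab])
      show "0 \<le> (C / T) / (T / 2)" using C T3 by simp
      fix z assume z: "z \<in> path_image (rectpath a b)"
      show "norm (H z / (z - w)) \<le> (C / T) / (T / 2)"
        unfolding norm_divide using bdry[OF z] T3 C by (intro frac_le) auto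
    qed
    also have "\<dots> \<le> (C / T) / (T / 2) * (14 * T)"
      using A C T3 by (intro mult_left_mono) (auto simp: a_def b_def)
    also have "\<dots> = 14 * 2 * C / T" using T3 by (simp add: field_simps)
    finally have "norm (2 * complex_of_real pi * \<i> * (H w - (\<Sum>\<rho>\<in>X. principal_part xiu \<rho> w))) \<le> 14 * 2 * C / T"
      unfolding rect_residues(1)[OF w wb bd] X_def by simp
    hence "2 * pi * norm (H w - (\<Sum>\<rho>\<in>X. principal_part xiu \<rho> w)) \<le> 14 * 2 * C / T"
      by (simp only: norm_mult norm_ii norm_of_real norm_numeral) simp
    hence "(2 * pi * norm (H w - (\<Sum>\<rho>\<in>X. principal_part xiu \<rho> w))) / (2 * pi) \<le> (14 * 2 * C / T) / (2 * pi)"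
      by (rule divide_right_mono) simp
    hence "norm (H w - (\<Sum>\<rho>\<in>X. principal_part xiu \<rho> w)) \<le> (14 * 2 * C / (2 * pi)) / T" by (simp add: mult.commute)
    moreover have "finite X" unfolding X_def by (rule rect_residues(2)[OF w wb bd])
    moreover have "X \<subseteq> Z" "Z \<inter> ball 0 T \<subseteq> X" using ball by (auto simp: X_def)
    ultimately show ?thesis using T3 by (intro exI[of _ T]) auto
  qed
  thus ?thesis using that by blast
qed

text \<open>The sets X n tend to \<open>Z\<close> along its finite subsets, so the partial sums over
  them converge to the unordered sum, which exists by \<open>pp_summable\<close>; the error bound
  identifies its value.\<close>

theorem principal_parts_eq:
  assumes w: "w \<notin> Z"
  shows "xi_pp q u chi w = H w"
proof -
  obtain C where C: "\<And>M. \<exists>T\<ge>M. T > 0 \<and> (\<exists>X. finite X \<and> X \<subseteq> Z \<and> Z \<inter> ball 0 T \<subseteq> X \<and>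
      norm (H w - (\<Sum>\<rho>\<in>X. principal_part xiu \<rho> w)) \<le> C / T)"
    using principal_parts_approx[OF w] by metis
  have "\<forall>n::nat. \<exists>T X. real n \<le> T \<and> T > 0 \<and> finite X \<and> X \<subseteq> Z \<and> Z \<inter> ball 0 T \<subseteq> X \<and>
      norm (H w - (\<Sum>\<rho>\<in>X. principal_part xiu \<rho> w)) \<le> C / T"
    using C by metis
  then obtain T X where TX: "\<And>n::nat. real n \<le> T n" "\<And>n. T n > 0" "\<And>n. finite (X n)" "\<And>n. X n \<subseteq> Z"
    "\<And>n. Z \<inter> ball 0 (T n) \<subseteq> X n" "\<And>n. norm (H w - (\<Sum>\<rho>\<in>X n. principal_part xiu \<rho> w)) \<le> C / T n"
    by metis
  have Tlim: "filterlim T at_top sequentially"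
    by (rule filterlim_at_top_mono[OF filterlim_real_sequentially]) (use TX(1) in auto)
  have "filterlim X (finite_subsets_at_top Z) sequentially"
    unfolding filterlim_finite_subsets_at_top
  proof (intro allI impI)
    fix Y assume Y: "finite Y \<and> Y \<subseteq> Z"
    define r where "r = (\<Sum>y\<in>Y. norm y)"
    have r: "norm y \<le> r" if "y \<in> Y" for y
      unfolding r_def using Y that by (intro member_le_sum) auto
    have "\<forall>\<^sub>F n in sequentially. T n > r" using Tlim by (simp add: filterlim_at_top_dense)
    thus "\<forall>\<^sub>F n in sequentially. finite (X n) \<and> Y \<subseteq> X n \<and> X n \<subseteq> Z"
    proof eventually_elim
      case (elim n)
      have "Y \<subseteq> Z \<inter> ball 0 (T n)" using Y r elim by force
      thus ?case using TX(3,4,5) by blast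
    qed
  qed
  moreover have "((\<lambda>\<rho>. principal_part xiu \<rho> w) has_sum xi_pp q u chi w) Z"
    unfolding xi_pp_eq by (rule has_sum_infsum[OF pp_summable])
  ultimately have l1: "(\<lambda>n. \<Sum>\<rho>\<in>X n. principal_part xiu \<rho> w) \<longlonglongrightarrow> xi_pp q u chi w"
    unfolding has_sum_def by (rule filterlim_compose[rotated])
  have "(\<lambda>n. H w - (\<Sum>\<rho>\<in>X n. principal_part xiu \<rho> w)) \<longlonglongrightarrow> 0"
  proof (rule Lim_null_comparison)
    show "\<forall>\<^sub>F n in sequentially. norm (H w - (\<Sum>\<rho>\<in>X n. principal_part xiu \<rho> w)) \<le> C / T n" using TX(6) by simp
    show "(\<lambda>n. C / T n) \<longlonglongrightarrow> 0" using Tlim by (intro tendsto_divide_0[OF tendsto_const] filterlim_at_top_imp_at_infinity)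
  qed
  moreover have "(\<lambda>n. H w - (\<Sum>\<rho>\<in>X n. principal_part xiu \<rho> w)) \<longlonglongrightarrow> H w - xi_pp q u chi w"
    by (intro tendsto_diff tendsto_const l1)
  ultimately have "H w - xi_pp q u chi w = 0" by (metis LIMSEQ_unique)
  thus ?thesis by simp
qed

text \<open>The formula for the principal parts holds off the locally finite set \<open>Z\<close>.
  At points of \<open>Z\<close>, \<open>remove_sings\<close> takes the limit of nearby values, which
  are those of an entire function.\<close>

theorem xi_reg_eq: "xi_reg q u chi s = S.E s"
proof -
  have "((\<lambda>s. xi_trunc q u chi s - xi_pp q u chi s) \<longlongrightarrow> S.E s) (at s)"
  proof (rule Lim_transform_eventually)
    show "(S.E \<longlongrightarrow> S.E s) (at s)"
      using holomorphic_on_imp_continuous_on[OF S.E_holomorphic] by (auto simp: continuous_on_def)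
    have "\<forall>\<^sub>F w in at s. w \<notin> Z" by (rule eventually_notin_locally_finite) (rule finite_Z_cball)
    thus "\<forall>\<^sub>F w in at s. S.E w = xi_trunc q u chi w - xi_pp q u chi w"
      by eventually_elim (simp add: principal_parts_eq H_def xiu_def)
  qed
  thus ?thesis unfolding xi_reg_def by (rule remove_sings_eqI)
qed

end

section \<open>Comparison of all positive integers with the smooth ones\<close>

lemma has_sum_of_summable_norm:
  fixes g :: "nat \<Rightarrow> complex"
  assumes g: "summable (\<lambda>n. norm (g n))" and h: "summable (\<lambda>n. norm (h n))"
    and A: "\<And>n. n \<in> A \<Longrightarrow> h n = 0" "\<And>n. n \<notin> A \<Longrightarrow> h n = g n"
  shows "(g has_sum (suminf g - suminf h)) A"
proof -
  have "(g has_sum suminf g) UNIV" "(h has_sum suminf h) UNIV"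
    using norm_summable_imp_has_sum[OF g] norm_summable_imp_has_sum[OF h] summable_norm_cancel g h summable_sums by blast+
  hence "((\<lambda>n. g n + - h n) has_sum (suminf g + - suminf h)) UNIV"
    by (intro has_sum_add) (simp_all add: has_sum_uminus)
  thus ?thesis
    by (subst has_sum_cong_neutral[where T = UNIV and g = "\<lambda>n. g n + - h n"]) (use A in auto)
qed

context trunc
begin

text \<open>The regular part is the same series of upper parts restricted to smooth numbers, so
  subtracting it retains exactly the integers with a prime factor above u.\<close>

lemma large_part_has_sum:
  "(A.Eterm s has_sum (A.E s - xi_reg q u chi s)) {n. n > 0 \<and> has_large_prime_factor u n}"
proof -
  have sm: "n \<in> smooth_set P \<longleftrightarrow> n > 0 \<and> \<not> has_large_prime_factor u n" for n by (rule smooth_iff)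
  have c0: "chi 0 = 0" by (rule A.c0)
  show ?thesis unfolding xi_reg_eq A.E_def S.E_def
  proof (rule has_sum_of_summable_norm[OF A.Eterm_summable S.Eterm_summable])
    fix n assume "n \<in> {n. n > 0 \<and> has_large_prime_factor u n}"
    thus "S.Eterm s n = 0" by (simp add: S.Eterm_def chi_smooth_def sm)
  next
    fix n assume n: "n \<notin> {n. n > 0 \<and> has_large_prime_factor u n}"
    thus "S.Eterm s n = A.Eterm s n" by (cases "n = 0") (simp_all add: S.Eterm_def A.Eterm_def chi_smooth_def sm c0)
  qed
qed

end

theorem theorem1:
  fixes q :: nat and chi :: "nat \<Rightarrow> complex" and u :: real and s0 :: complex
  assumes "q \<ge> 3"
    and "primitive_dirichlet_char q chi"
    and "u \<ge> 2"
  shows "((\<lambda>n. chi n * of_nat n ^ kappa q chi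
               * of_real (real q / (real n ^ 2 * pi)) powr ((of_nat (kappa q chi) + s0) / 2)
               * inc_Gamma ((of_nat (kappa q chi) + s0) / 2) (real n ^ 2 * pi / real q)
           + root_number q chi * cnj (chi n) * of_nat n ^ kappa q chi
               * of_real (real q / (real n ^ 2 * pi)) powr ((of_nat (kappa q chi) + 1 - s0) / 2)
               * inc_Gamma ((of_nat (kappa q chi) + 1 - s0) / 2) (real n ^ 2 * pi / real q))
         has_sum (xi q chi s0 - xi_approx q u chi s0))
         {n. n > 0 \<and> has_large_prime_factor u n}"
proof -
  interpret X: trunc q chi u by unfold_locales (use assms in auto)
  \<comment> \<open>The dual half is the same result for the conjugate character at 1 - s; that both
    characters share \<kappa> aligns the exponents.\<close>
  interpret Y: trunc q "\<lambda>n. cnj (chi n)" u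
    using X.char_mod_cnj assms(3) by (simp add: trunc_def trunc_axioms_def)
  define S where "S = {n. n > 0 \<and> has_large_prime_factor u n}"
  have "((\<lambda>n. X.A.Eterm s0 n + root_number q chi * Y.A.Eterm (1 - s0) n) has_sum
      ((X.A.E s0 - xi_reg q u chi s0) + root_number q chi * (Y.A.E (1 - s0) - xi_reg q u (\<lambda>n. cnj (chi n)) (1 - s0)))) S"
    unfolding S_def by (intro has_sum_add has_sum_cmult_right X.large_part_has_sum Y.large_part_has_sum)
  moreover have "(X.A.E s0 - xi_reg q u chi s0) + root_number q chi * (Y.A.E (1 - s0) - xi_reg q u (\<lambda>n. cnj (chi n)) (1 - s0))
      = xi q chi s0 - xi_approx q u chi s0"
    unfolding X.xi_eq xi_approx_def X.kappa_cnj by (simp add: algebra_simps)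
  moreover have "1 / X.A.xn n = real q / (real n ^ 2 * pi)" for n
    unfolding X.A.xn_def by simp
  ultimately show ?thesis
    unfolding S_def X.A.Eterm_def Y.A.Eterm_def upper_part_def X.A.zz_def Y.A.zz_def X.A.xn_def
    by (simp only: X.kappa_cnj add_diff_eq mult.assoc)
qed

end
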